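(* There is no algorithm which, given as input a matroid $M$ on a finite ground set $E$ with rank function $r$, decides whether $M$ is entropic, i.e. whether there exist a family $\{X_e\}_{e\in E}$ of discrete random variables on a common probability space and a positive real number $\lambda$ such that $r(A)=\lambda H(X_A)$ for all subsets $A\subseteq E$.
   Context: A matroid $M=(E,r)$ is a finite set $E$ with a function $r:\mathcal P(E)\to\mathbb N$ satisfying $r(A)\le |A|$, monotonicity and submodularity. For $A\subseteq E$, $X_A$ denotes the joint random variable $(X_e)_{e\in A}$ (with values in the product of the codomains), and $H(X_A)=-\sum_{\omega} P(X_A=\omega)\log P(X_A=\omega)$ is its Shannon entropy (set to $\infty$ if the sum diverges). *)

theory Defs
  imports "HOL-Probability.Probability" "HOL-Library.Nat_Bijection"
begin

section \<open>Matroids\<close>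

definition matroid :: "'a set \<Rightarrow> ('a set \<Rightarrow> nat) \<Rightarrow> bool" where
  "matroid E r \<longleftrightarrow> finite E
     \<and> (\<forall>A\<subseteq>E. r A \<le> card A)
     \<and> (\<forall>A B. A \<subseteq> B \<longrightarrow> B \<subseteq> E \<longrightarrow> r A \<le> r B)
     \<and> (\<forall>A\<subseteq>E. \<forall>B\<subseteq>E. r (A \<union> B) + r (A \<inter> B) \<le> r A + r B)"


section \<open>Entropic matroids\<close>

definition discrete_rv :: "'w measure \<Rightarrow> ('w \<Rightarrow> 'v) \<Rightarrow> bool" where
  "discrete_rv M Y \<longleftrightarrow> Y \<in> measurable M (count_space UNIV) \<and> countable (Y ` space M)"

definition joint_rv :: "('a \<Rightarrow> 'w \<Rightarrow> 'v) \<Rightarrow> 'a set \<Rightarrow> 'w \<Rightarrow> ('a \<Rightarrow> 'v)" where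
  "joint_rv X A w = restrict (\<lambda>e. X e w) A"

text \<open>The summands are nonnegative, so summing in \<^typ>\<open>ennreal\<close> gives \<open>\<infinity>\<close> exactly when
  the series diverges. Values of probability zero contribute nothing because \<open>0 * ln 0 = 0\<close>.\<close>

definition shannon_entropy :: "'w measure \<Rightarrow> ('w \<Rightarrow> 'v) \<Rightarrow> ennreal" where
  "shannon_entropy M Y =
     (\<Sum>\<^sub>\<infinity>y. ennreal (- (measure M {w \<in> space M. Y w = y} * ln (measure M {w \<in> space M. Y w = y}))))"

definition entropic_representation ::
  "'w measure \<Rightarrow> ('a \<Rightarrow> 'w \<Rightarrow> 'v) \<Rightarrow> real \<Rightarrow> 'a set \<Rightarrow> ('a set \<Rightarrow> nat) \<Rightarrow> bool" where
  "entropic_representation M X c E r \<longleftrightarrow>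
     prob_space M \<and> (\<forall>e\<in>E. discrete_rv M (X e)) \<and> c > 0
     \<and> (\<forall>A\<subseteq>E. of_nat (r A) = ennreal c * shannon_entropy M (joint_rv X A))"

text \<open>HOL cannot quantify existentially over types, so the sample space and the values are taken
  in \<^typ>\<open>nat\<close>. Lemma \<open>entropicI\<close> below shows that this loses nothing: a representation over
  arbitrary types yields one over \<^typ>\<open>nat\<close>.\<close>

definition entropic :: "'a set \<Rightarrow> ('a set \<Rightarrow> nat) \<Rightarrow> bool" where
  "entropic E r \<longleftrightarrow>
     (\<exists>(M :: nat measure) (X :: 'a \<Rightarrow> nat \<Rightarrow> nat) c. entropic_representation M X c E r)"

lemma shannon_entropy_transport:
  fixes M :: "'w measure" and T :: "'w \<Rightarrow> 'u"
    and Y :: "'w \<Rightarrow> 'v" and Y' :: "'u \<Rightarrow> 'z"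
  assumes T: "T \<in> measurable M (count_space UNIV)"
    and eq: "\<And>w. w \<in> space M \<Longrightarrow> Y' (T w) = \<phi> (Y w)"
    and inj: "inj_on \<phi> (Y ` space M)"
  shows "shannon_entropy (distr M (count_space UNIV) T) Y' = shannon_entropy M Y"
proof -
  define h where "h p = ennreal (- (p * ln p))" for p :: real
  define P where "P y = measure M {w \<in> space M. Y w = y}" for y
  define P' where "P' z = measure (distr M (count_space UNIV) T)
      {u \<in> space (distr M (count_space UNIV) T). Y' u = z}" for z
  have P': "P' z = measure M {w \<in> space M. \<phi> (Y w) = z}" for z
  proof -
    have "P' z = measure M (T -` {u. Y' u = z} \<inter> space M)"
      unfolding P'_def using T by (simp add: measure_distr)
    also have "T -` {u. Y' u = z} \<inter> space M = {w \<in> space M. \<phi> (Y w) = z}"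
      using eq by auto
    finally show ?thesis .
  qed
  have "P' (\<phi> y) = P y" if "y \<in> Y ` space M" for y
  proof -
    have "{w \<in> space M. \<phi> (Y w) = \<phi> y} = {w \<in> space M. Y w = y}"
      using inj that by (auto dest: inj_onD)
    then show ?thesis by (simp add: P' P_def)
  qed
  note P'_\<phi> = this
  have P'_0: "P' z = 0" if "z \<notin> \<phi> ` Y ` space M" for z
  proof -
    have "{w \<in> space M. \<phi> (Y w) = z} = {}" using that by auto
    then show ?thesis by (simp only: P' measure_empty)
  qed
  have P_0: "P y = 0" if "y \<notin> Y ` space M" for y
  proof -
    have "{w \<in> space M. Y w = y} = {}" using that by auto
    then show ?thesis by (simp only: P_def measure_empty)
  qed
  have "shannon_entropy (distr M (count_space UNIV) T) Y' = (\<Sum>\<^sub>\<infinity>z. h (P' z))"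
    by (simp add: shannon_entropy_def h_def P'_def)
  also have "\<dots> = (\<Sum>\<^sub>\<infinity>z\<in>\<phi> ` Y ` space M. h (P' z))"
    by (rule infsum_cong_neutral) (auto simp: P'_0 h_def)
  also have "\<dots> = (\<Sum>\<^sub>\<infinity>y\<in>Y ` space M. h (P' (\<phi> y)))"
    using infsum_reindex[OF inj, of "\<lambda>z. h (P' z)"] by (simp add: o_def)
  also have "\<dots> = (\<Sum>\<^sub>\<infinity>y\<in>Y ` space M. h (P y))"
    by (rule infsum_cong) (simp add: P'_\<phi>)
  also have "\<dots> = (\<Sum>\<^sub>\<infinity>y. h (P y))"
    by (rule infsum_cong_neutral) (auto simp: P_0 h_def)
  also have "\<dots> = shannon_entropy M Y"
    by (simp add: shannon_entropy_def h_def P_def)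
  finally show ?thesis .
qed

lemma entropicI:
  fixes M :: "'w measure" and X :: "'a \<Rightarrow> 'w \<Rightarrow> 'v"
  assumes "finite E" and rep: "entropic_representation M X c E r"
  shows "entropic E r"
proof -
  interpret prob_space M using rep by (simp add: entropic_representation_def)
  have meas: "X e \<in> measurable M (count_space UNIV)"
    and count: "countable (X e ` space M)" if "e \<in> E" for e
    using rep that by (auto simp: entropic_representation_def discrete_rv_def)
  define Y where "Y = joint_rv X E"
  define S where "S = Y ` space M"
  have "S \<subseteq> PiE E (\<lambda>e. X e ` space M)"
    by (auto simp: S_def Y_def joint_rv_def)
  moreover have "countable (PiE E (\<lambda>e. X e ` space M))"
    using \<open>finite E\<close> count by (intro countable_PiE) auto
  ultimately have S: "countable S" by (rule countable_subset)
  define T where "T w = to_nat_on S (Y w)" for w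
  have from_T: "from_nat_into S (T w) = Y w" if "w \<in> space M" for w
    using S that by (simp add: T_def S_def)
  have Y_meas: "Y \<in> measurable M (count_space S)"
    unfolding measurable_count_space_eq_countable[OF S]
  proof (intro conjI ballI)
    show "Y \<in> space M \<rightarrow> S" by (auto simp: S_def)
    fix s assume s: "s \<in> S"
    have "{w \<in> space M. \<forall>e\<in>E. X e w = s e} \<in> sets M"
    proof (rule sets.sets_Collect_finite_All[OF _ \<open>finite E\<close>])
      fix e assume "e \<in> E"
      have "X e -` {s e} \<inter> space M \<in> sets M"
        using measurable_sets[OF meas[OF \<open>e \<in> E\<close>], of "{s e}"] by simp
      then show "{w \<in> space M. X e w = s e} \<in> sets M"
        by (simp add: vimage_def Int_def conj_commute)
    qed
    also have "{w \<in> space M. \<forall>e\<in>E. X e w = s e} = Y -` {s} \<inter> space M"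
    proof -
      have "Y w = Y w' \<longleftrightarrow> (\<forall>e\<in>E. X e w = X e w')" for w w'
      proof
        assume eq: "Y w = Y w'"
        show "\<forall>e\<in>E. X e w = X e w'"
        proof
          fix e assume "e \<in> E"
          with fun_cong[OF eq, of e] show "X e w = X e w'" by (simp add: Y_def joint_rv_def)
        qed
      qed (auto simp: Y_def joint_rv_def intro: restrict_ext)
      moreover have "Y w' e = X e w'" if "e \<in> E" for w' e
        using that by (simp add: Y_def joint_rv_def)
      ultimately have "Y w = Y w' \<longleftrightarrow> (\<forall>e\<in>E. X e w = Y w' e)" for w w'
        by simp
      with s show ?thesis by (auto simp: S_def)
    qed
    finally show "Y -` {s} \<inter> space M \<in> sets M" .
  qed
  have T_meas: "T \<in> measurable M (count_space UNIV)"
    unfolding T_def by (rule measurable_compose[OF Y_meas]) simp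
  define enc where "enc e = to_nat_on (X e ` space M)" for e
  define X' where "X' e k = enc e (from_nat_into S k e)" for e k
  define M' where "M' = distr M (count_space UNIV) T"
  have "entropic_representation M' X' c E r"
    unfolding entropic_representation_def
  proof (intro conjI ballI allI impI)
    show "prob_space M'" unfolding M'_def by (rule prob_space_distr[OF T_meas])
    show "discrete_rv M' (X' e)" for e by (simp add: M'_def discrete_rv_def)
    show "c > 0" using rep by (simp add: entropic_representation_def)
    fix A assume A: "A \<subseteq> E"
    define \<phi> where "\<phi> y = restrict (\<lambda>e. enc e (y e)) A" for y
    have "shannon_entropy M' (joint_rv X' A) = shannon_entropy M (joint_rv X A)"
      unfolding M'_def
    proof (rule shannon_entropy_transport[OF T_meas, where \<phi> = \<phi>])
      show "joint_rv X' A (T w) = \<phi> (joint_rv X A w)" if "w \<in> space M" for w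
        using A that
        by (auto simp: joint_rv_def \<phi>_def X'_def from_T Y_def restrict_def fun_eq_iff)
      show "inj_on \<phi> (joint_rv X A ` space M)"
      proof (rule inj_onI, clarify)
        fix w w' assume w: "w \<in> space M" "w' \<in> space M"
          and eq: "\<phi> (joint_rv X A w) = \<phi> (joint_rv X A w')"
        have "X e w = X e w'" if "e \<in> A" for e
        proof -
          have "enc e (X e w) = enc e (X e w')"
            using fun_cong[OF eq, of e] that by (simp add: \<phi>_def joint_rv_def)
          moreover have "inj_on (enc e) (X e ` space M)"
            unfolding enc_def using count A that by (intro inj_on_to_nat_on) auto
          ultimately show ?thesis using w by (auto dest: inj_onD)
        qed
        then show "joint_rv X A w = joint_rv X A w'"
          by (simp add: joint_rv_def restrict_def fun_eq_iff)
      qed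
    qed
    with rep A show "of_nat (r A) = ennreal c * shannon_entropy M' (joint_rv X' A)"
      by (simp add: entropic_representation_def)
  qed
  then show ?thesis unfolding entropic_def by blast
qed


section \<open>Algorithms\<close>

text \<open>Algorithms are programs for partial recursive functions. Arities are left implicit: a
  program is run on a list of arguments, and \<open>computes p xs y\<close> says that the run of \<open>p\<close> on
  \<open>xs\<close> halts with output \<open>y\<close>.\<close>

datatype recf =
    Zero
  | Succ
  | Proj nat
  | Comp recf "recf list"
  | PrimRec recf recf
  | Mu recf

inductive computes :: "recf \<Rightarrow> nat list \<Rightarrow> nat \<Rightarrow> bool" where
  Zero: "computes Zero xs 0"
| Succ: "computes Succ [x] (Suc x)"
| Proj: "i < length xs \<Longrightarrow> computes (Proj i) xs (xs ! i)"
| Comp: "list_all2 (\<lambda>g y. computes g xs y) gs ys \<Longrightarrow> computes f ys z \<Longrightarrow> computes (Comp f gs) xs z"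
| PrimRec_0: "computes f xs y \<Longrightarrow> computes (PrimRec f g) (0 # xs) y"
| PrimRec_Suc: "computes (PrimRec f g) (n # xs) y \<Longrightarrow> computes g (n # y # xs) z
    \<Longrightarrow> computes (PrimRec f g) (Suc n # xs) z"
| Mu: "(\<And>m. m < n \<Longrightarrow> \<exists>y. computes f (m # xs) (Suc y)) \<Longrightarrow> computes f (n # xs) 0
    \<Longrightarrow> computes (Mu f) xs n"

inductive_cases computes_elims:
  "computes Zero xs y" "computes Succ xs y" "computes (Proj i) xs y" "computes (Comp f gs) xs y"
  "computes (PrimRec f g) (0 # xs) y" "computes (PrimRec f g) (Suc n # xs) y" "computes (Mu f) xs y"

lemma computes_deterministic:
  assumes "computes p xs y" and "computes p xs z"
  shows "y = z"
  using assms
proof (induction arbitrary: z rule: computes.induct)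
  case (Comp xs gs ys f z')
  from Comp.prems obtain ys' where ys': "list_all2 (\<lambda>g y. computes g xs y) gs ys'" "computes f ys' z"
    by (auto elim: computes_elims)
  have "ys = ys'"
    using Comp.IH(1) ys'(1) by (auto simp: list_all2_conv_all_nth intro!: nth_equalityI)
  with ys' Comp.IH show ?case by blast
next
  case (Mu n f xs)
  from Mu.prems have z: "\<And>m. m < z \<Longrightarrow> \<exists>y. computes f (m # xs) (Suc y)" "computes f (z # xs) 0"
    by (auto elim: computes_elims)
  have "\<not> n < z" using z(1) Mu.IH(2) by fastforce
  moreover have "\<not> z < n" using z(2) Mu.IH(1) by fastforce
  ultimately show ?case by simp
qed (blast elim: computes_elims)+


section \<open>Matroids as inputs\<close>

text \<open>An input is a finite object, so ground sets are finite sets of natural numbers. A matroid is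
  presented by its ground set and the table of its rank function, the subsets of the ground set
  being listed in the order of their codes. Every code of a subset of \<open>E\<close> is at most
  \<^term>\<open>set_encode E\<close>.\<close>

definition subset_codes :: "nat set \<Rightarrow> nat list" where
  "subset_codes E = filter (\<lambda>k. set_decode k \<subseteq> E) [0..<Suc (set_encode E)]"

definition matroid_code :: "nat set \<Rightarrow> (nat set \<Rightarrow> nat) \<Rightarrow> nat" where
  "matroid_code E r =
     prod_encode (set_encode E, list_encode (map (\<lambda>k. r (set_decode k)) (subset_codes E)))"

lemma set_subset_codes:
  assumes "finite E"
  shows "set_decode ` set (subset_codes E) = Pow E"
proof
  show "Pow E \<subseteq> set_decode ` set (subset_codes E)"
  proof
    fix A assume "A \<in> Pow E"
    then have A: "A \<subseteq> E" "finite A" using assms by (auto intro: finite_subset)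
    then have "set_encode A \<le> set_encode E"
      unfolding set_encode_def using assms by (auto intro: sum_mono2)
    with A show "A \<in> set_decode ` set (subset_codes E)"
      by (intro image_eqI[of _ _ "set_encode A"]) (auto simp: subset_codes_def less_Suc_eq_le simp del: upt_Suc)
  qed
qed (auto simp: subset_codes_def)

lemma matroid_code_inject:
  assumes "finite E" "finite E'"
  shows "matroid_code E r = matroid_code E' r' \<longleftrightarrow> E = E' \<and> (\<forall>A\<subseteq>E. r A = r' A)"
proof -
  have "matroid_code E r = matroid_code E r'
      \<longleftrightarrow> (\<forall>A\<in>set_decode ` set (subset_codes E). r A = r' A)"
    by (simp add: matroid_code_def list_encode_eq)
  then have *: "matroid_code E r = matroid_code E r' \<longleftrightarrow> (\<forall>A\<subseteq>E. r A = r' A)"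
    using set_subset_codes[OF assms(1)] by auto
  have "E = E'" if "matroid_code E r = matroid_code E' r'"
    using that assms set_encode_eq by (simp add: matroid_code_def)
  with * show ?thesis by blast
qed

end

theory Submission
  imports Defs "HOL-Library.Set_Algebras" "HOL-Number_Theory.Cong"
begin

text \<open>A decider would be a program that can be applied to the matroid built from its own
  code. Composing it with the map \<open>e \<mapsto> gadget_code e\<close> and compiling to a loop program \<open>cs\<close> gives
  monoid relations \<open>x y = z\<close> in which the input word of \<open>cs\<close> vanishes if \<open>cs\<close> halts with nonzero
  output, while it is nonzero in some finite model if the output is zero. Commutators of elementary
  matrices satisfy \<open>[e\<^sub>i\<^sub>j(x), e\<^sub>j\<^sub>k(y)] = e\<^sub>i\<^sub>k(x y)\<close>, so the monoid relations become relations
  \<open>x y = z\<close> between group elements, one of which, \<open>g\<close>, is trivial in every group in the first case and a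
  nontrivial involution in a finite model in the second. Everything except the input \<open>e\<close> is
  coded into the number \<open>e\<close> itself, which is what makes the diagonal argument possible.

  The rank-3 matroid has the lines of a Dowling-like geometry as its dependencies. In an entropic
  representation the points on the lines of the frame act as families of permutations, and
  these generate a group satisfying the relations up to central scalars; the points \<open>PX\<close> and \<open>PY\<close> force
  \<open>g\<close> to act nontrivially, so the matroid is not entropic if \<open>g\<close> must be trivial. Conversely, a finite
  model with an involution \<open>g \<noteq> 1\<close> gives weighted translations of functions to \<open>\<int>/p\<close>. There \<open>g\<close>
  anticommutes with a sign function, which separates \<open>PX\<close> from \<open>PY\<close>, and generic
  powers of 2 as scalars separate all other points, so the matroid is represented by linear forms.\<close>

section \<open>Entropy of tuples\<close>

text \<open>The matroid has to be written down before it is known which case holds, so its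
  independences must not depend on accidental equalities in a model. Two symbols may have the same
  value in the group, while different points of the matroid demand independent variables. Hence
  every symbol carries a generic scalar, and a relation \<open>x y = z\<close> is imposed only as
  \<open>x (\<kappa> y) = \<sigma> z\<close>, with two scalars of its own. The price is that
  \<open>g = 1\<close> becomes visible only up to scalars. It is tested by a property that ignores
  scalars: whether \<open>g\<close> commutes with one extra symbol that occurs in no relation. The
  opposite obstacle is that points act as permutations, so symbols become invertible, whereas the
  word of a run has to be able to vanish. A commutator with the unit is the unit, so the letter
  \<open>Oo\<close> can play the role of zero once words are matrix entries. From an entropic
  representation only the supports of the joint laws are extracted, as value sets may be infinite
  and laws nonuniform. Counting is replaced by sharp transitivity.\<close>

lemma infsum_eq_nn_integral_count_space:
  fixes f :: "'a \<Rightarrow> ennreal"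
  assumes "countable {x. f x \<noteq> 0}"
  shows "infsum f UNIV = (\<integral>\<^sup>+x. f x \<partial>count_space UNIV)"
proof -
  let ?S = "{x. f x \<noteq> 0}"
  have I: "infsum f UNIV = (SUP F\<in>{F. finite F}. sum f F)"
    by (subst nonneg_infsum_complete) (auto simp: subset_UNIV)
  have S: "(\<integral>\<^sup>+x. f x \<partial>count_space UNIV) = (\<integral>\<^sup>+x. f x \<partial>count_space ?S)"
    by (rule nn_integral_count_space_eq) auto
  show ?thesis
  proof (rule antisym)
    show "infsum f UNIV \<le> (\<integral>\<^sup>+x. f x \<partial>count_space UNIV)"
      unfolding I
    proof (rule SUP_least)
      fix F :: "'a set" assume "F \<in> {F. finite F}"
      then have "sum f F = (\<integral>\<^sup>+x. f x \<partial>count_space F)" by (simp add: nn_integral_count_space_finite)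
      also have "\<dots> = (\<integral>\<^sup>+x. f x * indicator F x \<partial>count_space UNIV)"
        by (subst nn_integral_count_space_indicator[symmetric]) auto
      also have "\<dots> \<le> (\<integral>\<^sup>+x. f x \<partial>count_space UNIV)"
        by (rule nn_integral_mono) (auto split: split_indicator)
      finally show "sum f F \<le> (\<integral>\<^sup>+x. f x \<partial>count_space UNIV)" .
    qed
  next
    have le: "sum f F \<le> infsum f UNIV" if "finite F" for F
      unfolding I using that by (auto intro: SUP_upper)
    show "(\<integral>\<^sup>+x. f x \<partial>count_space UNIV) \<le> infsum f UNIV"
    proof (cases "finite ?S")
      case True
      then show ?thesis unfolding S using le[OF True] by (simp add: nn_integral_count_space_finite)
    next
      case False
      then have b: "bij_betw (from_nat_into ?S) UNIV ?S" using assms by (rule bij_betw_from_nat_into[rotated])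
      have "(\<integral>\<^sup>+x. f x \<partial>count_space ?S) = (\<integral>\<^sup>+n. f (from_nat_into ?S n) \<partial>count_space UNIV)"
        by (rule nn_integral_bij_count_space[OF b, symmetric])
      also have "\<dots> = (\<Sum>n. f (from_nat_into ?S n))" by (rule nn_integral_count_space_nat)
      also have "\<dots> \<le> infsum f UNIV"
      proof (rule suminf_le_const)
        fix n
        have "inj_on (from_nat_into ?S) {..<n}" using b by (meson bij_betw_imp_inj_on inj_on_subset top_greatest)
        then have "(\<Sum>i<n. f (from_nat_into ?S i)) = sum f (from_nat_into ?S ` {..<n})"
          by (simp add: sum.reindex)
        also have "\<dots> \<le> infsum f UNIV" by (rule le) auto
        finally show "(\<Sum>i<n. f (from_nat_into ?S i)) \<le> infsum f UNIV" .
      qed auto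
      finally show ?thesis unfolding S .
    qed
  qed
qed

text \<open>Entropy as the expectation of the information content \<open>- ln P(g = g z)\<close>. As
  the integral of a function of the outcome, it allows identities between entropies to be turned
  into pointwise identities on the support.\<close>

definition pent :: "'z pmf \<Rightarrow> ('z \<Rightarrow> 'y) \<Rightarrow> ennreal" where
  "pent \<pi> g = (\<integral>\<^sup>+z. ennreal (- ln (pmf (map_pmf g \<pi>) (g z))) \<partial>measure_pmf \<pi>)"

lemma infsum_pmf_entropy:
  "(\<Sum>\<^sub>\<infinity>y. ennreal (- (pmf (map_pmf g \<pi>) y * ln (pmf (map_pmf g \<pi>) y)))) = pent \<pi> g"
proof -
  let ?p = "map_pmf g \<pi>"
  have "(\<Sum>\<^sub>\<infinity>y. ennreal (- (pmf ?p y * ln (pmf ?p y)))) = (\<integral>\<^sup>+y. ennreal (- (pmf ?p y * ln (pmf ?p y))) \<partial>count_space UNIV)"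
    by (rule infsum_eq_nn_integral_count_space, rule countable_subset[OF _ countable_set_pmf[of ?p]])
       (auto simp: set_pmf_iff simp del: set_map_pmf)
  also have "\<dots> = (\<integral>\<^sup>+y. ennreal (pmf ?p y) * ennreal (- ln (pmf ?p y)) \<partial>count_space UNIV)"
    by (rule nn_integral_cong) (simp add: ennreal_mult'[symmetric])
  also have "\<dots> = (\<integral>\<^sup>+y. ennreal (- ln (pmf ?p y)) \<partial>measure_pmf ?p)"
    by (rule nn_integral_measure_pmf[symmetric])
  also have "\<dots> = pent \<pi> g" unfolding pent_def by simp
  finally show ?thesis .
qed

text \<open>The nonnegative difference has integral 0, so it vanishes almost everywhere, and a point
  of the support is not a null set.\<close>

lemma nn_integral_pmf_eq:
  fixes f g :: "'z \<Rightarrow> ennreal"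
  assumes le: "\<And>z. z \<in> set_pmf \<pi> \<Longrightarrow> f z \<le> g z"
    and eq: "(\<integral>\<^sup>+z. g z \<partial>measure_pmf \<pi>) \<le> (\<integral>\<^sup>+z. f z \<partial>measure_pmf \<pi>)"
    and fin: "(\<integral>\<^sup>+z. f z \<partial>measure_pmf \<pi>) \<noteq> \<infinity>" and z: "z \<in> set_pmf \<pi>"
  shows "f z = g z"
proof -
  have AE: "AE z in measure_pmf \<pi>. f z \<le> g z" using le by (simp add: AE_measure_pmf_iff)
  have "(\<integral>\<^sup>+z. g z - f z \<partial>measure_pmf \<pi>) = (\<integral>\<^sup>+z. g z \<partial>measure_pmf \<pi>) - (\<integral>\<^sup>+z. f z \<partial>measure_pmf \<pi>)"
    by (rule nn_integral_diff) (use AE fin in auto)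
  also have "\<dots> = 0" using eq le_less_trans[OF eq] fin by (simp add: diff_eq_0_iff_ennreal less_top)
  finally have "AE z in measure_pmf \<pi>. g z - f z = 0"
    by (subst (asm) nn_integral_0_iff_AE) auto
  then have 0: "g z - f z = 0" using z by (simp add: AE_measure_pmf_iff)
  have "f z \<noteq> \<infinity>"
  proof
    assume inf: "f z = \<infinity>"
    have "ennreal (pmf \<pi> z) * f z \<le> (\<integral>\<^sup>+z. ennreal (pmf \<pi> z) * f z \<partial>count_space UNIV)"
      by (rule nn_integral_ge_point) auto
    moreover have "ennreal (pmf \<pi> z) * f z = \<infinity>" using z inf by (simp add: set_pmf_iff ennreal_mult_top)
    ultimately show False using fin by (simp add: nn_integral_measure_pmf top_unique)
  qed
  then show ?thesis using 0 le[OF z] by (metis antisym diff_eq_0_iff_ennreal less_top infinity_ennreal_def le_less leD)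
qed

lemma pmf_map_pos: "z \<in> set_pmf \<pi> \<Longrightarrow> 0 < pmf (map_pmf g \<pi>) (g z)"
  by (simp add: pmf_positive)

lemma pent_determined:
  assumes eq: "pent \<pi> (\<lambda>z. (u z, v z)) = pent \<pi> u" and fin: "pent \<pi> u \<noteq> \<infinity>" and z: "z \<in> set_pmf \<pi>"
  shows "pmf (map_pmf (\<lambda>z. (u z, v z)) \<pi>) (u z, v z) = pmf (map_pmf u \<pi>) (u z)"
proof -
  let ?uv = "\<lambda>z. (u z, v z)"
  have le: "pmf (map_pmf ?uv \<pi>) (?uv z) \<le> pmf (map_pmf u \<pi>) (u z)" for z
    unfolding pmf_map by (rule measure_pmf.finite_measure_mono) auto
  have "ennreal (- ln (pmf (map_pmf u \<pi>) (u z))) = ennreal (- ln (pmf (map_pmf ?uv \<pi>) (?uv z)))"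
    by (rule nn_integral_pmf_eq[of \<pi> "\<lambda>z. ennreal (- ln (pmf (map_pmf u \<pi>) (u z)))"
          "\<lambda>z. ennreal (- ln (pmf (map_pmf ?uv \<pi>) (?uv z)))" z])
       (use eq fin le pmf_map_pos[of _ \<pi> u] pmf_map_pos[of _ \<pi> ?uv] z in \<open>auto simp: pent_def intro!: ennreal_leI\<close>)
  then have "ln (pmf (map_pmf u \<pi>) (u z)) = ln (pmf (map_pmf ?uv \<pi>) (?uv z))"
    using pmf_map_pos[OF z, of u] pmf_map_pos[OF z, of ?uv] pmf_le_1[of "map_pmf u \<pi>" "u z"]
      pmf_le_1[of "map_pmf ?uv \<pi>" "?uv z"] by (subst (asm) ennreal_inj) auto
  then show ?thesis using pmf_map_pos[OF z, of u] pmf_map_pos[OF z, of ?uv] by simp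
qed

text \<open>Equality case of Gibbs' inequality: with \<open>t = a * b / p\<close> one has
  \<open>ln t \<le> t - 1\<close>, with equality only at \<open>t = 1\<close>. To stay within
  nonnegative integrands, 1 is added on one side and \<open>t\<close> on the other; the integral of
  \<open>t\<close> is at most 1 because it sums the product law over the support of the joint
  law.\<close>

lemma pent_independent:
  assumes eq: "pent \<pi> (\<lambda>z. (u z, v z)) = pent \<pi> u + pent \<pi> v" and fin: "pent \<pi> (\<lambda>z. (u z, v z)) \<noteq> \<infinity>"
    and z: "z \<in> set_pmf \<pi>"
  shows "pmf (map_pmf (\<lambda>z. (u z, v z)) \<pi>) (u z, v z) = pmf (map_pmf u \<pi>) (u z) * pmf (map_pmf v \<pi>) (v z)"
proof -
  let ?uv = "\<lambda>z. (u z, v z)"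
  define a where "a z = pmf (map_pmf u \<pi>) (u z)" for z
  define b where "b z = pmf (map_pmf v \<pi>) (v z)" for z
  define p where "p z = pmf (map_pmf ?uv \<pi>) (?uv z)" for z
  have pos: "0 < a z" "0 < b z" "0 < p z" if "z \<in> set_pmf \<pi>" for z
    unfolding a_def b_def p_def using pmf_map_pos[OF that, of u] pmf_map_pos[OF that, of v] pmf_map_pos[OF that, of ?uv] by auto
  have le1: "a z \<le> 1" "b z \<le> 1" "p z \<le> 1" for z by (auto simp: a_def b_def p_def pmf_le_1)
  have nn: "0 \<le> - ln (a z)" "0 \<le> - ln (b z)" "0 \<le> - ln (p z)" "0 \<le> a z * b z / p z" if "z \<in> set_pmf \<pi>" for z
    using pos[OF that] le1[of z] by auto
  define f where "f z = ennreal (- ln (p z)) + 1" for z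
  define g where "g z = ennreal (- ln (a z)) + ennreal (- ln (b z)) + ennreal (a z * b z / p z)" for z
  have real_f: "f z = ennreal (- ln (p z) + 1)" and real_g: "g z = ennreal (- ln (a z) - ln (b z) + a z * b z / p z)"
    if "z \<in> set_pmf \<pi>" for z
    using nn[OF that] ennreal_plus[of "- ln (p z)" 1]
    by (simp_all add: f_def g_def ennreal_plus[symmetric] del: ennreal_plus)
  have ln_eq: "- ln (a z) - ln (b z) = - ln (p z) - ln (a z * b z / p z)" if "z \<in> set_pmf \<pi>" for z
    using pos[OF that] by (simp add: ln_mult ln_div)
  have le: "f z \<le> g z" if "z \<in> set_pmf \<pi>" for z
    unfolding real_f[OF that] real_g[OF that] ln_eq[OF that]
    using ln_le_minus_one[of "a z * b z / p z"] pos[OF that] by (intro ennreal_leI) simp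
  have If: "(\<integral>\<^sup>+z. f z \<partial>measure_pmf \<pi>) = pent \<pi> ?uv + 1"
    unfolding f_def pent_def p_def by (subst nn_integral_add) auto
  have "(\<integral>\<^sup>+z. ennreal (a z * b z / p z) \<partial>measure_pmf \<pi>)
     = (\<integral>\<^sup>+x. ennreal (pmf (map_pmf u \<pi>) (fst x) * pmf (map_pmf v \<pi>) (snd x) / pmf (map_pmf ?uv \<pi>) x) \<partial>measure_pmf (map_pmf ?uv \<pi>))"
    by (simp add: a_def b_def p_def)
  also have "\<dots> = (\<integral>\<^sup>+x. ennreal (pmf (map_pmf ?uv \<pi>) x) *
      ennreal (pmf (map_pmf u \<pi>) (fst x) * pmf (map_pmf v \<pi>) (snd x) / pmf (map_pmf ?uv \<pi>) x) \<partial>count_space UNIV)"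
    by (rule nn_integral_measure_pmf)
  also have "\<dots> \<le> (\<integral>\<^sup>+x. ennreal (pmf (pair_pmf (map_pmf u \<pi>) (map_pmf v \<pi>)) x) \<partial>count_space UNIV)"
    by (rule nn_integral_mono) (auto simp: ennreal_mult'[symmetric] pmf_pair intro!: ennreal_leI)
  also have "\<dots> = 1" by (simp add: nn_integral_pmf)
  finally have I1: "(\<integral>\<^sup>+z. ennreal (a z * b z / p z) \<partial>measure_pmf \<pi>) \<le> 1" .
  have "(\<integral>\<^sup>+z. g z \<partial>measure_pmf \<pi>) = pent \<pi> u + pent \<pi> v + (\<integral>\<^sup>+z. ennreal (a z * b z / p z) \<partial>measure_pmf \<pi>)"
    unfolding g_def pent_def a_def[symmetric] b_def[symmetric] by (simp add: nn_integral_add)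
  also have "\<dots> \<le> pent \<pi> ?uv + 1" unfolding eq using I1 by (intro add_left_mono)
  finally have Ig: "(\<integral>\<^sup>+z. g z \<partial>measure_pmf \<pi>) \<le> (\<integral>\<^sup>+z. f z \<partial>measure_pmf \<pi>)" unfolding If .
  have "f z = g z"
    by (rule nn_integral_pmf_eq[OF le Ig _ z]) (use fin in \<open>simp_all add: If\<close>)
  then have "- ln (p z) + 1 = - ln (p z) - ln (a z * b z / p z) + a z * b z / p z"
    unfolding real_f[OF z] real_g[OF z] ln_eq[OF z]
  proof (subst (asm) ennreal_inj)
    show "0 \<le> - ln (p z) + 1" using nn[OF z] by simp
    show "0 \<le> - ln (p z) - ln (a z * b z / p z) + a z * b z / p z"
      using nn[OF z] ln_eq[OF z] by simp
  qed
  then have "ln (a z * b z / p z) = a z * b z / p z - 1" by simp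
  then have "a z * b z / p z = 1" using ln_eq_minus_one[of "a z * b z / p z"] pos[OF z] by simp
  then show ?thesis using pos[OF z] by (simp add: a_def b_def p_def field_simps)
qed

lemma pent_inj_image:
  assumes "\<And>z z'. g z = g z' \<longleftrightarrow> g' z = g' z'"
  shows "pent \<pi> g = pent \<pi> g'"
proof -
  have "pmf (map_pmf g \<pi>) (g z) = pmf (map_pmf g' \<pi>) (g' z)" for z
    unfolding pmf_map using assms by (metis (mono_tags, lifting) vimage_singleton_eq subsetI subset_antisym)
  then show ?thesis by (simp add: pent_def)
qed

text \<open>Agreement on the support makes the joint law at most the product law everywhere. Both
  have total mass 1, so they coincide, and the support is a full rectangle.\<close>

lemma pent_independent_support:
  assumes eq: "pent \<pi> (\<lambda>z. (u z, v z)) = pent \<pi> u + pent \<pi> v" and fin: "pent \<pi> (\<lambda>z. (u z, v z)) \<noteq> \<infinity>"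
    and z: "z1 \<in> set_pmf \<pi>" "z2 \<in> set_pmf \<pi>"
  shows "\<exists>z\<in>set_pmf \<pi>. u z = u z1 \<and> v z = v z2"
proof -
  let ?uv = "\<lambda>z. (u z, v z)" let ?P = "map_pmf ?uv \<pi>" and ?Q = "pair_pmf (map_pmf u \<pi>) (map_pmf v \<pi>)"
  have le: "pmf ?P x \<le> pmf ?Q x" for x
  proof (cases "x \<in> set_pmf ?P")
    case True
    then obtain z where "z \<in> set_pmf \<pi>" "x = ?uv z" by auto
    then show ?thesis using pent_independent[OF eq fin] by (simp add: pmf_pair)
  next
    case False
    then show ?thesis by (simp add: set_pmf_iff del: set_map_pmf)
  qed
  have "?P = ?Q"
  proof (rule pmf_eqI)
    fix x
    have 1: "(\<integral>\<^sup>+x. pmf ?Q x - pmf ?P x \<partial>count_space UNIV) = (\<integral>\<^sup>+x. pmf ?Q x \<partial>count_space UNIV) - (\<integral>\<^sup>+x. pmf ?P x \<partial>count_space UNIV)"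
      by (subst nn_integral_diff[symmetric]) (auto simp: le nn_integral_pmf ennreal_minus intro!: ennreal_leI)
    have "ennreal (pmf ?Q x - pmf ?P x) \<le> (\<integral>\<^sup>+x. pmf ?Q x - pmf ?P x \<partial>count_space UNIV)"
      by (rule nn_integral_ge_point) auto
    also have "\<dots> = 0" unfolding 1 by (simp add: nn_integral_pmf)
    finally show "pmf ?P x = pmf ?Q x" using le[of x] by (simp add: ennreal_eq_0_iff)
  qed
  then have "set_pmf ?P = set_pmf (map_pmf u \<pi>) \<times> set_pmf (map_pmf v \<pi>)" by simp
  then have "(u z1, v z2) \<in> set_pmf ?P" using z by auto
  then show ?thesis by auto
qed

text \<open>By \<open>pent_determined\<close>, each value of \<open>v\<close> occurring over a value
  of \<open>u\<close> carries the whole mass of that fibre, so there is room for one only.\<close>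

lemma pent_determined_support:
  assumes eq: "pent \<pi> (\<lambda>z. (u z, v z)) = pent \<pi> u" and fin: "pent \<pi> u \<noteq> \<infinity>"
    and z: "z1 \<in> set_pmf \<pi>" "z2 \<in> set_pmf \<pi>" "u z1 = u z2"
  shows "v z1 = v z2"
proof (rule ccontr)
  assume ne: "v z1 \<noteq> v z2"
  let ?uv = "\<lambda>z. (u z, v z)"
  have "measure_pmf.prob \<pi> (?uv -` {?uv z1}) + measure_pmf.prob \<pi> (?uv -` {?uv z2})
     = measure_pmf.prob \<pi> (?uv -` {?uv z1} \<union> ?uv -` {?uv z2})"
    by (rule measure_pmf.finite_measure_Union[symmetric]) (use ne in auto)
  also have "\<dots> \<le> measure_pmf.prob \<pi> (u -` {u z1})"
    by (rule measure_pmf.finite_measure_mono) (use z in auto)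
  finally have "pmf (map_pmf ?uv \<pi>) (?uv z1) + pmf (map_pmf ?uv \<pi>) (?uv z2) \<le> pmf (map_pmf u \<pi>) (u z1)"
    by (simp add: pmf_map)
  then show False using pent_determined[OF eq fin z(1)] pmf_map_pos[OF z(2), of ?uv] by simp
qed

text \<open>Finitely many variables with countably many values have countably many joint values, so
  the law of the whole tuple is a pmf. Outcomes are from now on functions on the ground set.\<close>

lemma entropic_pmf:
  fixes M :: "'w measure" and X :: "'a \<Rightarrow> 'w \<Rightarrow> 'v"
  assumes rep: "entropic_representation M X c E r" and "finite E"
  obtains \<pi> :: "('a \<Rightarrow> 'v) pmf" where "\<And>A. A \<subseteq> E \<Longrightarrow> of_nat (r A) = ennreal c * pent \<pi> (\<lambda>z. restrict z A)"
proof -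
  interpret prob_space M using rep by (simp add: entropic_representation_def)
  have meas: "X e \<in> measurable M (count_space UNIV)"
    and count: "countable (X e ` space M)" if "e \<in> E" for e
    using rep that by (auto simp: entropic_representation_def discrete_rv_def)
  define Y where "Y = joint_rv X E"
  define S where "S = Y ` space M"
  have "S \<subseteq> PiE E (\<lambda>e. X e ` space M)" by (auto simp: S_def Y_def joint_rv_def)
  moreover have "countable (PiE E (\<lambda>e. X e ` space M))"
    using \<open>finite E\<close> count by (intro countable_PiE) auto
  ultimately have S: "countable S" by (rule countable_subset)
  define B where "B s = {w \<in> space M. Y w = s}" for s
  have B: "B s \<in> sets M" for s
  proof (cases "s \<in> S")
    case True
    have "{w \<in> space M. \<forall>e\<in>E. X e w = s e} \<in> sets M"
    proof (rule sets.sets_Collect_finite_All[OF _ \<open>finite E\<close>])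
      fix e assume "e \<in> E"
      have "X e -` {s e} \<inter> space M \<in> sets M"
        using measurable_sets[OF meas[OF \<open>e \<in> E\<close>], of "{s e}"] by simp
      then show "{w \<in> space M. X e w = s e} \<in> sets M" by (simp add: vimage_def Int_def conj_commute)
    qed
    also have "{w \<in> space M. \<forall>e\<in>E. X e w = s e} = B s"
      using True by (auto simp: B_def S_def Y_def joint_rv_def restrict_def fun_eq_iff)
    finally show ?thesis .
  next
    case False
    then have "B s = {}" by (auto simp: B_def S_def)
    then show ?thesis by simp
  qed
  have em: "(\<integral>\<^sup>+s. ennreal (prob (B s)) \<partial>count_space C) = emeasure M {w \<in> space M. Y w \<in> C}" for C
  proof -
    have "(\<integral>\<^sup>+s. ennreal (prob (B s)) \<partial>count_space C) = (\<integral>\<^sup>+s. emeasure M (B s) \<partial>count_space (C \<inter> S))"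
      unfolding emeasure_eq_measure
    proof (rule nn_integral_count_space_eq)
      fix x assume "x \<in> C - C \<inter> S"
      then have "B x = {}" by (auto simp: B_def S_def)
      then show "ennreal (prob (B x)) = 0" by simp
    qed auto
    also have "\<dots> = emeasure M (\<Union>s\<in>C \<inter> S. B s)"
      by (rule emeasure_UN_countable[symmetric]) (use B S in \<open>auto simp: disjoint_family_on_def B_def intro: countable_subset\<close>)
    also have "(\<Union>s\<in>C \<inter> S. B s) = {w \<in> space M. Y w \<in> C}" by (auto simp: B_def S_def)
    finally show ?thesis .
  qed
  define \<pi> where "\<pi> = embed_pmf (\<lambda>s. prob (B s))"
  have \<pi>: "pmf \<pi> s = prob (B s)" for s
    unfolding \<pi>_def by (rule pmf_embed_pmf) (simp_all add: em[of UNIV] emeasure_space_1)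
  have pr: "pmf (map_pmf (\<lambda>z. restrict z A) \<pi>) y = prob {w \<in> space M. joint_rv X A w = y}" if "A \<subseteq> E" for A y
  proof -
    have "emeasure (measure_pmf \<pi>) ((\<lambda>z. restrict z A) -` {y}) = (\<integral>\<^sup>+s. ennreal (prob (B s)) \<partial>count_space ((\<lambda>z. restrict z A) -` {y}))"
      by (subst nn_integral_pmf[symmetric]) (simp add: \<pi>)
    also have "\<dots> = emeasure M {w \<in> space M. joint_rv X A w = y}"
      unfolding em using that by (intro arg_cong[of _ _ "emeasure M"]) (auto simp: Y_def joint_rv_def restrict_def fun_eq_iff)
    finally show ?thesis by (simp add: pmf_map measure_pmf.emeasure_eq_measure emeasure_eq_measure)
  qed
  show thesis
  proof (rule that)
    fix A assume A: "A \<subseteq> E"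
    have "shannon_entropy M (joint_rv X A) = pent \<pi> (\<lambda>z. restrict z A)"
      unfolding shannon_entropy_def pr[OF A, symmetric] by (rule infsum_pmf_entropy)
    then show "of_nat (r A) = ennreal c * pent \<pi> (\<lambda>z. restrict z A)"
      using rep A by (simp add: entropic_representation_def)
  qed
qed

section \<open>Closure properties of computable functions\<close>

definition rf :: "nat \<Rightarrow> (nat list \<Rightarrow> nat) \<Rightarrow> bool" where
  "rf n F \<longleftrightarrow> (\<exists>p. \<forall>xs. length xs = n \<longrightarrow> computes p xs (F xs))"

abbreviation rp :: "nat \<Rightarrow> (nat list \<Rightarrow> bool) \<Rightarrow> bool" where
  "rp n P \<equiv> rf n (\<lambda>xs. of_bool (P xs))"

lemma rf_cong: "rf n F \<Longrightarrow> (\<And>xs. length xs = n \<Longrightarrow> F xs = G xs) \<Longrightarrow> rf n G"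
  unfolding rf_def by metis

lemma rf_comp:
  assumes "rf (length Gs) G" "\<forall>g\<in>set Gs. rf n g"
  shows "rf n (\<lambda>xs. G (map (\<lambda>g. g xs) Gs))"
proof -
  obtain p where p: "\<And>ys. length ys = length Gs \<Longrightarrow> computes p ys (G ys)"
    using assms(1) unfolding rf_def by metis
  have "\<exists>ps. \<forall>xs. length xs = n \<longrightarrow> list_all2 (\<lambda>q y. computes q xs y) ps (map (\<lambda>g. g xs) Gs)"
    using assms(2)
  proof (induction Gs)
    case (Cons g Gs)
    then obtain ps where ps: "\<forall>xs. length xs = n \<longrightarrow> list_all2 (\<lambda>q y. computes q xs y) ps (map (\<lambda>g. g xs) Gs)"
      by auto
    obtain q where q: "\<forall>xs. length xs = n \<longrightarrow> computes q xs (g xs)"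
      using Cons.prems unfolding rf_def by auto
    show ?case by (rule exI[of _ "q # ps"]) (use ps q in auto)
  qed (rule exI[of _ "[]"], simp)
  then obtain ps where ps: "\<And>xs. length xs = n \<Longrightarrow> list_all2 (\<lambda>q y. computes q xs y) ps (map (\<lambda>g. g xs) Gs)"
    by metis
  show ?thesis unfolding rf_def
    by (rule exI[of _ "Comp p ps"]) (auto intro!: computes.Comp[OF ps] p)
qed

lemma rf_comp1: "rf 1 (\<lambda>ys. G (hd ys)) \<Longrightarrow> rf n F \<Longrightarrow> rf n (\<lambda>xs. G (F xs))"
  using rf_comp[of "[F]" "\<lambda>ys. G (hd ys)" n] by simp

lemma rf_comp2: "rf 2 (\<lambda>ys. G (hd ys) (hd (tl ys))) \<Longrightarrow> rf n F1 \<Longrightarrow> rf n F2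
  \<Longrightarrow> rf n (\<lambda>xs. G (F1 xs) (F2 xs))"
  using rf_comp[of "[F1, F2]" "\<lambda>ys. G (hd ys) (hd (tl ys))" n] by (simp add: numeral_2_eq_2)

lemma rf_nth: "k < n \<Longrightarrow> rf n (\<lambda>xs. xs ! k)"
  unfolding rf_def by (rule exI[of _ "Proj k"]) (auto intro: computes.Proj)

lemma hd_tl_funpow: "k < length xs \<Longrightarrow> hd ((tl ^^ k) xs) = xs ! k"
proof (induction k arbitrary: xs)
  case (Suc k)
  then show ?case by (cases xs) (auto simp: funpow_swap1)
qed (auto simp: hd_conv_nth)

lemma rf_hd: "k < n \<Longrightarrow> rf n (\<lambda>xs. hd ((tl ^^ k) xs))"
  by (rule rf_cong[OF rf_nth]) (auto simp: hd_tl_funpow)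

lemma rf_var:
  "0 < n \<Longrightarrow> rf n (\<lambda>xs. hd xs)"
  "1 < n \<Longrightarrow> rf n (\<lambda>xs. hd (tl xs))"
  "Suc 1 < n \<Longrightarrow> rf n (\<lambda>xs. hd (tl (tl xs)))"
  "3 < n \<Longrightarrow> rf n (\<lambda>xs. hd (tl (tl (tl xs))))"
  "4 < n \<Longrightarrow> rf n (\<lambda>xs. hd (tl (tl (tl (tl xs)))))"
  "5 < n \<Longrightarrow> rf n (\<lambda>xs. hd (tl (tl (tl (tl (tl xs))))))"
  "6 < n \<Longrightarrow> rf n (\<lambda>xs. hd (tl (tl (tl (tl (tl (tl xs)))))))"
  "7 < n \<Longrightarrow> rf n (\<lambda>xs. hd (tl (tl (tl (tl (tl (tl (tl xs))))))))"
  "8 < n \<Longrightarrow> rf n (\<lambda>xs. hd (tl (tl (tl (tl (tl (tl (tl (tl xs)))))))))"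
  using rf_hd[of 0 n] rf_hd[of 1 n] rf_hd[of 2 n] rf_hd[of 3 n] rf_hd[of 4 n] rf_hd[of 5 n]
    rf_hd[of 6 n] rf_hd[of 7 n] rf_hd[of 8 n]
  by (simp_all add: eval_nat_numeral)

lemma rf_Suc: "rf n F \<Longrightarrow> rf n (\<lambda>xs. Suc (F xs))"
proof (rule rf_comp1[of Suc])
  show "rf 1 (\<lambda>ys. Suc (hd ys))"
    unfolding rf_def by (rule exI[of _ Succ]) (auto simp: length_Suc_conv intro: computes.Succ)
qed

lemma rf_const: "rf n (\<lambda>_. c)"
proof (induction c)
  case 0
  show ?case unfolding rf_def by (rule exI[of _ Zero]) (auto intro: computes.Zero)
qed (rule rf_Suc)

lemma rf_rec_aux:
  assumes "rf n F" "rf (Suc (Suc n)) (\<lambda>ys. G (hd ys) (hd (tl ys)) (tl (tl ys)))"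
  shows "rf (Suc n) (\<lambda>ys. rec_nat (F (tl ys)) (\<lambda>i y. G i y (tl ys)) (hd ys))"
proof -
  obtain p q where p: "\<And>xs. length xs = n \<Longrightarrow> computes p xs (F xs)"
    and q: "\<And>i y xs. length xs = n \<Longrightarrow> computes q (i # y # xs) (G i y xs)"
    using assms unfolding rf_def by (metis length_Cons list.sel(1) list.sel(3))
  have "computes (PrimRec p q) (m # xs) (rec_nat (F xs) (\<lambda>i y. G i y xs) m)" if "length xs = n" for m xs
    by (induction m) (auto intro: computes.PrimRec_0 computes.PrimRec_Suc p[OF that] q[OF that])
  then show ?thesis
    unfolding rf_def by (intro exI[of _ "PrimRec p q"]) (auto simp: length_Suc_conv)
qed

lemma rf_rec:
  assumes "rf n F" "rf (Suc (Suc n)) (\<lambda>ys. G (hd ys) (hd (tl ys)) (tl (tl ys)))" "rf n B"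
  shows "rf n (\<lambda>xs. rec_nat (F xs) (\<lambda>i y. G i y xs) (B xs))"
proof -
  let ?H = "\<lambda>ys. rec_nat (F (tl ys)) (\<lambda>i y. G i y (tl ys)) (hd ys)"
  let ?Gs = "B # map (\<lambda>k xs. xs ! k) [0..<n]"
  have "rf n (\<lambda>xs. ?H (map (\<lambda>g. g xs) ?Gs))"
    by (rule rf_comp) (use rf_rec_aux[OF assms(1,2)] assms(3) in \<open>auto intro: rf_nth\<close>)
  then show ?thesis
    by (rule rf_cong) (auto simp: comp_def map_nth)
qed

lemma rf_add: "rf n F \<Longrightarrow> rf n G \<Longrightarrow> rf n (\<lambda>xs. F xs + G xs)"
proof -
  assume *: "rf n F" "rf n G"
  have "rf n (\<lambda>xs. rec_nat (F xs) (\<lambda>i y. Suc y) (G xs))"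
    by (intro rf_rec rf_Suc rf_var * ) auto
  moreover have "rec_nat a (\<lambda>i y. Suc y) b = a + b" for a b by (induction b) auto
  ultimately show ?thesis by simp
qed

lemma rf_mult: "rf n F \<Longrightarrow> rf n G \<Longrightarrow> rf n (\<lambda>xs. F xs * G xs)"
proof (rule rf_comp2[of "(*)"])
  have "rf 2 (\<lambda>ys. rec_nat 0 (\<lambda>i y. y + hd ys) (hd (tl ys)))"
    by (intro rf_rec rf_add rf_var rf_const) auto
  moreover have "rec_nat 0 (\<lambda>i y. y + a) b = a * b" for a b by (induction b) auto
  ultimately show "rf 2 (\<lambda>ys. hd ys * hd (tl ys))" by simp
qed

lemma rf_pow2: "rf n F \<Longrightarrow> rf n (\<lambda>xs. 2 ^ F xs)"
proof -
  assume *: "rf n F"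
  have "rf n (\<lambda>xs. rec_nat 1 (\<lambda>i y. 2 * y) (F xs))"
    by (intro rf_rec rf_mult rf_var rf_const * ) auto
  moreover have "rec_nat 1 (\<lambda>i y. 2 * y) b = (2 ^ b :: nat)" for b by (induction b) auto
  ultimately show ?thesis by simp
qed

lemma rf_diff: "rf n F \<Longrightarrow> rf n G \<Longrightarrow> rf n (\<lambda>xs. F xs - G xs)"
proof (rule rf_comp2[of "(-)"])
  have pred: "rf 1 (\<lambda>ys. hd ys - 1)"
  proof -
    have "rf 1 (\<lambda>ys. rec_nat 0 (\<lambda>i y. i) (hd ys))"
      by (intro rf_rec rf_var rf_const) auto
    moreover have "rec_nat 0 (\<lambda>i y. i) b = b - 1" for b by (induction b) auto
    ultimately show ?thesis by simp
  qed
  have "rf 2 (\<lambda>ys. rec_nat (hd ys) (\<lambda>i y. y - 1) (hd (tl ys)))"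
    by (intro rf_rec rf_comp1[OF pred] rf_var rf_const) auto
  moreover have "rec_nat a (\<lambda>i y. y - 1) b = a - b" for a b by (induction b) auto
  ultimately show "rf 2 (\<lambda>ys. hd ys - hd (tl ys))" by simp
qed

lemma rf_prod_encode: "rf n F \<Longrightarrow> rf n G \<Longrightarrow> rf n (\<lambda>xs. prod_encode (F xs, G xs))"
proof -
  assume *: "rf n F" "rf n G"
  have tri: "rf 1 (\<lambda>ys. triangle (hd ys))"
  proof -
    have "rf 1 (\<lambda>ys. rec_nat 0 (\<lambda>i y. y + Suc i) (hd ys))"
      by (intro rf_rec rf_add rf_Suc rf_var rf_const) auto
    moreover have "rec_nat 0 (\<lambda>i y. y + Suc i) b = triangle b" for b by (induction b) auto
    ultimately show ?thesis by simp
  qed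
  show ?thesis unfolding prod_encode_def prod.case
    by (intro rf_add rf_comp1[OF tri] * )
qed

lemma rp_not: "rp n P \<Longrightarrow> rp n (\<lambda>xs. \<not> P xs)"
  by (rule rf_cong[OF rf_diff[OF rf_const[of _ 1]]]) auto

lemma rp_conj: "rp n P \<Longrightarrow> rp n Q \<Longrightarrow> rp n (\<lambda>xs. P xs \<and> Q xs)"
  by (drule (1) rf_mult) (erule rf_cong, auto)

lemma rp_disj: "rp n P \<Longrightarrow> rp n Q \<Longrightarrow> rp n (\<lambda>xs. P xs \<or> Q xs)"
  by (rule rf_cong[OF rp_not[OF rp_conj[OF rp_not rp_not]]]) auto

lemma rp_less: "rf n F \<Longrightarrow> rf n G \<Longrightarrow> rp n (\<lambda>xs. F xs < G xs)"
proof -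
  assume *: "rf n F" "rf n G"
  have "rf n (\<lambda>xs. 1 - (1 - (G xs - F xs)))"
    by (intro rf_diff rf_const * )
  then show ?thesis by (rule rf_cong) auto
qed

lemma rp_eq: "rf n F \<Longrightarrow> rf n G \<Longrightarrow> rp n (\<lambda>xs. F xs = G xs)"
proof -
  assume *: "rf n F" "rf n G"
  have "rp n (\<lambda>xs. \<not> F xs < G xs \<and> \<not> G xs < F xs)"
    by (intro rp_conj rp_not rp_less * )
  then show ?thesis by (rule rf_cong) auto
qed

text \<open>The arguments of a recursion step are counter, accumulator and parameters. This drops
  the accumulator and replaces the counter by a computed value, as bounded search and list coding
  require.\<close>

lemma rf_comp_tl2:
  assumes "rf (Suc n) H" "rf (Suc (Suc n)) A"
  shows "rf (Suc (Suc n)) (\<lambda>ys. H (A ys # tl (tl ys)))"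
proof -
  define Gs where "Gs = map (\<lambda>k xs. (xs ! k :: nat)) [2..<Suc (Suc n)]"
  have "rf (length (A # Gs)) H" using assms(1) by (simp add: Gs_def del: upt_Suc)
  then have "rf (Suc (Suc n)) (\<lambda>xs. H (map (\<lambda>g. g xs) (A # Gs)))"
    by (rule rf_comp) (use assms(2) in \<open>auto intro!: rf_nth simp: Gs_def simp del: upt_Suc\<close>)
  then show ?thesis
  proof (rule rf_cong)
    fix xs :: "nat list" assume "length xs = Suc (Suc n)"
    then have "map (\<lambda>g. g xs) Gs = tl (tl xs)"
      unfolding Gs_def by (intro nth_equalityI) (auto simp: nth_tl simp del: upt_Suc)
    then show "H (map (\<lambda>g. g xs) (A # Gs)) = H (A xs # tl (tl xs))" by simp
  qed
qed

lemma rf_tl: "rf n F \<Longrightarrow> rf (Suc n) (\<lambda>ys. F (tl ys))"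
proof -
  define Gs where "Gs = map (\<lambda>k xs. (xs ! k :: nat)) [1..<Suc n]"
  assume "rf n F"
  then have "rf (length Gs) F" by (simp add: Gs_def del: upt_Suc)
  then have "rf (Suc n) (\<lambda>xs. F (map (\<lambda>g. g xs) Gs))"
    by (rule rf_comp) (auto intro!: rf_nth simp: Gs_def simp del: upt_Suc)
  then show ?thesis
  proof (rule rf_cong)
    fix xs :: "nat list" assume "length xs = Suc n"
    then have "map (\<lambda>g. g xs) Gs = tl xs"
      unfolding Gs_def by (intro nth_equalityI) (auto simp: nth_tl simp del: upt_Suc)
    then show "F (map (\<lambda>g. g xs) Gs) = F (tl xs)" by simp
  qed
qed

lemma rp_bex:
  assumes "rf n B" "rp (Suc n) (\<lambda>ys. P (hd ys) (tl ys))"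
  shows "rp n (\<lambda>xs. \<exists>i<B xs. P i xs)"
proof -
  have P: "rp (Suc (Suc n)) (\<lambda>ys. P (hd ys) (tl (tl ys)))"
    using rf_comp_tl2[OF assms(2) rf_var(1)] by simp
  have "rf n (\<lambda>xs. rec_nat 0 (\<lambda>i y. of_bool (y \<noteq> 0 \<or> P i xs)) (B xs))"
    by (intro rf_rec rp_disj rp_not rp_eq rf_var rf_const assms P) auto
  moreover have "rec_nat 0 (\<lambda>i y. of_bool (y \<noteq> 0 \<or> P i xs)) b = (of_bool (\<exists>i<b. P i xs) :: nat)" for b xs
    by (induction b) (auto simp: less_Suc_eq)
  ultimately show ?thesis by simp
qed

lemma rf_list_encode_map:
  assumes "rf n B" "rf (Suc n) (\<lambda>ys. F (hd ys) (tl ys))"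
  shows "rf n (\<lambda>xs. list_encode (map (\<lambda>k. F k xs) [0..<B xs]))"
proof -
  have F: "rf (Suc (Suc n)) (\<lambda>ys. F (B (tl (tl ys)) - Suc (hd ys)) (tl (tl ys)))"
    using rf_comp_tl2[OF assms(2) rf_diff[OF rf_tl[OF rf_tl[OF assms(1)]] rf_Suc[OF rf_var(1)]]] by simp
  \<comment> \<open>\<open>list_encode\<close> adds elements in front, so the recursion starts at
    the end of the list: after \<open>k\<close> rounds it holds the code of the last
    \<open>k\<close> entries.\<close>
  have "rf n (\<lambda>xs. rec_nat 0 (\<lambda>i y. Suc (prod_encode (F (B xs - Suc i) xs, y))) (B xs))"
    by (intro rf_rec rf_Suc rf_prod_encode rf_var rf_const assms F) auto
  moreover have "k \<le> b \<Longrightarrow> rec_nat 0 (\<lambda>i y. Suc (prod_encode (F (b - Suc i) xs, y))) k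
      = list_encode (map (\<lambda>k. F k xs) [b - k..<b])" for b k xs
  proof (induction k)
    case (Suc k)
    then have "[b - Suc k..<b] = (b - Suc k) # [b - k..<b]"
      by (simp add: Suc_diff_Suc upt_conv_Cons)
    with Suc show ?case by simp
  qed simp
  ultimately show ?thesis by simp
qed

text \<open>A bounded search for an odd quotient \<open>2 * a + 1\<close> and a remainder below
  \<open>2 ^ i\<close> takes the place of division by \<open>2 ^ i\<close>.\<close>

lemma rp_set_decode: "rf n F \<Longrightarrow> rf n G \<Longrightarrow> rp n (\<lambda>xs. F xs \<in> set_decode (G xs))"
proof (rule rf_comp2[of "\<lambda>i k. of_bool (i \<in> set_decode k)"])
  have "rp 2 (\<lambda>ys. \<exists>a<Suc (hd (tl ys)). \<exists>b<2 ^ hd ys. hd (tl ys) = (2 * a + 1) * 2 ^ hd ys + b)"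
    by (intro rp_bex rp_eq rf_Suc rf_pow2 rf_add rf_mult rf_const rf_var) auto
  moreover have "(\<exists>a<Suc k. \<exists>b<2 ^ i. k = (2 * a + 1) * 2 ^ i + b) \<longleftrightarrow> i \<in> set_decode k" for i k
  proof
    assume "\<exists>a<Suc k. \<exists>b<2 ^ i. k = (2 * a + 1) * 2 ^ i + b"
    then obtain a b where "b < 2 ^ i" "k = (2 * a + 1) * 2 ^ i + b" by auto
    then have "k div 2 ^ i = 2 * a + 1"
      by (metis div_less div_mult_self3 add.right_neutral add.commute power_not_zero zero_neq_numeral)
    then show "i \<in> set_decode k" by (simp add: set_decode_def)
  next
    assume "i \<in> set_decode k"
    then obtain a where a: "k div 2 ^ i = 2 * a + 1" by (auto simp: set_decode_def elim: oddE)
    have k: "k = (2 * a + 1) * 2 ^ i + k mod 2 ^ i" by (metis a div_mult_mod_eq)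
    have "2 * a + 1 \<le> k" using a div_le_dividend by metis
    then have "a < Suc k" by simp
    with k show "\<exists>a<Suc k. \<exists>b<2 ^ i. k = (2 * a + 1) * 2 ^ i + b"
      by (intro exI[of _ a] exI[of _ "k mod 2 ^ i"] conjI) auto
  qed
  ultimately show "rp 2 (\<lambda>ys. hd ys \<in> set_decode (hd (tl ys)))" by simp
qed

section \<open>Loop programs\<close>

text \<open>\<open>LOOP j b\<close> decrements register \<open>j\<close> and runs \<open>b\<close>
  as long as \<open>j\<close> is nonzero. The body may itself change \<open>j\<close>, so this is a
  while loop and can express unbounded search.\<close>

datatype com = INC nat | LOOP nat "com list"

fun step :: "com list \<times> (nat \<Rightarrow> nat) \<Rightarrow> com list \<times> (nat \<Rightarrow> nat)" where
  "step ([], r) = ([], r)"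
| "step (INC j # k, r) = (k, r(j := Suc (r j)))"
| "step (LOOP j b # k, r) = (if r j = 0 then (k, r) else (b @ LOOP j b # k, r(j := r j - 1)))"

inductive steps :: "nat \<Rightarrow> com list \<times> (nat \<Rightarrow> nat) \<Rightarrow> com list \<times> (nat \<Rightarrow> nat) \<Rightarrow> bool" where
  steps_0: "steps 0 c c"
| steps_Suc: "fst c \<noteq> [] \<Longrightarrow> steps n (step c) c' \<Longrightarrow> steps (Suc n) c c'"

lemma steps_trans: "steps m a b \<Longrightarrow> steps n b c \<Longrightarrow> steps (m + n) a c"
  by (induction rule: steps.induct) (auto intro: steps.intros)

text \<open>The control state is the list of commands still to be executed. Quantifying over the
  rest \<open>k\<close> of that list makes runs composable.\<close>

definition run :: "com list \<Rightarrow> (nat \<Rightarrow> nat) \<Rightarrow> (nat \<Rightarrow> nat) \<Rightarrow> bool" where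
  "run ks r r' \<longleftrightarrow> (\<forall>k. \<exists>n. steps n (ks @ k, r) (k, r'))"

lemma run_Nil: "run [] r r"
  unfolding run_def using steps_0 by auto

lemma run_append: "run ks r r' \<Longrightarrow> run ls r' r'' \<Longrightarrow> run (ks @ ls) r r''"
  unfolding run_def by (metis append_assoc steps_trans)

lemma run_INC: "run [INC j] r (r(j := Suc (r j)))"
  unfolding run_def
proof
  fix k show "\<exists>n. steps n ([INC j] @ k, r) (k, r(j := Suc (r j)))"
    by (rule exI[of _ "Suc 0"]) (auto intro!: steps.intros)
qed

lemma run_LOOP_0: "r j = 0 \<Longrightarrow> run [LOOP j b] r r"
  unfolding run_def
proof
  fix k assume "r j = 0"
  then show "\<exists>n. steps n ([LOOP j b] @ k, r) (k, r)"
    by (intro exI[of _ "Suc 0"]) (auto intro!: steps.intros)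
qed

lemma run_LOOP_Suc:
  assumes "r j = Suc m" "run b (r(j := m)) r'" "run [LOOP j b] r' r''"
  shows "run [LOOP j b] r r''"
  unfolding run_def
proof
  fix k
  obtain n1 where 1: "steps n1 (b @ LOOP j b # k, r(j := m)) (LOOP j b # k, r')"
    using assms(2) unfolding run_def by blast
  obtain n2 where 2: "steps n2 (LOOP j b # k, r') (k, r'')"
    using assms(3) unfolding run_def by auto
  have "steps (Suc (n1 + n2)) ([LOOP j b] @ k, r) (k, r'')"
    by (rule steps_Suc) (use steps_trans[OF 1 2] assms(1) in auto)
  then show "\<exists>n. steps n ([LOOP j b] @ k, r) (k, r'')" ..
qed

lemma run_Cons: "run [c] r r' \<Longrightarrow> run ls r' r'' \<Longrightarrow> run (c # ls) r r''"
  using run_append[of "[c]"] by simp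

lemma run_clear: "run [LOOP j []] r (r(j := 0))"
proof (induction "r j" arbitrary: r)
  case 0
  then show ?case using run_LOOP_0[of r j "[]"] by (simp add: fun_upd_idem)
next
  case (Suc m)
  then have "run [LOOP j []] (r(j := m)) (r(j := 0))" using Suc.hyps(1)[of "r(j := m)"] by simp
  with Suc show ?case by (intro run_LOOP_Suc[of r j m, OF _ run_Nil]) auto
qed

definition move :: "nat \<Rightarrow> nat \<Rightarrow> com list" where
  "move a b = [LOOP a [INC b]]"

lemma run_move: "a \<noteq> b \<Longrightarrow> run (move a b) r (r(a := 0, b := r b + r a))"
  unfolding move_def
proof (induction "r a" arbitrary: r)
  case 0
  then show ?case using run_LOOP_0[of r a "[INC b]"] by (simp add: fun_upd_idem)
next
  case (Suc m)
  have "run [LOOP a [INC b]] (r(a := m, b := Suc (r b))) (r(a := 0, b := r b + r a))"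
    using Suc.hyps(1)[of "r(a := m, b := Suc (r b))"] Suc.hyps(2)[symmetric] Suc.prems
    by (simp add: fun_upd_twist)
  with Suc show ?case by (intro run_LOOP_Suc[of r a m, OF _ run_INC]) auto
qed

definition copy :: "nat \<Rightarrow> nat \<Rightarrow> nat \<Rightarrow> com list" where
  "copy a b t = LOOP a [INC b, INC t] # move t a"

lemma run_copy:
  assumes "a \<noteq> b" "a \<noteq> t" "b \<noteq> t" "r t = 0"
  shows "run (copy a b t) r (r(b := r b + r a))"
proof -
  have *: "run [LOOP a [INC b, INC t]] r (r(a := 0, b := r b + r a, t := r t + r a))" for r
    using assms(1-3)
  proof (induction "r a" arbitrary: r)
    case 0
    then show ?case using run_LOOP_0[of r a "[INC b, INC t]"] by (simp add: fun_upd_idem)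
  next
    case (Suc m)
    have "run [LOOP a [INC b, INC t]] (r(a := m, b := Suc (r b), t := Suc (r t)))
       (r(a := 0, b := r b + r a, t := r t + r a))"
      using Suc.hyps(1)[of "r(a := m, b := Suc (r b), t := Suc (r t))"] Suc.hyps(2)[symmetric] Suc.prems
      by (simp add: fun_upd_twist)
    moreover have "run [INC b, INC t] (r(a := m)) (r(a := m, b := Suc (r b), t := Suc (r t)))"
      using run_Cons[OF run_INC[of b "r(a := m)"] run_INC[of t]] Suc.prems by simp
    ultimately show ?case using Suc by (intro run_LOOP_Suc[of r a m]) auto
  qed
  have "run (copy a b t) r ((r(a := 0, b := r b + r a, t := r t + r a))(t := 0, a := 0 + r a))"
    unfolding copy_def
    by (rule run_Cons[OF *]) (use run_move[of t a "r(a := 0, b := r b + r a, t := r t + r a)"] assms in simp)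
  moreover have "(r(a := 0, b := r b + r a, t := r t + r a))(t := 0, a := 0 + r a) = r(b := r b + r a)"
    using assms by auto
  ultimately show ?thesis by simp
qed

fun clears :: "nat \<Rightarrow> nat \<Rightarrow> com list" where
  "clears n 0 = []"
| "clears n (Suc m) = LOOP n [] # clears (Suc n) m"

lemma run_clears: "run (clears n m) r (\<lambda>j. if n \<le> j \<and> j < n + m then 0 else r j)"
proof (induction m arbitrary: n r)
  case 0
  have "(\<lambda>j. if n \<le> j \<and> j < n + 0 then 0 else r j) = r" by auto
  then show ?case by (simp add: run_Nil)
next
  case (Suc m)
  have "run (clears n (Suc m)) r (\<lambda>j. if Suc n \<le> j \<and> j < Suc n + m then 0 else (r(n := 0)) j)"
    unfolding clears.simps by (rule run_Cons[OF run_clear Suc])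
  moreover have "(\<lambda>j. if Suc n \<le> j \<and> j < Suc n + m then 0 else (r(n := 0)) j)
     = (\<lambda>j. if n \<le> j \<and> j < n + Suc m then 0 else r j)" by auto
  ultimately show ?case by simp
qed

text \<open>\<open>compile p is out n\<close> evaluates \<open>p\<close> on the registers \<open>is\<close> into the zero register \<open>out\<close>; the
  registers from \<open>n\<close> on are scratch space, zero before and after the run.\<close>

fun compile :: "recf \<Rightarrow> nat list \<Rightarrow> nat \<Rightarrow> nat \<Rightarrow> com list"
  and compiles :: "recf list \<Rightarrow> nat list \<Rightarrow> nat \<Rightarrow> com list" where
  "compile Zero is out n = []"
| "compile Succ is out n = copy (hd is) out n @ [INC out]"
| "compile (Proj i) is out n = copy (is ! i) out n"
| "compile (Comp f gs) is out n = compiles gs is n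
     @ compile f [n..<n + length gs] out (n + length gs) @ clears n (length gs)"
| "compile (PrimRec f g) is out n = copy (hd is) n (n + 3) @ compile f (tl is) (n + 2) (n + 4)
     @ [LOOP n (compile g ((n + 1) # (n + 2) # tl is) (n + 3) (n + 4) @ LOOP (n + 2) [] # move (n + 3) (n + 2) @ [INC (n + 1)])]
     @ move (n + 2) out @ [LOOP (n + 1) []]"
| "compile (Mu f) is out n = compile f (n # is) (n + 1) (n + 2)
     @ [LOOP (n + 1) (LOOP (n + 1) [] # INC n # compile f (n # is) (n + 1) (n + 2))] @ move n out"
| "compiles [] is n = []"
| "compiles (g # gs) is n = compile g is n (Suc n) @ compiles gs is (Suc n)"

lemma PrimRec_values:
  assumes "computes (PrimRec f g) (m # xs) y"
  obtains v where "computes f xs (v 0)" "\<And>i. i < m \<Longrightarrow> computes g (i # v i # xs) (v (Suc i))" "v m = y"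
  using assms
proof (induction m arbitrary: y thesis)
  case 0
  show ?case by (rule 0(1)[of "\<lambda>_. y"]) (use 0(2) in \<open>auto elim: computes_elims\<close>)
next
  case (Suc m)
  obtain y' where y': "computes (PrimRec f g) (m # xs) y'" "computes g (m # y' # xs) y"
    using Suc.prems(2) by (auto elim: computes_elims)
  obtain v where v: "computes f xs (v 0)" "\<And>i. i < m \<Longrightarrow> computes g (i # v i # xs) (v (Suc i))" "v m = y'"
    using Suc.IH[OF _ y'(1)] by blast
  show ?case
    by (rule Suc.prems(1)[of "v(Suc m := y)"]) (use v y' in \<open>auto simp: less_Suc_eq\<close>)
qed

definition correct :: "recf \<Rightarrow> bool" where
  "correct p \<longleftrightarrow> (\<forall>xs y is out n r. computes p xs y \<longrightarrow> map r is = xs \<longrightarrow> set is \<subseteq> {..<n} \<longrightarrow> out < n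
     \<longrightarrow> out \<notin> set is \<longrightarrow> r out = 0 \<longrightarrow> (\<forall>j\<ge>n. r j = 0) \<longrightarrow> run (compile p is out n) r (r(out := y)))"

lemma correctD:
  assumes "correct p" "computes p xs y" "map r is = xs" "set is \<subseteq> {..<n}" "out < n" "out \<notin> set is" "r out = 0"
    "\<And>j. j \<ge> n \<Longrightarrow> r j = 0" "r' = r(out := y)"
  shows "run (compile p is out n) r r'"
  using assms unfolding correct_def by blast

lemma run_compiles:
  assumes "\<And>g. g \<in> set gs \<Longrightarrow> correct g" "list_all2 (\<lambda>g y. computes g (map r is) y) gs ys" "set is \<subseteq> {..<n}"
    "\<forall>j\<ge>n. r j = 0"
  shows "run (compiles gs is n) r (\<lambda>j. if n \<le> j \<and> j < n + length gs then ys ! (j - n) else r j)"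
  using assms
proof (induction gs arbitrary: ys n r)
  case Nil
  have "(\<lambda>j. if n \<le> j \<and> j < n + 0 then ys ! (j - n) else r j) = r" by auto
  then show ?case using Nil by (simp add: run_Nil)
next
  case (Cons g gs)
  then obtain y ys' where ys: "ys = y # ys'" "computes g (map r is) y"
    "list_all2 (\<lambda>g y. computes g (map r is) y) gs ys'"
    by (auto simp: list_all2_Cons1)
  have mapr: "map (r(n := y)) is = map r is" using Cons.prems(3) by auto
  have "run (compile g is n (Suc n)) r (r(n := y))"
    by (rule correctD[OF Cons.prems(1) ys(2)]) (use Cons.prems in auto)
  moreover have "run (compiles gs is (Suc n)) (r(n := y))
     (\<lambda>j. if Suc n \<le> j \<and> j < Suc n + length gs then ys' ! (j - Suc n) else (r(n := y)) j)"
  proof (rule Cons.IH)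
    show "list_all2 (\<lambda>g. computes g (map (r(n := y)) is)) gs ys'"
      unfolding mapr by (rule ys(3))
  qed (use Cons.prems in auto)
  ultimately have "run (compiles (g # gs) is n) r
     (\<lambda>j. if Suc n \<le> j \<and> j < Suc n + length gs then ys' ! (j - Suc n) else (r(n := y)) j)"
    by (simp add: run_append)
  moreover have "(\<lambda>j. if Suc n \<le> j \<and> j < Suc n + length gs then ys' ! (j - Suc n) else (r(n := y)) j)
    = (\<lambda>j. if n \<le> j \<and> j < n + length (g # gs) then ys ! (j - n) else r j)"
    using ys(1) by (auto simp: fun_eq_iff nth_Cons' not_le less_Suc_eq_le)
  ultimately show ?case by simp
qed

lemma correct_Comp:
  assumes "correct f" "\<And>g. g \<in> set gs \<Longrightarrow> correct g"
  shows "correct (Comp f gs)"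
  unfolding correct_def
proof (intro allI impI)
  fix xs y and "is" :: "nat list" and out n :: nat and r
  assume *: "computes (Comp f gs) xs y" "map r is = xs" "set is \<subseteq> {..<n}" "out < n" "out \<notin> set is"
    "r out = 0" "\<forall>j\<ge>n. r j = 0"
  obtain ys where ys: "list_all2 (\<lambda>g y. computes g xs y) gs ys" "computes f ys y"
    using *(1) by (auto elim: computes_elims)
  have len: "length ys = length gs" using list_all2_lengthD[OF ys(1)] by simp
  define r1 where "r1 = (\<lambda>j. if n \<le> j \<and> j < n + length gs then ys ! (j - n) else r j)"
  have 1: "run (compiles gs is n) r r1"
    unfolding r1_def by (rule run_compiles) (use assms(2) ys * in auto)
  have 2: "run (compile f [n..<n + length gs] out (n + length gs)) r1 (r1(out := y))"
  proof (rule correctD[OF assms(1) ys(2)])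
    show "map r1 [n..<n + length gs] = ys"
      by (rule nth_equalityI) (auto simp: len r1_def)
  qed (use * in \<open>auto simp: r1_def\<close>)
  have 3: "run (clears n (length gs)) (r1(out := y)) (r(out := y))"
  proof -
    have "(\<lambda>j. if n \<le> j \<and> j < n + length gs then 0 else (r1(out := y)) j) = r(out := y)"
      using * by (auto simp: r1_def fun_eq_iff)
    then show ?thesis using run_clears[of n "length gs" "r1(out := y)"] by simp
  qed
  show "run (compile (Comp f gs) is out n) r (r(out := y))"
    using run_append[OF 1 run_append[OF 2 3]] by simp
qed

text \<open>Register \<open>n\<close> counts the remaining rounds, \<open>n + 1\<close> is the
  current argument, \<open>n + 2\<close> the accumulator and \<open>n + 3\<close> the new value.
  \<open>st i\<close> describes the registers after \<open>i\<close> rounds.\<close>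

lemma correct_PrimRec:
  assumes "correct f" "correct g"
  shows "correct (PrimRec f g)"
  unfolding correct_def
proof (intro allI impI)
  fix xs y and "is" :: "nat list" and out n :: nat and r
  assume *: "computes (PrimRec f g) xs y" "map r is = xs" "set is \<subseteq> {..<n}" "out < n" "out \<notin> set is"
    "r out = 0" "\<forall>j\<ge>n. r j = 0"
  obtain m xs' where xs: "xs = m # xs'"
    using *(1) by (cases rule: computes.cases) auto
  then obtain i0 is' where is': "is = i0 # is'" "r i0 = m" "map r is' = xs'"
    using *(2) by auto
  obtain v where v: "computes f xs' (v 0)" "\<And>i. i < m \<Longrightarrow> computes g (i # v i # xs') (v (Suc i))" "v m = y"
    using PrimRec_values *(1) unfolding xs by blast
  define st where "st i = r(n := m - i, n + 1 := i, n + 2 := v i)" for i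
  let ?body = "compile g ((n + 1) # (n + 2) # is') (n + 3) (n + 4) @ LOOP (n + 2) [] # move (n + 3) (n + 2) @ [INC (n + 1)]"
  have nin: "n \<notin> set is'" "Suc n \<notin> set is'" "Suc (Suc n) \<notin> set is'" using * is' by auto
  have 1: "run (copy i0 n (n + 3)) r (r(n := m))"
    using run_copy[of i0 n "n + 3" r] * is' by auto
  have 2: "run (compile f is' (n + 2) (n + 4)) (r(n := m)) (st 0)"
    by (rule correctD[OF assms(1) v(1)]) (use * is' nin in \<open>auto simp: st_def fun_eq_iff\<close>)
  have body: "run ?body ((st i)(n := m - Suc i)) (st (Suc i))" if "i < m" for i
  proof -
    let ?s = "(st i)(n := m - Suc i)"
    have a: "run (compile g ((n + 1) # (n + 2) # is') (n + 3) (n + 4)) ?s (?s(n + 3 := v (Suc i)))"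
      by (rule correctD[OF assms(2) v(2)[OF that]]) (use * is' nin in \<open>auto simp: st_def fun_eq_iff\<close>)
    have b: "run (move (n + 3) (n + 2)) (?s(n + 3 := v (Suc i), n + 2 := 0)) (?s(n + 2 := v (Suc i)))"
    proof -
      have "(?s(n + 3 := v (Suc i), n + 2 := 0))(n + 3 := 0, n + 2 := (?s(n + 3 := v (Suc i), n + 2 := 0)) (n + 2) + (?s(n + 3 := v (Suc i), n + 2 := 0)) (n + 3))
         = ?s(n + 2 := v (Suc i))"
        using * by (auto simp: st_def fun_eq_iff)
      then show ?thesis using run_move[of "n + 3" "n + 2" "?s(n + 3 := v (Suc i), n + 2 := 0)"] by simp
    qed
    have c: "run [INC (n + 1)] (?s(n + 2 := v (Suc i))) (st (Suc i))"
    proof -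
      have "(?s(n + 2 := v (Suc i)))(n + 1 := Suc ((?s(n + 2 := v (Suc i))) (n + 1))) = st (Suc i)"
        by (auto simp: st_def fun_eq_iff)
      then show ?thesis using run_INC[of "n + 1" "?s(n + 2 := v (Suc i))"] by simp
    qed
    show ?thesis
      by (rule run_append[OF a run_Cons[OF run_clear run_append[OF b c]]])
  qed
  have loop: "i \<le> m \<Longrightarrow> run [LOOP n ?body] (st (m - i)) (st m)" for i
  proof (induction i)
    case 0
    have "st m n = 0" by (simp add: st_def)
    then show ?case by (simp add: run_LOOP_0)
  next
    case (Suc i)
    show ?case
    proof (rule run_LOOP_Suc)
      show "st (m - Suc i) n = Suc i" using Suc by (simp add: st_def)
      show "run ?body ((st (m - Suc i))(n := i)) (st (m - i))"
        using body[of "m - Suc i"] Suc.prems by (simp add: Suc_diff_Suc)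
      show "run [LOOP n ?body] (st (m - i)) (st m)" using Suc by simp
    qed
  qed
  have 3: "run [LOOP n ?body] (st 0) (st m)" using loop[of m] by simp
  have 4: "run (move (n + 2) out) (st m) (r(n + 1 := m, out := y))"
  proof -
    have "(st m)(n + 2 := 0, out := st m out + st m (n + 2)) = r(n + 1 := m, out := y)"
      using * v(3) by (auto simp: st_def fun_eq_iff)
    then show ?thesis using run_move[of "n + 2" out "st m"] * by simp
  qed
  have 5: "run [LOOP (n + 1) []] (r(n + 1 := m, out := y)) (r(out := y))"
  proof -
    have "(r(n + 1 := m, out := y))(n + 1 := 0) = r(out := y)"
      using * by (auto simp: fun_eq_iff)
    then show ?thesis using run_clear[of "n + 1" "r(n + 1 := m, out := y)"] by simp
  qed
  show "run (compile (PrimRec f g) is out n) r (r(out := y))"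
    using run_append[OF 1 run_append[OF 2 run_append[OF 3 run_append[OF 4 5]]]] is' by simp
qed

text \<open>Register \<open>n\<close> holds the candidate and \<open>n + 1\<close> the value of
  \<open>f\<close> there. The loop on \<open>n + 1\<close> serves as a test: its body first clears
  what the decrement has left, so one pass corresponds to one nonzero value, however large.\<close>

lemma correct_Mu:
  assumes "correct f"
  shows "correct (Mu f)"
  unfolding correct_def
proof (intro allI impI)
  fix xs y and "is" :: "nat list" and out n :: nat and r
  assume *: "computes (Mu f) xs y" "map r is = xs" "set is \<subseteq> {..<n}" "out < n" "out \<notin> set is"
    "r out = 0" "\<forall>j\<ge>n. r j = 0"
  have "\<And>m. m < y \<Longrightarrow> \<exists>w. computes f (m # xs) (Suc w)" "computes f (y # xs) 0"
    using *(1) by (auto elim: computes_elims)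
  then obtain v where v: "\<And>m. m \<le> y \<Longrightarrow> computes f (m # xs) (v m)" "v y = 0" "\<And>m. m < y \<Longrightarrow> v m \<noteq> 0"
  proof -
    assume a: "\<And>m. m < y \<Longrightarrow> \<exists>w. computes f (m # xs) (Suc w)" "computes f (y # xs) 0"
    obtain w where w: "\<And>m. m < y \<Longrightarrow> computes f (m # xs) (Suc (w m))" using a(1) by metis
    show thesis
      by (rule that[of "\<lambda>m. if m < y then Suc (w m) else 0"]) (use w a(2) in \<open>auto simp: le_less\<close>)
  qed
  define st where "st i = r(n := i, n + 1 := v i)" for i
  let ?body = "LOOP (n + 1) [] # INC n # compile f (n # is) (n + 1) (n + 2)"
  have f: "run (compile f (n # is) (n + 1) (n + 2)) (r(n := i)) (st i)" if "i \<le> y" for i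
    by (rule correctD[OF assms v(1)[OF that]]) (use * in \<open>auto simp: st_def fun_eq_iff\<close>)
  have 1: "run (compile f (n # is) (n + 1) (n + 2)) r (st 0)"
    using f[of 0] * by (simp add: fun_upd_idem)
  have body: "run ?body ((st i)(n + 1 := w)) (st (Suc i))" if "i < y" for i w
  proof -
    have 1: "run [LOOP (n + 1) []] ((st i)(n + 1 := w)) (r(n := i))"
      using run_clear[of "n + 1" "(st i)(n + 1 := w)"] * by (simp add: st_def fun_upd_idem)
    have 2: "run [INC n] (r(n := i)) (r(n := Suc i))"
      using run_INC[of n "r(n := i)"] by simp
    show ?thesis by (rule run_Cons[OF 1 run_Cons[OF 2 f]]) (use that in simp)
  qed
  have loop: "i \<le> y \<Longrightarrow> run [LOOP (n + 1) ?body] (st (y - i)) (st y)" for i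
  proof (induction i)
    case 0
    have "st y (n + 1) = 0" using v(2) by (simp add: st_def)
    then show ?case by (simp add: run_LOOP_0)
  next
    case (Suc i)
    obtain w where w: "v (y - Suc i) = Suc w" using v(3)[of "y - Suc i"] Suc.prems by (cases "v (y - Suc i)") auto
    show ?case
    proof (rule run_LOOP_Suc)
      show "st (y - Suc i) (n + 1) = Suc w" using w by (simp add: st_def)
      show "run ?body ((st (y - Suc i))(n + 1 := w)) (st (y - i))"
        using body[of "y - Suc i"] Suc.prems by (simp add: Suc_diff_Suc)
      show "run [LOOP (n + 1) ?body] (st (y - i)) (st y)" using Suc by simp
    qed
  qed
  have 2: "run [LOOP (n + 1) ?body] (st 0) (st y)" using loop[of y] by simp
  have 3: "run (move n out) (st y) (r(out := y))"
  proof -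
    have "(st y)(n := 0, out := st y out + st y n) = r(out := y)"
      using * v(2) by (auto simp: st_def fun_eq_iff)
    then show ?thesis using run_move[of n out "st y"] * by simp
  qed
  show "run (compile (Mu f) is out n) r (r(out := y))"
    using run_append[OF 1 run_append[OF 2 3]] by simp
qed

lemma compile_correct: "correct p"
proof (induction p)
  case Zero
  show ?case unfolding correct_def by (auto elim!: computes_elims simp: run_Nil fun_upd_idem)
next
  case Succ
  show ?case unfolding correct_def
  proof (intro allI impI)
    fix xs y and "is" :: "nat list" and out n :: nat and r
    assume *: "computes Succ xs y" "map r is = xs" "set is \<subseteq> {..<n}" "out < n" "out \<notin> set is"
      "r out = 0" "\<forall>j\<ge>n. r j = 0"
    then obtain x where x: "xs = [x]" "y = Suc x" by (auto elim: computes_elims)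
    then obtain i where i: "is = [i]" "r i = x" using *(2) by auto
    have "run (copy i out n) r (r(out := x))" using run_copy[of i out n r] * i by auto
    moreover have "run [INC out] (r(out := x)) (r(out := y))" using run_INC[of out "r(out := x)"] x by simp
    ultimately show "run (compile Succ is out n) r (r(out := y))" using i by (simp add: run_append)
  qed
next
  case (Proj k)
  show ?case unfolding correct_def
  proof (intro allI impI)
    fix xs y and "is" :: "nat list" and out n :: nat and r
    assume *: "computes (Proj k) xs y" "map r is = xs" "set is \<subseteq> {..<n}" "out < n" "out \<notin> set is"
      "r out = 0" "\<forall>j\<ge>n. r j = 0"
    then have y: "k < length is" "y = r (is ! k)" by (auto elim!: computes_elims)
    then have "is ! k \<in> set is" by simp
    then have "is ! k < n" "is ! k \<noteq> out" using * by auto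
    then show "run (compile (Proj k) is out n) r (r(out := y))"
      using run_copy[of "is ! k" out n r] * y by auto
  qed
qed (auto intro: correct_Comp correct_PrimRec correct_Mu)

text \<open>Register 1 receives a second copy of the input so that the initial state matches the
  input word, in which \<open>Cc 0\<close> and \<open>Cc 1\<close> alternate. With two letters the
  word can grow back and forth between two matrix positions.\<close>

lemma compile_steps:
  assumes "computes p [m] y"
  shows "\<exists>n r. steps n (compile p [0] 2 3, (\<lambda>j. if j < 2 then m else 0)) ([], r) \<and> r 2 = y"
proof -
  let ?r = "\<lambda>j. if j < 2 then m else (0::nat)"
  have "run (compile p [0] 2 3) ?r (?r(2 := y))"
    by (rule correctD[OF compile_correct assms]) auto
  then have "\<exists>n. steps n (compile p [0] 2 3 @ [], ?r) ([], ?r(2 := y))"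
    unfolding run_def by blast
  then show ?thesis by force
qed

section \<open>A monoid simulating a loop program\<close>

text \<open>The control states that occur while \<open>cs\<close> is executed in front of
  \<open>k\<close>. Entering a loop lengthens the control list, but finishing the body restores the
  list from which it was entered, so the set is finite and closed under \<open>step\<close>.\<close>

fun conts :: "com list \<Rightarrow> com list \<Rightarrow> com list set" where
  "conts [] k = {k}"
| "conts (INC j # cs) k = insert (INC j # cs @ k) (conts cs k)"
| "conts (LOOP j b # cs) k = insert (LOOP j b # cs @ k) (conts b (LOOP j b # cs @ k) \<union> conts cs k)"

fun regs :: "com list \<Rightarrow> nat set" where
  "regs [] = {}"
| "regs (INC j # cs) = insert j (regs cs)"
| "regs (LOOP j b # cs) = insert j (regs b \<union> regs cs)"

lemma finite_conts: "finite (conts cs k)"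
  by (induction cs k rule: conts.induct) auto

lemma finite_regs: "finite (regs cs)"
  by (induction cs rule: regs.induct) auto

lemma regs_append: "regs (a @ b) = regs a \<union> regs b"
  by (induction a rule: regs.induct) auto

lemma conts_self: "cs @ k \<in> conts cs k"
  by (induction cs k rule: conts.induct) auto

lemma conts_step: "s \<in> conts cs k \<Longrightarrow> s \<noteq> k \<Longrightarrow> fst (step (s, r)) \<in> conts cs k"
proof (induction cs k rule: conts.induct)
  case (2 j cs k)
  then show ?case using conts_self[of cs k] by auto
next
  case (3 j b cs k)
  show ?case
  proof (cases "s = LOOP j b # cs @ k")
    case True
    then show ?thesis using conts_self[of cs k] conts_self[of b "LOOP j b # cs @ k"] by auto
  qed (use 3 in auto)
qed auto

lemma conts_regs: "s \<in> conts cs k \<Longrightarrow> regs s \<subseteq> regs cs \<union> regs k"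
  by (induction cs k arbitrary: s rule: conts.induct) (fastforce simp: regs_append)+

lemma conts_step_LOOP:
  assumes "LOOP j b # s \<in> conts cs []"
  shows "s \<in> conts cs []" "b @ LOOP j b # s \<in> conts cs []"
  using conts_step[OF assms, of "\<lambda>_. 0"] conts_step[OF assms, of "\<lambda>_. 1"] by auto

lemma conts_step_INC:
  assumes "INC j # s \<in> conts cs []"
  shows "s \<in> conts cs []"
  using conts_step[OF assms, of "\<lambda>_. 0"] by auto

lemma conts_Nil: "[] \<in> conts cs []"
proof -
  have "k \<in> conts cs k" for k by (induction cs k rule: conts.induct) auto
  then show ?thesis .
qed

text \<open>In the word \<open>Bb k # L @ [Qq s]\<close> the state \<open>s\<close> of the program sits at the right end, register
  \<open>i\<close> is the number of letters \<open>Cc i\<close> in \<open>L\<close>, and \<open>Bb k\<close> stands for \<open>Bb 0, Zz 0, \<dots>, Zz (k-1)\<close>. The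
  letter \<open>Zz i\<close> commutes with everything but \<open>Cc i\<close>, so it reaches the state exactly if register
  \<open>i\<close> is zero. Every step leaves a letter \<open>Dd\<close>, which keeps the finite model bounded.\<close>

datatype letter =
  Cc nat | Zz nat | Dd | Qq "com list" | Nn "com list" | Yy "com list" | Mm letter letter | Bb nat | Oo

definition commuting :: "nat \<Rightarrow> letter \<Rightarrow> letter \<Rightarrow> bool" where
  "commuting k x y \<longleftrightarrow> x \<in> Cc ` {..<k} \<union> Zz ` {..<k} \<union> {Dd} \<and> y \<in> Cc ` {..<k} \<union> Zz ` {..<k} \<union> {Dd}
     \<and> (\<forall>j. (x, y) \<noteq> (Cc j, Zz j) \<and> (x, y) \<noteq> (Zz j, Cc j))"

text \<open>Every relation has the shape letter times letter equals letter, the only shape that a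
  commutator of elementary matrices expresses. Longer relations are cut by auxiliary letters:
  \<open>Mm x y\<close> is the common value of \<open>x y\<close> and \<open>y x\<close>,
  \<open>Nn s\<close> abbreviates \<open>Dd (Qq s)\<close>, and \<open>Yy\<close> names the two
  equal words of a loop exit. Thus \<open>Inc\<close> reads
  \<open>Cc j Dd (Qq s) = Qq (INC j # s)\<close>, and \<open>Halt\<close> turns a final state with
  nonzero output into \<open>Oo\<close>.\<close>

inductive trip :: "nat \<Rightarrow> com list set \<Rightarrow> letter \<Rightarrow> letter \<Rightarrow> letter \<Rightarrow> bool" for k S where
  comm1: "commuting k x y \<Longrightarrow> trip k S x y (Mm x y)"
| comm2: "commuting k x y \<Longrightarrow> trip k S y x (Mm x y)"
| Dq: "s \<in> S \<Longrightarrow> trip k S Dd (Qq s) (Nn s)"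
| Inc: "INC j # s \<in> S \<Longrightarrow> trip k S (Cc j) (Nn s) (Qq (INC j # s))"
| Loop: "LOOP j b # s \<in> S \<Longrightarrow> trip k S (Cc j) (Qq (LOOP j b # s)) (Nn (b @ LOOP j b # s))"
| Exit1: "LOOP j b # s \<in> S \<Longrightarrow> trip k S (Zz j) (Qq (LOOP j b # s)) (Yy (LOOP j b # s))"
| Exit2: "LOOP j b # s \<in> S \<Longrightarrow> trip k S (Zz j) (Nn s) (Yy (LOOP j b # s))"
| Halt: "trip k S (Cc 2) (Qq []) Oo"
| Start: "i < k \<Longrightarrow> trip k S (Bb i) (Zz i) (Bb (Suc i))"

definition alphabet :: "nat \<Rightarrow> com list set \<Rightarrow> letter set" where
  "alphabet k S = (let K = Cc ` {..<k} \<union> Zz ` {..<k} \<union> {Dd} in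
     K \<union> Qq ` S \<union> Nn ` S \<union> Yy ` S \<union> (\<lambda>(x, y). Mm x y) ` (K \<times> K) \<union> Bb ` {..k} \<union> {Oo})"

lemma finite_alphabet: "finite S \<Longrightarrow> finite (alphabet k S)"
  by (auto simp: alphabet_def Let_def)

lemma trip_alphabet:
  assumes "trip k (conts cs []) x y z" "regs cs \<subseteq> {..<k}" "2 < k"
  shows "x \<in> alphabet k (conts cs []) \<and> y \<in> alphabet k (conts cs []) \<and> z \<in> alphabet k (conts cs [])"
  using assms(1)
proof cases
  case (Inc j s)
  then show ?thesis using conts_step_INC[of j s cs] conts_regs[of "INC j # s" cs "[]"] assms(2)
    by (auto simp: alphabet_def Let_def)
next
  case (Loop j b s)
  then show ?thesis using conts_step_LOOP[of j b s cs] conts_regs[of "LOOP j b # s" cs "[]"] assms(2)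
    by (auto simp: alphabet_def Let_def)
next
  case (Exit1 j b s)
  then show ?thesis using conts_step_LOOP[of j b s cs] conts_regs[of "LOOP j b # s" cs "[]"] assms(2)
    by (auto simp: alphabet_def Let_def)
next
  case (Exit2 j b s)
  then show ?thesis using conts_step_LOOP[of j b s cs] conts_regs[of "LOOP j b # s" cs "[]"] assms(2)
    by (auto simp: alphabet_def Let_def)
next
  case Halt
  then show ?thesis using conts_Nil assms(3) by (auto simp: alphabet_def Let_def)
qed (auto simp: commuting_def alphabet_def Let_def)

inductive weq :: "('l \<Rightarrow> 'l \<Rightarrow> 'l \<Rightarrow> bool) \<Rightarrow> 'l list \<Rightarrow> 'l list \<Rightarrow> bool" for T where
  rule: "T x y z \<Longrightarrow> weq T (a @ [x, y] @ b) (a @ [z] @ b)"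
| refl: "weq T u u"
| sym: "weq T u v \<Longrightarrow> weq T v u"
| trans: "weq T u v \<Longrightarrow> weq T v w \<Longrightarrow> weq T u w"

declare weq.trans [trans]

lemma weq_rule: "T x y z \<Longrightarrow> weq T (a @ x # y # b) (a @ z # b)"
  using weq.rule[of T x y z a b] by simp

lemma weq_rule': "T x y z \<Longrightarrow> weq T (a @ z # b) (a @ x # y # b)"
  by (rule weq.sym[OF weq_rule])

lemma weq_swap: "commuting k x y \<Longrightarrow> weq (trip k S) (a @ x # y # b) (a @ y # x # b)"
  by (rule weq.trans[OF weq_rule weq_rule']) (erule trip.comm1, erule trip.comm2)

lemma weq_move: "\<forall>y\<in>set p. commuting k x y \<Longrightarrow> weq (trip k S) (a @ x # p @ b) (a @ p @ x # b)"
proof (induction p arbitrary: a)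
  case (Cons y p)
  have "weq (trip k S) (a @ x # y # (p @ b)) (a @ y # x # (p @ b))"
    by (rule weq_swap) (use Cons.prems in simp)
  also have "weq (trip k S) \<dots> (a @ (y # p) @ x # b)"
    using Cons.IH[of "a @ [y]"] Cons.prems by simp
  finally show ?case by simp
qed (auto intro: weq.refl)

lemma weq_perm:
  assumes "mset L = mset L'" "set L \<subseteq> Cc ` {..<k} \<union> {Dd}"
  shows "weq (trip k S) (a @ L @ b) (a @ L' @ b)"
  using assms
proof (induction L arbitrary: L' a)
  case (Cons x L)
  then have "x \<in> set L'" by (metis list.set_intros(1) mset_eq_setD)
  then obtain p q where L': "L' = p @ x # q" by (meson split_list)
  have "set L' \<subseteq> Cc ` {..<k} \<union> {Dd}" using Cons.prems by (metis mset_eq_setD)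
  then have comm: "\<forall>y\<in>set p. commuting k x y"
    using Cons.prems(2) by (auto simp: L' commuting_def)
  have "weq (trip k S) ((a @ [x]) @ L @ b) ((a @ [x]) @ (p @ q) @ b)"
    by (rule Cons.IH) (use Cons.prems L' in auto)
  also have "weq (trip k S) ((a @ [x]) @ (p @ q) @ b) (a @ p @ x # q @ b)"
    using weq_move[OF comm, of S a "q @ b"] by simp
  finally show ?case by (simp add: L')
qed (auto intro: weq.refl)

definition conf :: "nat \<Rightarrow> letter list \<Rightarrow> com list \<Rightarrow> letter list" where
  "conf k L s = Bb 0 # map Zz [0..<k] @ L @ [Qq s]"

lemma conf_step:
  assumes S: "S = conts cs []" and k: "regs cs \<subseteq> {..<k}" and s: "s \<in> S" "s \<noteq> []"
    and L: "set L \<subseteq> Cc ` {..<k} \<union> {Dd}" "\<forall>i<k. count_list L (Cc i) = r i"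
    and st: "step (s, r) = (s', r')"
  shows "\<exists>L'. weq (trip k S) (conf k L s) (conf k L' s') \<and> set L' \<subseteq> Cc ` {..<k} \<union> {Dd}
    \<and> (\<forall>i<k. count_list L' (Cc i) = r' i) \<and> s' \<in> S"
proof -
  have s'S: "s' \<in> S" using conts_step[of s cs "[]" r] s st S by auto
  let ?z = "Bb 0 # map Zz [0..<k]"
  obtain c ks where cks: "s = c # ks" using s(2) by (cases s) auto
  show ?thesis
  proof (cases c)
    case (INC j)
    then have j: "j < k" using conts_regs[of s cs "[]"] s k S cks by auto
    have st': "s' = ks" "r' = r(j := Suc (r j))" using st INC cks by auto
    have "weq (trip k S) ((?z @ L) @ Qq s # []) ((?z @ L) @ Cc j # Nn ks # [])"
      by (rule weq_rule') (use s INC cks in \<open>auto intro: trip.Inc\<close>)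
    also have "weq (trip k S) ((?z @ L) @ Cc j # Nn ks # []) ((?z @ L @ [Cc j]) @ Dd # Qq ks # [])"
      using weq_rule'[of "trip k S" Dd "Qq ks" "Nn ks" "?z @ L @ [Cc j]" "[]"] s'S st' by (auto intro: trip.Dq)
    finally have "weq (trip k S) (conf k L s) (conf k (L @ [Cc j, Dd]) s')"
      by (simp add: conf_def st')
    then show ?thesis using L j s'S st' by (intro exI[of _ "L @ [Cc j, Dd]"]) auto
  next
    case (LOOP j b)
    then have j: "j < k" using conts_regs[of s cs "[]"] s k S cks by auto
    have sS: "LOOP j b # ks \<in> S" "s = LOOP j b # ks" using s cks LOOP by auto
    show ?thesis
    proof (cases "r j = 0")
      case True
      then have st': "s' = ks" "r' = r" using st LOOP cks by auto
      have nj: "Cc j \<notin> set L" using L(2) j True by (metis count_list_0_iff)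
      let ?z1 = "Bb 0 # map Zz [0..<j]" and ?z2 = "map Zz [Suc j..<k]"
      have z: "?z = ?z1 @ Zz j # ?z2"
        using j upt_add_eq_append[of 0 j "k - j"] by (simp add: upt_conv_Cons)
      have comm: "\<forall>y\<in>set (?z2 @ L). commuting k (Zz j) y"
        using L(1) nj j by (auto simp: commuting_def)
      have "weq (trip k S) (?z1 @ Zz j # (?z2 @ L) @ [Qq s]) (?z1 @ (?z2 @ L) @ Zz j # [Qq s])"
        by (rule weq_move[OF comm])
      also have "weq (trip k S) \<dots> ((?z1 @ ?z2 @ L) @ Yy s # [])"
        using weq_rule[of "trip k S" "Zz j" "Qq s" "Yy s" "?z1 @ ?z2 @ L" "[]"] sS by (auto intro: trip.Exit1)
      also have "weq (trip k S) \<dots> ((?z1 @ ?z2 @ L) @ Zz j # Nn ks # [])"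
        by (rule weq_rule') (use sS in \<open>auto intro: trip.Exit2\<close>)
      also have "weq (trip k S) \<dots> ((?z1 @ ?z2 @ L @ [Zz j]) @ Dd # Qq ks # [])"
        using weq_rule'[of "trip k S" Dd "Qq ks" "Nn ks" "?z1 @ ?z2 @ L @ [Zz j]" "[]"] s'S st'
        by (auto intro: trip.Dq)
      also have "weq (trip k S) \<dots> (?z1 @ Zz j # (?z2 @ L) @ [Dd, Qq ks])"
        using weq.sym[OF weq_move[OF comm, of S ?z1 "[Dd, Qq ks]"]] by simp
      finally have "weq (trip k S) (conf k L s) (conf k (L @ [Dd]) s')"
        unfolding conf_def using z by (simp add: st')
      then show ?thesis using L s'S st' by (intro exI[of _ "L @ [Dd]"]) auto
    next
      case False
      then have st': "s' = b @ LOOP j b # ks" "r' = r(j := r j - 1)" using st LOOP cks by auto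
      have "Cc j \<in> set L" using L(2) j False by (metis count_list_0_iff)
      then obtain p q where pq: "L = p @ Cc j # q" by (meson split_list)
      have "weq (trip k S) (?z @ L @ [Qq s]) (?z @ (p @ q @ [Cc j]) @ [Qq s])"
        by (rule weq_perm[OF _ L(1)]) (simp add: pq)
      also have "weq (trip k S) \<dots> ((?z @ p @ q) @ Nn s' # [])"
        using weq_rule[of "trip k S" "Cc j" "Qq s" "Nn s'" "?z @ p @ q" "[]"] sS st' by (auto intro: trip.Loop)
      also have "weq (trip k S) \<dots> ((?z @ p @ q) @ Dd # Qq s' # [])"
        by (rule weq_rule') (use s'S in \<open>auto intro: trip.Dq\<close>)
      finally have "weq (trip k S) (conf k L s) (conf k (p @ q @ [Dd]) s')"
        by (simp add: conf_def)
      moreover have "count_list (p @ q @ [Dd]) (Cc i) = r' i" if "i < k" for i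
      proof -
        have "count_list L (Cc i) = r i" using L(2) that by blast
        then show ?thesis using st'(2) by (auto simp: pq)
      qed
      ultimately show ?thesis using L(1) s'S pq by (intro exI[of _ "p @ q @ [Dd]"]) auto
    qed
  qed
qed

lemma conf_steps:
  assumes "steps n (s, r) (s', r')" "S = conts cs []" "regs cs \<subseteq> {..<k}" "s \<in> S"
    "set L \<subseteq> Cc ` {..<k} \<union> {Dd}" "\<forall>i<k. count_list L (Cc i) = r i"
  shows "\<exists>L'. weq (trip k S) (conf k L s) (conf k L' s') \<and> set L' \<subseteq> Cc ` {..<k} \<union> {Dd}
    \<and> (\<forall>i<k. count_list L' (Cc i) = r' i)"
  using assms
proof (induction n "(s, r)" "(s', r')" arbitrary: s r L rule: steps.induct)
  case steps_0
  then show ?case using weq.refl by blast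
next
  case (steps_Suc n s r)
  obtain s1 r1 where 1: "step (s, r) = (s1, r1)" by fastforce
  obtain L1 where L1: "weq (trip k S) (conf k L s) (conf k L1 s1)" "set L1 \<subseteq> Cc ` {..<k} \<union> {Dd}"
    "\<forall>i<k. count_list L1 (Cc i) = r1 i" "s1 \<in> S"
    using conf_step[OF steps_Suc(4,5,6) _ steps_Suc(7,8) 1] steps_Suc(1) by auto
  obtain L' where "weq (trip k S) (conf k L1 s1) (conf k L' s')" "set L' \<subseteq> Cc ` {..<k} \<union> {Dd}"
    "\<forall>i<k. count_list L' (Cc i) = r' i"
    using steps_Suc(3)[OF 1 steps_Suc(4,5) L1(4,2,3)] by blast
  then show ?case using weq.trans[OF L1(1)] by blast
qed

definition input_word :: "nat \<Rightarrow> com list \<Rightarrow> nat \<Rightarrow> letter list" where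
  "input_word k s m = Bb k # concat (replicate m [Cc 0, Cc 1]) @ [Qq s]"

lemma count_list_concat_replicate: "count_list (concat (replicate m xs)) x = m * count_list xs x"
  by (induction m) auto

lemma weq_Start: "i \<le> k \<Longrightarrow> weq (trip k S) (Bb i # a) (Bb 0 # map Zz [0..<i] @ a)"
proof (induction i arbitrary: a)
  case (Suc i)
  have "weq (trip k S) ([] @ Bb (Suc i) # a) ([] @ Bb i # Zz i # a)"
    by (rule weq_rule') (use Suc.prems in \<open>auto intro: trip.Start\<close>)
  also have "weq (trip k S) \<dots> (Bb 0 # map Zz [0..<i] @ Zz i # a)"
    using Suc by simp
  finally show ?case by simp
qed (simp add: weq.refl)

text \<open>The output register is nonzero at the end, so a letter \<open>Cc 2\<close> can be
  carried to the final state, where \<open>Halt\<close> applies. The nonempty prefix allows the word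
  to be split later as a commutator with the entry of \<open>Oo\<close>.\<close>

theorem input_word_zero:
  assumes "steps n (cs, \<lambda>j. if j < 2 then m else 0) ([], r)" "r 2 \<noteq> 0" "regs cs \<subseteq> {..<k}" "2 < k"
  shows "\<exists>u. u \<noteq> [] \<and> weq (trip k (conts cs [])) (input_word k cs m) (u @ [Oo])"
proof -
  let ?L = "concat (replicate m [Cc 0, Cc 1])"
  let ?T = "trip k (conts cs [])"
  have 1: "weq ?T (input_word k cs m) (conf k ?L cs)"
    using weq_Start[of k k] by (simp add: input_word_def conf_def)
  have L0: "set ?L \<subseteq> Cc ` {..<k} \<union> {Dd}" "\<forall>i<k. count_list ?L (Cc i) = (if i < 2 then m else 0)"
    using assms(4) by (auto simp: count_list_concat_replicate less_2_cases_iff split: if_splits)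
  obtain L where L: "weq ?T (conf k ?L cs) (conf k L [])" "set L \<subseteq> Cc ` {..<k} \<union> {Dd}"
    "\<forall>i<k. count_list L (Cc i) = r i"
    using conf_steps[OF assms(1) HOL.refl assms(3) _ L0] conts_self[of cs "[]"] by auto
  have "Cc 2 \<in> set L" using L(3) assms(2,4) by (metis count_list_0_iff)
  then obtain p q where pq: "L = p @ Cc 2 # q" by (meson split_list)
  let ?z = "Bb 0 # map Zz [0..<k]"
  have "weq ?T (?z @ L @ [Qq []]) (?z @ (p @ q @ [Cc 2]) @ [Qq []])"
    by (rule weq_perm[OF _ L(2)]) (simp add: pq)
  also have "weq ?T \<dots> ((?z @ p @ q) @ [Oo])"
    using weq_rule[of ?T "Cc 2" "Qq []" Oo "?z @ p @ q" "[]"] by (auto intro: trip.Halt)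
  finally have "weq ?T (conf k L []) ((?z @ p @ q) @ [Oo])" by (simp add: conf_def)
  then have "weq ?T (input_word k cs m) ((?z @ p @ q) @ [Oo])"
    using 1 L(1) weq.trans by blast
  then show ?thesis by blast
qed


section \<open>A finite model of the monoid by partial maps\<close>

type_synonym cell = "((nat \<Rightarrow> nat) \<times> nat set \<times> nat) option"

text \<open>Acceptance with output zero after exactly \<open>n\<close> steps. Exactness keeps the
  clock in balance: in a relation that performs a step of the program, one side contains one more
  letter \<open>Dd\<close>.\<close>

fun accepts :: "nat \<Rightarrow> com list \<Rightarrow> (nat \<Rightarrow> nat) \<Rightarrow> bool" where
  "accepts 0 s r \<longleftrightarrow> s = [] \<and> r 2 = 0"
| "accepts (Suc n) s r \<longleftrightarrow> s \<noteq> [] \<and> accepts n (fst (step (s, r))) (snd (step (s, r)))"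

lemma steps_accepts: "steps n (s, r) ([], r') \<Longrightarrow> r' 2 = 0 \<Longrightarrow> accepts n s r"
  by (induction n "(s, r)" "([] :: com list, r')" arbitrary: s r rule: steps.induct) auto

text \<open>A run of \<open>n\<close> steps lowers a register by at most \<open>n\<close>, so a
  value above \<open>n\<close> is never found to be zero, and two such values cannot be told
  apart.\<close>

lemma accepts_cong:
  "\<forall>j. r j = r' j \<or> (n < r j \<and> n < r' j) \<Longrightarrow> accepts n s r \<longleftrightarrow> accepts n s r'"
proof (induction n arbitrary: s r r')
  case 0
  have "r 2 = 0 \<longleftrightarrow> r' 2 = 0" using 0[rule_format, of 2] by auto
  then show ?case by simp
next
  case (Suc n)
  show ?case
  proof (cases s)
    case (Cons c ks)
    show ?thesis
    proof (cases c)
      case (INC j)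
      have "accepts n ks (r(j := Suc (r j))) \<longleftrightarrow> accepts n ks (r'(j := Suc (r' j)))"
        by (rule Suc.IH) (use Suc.prems in \<open>fastforce dest: Suc_lessD\<close>)
      then show ?thesis by (simp add: Cons INC)
    next
      case (LOOP j b)
      have z: "r j = 0 \<longleftrightarrow> r' j = 0" using Suc.prems[rule_format, of j] by auto
      have 1: "accepts n ks r \<longleftrightarrow> accepts n ks r'"
        by (rule Suc.IH) (use Suc.prems in \<open>fastforce dest: Suc_lessD\<close>)
      have "\<forall>i. (r(j := r j - 1)) i = (r'(j := r' j - 1)) i
          \<or> (n < (r(j := r j - 1)) i \<and> n < (r'(j := r' j - 1)) i)"
      proof
        fix i show "(r(j := r j - 1)) i = (r'(j := r' j - 1)) i
          \<or> (n < (r(j := r j - 1)) i \<and> n < (r'(j := r' j - 1)) i)"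
          using Suc.prems[rule_format, of i] by auto
      qed
      then have 2: "accepts n (b @ LOOP j b # ks) (r(j := r j - 1)) \<longleftrightarrow> accepts n (b @ LOOP j b # ks) (r'(j := r' j - 1))"
        by (rule Suc.IH)
      from 1 2 z show ?thesis by (simp add: Cons LOOP)
    qed
  qed simp
qed

text \<open>The cell \<open>Some (r, Z, t)\<close> records the registers, saturated at \<open>Suc T\<close>, the set of letters
  \<open>Zz\<close> read so far and the number of letters \<open>Dd\<close>; \<open>None\<close> is the accepting cell. As
  only \<open>T - t\<close> steps remain, saturation is invisible to the program.\<close>

fun basic :: "nat \<Rightarrow> nat \<Rightarrow> letter \<Rightarrow> cell \<Rightarrow> cell option" where
  "basic k T (Cc j) (Some (r, Z, t)) = Some (Some (r(j := min (Suc T) (Suc (r j))), Z, t))"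
| "basic k T (Zz j) (Some (r, Z, t)) = (if r j = 0 \<and> j \<notin> Z then Some (Some (r, insert j Z, t)) else None)"
| "basic k T Dd (Some (r, Z, t)) = (if t < T then Some (Some (r, Z, Suc t)) else None)"
| "basic k T (Qq s) (Some (r, Z, t)) = (if Z = {..<k} \<and> accepts (T - t) s r then Some None else None)"
| "basic k T (Bb i) (Some (r, Z, t)) = (if (r, Z, t) = (\<lambda>_. 0, {}, 0) then Some (Some (\<lambda>_. 0, {..<i}, 0)) else None)"
| "basic k T _ _ = None"

definition andthen :: "('a \<Rightarrow> 'a option) \<Rightarrow> ('a \<Rightarrow> 'a option) \<Rightarrow> 'a \<Rightarrow> 'a option" where
  "andthen f g v = Option.bind (f v) g"

fun action :: "nat \<Rightarrow> nat \<Rightarrow> letter \<Rightarrow> cell \<Rightarrow> cell option" where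
  "action k T (Mm x y) = andthen (basic k T x) (basic k T y)"
| "action k T (Nn s) = andthen (basic k T Dd) (basic k T (Qq s))"
| "action k T (Yy (LOOP j b # s)) = andthen (basic k T (Zz j)) (basic k T (Qq (LOOP j b # s)))"
| "action k T (Yy s) = (\<lambda>_. None)"
| "action k T x = basic k T x"

definition cells :: "nat \<Rightarrow> nat \<Rightarrow> cell set" where
  "cells k T = insert None (Some ` {(r, Z, t). (\<forall>j. r j \<le> Suc T) \<and> (\<forall>j\<ge>k. r j = 0) \<and> Z \<subseteq> {..<k} \<and> t \<le> T})"

lemma finite_cells: "finite (cells k T)"
proof -
  have "finite {r :: nat \<Rightarrow> nat. (\<forall>j. r j \<le> Suc T) \<and> (\<forall>j\<ge>k. r j = 0)}" (is "finite ?R")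
  proof -
    have "?R \<subseteq> {f. \<forall>x. (x \<in> {..<k} \<longrightarrow> f x \<in> {..Suc T}) \<and> (x \<notin> {..<k} \<longrightarrow> f x = 0)}" by auto
    then show ?thesis by (rule finite_subset) (rule finite_set_of_finite_funs, auto)
  qed
  then have "finite (?R \<times> Pow {..<k} \<times> {..T})" by auto
  moreover have "{(r, Z, t). (\<forall>j. r j \<le> Suc T) \<and> (\<forall>j\<ge>k. r j = 0) \<and> Z \<subseteq> {..<k} \<and> t \<le> T} = ?R \<times> Pow {..<k} \<times> {..T}"
    by auto
  ultimately show ?thesis unfolding cells_def by simp
qed

definition letter_map :: "nat \<Rightarrow> nat \<Rightarrow> letter set \<Rightarrow> letter \<Rightarrow> cell \<Rightarrow> cell option" where
  "letter_map k T \<Sigma> x v = (if x \<in> \<Sigma> \<and> v \<in> cells k T then action k T x v else None)"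

lemma basic_cells:
  assumes "basic k T x v = Some w" "v \<in> cells k T"
    "x \<in> Cc ` {..<k} \<union> Zz ` {..<k} \<union> {Dd} \<union> range Qq \<union> Bb ` {..k}"
  shows "w \<in> cells k T"
  using assms by (cases "(k, T, x, v)" rule: basic.cases) (auto simp: cells_def split: if_splits)

lemma action_cells:
  assumes "action k T x v = Some w" "v \<in> cells k T" "x \<in> alphabet k (conts cs [])" "regs cs \<subseteq> {..<k}"
  shows "w \<in> cells k T"
proof -
  have b: "\<And>x v w. basic k T x v = Some w \<Longrightarrow> v \<in> cells k T \<Longrightarrow>
    x \<in> Cc ` {..<k} \<union> Zz ` {..<k} \<union> {Dd} \<union> range Qq \<union> Bb ` {..k} \<Longrightarrow> w \<in> cells k T"
    by (rule basic_cells)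
  show ?thesis
  proof (cases "(k, T, x)" rule: action.cases)
    case (1 k' T' y z)
    then obtain u where u: "basic k T y v = Some u" "basic k T z u = Some w"
      using assms(1) by (auto simp: andthen_def Option.bind_eq_Some_conv)
    show ?thesis
      by (rule b[OF u(2) b[OF u(1) assms(2)]]) (use assms(3) 1 in \<open>auto simp: alphabet_def Let_def\<close>)
  next
    case (2 k' T' s)
    then obtain u where u: "basic k T Dd v = Some u" "basic k T (Qq s) u = Some w"
      using assms(1) by (auto simp: andthen_def Option.bind_eq_Some_conv)
    show ?thesis by (rule b[OF u(2) b[OF u(1) assms(2)]]) auto
  next
    case (3 k' T' j c s)
    then obtain u where u: "basic k T (Zz j) v = Some u" "basic k T (Qq (LOOP j c # s)) u = Some w"
      using assms(1) by (auto simp: andthen_def Option.bind_eq_Some_conv)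
    have "LOOP j c # s \<in> conts cs []" using assms(3) 3 by (auto simp: alphabet_def Let_def)
    then have "j < k" using conts_regs[of "LOOP j c # s" cs "[]"] assms(4) by auto
    then show ?thesis by (intro b[OF u(2) b[OF u(1) assms(2)]]) auto
  qed (use assms b in \<open>auto simp: alphabet_def Let_def\<close>)
qed

text \<open>Both sides of a relation lead to the same acceptance test. When the clock is exhausted,
  \<open>t = T\<close>, both sides of a program step are undefined: no \<open>Dd\<close> can be
  read, and a nonempty program is not accepted in zero steps. \<open>Halt\<close> holds because
  after \<open>Cc 2\<close> the final state is rejected, so \<open>Oo\<close> can act as the empty
  map.\<close>

lemma action_trip:
  assumes "trip k (conts cs []) x y z" "v \<in> cells k T" "2 < k"
  shows "andthen (action k T x) (action k T y) v = action k T z v"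
  using assms(1)
proof cases
  case comm1
  then show ?thesis by (auto simp: commuting_def)
next
  case comm2
  show ?thesis
  proof (cases v)
    case None
    then show ?thesis using comm2 by (auto simp: commuting_def andthen_def)
  next
    case (Some c)
    obtain r Z t where c: "c = (r, Z, t)" by (cases c)
    show ?thesis using comm2 unfolding Some c
      by (auto simp: commuting_def andthen_def fun_upd_twist insert_commute)
  qed
next
  case (Dq s)
  then show ?thesis by simp
next
  case (Inc j s)
  show ?thesis
  proof (cases v)
    case (Some c)
    obtain r Z t where c: "c = (r, Z, t)" by (cases c)
    have "accepts (T - Suc t) s (r(j := min (Suc T) (Suc (r j)))) \<longleftrightarrow> accepts (T - Suc t) s (r(j := Suc (r j)))"
      by (rule accepts_cong) auto
    moreover have "T - t = Suc (T - Suc t)" if "t < T" using that by simp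
    moreover have "t = T" if "\<not> t < T" using that assms(2) by (auto simp: Some c cells_def)
    ultimately show ?thesis unfolding Some c Inc
      by (cases "t < T") (auto simp: andthen_def)
  qed (use Inc in \<open>simp add: andthen_def\<close>)
next
  case (Loop j b s)
  show ?thesis
  proof (cases v)
    case (Some c)
    obtain r Z t where c: "c = (r, Z, t)" by (cases c)
    have "r j \<le> Suc T" using assms(2) by (auto simp: Some c cells_def)
    \<comment> \<open>At a saturated register the increment by \<open>Cc j\<close> is lost, and the
      decrement of the loop leaves \<open>T\<close> in place of \<open>Suc T\<close>. Both exceed
      the \<open>T - Suc t\<close> remaining steps.\<close>
    then have "t < T \<Longrightarrow> accepts (T - Suc t) (b @ LOOP j b # s) (r(j := min T (r j))) \<longleftrightarrow> accepts (T - Suc t) (b @ LOOP j b # s) r"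
      by (intro accepts_cong) auto
    moreover have "T - t = Suc (T - Suc t)" if "t < T" using that by simp
    moreover have "t = T" if "\<not> t < T" using that assms(2) by (auto simp: Some c cells_def)
    ultimately show ?thesis unfolding Some c Loop
      by (cases "t < T") (auto simp: andthen_def)
  qed (use Loop in \<open>simp add: andthen_def\<close>)
next
  case (Exit1 j b s)
  then show ?thesis by simp
next
  case (Exit2 j b s)
  show ?thesis
  proof (cases v)
    case (Some c)
    obtain r Z t where c: "c = (r, Z, t)" by (cases c)
    have "T - t = Suc (T - Suc t)" if "t < T" using that by simp
    moreover have "t = T" if "\<not> t < T" using that assms(2) by (auto simp: Some c cells_def)
    ultimately show ?thesis unfolding Some c Exit2
      by (cases "t < T") (auto simp: andthen_def)
  qed (use Exit2 in \<open>simp add: andthen_def\<close>)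
next
  case Halt
  show ?thesis
  proof (cases v)
    case (Some c)
    obtain r Z t where c: "c = (r, Z, t)" by (cases c)
    show ?thesis unfolding Some c Halt
      by (cases "T - t") (auto simp: andthen_def)
  qed (use Halt in \<open>simp add: andthen_def\<close>)
next
  case (Start i)
  show ?thesis
  proof (cases v)
    case (Some c)
    obtain r Z t where c: "c = (r, Z, t)" by (cases c)
    show ?thesis unfolding Some c Start
      by (auto simp: andthen_def lessThan_Suc)
  qed (use Start in \<open>simp add: andthen_def\<close>)
qed

fun word_map :: "('l \<Rightarrow> 'a \<Rightarrow> 'a option) \<Rightarrow> 'l list \<Rightarrow> 'a \<Rightarrow> 'a option" where
  "word_map f [] v = Some v"
| "word_map f (x # w) v = Option.bind (f x v) (word_map f w)"

lemma word_map_append: "word_map f (u @ w) v = Option.bind (word_map f u v) (word_map f w)"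
  by (induction u arbitrary: v) (auto split: bind_splits)

theorem input_word_model:
  assumes "steps T (cs, \<lambda>j. if j < 2 then m else 0) ([], r)" "r 2 = 0" "regs cs \<subseteq> {..<k}" "2 < k"
  obtains Y and f :: "letter \<Rightarrow> cell \<Rightarrow> cell option" where
    "finite Y" "\<And>x v w. f x v = Some w \<Longrightarrow> v \<in> Y \<and> w \<in> Y"
    "\<And>x y z. trip k (conts cs []) x y z \<Longrightarrow> andthen (f x) (f y) = f z"
    "\<And>v. f Oo v = None"
    "\<exists>v. word_map f (input_word k cs m) v \<noteq> None"
proof
  let ?\<Sigma> = "alphabet k (conts cs [])"
  let ?f = "letter_map k T ?\<Sigma>"
  show "finite (cells k T)" by (rule finite_cells)
  show cl: "v \<in> cells k T \<and> w \<in> cells k T" if "?f x v = Some w" for x v w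
    using that action_cells[OF _ _ _ assms(3)] by (auto simp: letter_map_def split: if_splits)
  show "andthen (?f x) (?f y) = ?f z" if "trip k (conts cs []) x y z" for x y z
  proof
    fix v
    have xyz: "x \<in> ?\<Sigma>" "y \<in> ?\<Sigma>" "z \<in> ?\<Sigma>" using trip_alphabet[OF that assms(3,4)] by auto
    show "andthen (?f x) (?f y) v = ?f z v"
    proof (cases "v \<in> cells k T")
      case True
      have "andthen (?f x) (?f y) v = andthen (action k T x) (action k T y) v"
        using xyz True action_cells[OF _ True xyz(1) assms(3)]
        by (cases "action k T x v") (auto simp: andthen_def letter_map_def)
      then show ?thesis using action_trip[OF that True assms(4)] xyz True by (simp add: letter_map_def)
    qed (simp add: andthen_def letter_map_def)
  qed
  show "?f Oo v = None" for v by (simp add: letter_map_def)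
  let ?vac = "Some (\<lambda>_. 0, {}, 0) :: cell"
  let ?c = "\<lambda>i. Some (\<lambda>j. if j < 2 then min (Suc T) i else 0, {..<k}, 0) :: cell"
  have L: "Cc 0 \<in> ?\<Sigma>" "Cc 1 \<in> ?\<Sigma>" "Bb k \<in> ?\<Sigma>" "Qq cs \<in> ?\<Sigma>"
    using assms(4) conts_self[of cs "[]"] by (auto simp: alphabet_def Let_def)
  have cells: "?c i \<in> cells k T" for i using assms(4) by (auto simp: cells_def)
  have 1: "word_map ?f (concat (replicate i [Cc 0, Cc 1])) (?c j) = Some (?c (j + i))" for i j
  proof (induction i arbitrary: j)
    case (Suc i)
    let ?c' = "Some ((\<lambda>j'. if j' < 2 then min (Suc T) j else 0)(0 := min (Suc T) (Suc j)), {..<k}, 0) :: cell"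
    have "?f (Cc 0) (?c j) = Some ?c'"
      using cells[of j] L by (simp add: letter_map_def min_def)
    moreover have "?f (Cc 1) ?c' = Some (?c (Suc j))"
    proof -
      have "?c' \<in> cells k T" using assms(4) by (auto simp: cells_def)
      then show ?thesis using L by (auto simp: letter_map_def fun_eq_iff min_def)
    qed
    moreover have "Suc j + i = j + Suc i" by simp
    ultimately show ?case using Suc[of "Suc j"] by (simp only: replicate.simps concat.simps append.simps word_map.simps bind.bind_lunit)
  qed (simp only: replicate.simps concat.simps word_map.simps add_0_right)
  have "accepts T cs (\<lambda>j. if j < 2 then min (Suc T) m else 0)"
    using steps_accepts[OF assms(1,2)]
    by (rule iffD1[OF accepts_cong, rotated]) (auto simp: min_def)
  then have 3: "?f (Qq cs) (?c m) = Some None"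
    using cells[of m] L by (simp add: letter_map_def)
  have "?vac \<in> cells k T" by (auto simp: cells_def)
  then have 0: "?f (Bb k) ?vac = Some (?c 0)" using L by (simp add: letter_map_def fun_eq_iff)
  have "word_map ?f (input_word k cs m) ?vac = Some None"
    using 0 1[of m 0, unfolded add_0] 3 by (simp add: input_word_def word_map_append)
  then show "\<exists>v. word_map ?f (input_word k cs m) v \<noteq> None" by auto
qed

section \<open>Steinberg relations\<close>

typedef 'a bijection = "{f :: 'a \<Rightarrow> 'a. bij f}"
  morphisms bij_fun Bij by (rule exI[of _ id]) simp

setup_lifting type_definition_bijection

instantiation bijection :: (type) group_add
begin

lift_definition zero_bijection :: "'a bijection" is id by simp
lift_definition plus_bijection :: "'a bijection \<Rightarrow> 'a bijection \<Rightarrow> 'a bijection" is comp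
  by (rule bij_comp)
lift_definition uminus_bijection :: "'a bijection \<Rightarrow> 'a bijection" is inv
  by (rule bij_imp_bij_inv)
definition minus_bijection :: "'a bijection \<Rightarrow> 'a bijection \<Rightarrow> 'a bijection" where
  "minus_bijection a b = a + - b"

instance
proof
  fix a b c :: "'a bijection"
  show "a + b + c = a + (b + c)" by transfer (rule comp_assoc)
  show "0 + a = a" "a + 0 = a" by (transfer, simp)+
  show "- a + a = 0" by transfer (simp add: bij_is_inj)
  show "a + - b = a - b" by (rule minus_bijection_def[symmetric])
qed

end

lemma bij_fun_plus: "bij_fun (a + b) x = bij_fun a (bij_fun b x)"
  by transfer simp

lemma bij_fun_zero: "bij_fun 0 x = x"
  by transfer simp

lemma bijection_eqI: "(\<And>x. bij_fun a x = bij_fun b x) \<Longrightarrow> a = b"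
  by transfer auto

lemma bij_fun_uminus: "bij_fun (- a) (bij_fun a x) = x" "bij_fun a (bij_fun (- a) x) = x"
  by (metis bij_fun_plus bij_fun_zero left_minus, metis bij_fun_plus bij_fun_zero right_minus)

definition commutator :: "'g::group_add \<Rightarrow> 'g \<Rightarrow> 'g" where
  "commutator a b = a + b - a - b"

lemma commutator_eq_iff: "commutator a b = v \<longleftrightarrow> a + b = v + (b + a)"
  unfolding commutator_def by (metis add.assoc add_diff_cancel diff_add_cancel)

lemma commutator_0: "commutator a 0 = 0" "commutator 0 a = 0"
  by (simp_all add: commutator_def)

lemmas group_rules = diff_conv_add_uminus add.assoc minus_add minus_minus add_minus_cancel minus_add_cancel
  left_minus right_minus add_0_left add_0_right minus_zero

lemma commute_add:
  fixes a b c :: "'g::group_add"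
  assumes "c + a = a + c" "c + b = b + c"
  shows "c + (a + b) = (a + b) + c"
proof -
  have "c + (a + b) = a + (c + b)" by (simp only: assms(1) flip: add.assoc)
  then show ?thesis by (simp only: assms(2) add.assoc)
qed

lemma commute_minus:
  fixes a c :: "'g::group_add"
  assumes "c + a = a + c"
  shows "c + - a = - a + c"
proof -
  have "- a + (c + a) + - a = - a + (a + c) + - a" by (simp only: assms)
  then show ?thesis by (simp only: group_rules)
qed

lemma commute_commutator:
  fixes a b c :: "'g::group_add"
  assumes "c + a = a + c" "c + b = b + c"
  shows "c + commutator a b = commutator a b + c"
  unfolding commutator_def diff_conv_add_uminus
  by (intro commute_add commute_minus assms)

text \<open>An identity of Hall-Witt type. Since \<open>c\<close> commutes with \<open>a\<close>,
  conjugating \<open>[a, b]\<close> by \<open>c\<close> only affects \<open>b\<close>, which becomes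
  \<open>- d + b\<close> with \<open>d = [b, c]\<close>. The right-hand side is the commutator of
  \<open>- d\<close> and \<open>a\<close>: associativity of the product of matrix entries, in
  disguise.\<close>

lemma commutator_commutator:
  fixes a b c :: "'g::group_add"
  assumes ac: "a + c = c + a"
    and d: "commutator a b + commutator b c = commutator b c + commutator a b"
  shows "commutator (commutator a b) c = - commutator b c + a + commutator b c - a"
proof -
  define p where "p = commutator a b"
  define d where "d = commutator b c"
  have pd: "p + d = d + p" using assms(2) by (simp only: p_def d_def)
  have ca: "- a + c = c + - a" using commute_minus[of c a] ac by simp
  have 1: "c + b + - c = - d + b"
    by (simp only: d_def commutator_def group_rules)
  have 2: "b + - a + - b = - a + p"
    by (simp only: p_def commutator_def group_rules)
  have "c + p + - c = (c + a) + b + - a + - b + - c"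
    by (simp only: p_def commutator_def group_rules)
  also have "\<dots> = a + (c + b + - c) + (c + - a) + - b + - c"
    by (simp only: ac[symmetric] group_rules)
  also have "\<dots> = a + (c + b + - c) + - a + - (c + b + - c)"
    by (simp only: ca[symmetric] group_rules)
  also have "\<dots> = a + - d + (b + - a + - b) + d"
    unfolding 1 by (simp only: group_rules)
  also have "\<dots> = a + - d + - a + (p + d)"
    unfolding 2 by (simp only: group_rules)
  also have "\<dots> = a + - d + - a + d + p"
    unfolding pd by (simp only: group_rules)
  finally have 3: "c + p + - c = a + - d + - a + d + p" .
  have "commutator p c = p + - (c + p + - c)"
    by (simp only: commutator_def group_rules)
  also have "\<dots> = - d + a + d - a"
    unfolding 3 by (simp only: group_rules)
  finally show ?thesis by (simp only: p_def d_def)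
qed

section \<open>Words as matrix entries: commutator calculus for elementary matrices without
  addition\<close>

locale steinberg =
  fixes e :: "nat \<Rightarrow> nat \<Rightarrow> 'l \<Rightarrow> 'g::group_add" and pi :: "nat \<Rightarrow> nat \<Rightarrow> 'l \<Rightarrow> 'l \<Rightarrow> 'g"
  assumes commute: "\<lbrakk>i < 5; j < 5; k < 5; l < 5; i \<noteq> j; k \<noteq> l; j \<noteq> k; i \<noteq> l\<rbrakk> \<Longrightarrow> e i j x + e k l y = e k l y + e i j x"
    and comm_pi: "\<lbrakk>i < 5; j < 5; k < 5; distinct [i, j, k]\<rbrakk> \<Longrightarrow> commutator (e i j x) (e j k y) = pi i k x y"
begin

definition pick :: "nat set \<Rightarrow> nat" where
  "pick A = (SOME m. m < 5 \<and> m \<notin> A)"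

lemma pick: "finite A \<Longrightarrow> card A < 5 \<Longrightarrow> pick A < 5 \<and> pick A \<notin> A"
  unfolding pick_def
proof (rule someI_ex, rule ccontr)
  assume A: "finite A" "card A < 5" "\<nexists>m. m < 5 \<and> m \<notin> A"
  then have "{..<5} \<subseteq> A" by auto
  then show False using card_mono[OF A(1), of "{..<5}"] A(2) by simp
qed

text \<open>The origin of the matrix size five: the commutator arguments call for an index off up to
  four given ones.\<close>

lemma ex_other: "\<exists>m<5. m \<notin> {i, j, k, l :: nat}"
proof -
  have "card {i, j, k, l} < 5" using card_length[of "[i, j, k, l]"] by simp
  then show ?thesis using pick[of "{i, j, k, l}"] by blast
qed

text \<open>The entry of a word is an iterated commutator through intermediate indices. The axioms
  give independence of the intermediate index for two letters only; for longer words one index is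
  fixed by \<open>pick\<close>, and its irrelevance is proved afterwards. The word is reversed
  because letters are appended at its end.\<close>

fun erev :: "nat \<Rightarrow> nat \<Rightarrow> 'l list \<Rightarrow> 'g" where
  "erev i j [] = 0"
| "erev i j [x] = e i j x"
| "erev i j (x # w) = commutator (erev i (pick {i, j}) w) (e (pick {i, j}) j x)"

definition ew :: "nat \<Rightarrow> nat \<Rightarrow> 'l list \<Rightarrow> 'g" where
  "ew i j w = erev i j (rev w)"

lemma ew_single: "ew i j [x] = e i j x"
  by (simp add: ew_def)

lemma ew_snoc_pick: "w \<noteq> [] \<Longrightarrow> ew i j (w @ [x]) = commutator (ew i (pick {i, j}) w) (e (pick {i, j}) j x)"
  unfolding ew_def by (cases "rev w") auto

text \<open>Commutation with letters and irrelevance of the intermediate index rely on each other,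
  so both go through one induction on the last letter.\<close>

lemma ew_aux:
  assumes "w \<noteq> []"
  shows "(\<forall>i j k l y. i < 5 \<longrightarrow> j < 5 \<longrightarrow> k < 5 \<longrightarrow> l < 5 \<longrightarrow> i \<noteq> j \<longrightarrow> k \<noteq> l \<longrightarrow> j \<noteq> k \<longrightarrow> i \<noteq> l
       \<longrightarrow> ew i j w + e k l y = e k l y + ew i j w)
    \<and> (\<forall>i j m x. i < 5 \<longrightarrow> j < 5 \<longrightarrow> m < 5 \<longrightarrow> distinct [i, m, j]
       \<longrightarrow> commutator (ew i m w) (e m j x) = ew i j (w @ [x]))"
  using assms
proof (induction w rule: rev_induct)
  case (snoc y u)
  show ?case
  proof (cases "u = []")
    case True
    have "commutator (e i m y) (e m j x) = commutator (e i (pick {i, j}) y) (e (pick {i, j}) j x)"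
      if "i < 5" "j < 5" "m < 5" "distinct [i, m, j]" for i j m x
      using comm_pi[of i m j y x] comm_pi[of i "pick {i, j}" j y x] that pick[of "{i, j}"]
      by (auto simp: card_insert_if)
    then show ?thesis using commute True ew_snoc_pick[of "[y]"] by (auto simp: ew_single)
  next
    case u: False
    have IH1: "ew i j u + e k l y = e k l y + ew i j u"
      if "i < 5" "j < 5" "k < 5" "l < 5" "i \<noteq> j" "k \<noteq> l" "j \<noteq> k" "i \<noteq> l" for i j k l y
      using snoc.IH[OF u] that by blast
    have IH2: "commutator (ew i m u) (e m j x) = ew i j (u @ [x])"
      if "i < 5" "j < 5" "m < 5" "distinct [i, m, j]" for i j m x
      using snoc.IH[OF u] that by blast
    have a: "e k l x + ew i j (u @ [y]) = ew i j (u @ [y]) + e k l x"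
      if "i < 5" "j < 5" "k < 5" "l < 5" "i \<noteq> j" "k \<noteq> l" "j \<noteq> k" "i \<noteq> l" for i j k l x
    proof -
      obtain m where m: "m < 5" "m \<notin> {i, j, k, l}" using ex_other by blast
      have "ew i j (u @ [y]) = commutator (ew i m u) (e m j y)" using IH2 that m by simp
      then show ?thesis
        by (simp only:) (rule commute_commutator; rule IH1[symmetric] commute; use that m in simp)
    qed
    \<comment> \<open>The right-hand side does not mention \<open>m\<close>. Choosing
      \<open>l\<close> off both candidates for the intermediate index therefore compares
      them.\<close>
    have b: "commutator (ew i m (u @ [y])) (e m j x) = - pi l j y x + ew i l u + pi l j y x - ew i l u"
      if "i < 5" "j < 5" "m < 5" "l < 5" "distinct [i, m, j, l]" for i j m l x
    proof -
      have p: "ew i m (u @ [y]) = commutator (ew i l u) (e l m y)" using IH2 that by simp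
      have d: "pi l j y x = commutator (e l m y) (e m j x)" using comm_pi that by simp
      obtain q where q: "q < 5" "q \<notin> {i, j, m, l}" using ex_other by blast
      have "ew i m (u @ [y]) + commutator (e l q y) (e q j x) = commutator (e l q y) (e q j x) + ew i m (u @ [y])"
        by (rule commute_commutator; rule a[symmetric]; use that q in auto)
      moreover have "commutator (e l q y) (e q j x) = pi l j y x"
        by (rule comm_pi) (use that q in auto)
      ultimately have "ew i m (u @ [y]) + pi l j y x = pi l j y x + ew i m (u @ [y])"
        by simp
      then show ?thesis
        unfolding p d by (intro commutator_commutator IH1) (use that in auto)
    qed
    have "commutator (ew i m (u @ [y])) (e m j x) = ew i j ((u @ [y]) @ [x])"
      if "i < 5" "j < 5" "m < 5" "distinct [i, m, j]" for i j m x
    proof -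
      obtain l where l: "l < 5" "l \<notin> {i, j, m, pick {i, j}}" using ex_other by blast
      have "pick {i, j} < 5" "pick {i, j} \<notin> {i, j}" using pick[of "{i, j}"] by (auto simp: card_insert_if)
      then show ?thesis
        using b[of i j m l x] b[of i j "pick {i, j}" l x] that l ew_snoc_pick[of "u @ [y]" i j x] by simp
    qed
    then show ?thesis using a by metis
  qed
qed simp

lemma ew_commute_letter:
  "\<lbrakk>w \<noteq> []; i < 5; j < 5; k < 5; l < 5; i \<noteq> j; k \<noteq> l; j \<noteq> k; i \<noteq> l\<rbrakk> \<Longrightarrow> ew i j w + e k l y = e k l y + ew i j w"
  using ew_aux by blast

lemma ew_snoc: "\<lbrakk>w \<noteq> []; i < 5; j < 5; m < 5; distinct [i, m, j]\<rbrakk>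
   \<Longrightarrow> ew i j (w @ [x]) = commutator (ew i m w) (e m j x)"
  using ew_aux[of w] by metis

lemma ew_commute:
  assumes "u \<noteq> []" "v \<noteq> []" "i < 5" "j < 5" "k < 5" "l < 5" "i \<noteq> j" "k \<noteq> l" "j \<noteq> k" "i \<noteq> l"
  shows "ew i j u + ew k l v = ew k l v + ew i j u"
  using assms
proof (induction v arbitrary: i j k l rule: rev_induct)
  case (snoc x v)
  show ?case
  proof (cases "v = []")
    case False
    obtain m where m: "m < 5" "m \<notin> {i, j, k, l}" using ex_other by blast
    have "ew k l (v @ [x]) = commutator (ew k m v) (e m l x)"
      by (rule ew_snoc) (use False snoc.prems m in auto)
    moreover have "ew i j u + commutator (ew k m v) (e m l x) = commutator (ew k m v) (e m l x) + ew i j u"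
      by (rule commute_commutator; rule snoc.IH ew_commute_letter; use False snoc.prems m in simp)
    ultimately show ?thesis by simp
  qed (use snoc.prems ew_commute_letter in \<open>simp add: ew_single\<close>)
qed simp

lemma ew_append:
  assumes "u \<noteq> []" "v \<noteq> []" "i < 5" "j < 5" "k < 5" "distinct [i, j, k]"
  shows "ew i k (u @ v) = commutator (ew i j u) (ew j k v)"
  using assms
proof (induction v arbitrary: i j k rule: rev_induct)
  case (snoc x v)
  show ?case
  proof (cases "v = []")
    case True
    then show ?thesis using snoc.prems ew_snoc[of u i k j x] by (simp add: ew_single)
  next
    case v: False
    obtain m where m: "m < 5" "m \<notin> {i, j, k, k}" using ex_other by blast
    let ?a = "ew i j u" and ?b = "ew j m v" and ?c = "e m k x"
    have p: "commutator ?a ?b = ew i m (u @ v)"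
      using snoc.IH[OF snoc.prems(1) v, of i j m] snoc.prems m by simp
    have d: "commutator ?b ?c = ew j k (v @ [x])"
      using ew_snoc[OF v, of j k m x] snoc.prems m by simp
    have pc: "commutator (ew i m (u @ v)) ?c = ew i k ((u @ v) @ [x])"
      using ew_snoc[of "u @ v" i k m x] v snoc.prems m by simp
    have pd: "commutator ?a ?b + commutator ?b ?c = commutator ?b ?c + commutator ?a ?b"
      unfolding p d by (rule ew_commute) (use v snoc.prems m in auto)
    have "?a + ?c = ?c + ?a"
      by (rule ew_commute_letter) (use snoc.prems m in auto)
    from commutator_commutator[OF this pd]
    \<comment> \<open>This reads \<open>[- d, a]\<close> with \<open>a = ew i j u\<close> and
      \<open>d = ew j k (v @ [x])\<close>. As \<open>d\<close> commutes with the left-hand side,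
      conjugation by \<open>d\<close> is harmless there and turns \<open>[- d, a]\<close> into
      \<open>[a, d]\<close>.\<close>
    have 1: "ew i k (u @ v @ [x]) = - ew j k (v @ [x]) + ?a + ew j k (v @ [x]) - ?a"
      unfolding p d pc by simp
    have "ew j k (v @ [x]) + ew i k (u @ v @ [x]) = ew i k (u @ v @ [x]) + ew j k (v @ [x])"
      by (rule ew_commute) (use v snoc.prems m in auto)
    then have "ew i k (u @ v @ [x]) = ew j k (v @ [x]) + ew i k (u @ v @ [x]) - ew j k (v @ [x])"
      by simp
    also have "\<dots> = commutator ?a (ew j k (v @ [x]))"
      unfolding 1 by (simp only: commutator_def group_rules)
    finally show ?thesis .
  qed
qed simp

lemma weq_ew:
  assumes "weq T u v"
    and T: "\<And>x y z i j k. T x y z \<Longrightarrow> i < 5 \<Longrightarrow> j < 5 \<Longrightarrow> k < 5 \<Longrightarrow> distinct [i, j, k] \<Longrightarrow>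
       commutator (e i j x) (e j k y) = e i k z"
  shows "i < 5 \<Longrightarrow> j < 5 \<Longrightarrow> i \<noteq> j \<Longrightarrow> ew i j u = ew i j v"
  using assms(1)
proof (induction arbitrary: i j rule: weq.induct)
  case (rule x y z a b)
  have xy: "ew i j [x, y] = ew i j [z]" if "i < 5" "j < 5" "i \<noteq> j" for i j
  proof -
    obtain m where "m < 5" "m \<notin> {i, j, j, j}" using ex_other by blast
    then show ?thesis
      using ew_append[of "[x]" "[y]" i m j] T[OF rule(1), of i m j] that by (simp add: ew_single)
  qed
  have a: "ew i j (a @ [x, y]) = ew i j (a @ [z])" if "i < 5" "j < 5" "i \<noteq> j" for i j
  proof (cases "a = []")
    case False
    obtain m where "m < 5" "m \<notin> {i, j, j, j}" using ex_other by blast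
    then show ?thesis
      using ew_append[of a _ i m j] xy[of m j] False that by simp
  qed (use xy that in simp)
  show ?case
  proof (cases "b = []")
    case False
    obtain m where "m < 5" "m \<notin> {i, j, j, j}" using ex_other by blast
    then show ?thesis
      using ew_append[of "a @ [x, y]" b i m j] ew_append[of "a @ [z]" b i m j] a[of i m] False rule by simp
  qed (use a rule in simp)
qed auto

end

text \<open>A set of pairs is a vector over the field with two elements, split into blocks by the
  first component. Block \<open>j\<close>, pulled back along the partial map \<open>f\<close>, is
  added to block \<open>i\<close>: the elementary matrix with entry \<open>f\<close> at
  \<open>(i, j)\<close>. The empty map gives the identity.\<close>

definition transv :: "nat \<Rightarrow> nat \<Rightarrow> ('y \<Rightarrow> 'y option) \<Rightarrow> (nat \<times> 'y) set \<Rightarrow> (nat \<times> 'y) set" where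
  "transv i j f v = {(k, y). ((k, y) \<in> v) \<noteq> (k = i \<and> (\<exists>w. f y = Some w \<and> (j, w) \<in> v))}"

lemma transv_transv: "i \<noteq> j \<Longrightarrow> transv i j f (transv i j f v) = v"
  by (auto simp: transv_def)

lemma transv_subset:
  "v \<subseteq> U \<Longrightarrow> (\<And>y w. f y = Some w \<Longrightarrow> (i, y) \<in> U) \<Longrightarrow> transv i j f v \<subseteq> U"
  by (auto simp: transv_def)

definition gtransv :: "(nat \<times> 'y) set \<Rightarrow> nat \<Rightarrow> nat \<Rightarrow> ('y \<Rightarrow> 'y option) \<Rightarrow> (nat \<times> 'y) set bijection" where
  "gtransv U i j f = Bij (\<lambda>v. if v \<subseteq> U then transv i j f v else v)"

text \<open>A finite group inside the permutations of all sets of pairs: the subsets of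
  \<open>U\<close> may move among themselves and every other set stays fixed. It is the carrier of
  the finite model.\<close>

definition pinned :: "(nat \<times> 'y) set \<Rightarrow> (nat \<times> 'y) set bijection set" where
  "pinned U = {b. \<forall>v. if v \<subseteq> U then bij_fun b v \<subseteq> U else bij_fun b v = v}"

lemma finite_pinned:
  assumes "finite U"
  shows "finite (pinned U)"
proof -
  let ?F = "\<lambda>b. restrict (bij_fun b) (Pow U)"
  have "inj_on ?F (pinned U)"
  proof (rule inj_onI, rule bijection_eqI)
    fix a b v assume *: "a \<in> pinned U" "b \<in> pinned U" "?F a = ?F b"
    show "bij_fun a v = bij_fun b v"
    proof (cases "v \<subseteq> U")
      case True
      then show ?thesis using fun_cong[OF *(3), of v] by simp
    next
      case False
      then show ?thesis using *(1,2) by (auto simp: pinned_def split: if_splits)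
    qed
  qed
  moreover have "?F ` pinned U \<subseteq> PiE (Pow U) (\<lambda>_. Pow U)"
  proof
    fix F assume "F \<in> ?F ` pinned U"
    then obtain b where b: "b \<in> pinned U" "F = ?F b" by auto
    then have "bij_fun b v \<subseteq> U" if "v \<subseteq> U" for v using that by (auto simp: pinned_def split: if_splits)
    then show "F \<in> PiE (Pow U) (\<lambda>_. Pow U)" unfolding b(2) by (intro restrict_PiE_iff[THEN iffD2]) blast
  qed
  then have "finite (?F ` pinned U)"
    by (rule finite_subset) (use assms in \<open>auto intro: finite_PiE\<close>)
  ultimately show ?thesis by (metis finite_imageD)
qed

lemma pinned_0: "0 \<in> pinned U"
  by (simp add: pinned_def bij_fun_zero)

lemma pinned_plus: "a \<in> pinned U \<Longrightarrow> b \<in> pinned U \<Longrightarrow> a + b \<in> pinned U"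
  by (auto simp: pinned_def bij_fun_plus split: if_splits)

locale transvections =
  fixes U :: "(nat \<times> 'y) set" and supp :: "('y \<Rightarrow> 'y option) \<Rightarrow> bool"
  assumes U: "\<And>f y w i. supp f \<Longrightarrow> f y = Some w \<Longrightarrow> i < 5 \<Longrightarrow> (i, y) \<in> U"
begin

lemma bij_fun_gtransv:
  assumes "i \<noteq> j" "supp f" "i < 5"
  shows "bij_fun (gtransv U i j f) v = (if v \<subseteq> U then transv i j f v else v)"
proof -
  let ?g = "\<lambda>v. if v \<subseteq> U then transv i j f v else v"
  have "?g (?g v) = v" for v
    using transv_subset[of v U f i j] U assms by (auto simp: transv_transv)
  then have "bij ?g" by (intro o_bij[of ?g]) auto
  then show ?thesis unfolding gtransv_def by (simp add: Bij_inverse)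
qed

lemma gtransv_pinned: "i \<noteq> j \<Longrightarrow> supp f \<Longrightarrow> i < 5 \<Longrightarrow> gtransv U i j f \<in> pinned U"
  using transv_subset[of _ U f i j] U by (auto simp: pinned_def bij_fun_gtransv)

lemma gtransv_eqI:
  assumes "a \<in> pinned U" "b \<in> pinned U" "\<And>v. v \<subseteq> U \<Longrightarrow> bij_fun a v = bij_fun b v"
  shows "a = b"
proof (rule bijection_eqI)
  fix v show "bij_fun a v = bij_fun b v"
    using assms by (cases "v \<subseteq> U") (auto simp: pinned_def split: if_splits)
qed

lemma bij_fun_gtransv_plus:
  assumes "i \<noteq> j" "supp f" "i < 5" "k \<noteq> l" "supp g" "k < 5" "v \<subseteq> U"
  shows "bij_fun (gtransv U i j f + gtransv U k l g) v = transv i j f (transv k l g v)"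
  using transv_subset[of v U g k l] U assms by (simp add: bij_fun_plus bij_fun_gtransv)

lemma gtransv_involution: "i \<noteq> j \<Longrightarrow> supp f \<Longrightarrow> i < 5 \<Longrightarrow> gtransv U i j f + gtransv U i j f = 0"
  by (rule gtransv_eqI[OF pinned_plus pinned_0])
     (auto simp: gtransv_pinned bij_fun_gtransv_plus bij_fun_zero transv_transv)

lemma gtransv_commute:
  assumes "i \<noteq> j" "k \<noteq> l" "j \<noteq> k" "i \<noteq> l" "supp f" "supp g" "i < 5" "k < 5"
  shows "gtransv U i j f + gtransv U k l g = gtransv U k l g + gtransv U i j f"
proof (rule gtransv_eqI[OF pinned_plus pinned_plus])
  fix v assume "v \<subseteq> U"
  then show "bij_fun (gtransv U i j f + gtransv U k l g) v = bij_fun (gtransv U k l g + gtransv U i j f) v"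
    using assms by (simp only: bij_fun_gtransv_plus not_False_eq_True) (auto simp: transv_def)
qed (use assms in \<open>auto simp: gtransv_pinned\<close>)

text \<open>The matrix identity \<open>[e\<^sub>i\<^sub>j(f), e\<^sub>j\<^sub>k(g)] =
  e\<^sub>i\<^sub>k(f g)\<close>. Pulling back along \<open>g\<close> and then along
  \<open>f\<close> is pulling back along \<open>f\<close> followed by \<open>g\<close>, so the
  product is \<open>andthen f g\<close>, in reading order.\<close>

lemma gtransv_commutator:
  assumes "distinct [i, j, k]" "supp f" "supp g" "supp (andthen f g)" "i < 5" "j < 5"
  shows "gtransv U i j f + gtransv U j k g = gtransv U i k (andthen f g) + (gtransv U j k g + gtransv U i j f)"
proof (rule gtransv_eqI[OF pinned_plus pinned_plus[OF _ pinned_plus]])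
  fix v assume v: "v \<subseteq> U"
  have ij: "i \<noteq> j" "j \<noteq> k" "i \<noteq> k" using assms(1) by auto
  have s: "transv j k g (transv i j f v) \<subseteq> U"
    using transv_subset U v assms by metis
  have "bij_fun (gtransv U i k (andthen f g) + (gtransv U j k g + gtransv U i j f)) v
      = transv i k (andthen f g) (transv j k g (transv i j f v))"
    unfolding bij_fun_plus[of "gtransv U i k (andthen f g)"]
    using s v ij assms by (simp only: bij_fun_gtransv_plus bij_fun_gtransv not_False_eq_True if_True)
  moreover have "bij_fun (gtransv U i j f + gtransv U j k g) v = transv i j f (transv j k g v)"
    using v ij assms by (simp only: bij_fun_gtransv_plus not_False_eq_True)
  moreover have "transv i j f (transv j k g v) = transv i k (andthen f g) (transv j k g (transv i j f v))"
    using ij by (auto simp: transv_def andthen_def Option.bind_eq_Some_conv)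
  ultimately show "bij_fun (gtransv U i j f + gtransv U j k g) v
     = bij_fun (gtransv U i k (andthen f g) + (gtransv U j k g + gtransv U i j f)) v" by simp
qed (use assms in \<open>auto simp: gtransv_pinned\<close>)

lemma gtransv_0: "i \<noteq> j \<Longrightarrow> i < 5 \<Longrightarrow> supp f \<Longrightarrow> (\<And>y. f y = None) \<Longrightarrow> gtransv U i j f = 0"
  by (rule gtransv_eqI[OF gtransv_pinned pinned_0]) (auto simp: bij_fun_zero bij_fun_gtransv transv_def)

lemma gtransv_neq_0:
  assumes "i \<noteq> j" "i < 5" "supp f" "f y = Some w" "(j, w) \<in> U"
  shows "gtransv U i j f \<noteq> 0"
proof
  assume "gtransv U i j f = 0"
  then have "transv i j f {(j, w)} = {(j, w)}"
    using bij_fun_zero[of "{(j, w)}"] bij_fun_gtransv[OF assms(1,3,2), of "{(j, w)}"] assms(5) by simp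
  moreover have "(i, y) \<in> transv i j f {(j, w)}" using assms by (auto simp: transv_def)
  ultimately show False using assms(1) by auto
qed

end

section \<open>Triangular group presentations\<close>

text \<open>\<open>Elem2 i h x y\<close> is the common value of the commutators of
  \<open>Elem i j x\<close> and \<open>Elem j h y\<close> for all \<open>j\<close>; giving it a name
  is how the presentation forces independence of \<open>j\<close>. \<open>Unit\<close> is a symbol
  for the neutral element.\<close>

datatype sym = Elem nat nat letter | Elem2 nat nat letter letter | Unit | Pr sym sym sym | Ro sym sym sym

instance com :: countable by countable_datatype
instance letter :: countable by countable_datatype
instance sym :: countable by countable_datatype

text \<open>\<open>comm_rel k cs x y v\<close> stands for \<open>x y = v y x\<close>, and \<open>Pr x y v\<close>, \<open>Ro x y v\<close> name the products
  \<open>x y\<close> and \<open>y x\<close>.\<close>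

inductive comm_rel :: "nat \<Rightarrow> com list \<Rightarrow> sym \<Rightarrow> sym \<Rightarrow> sym \<Rightarrow> bool" for k cs where
  comm: "\<lbrakk>i < 5; j < 5; h < 5; l < 5; i \<noteq> j; h \<noteq> l; j \<noteq> h; i \<noteq> l;
    x \<in> alphabet k (conts cs []); y \<in> alphabet k (conts cs [])\<rbrakk> \<Longrightarrow> comm_rel k cs (Elem i j x) (Elem h l y) Unit"
| prod: "\<lbrakk>i < 5; j < 5; h < 5; distinct [i, j, h];
    x \<in> alphabet k (conts cs []); y \<in> alphabet k (conts cs [])\<rbrakk> \<Longrightarrow> comm_rel k cs (Elem i j x) (Elem j h y) (Elem2 i h x y)"
| trip: "\<lbrakk>i < 5; j < 5; h < 5; distinct [i, j, h]; trip k (conts cs []) x y z;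
    x \<in> alphabet k (conts cs []); y \<in> alphabet k (conts cs []); z \<in> alphabet k (conts cs [])\<rbrakk>
    \<Longrightarrow> comm_rel k cs (Elem i j x) (Elem j h y) (Elem i h z)"
| zero: "\<lbrakk>i < 5; j < 5; i \<noteq> j\<rbrakk> \<Longrightarrow> comm_rel k cs Unit Unit (Elem i j Oo)"
| one: "comm_rel k cs Unit Unit Unit"

definition sym_triples :: "nat \<Rightarrow> com list \<Rightarrow> (sym \<times> sym \<times> sym) set" where
  "sym_triples k cs = (\<Union>(x, y, v)\<in>{(x, y, v). comm_rel k cs x y v}.
     {(x, y, Pr x y v), (y, x, Ro x y v), (v, Ro x y v, Pr x y v)})"

lemma finite_sym_triples: "finite (sym_triples k cs)"
proof -
  let ?\<Sigma> = "alphabet k (conts cs [])"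
  define F where "F = (\<lambda>(i, j, x). Elem i j x) ` ({..<5} \<times> {..<5} \<times> ?\<Sigma>)
    \<union> (\<lambda>(i, j, x, y). Elem2 i j x y) ` ({..<5} \<times> {..<5} \<times> ?\<Sigma> \<times> ?\<Sigma>) \<union> {Unit}"
  have F1: "Unit \<in> F" by (simp add: F_def)
  have F: "Elem i j x \<in> F" "Elem2 i j x y \<in> F" if "i < 5" "j < 5" "x \<in> ?\<Sigma>" "y \<in> ?\<Sigma>" for i j x y
    using that by (force simp: F_def)+
  have O: "Oo \<in> ?\<Sigma>" by (simp add: alphabet_def Let_def)
  have "x \<in> F \<and> y \<in> F \<and> v \<in> F" if "comm_rel k cs x y v" for x y v
    using that by cases (use F F1 O in auto)
  then have "{(x, y, v). comm_rel k cs x y v} \<subseteq> F \<times> F \<times> F" by blast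
  moreover have "finite (F \<times> F \<times> F)"
    unfolding F_def using finite_alphabet[OF finite_conts]
    by (intro finite_SigmaI finite_UnI finite_imageI) auto
  ultimately have "finite {(x, y, v). comm_rel k cs x y v}" by (rule finite_subset)
  then show ?thesis unfolding sym_triples_def by auto
qed

text \<open>A product symbol is a larger term than a factor or has a different outer constructor.
  The geometry is built from relations with this distinctness.\<close>

lemma sym_triples_distinct: "(x, y, z) \<in> sym_triples k cs \<Longrightarrow> z \<noteq> x \<and> z \<noteq> y"
proof -
  have "Pr x y v \<noteq> x \<and> Pr x y v \<noteq> y \<and> Ro x y v \<noteq> x \<and> Ro x y v \<noteq> y \<and> Pr x y v \<noteq> v" for x y v
  proof -
    have "size x < size (Pr x y v)" "size y < size (Pr x y v)" "size v < size (Pr x y v)"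
      "size x < size (Ro x y v)" "size y < size (Ro x y v)" by simp_all
    then show ?thesis by (metis less_irrefl)
  qed
  then show "(x, y, z) \<in> sym_triples k cs \<Longrightarrow> z \<noteq> x \<and> z \<noteq> y"
    unfolding sym_triples_def by auto
qed

text \<open>The four symbols that spell the input get the even codes 4, 6, 8 and 10, all others odd
  codes from 11 on. This reserves 0 for the identity, 1 for the extra symbol, 2 for the value of the
  input word and the even numbers from 12 on for its prefixes.\<close>

definition sym_code :: "nat \<Rightarrow> com list \<Rightarrow> sym \<Rightarrow> nat" where
  "sym_code k cs s = (if s = Elem 1 2 (Qq cs) then 4 else if s = Elem 1 2 (Cc 0) then 6 else if s = Elem 2 1 (Cc 1) then 8
     else if s = Elem 0 1 (Bb k) then 10 else 2 * to_nat s + 11)"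

lemma inj_sym_code: "inj (sym_code k cs)"
proof (rule injI)
  fix x y assume "sym_code k cs x = sym_code k cs y"
  moreover have "even (2 * to_nat z + 11) = False" for z :: sym by simp
  moreover have "2 * to_nat z + 11 \<noteq> c" if "even c" for c and z :: sym using that by auto
  moreover have "c \<noteq> 2 * to_nat z + 11" if "even c" for c and z :: sym using that by auto
  ultimately show "x = y"
    unfolding sym_code_def by (auto split: if_splits)
qed

definition triple_code :: "nat \<Rightarrow> nat \<Rightarrow> nat \<Rightarrow> nat" where
  "triple_code x y z = prod_encode (x, prod_encode (y, z))"

lemma triple_code_eq [simp]: "triple_code x y z = triple_code x' y' z' \<longleftrightarrow> x = x' \<and> y = y' \<and> z = z'"
  by (simp add: triple_code_def)

definition presentation :: "nat \<Rightarrow> com list \<Rightarrow> nat" where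
  "presentation k cs = set_encode ((\<lambda>(x, y, z). triple_code (sym_code k cs x) (sym_code k cs y) (sym_code k cs z)) ` sym_triples k cs)"

text \<open>The symbols \<open>12 i + 10\<close> and \<open>12 i + 12\<close> spell out the words \<open>Bb k (Cc 0 Cc 1)\<^sup>i\<close> and
  \<open>Bb k (Cc 0 Cc 1)\<^sup>i Cc 0\<close> at the matrix positions \<open>(0, 1)\<close> and \<open>(0, 2)\<close>, and the symbol \<open>2\<close> the
  whole input word.\<close>

definition chain_rel :: "nat \<Rightarrow> nat \<Rightarrow> nat \<Rightarrow> nat \<Rightarrow> bool" where
  "chain_rel i x y z \<longleftrightarrow>
     x = 12 * i + 10 \<and> y = 6 \<and> z = 12 * i + 14 \<or> x = 6 \<and> y = 12 * i + 10 \<and> z = 12 * i + 16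
   \<or> x = 12 * i + 12 \<and> y = 12 * i + 16 \<and> z = 12 * i + 14
   \<or> x = 12 * i + 12 \<and> y = 8 \<and> z = 12 * i + 18 \<or> x = 8 \<and> y = 12 * i + 12 \<and> z = 12 * i + 20
   \<or> x = 12 * i + 22 \<and> y = 12 * i + 20 \<and> z = 12 * i + 18"

definition final_rel :: "nat \<Rightarrow> nat \<Rightarrow> nat \<Rightarrow> nat \<Rightarrow> bool" where
  "final_rel i x y z \<longleftrightarrow>
     x = 12 * i + 10 \<and> y = 4 \<and> z = 12 * i + 14 \<or> x = 4 \<and> y = 12 * i + 10 \<and> z = 12 * i + 16
   \<or> x = 2 \<and> y = 12 * i + 16 \<and> z = 12 * i + 14"

definition rel :: "nat \<Rightarrow> nat \<Rightarrow> nat \<Rightarrow> nat \<Rightarrow> bool" where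
  "rel e x y z \<longleftrightarrow> triple_code x y z \<in> set_decode e \<or> (\<exists>i<e. chain_rel i x y z) \<or> final_rel e x y z"

lemma presentation_iff:
  "triple_code x y z \<in> set_decode (presentation k cs) \<longleftrightarrow>
    (\<exists>a b c. (a, b, c) \<in> sym_triples k cs \<and> x = sym_code k cs a \<and> y = sym_code k cs b \<and> z = sym_code k cs c)"
  unfolding presentation_def using finite_sym_triples[of k cs] by (simp add: image_iff Bex_def)

lemma sym_code_ge: "4 \<le> sym_code k cs s"
  by (simp add: sym_code_def)

lemma rel_valid:
  assumes "rel (presentation k cs) x y z"
  shows "2 \<le> x \<and> 2 \<le> y \<and> 2 \<le> z \<and> z \<noteq> x \<and> z \<noteq> y"
proof -
  have "2 \<le> x \<and> 2 \<le> y \<and> 2 \<le> z \<and> z \<noteq> x \<and> z \<noteq> y" if sym: "triple_code x y z \<in> set_decode (presentation k cs)"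
  proof -
    obtain a b c where "(a, b, c) \<in> sym_triples k cs" "x = sym_code k cs a" "y = sym_code k cs b" "z = sym_code k cs c"
      using sym unfolding presentation_iff by auto
    then show ?thesis
      using sym_triples_distinct[of a b c k cs] sym_code_ge[of k cs a] sym_code_ge[of k cs b] sym_code_ge[of k cs c]
        inj_eq[OF inj_sym_code, of k cs] by simp
  qed
  then show ?thesis
    using assms unfolding rel_def chain_rel_def final_rel_def by auto
qed

lemma rel_bounded:
  assumes "rel e x y z"
  shows "x < 12 * e + 23 \<and> y < 12 * e + 23 \<and> z < 12 * e + 23"
proof -
  have "x < e \<and> y < e \<and> z < e" if "triple_code x y z \<in> set_decode e"
  proof -
    have *: "i < e" if i: "i \<in> set_decode e" for i
    proof -
      have "odd (e div 2 ^ i)" using i by (simp add: set_decode_def)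
      then have "2 ^ i \<le> e" by (metis div_less even_zero not_less)
      then show ?thesis using less_exp[of i] by linarith
    qed
    have "x \<le> triple_code x y z" "y \<le> triple_code x y z" "z \<le> triple_code x y z"
      unfolding triple_code_def using le_prod_encode_1 le_prod_encode_2 by (meson order_trans)+
    then show ?thesis using *[OF that] by linarith
  qed
  then show ?thesis using assms unfolding rel_def chain_rel_def final_rel_def by auto
qed

theorem presentation_trivial:
  fixes \<phi> :: "nat \<Rightarrow> 'g::group_add"
  assumes st: "steps n (cs, \<lambda>j. if j < 2 then e else 0) ([], r)" "r 2 \<noteq> 0" "regs cs \<subseteq> {..<k}" "2 < k"
    and e: "e = presentation k cs"
    and \<phi>: "\<And>x y z. rel e x y z \<Longrightarrow> \<phi> x + \<phi> y = \<phi> z"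
  shows "\<phi> 2 = 0"
proof -
  let ?\<Sigma> = "alphabet k (conts cs [])"
  define g where "g s = \<phi> (sym_code k cs s)" for s
  have trip: "g x + g y = g z" if "(x, y, z) \<in> sym_triples k cs" for x y z
  proof -
    have "triple_code (sym_code k cs x) (sym_code k cs y) (sym_code k cs z) \<in> set_decode e"
      unfolding e presentation_iff using that by blast
    then show ?thesis unfolding g_def by (intro \<phi>) (simp add: rel_def)
  qed
  have comm: "g x + g y = g v + (g y + g x)" if "comm_rel k cs x y v" for x y v
  proof -
    have "g x + g y = g (Pr x y v)" "g y + g x = g (Ro x y v)" "g v + g (Ro x y v) = g (Pr x y v)"
      by (rule trip, unfold sym_triples_def, rule UN_I[of "(x, y, v)"]; use that in simp)+
    then show ?thesis by simp
  qed
  have Unit: "g Unit = 0" using comm[OF comm_rel.one] by (metis add.right_neutral add_left_cancel)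
  \<comment> \<open>Entries of letters outside the finite alphabet are set to 0. This satisfies both
    axioms trivially, so the calculus applies to the whole type of letters.\<close>
  define ee where "ee i j x = (if x \<in> ?\<Sigma> then g (Elem i j x) else 0)" for i j x
  define pp where "pp i j x y = (if x \<in> ?\<Sigma> \<and> y \<in> ?\<Sigma> then g (Elem2 i j x y) else 0)" for i j x y
  interpret steinberg ee pp
  proof
    fix i j h l :: nat and x y
    assume "i < 5" "j < 5" "h < 5" "l < 5" "i \<noteq> j" "h \<noteq> l" "j \<noteq> h" "i \<noteq> l"
    then show "ee i j x + ee h l y = ee h l y + ee i j x"
      using comm[OF comm_rel.comm, of i j h l x y] Unit by (simp add: ee_def)
  next
    fix i j h :: nat and x y
    assume *: "i < 5" "j < 5" "h < 5" "distinct [i, j, h]"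
    show "commutator (ee i j x) (ee j h y) = pp i h x y"
    proof (cases "x \<in> ?\<Sigma> \<and> y \<in> ?\<Sigma>")
      case True
      then show ?thesis
        using comm[OF comm_rel.prod[OF *], of x y] by (simp add: ee_def pp_def commutator_eq_iff)
    qed (auto simp: ee_def pp_def commutator_0)
  qed
  have T: "commutator (ee i j x) (ee j h y) = ee i h z"
    if "trip k (conts cs []) x y z" "i < 5" "j < 5" "h < 5" "distinct [i, j, h]" for x y z i j h
    using comm[OF comm_rel.trip[OF that(2-5,1)]] trip_alphabet[OF that(1) st(3,4)]
    by (simp add: ee_def commutator_eq_iff)
  obtain u where u: "u \<noteq> []" "weq (trip k (conts cs [])) (input_word k cs e) (u @ [Oo])"
    using input_word_zero[OF st] by auto
  have mem: "Bb k \<in> ?\<Sigma>" "Cc 0 \<in> ?\<Sigma>" "Cc 1 \<in> ?\<Sigma>" "Qq cs \<in> ?\<Sigma>" "Oo \<in> ?\<Sigma>"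
    using st(4) conts_self[of cs "[]"] by (auto simp: alphabet_def Let_def)
  have "ee 1 2 Oo = 0"
    using comm[OF comm_rel.zero[of 1 2]] Unit mem by (simp add: ee_def)
  \<comment> \<open>The input word equals \<open>u\<close> followed by \<open>Oo\<close>, so its
    entry is a commutator with \<open>ee 1 2 Oo\<close>, which the presentation makes
    trivial.\<close>
  then have zero: "ew 0 2 (input_word k cs e) = 0"
    using weq_ew[OF u(2) T, of 0 2] ew_append[of u "[Oo]" 0 1 2] u(1) by (simp add: ew_single commutator_0)
  have codes: "\<phi> 10 = ee 0 1 (Bb k)" "\<phi> 6 = ee 1 2 (Cc 0)" "\<phi> 8 = ee 2 1 (Cc 1)" "\<phi> 4 = ee 1 2 (Qq cs)"
    using mem by (auto simp: ee_def g_def sym_code_def)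
  let ?w = "\<lambda>i. Bb k # concat (replicate i [Cc 0, Cc 1])"
  have chain: "i \<le> e \<Longrightarrow> \<phi> (12 * i + 10) = ew 0 1 (?w i)" for i
  proof (induction i)
    case 0
    then show ?case by (simp add: codes ew_single)
  next
    case (Suc i)
    then have IH: "\<phi> (12 * i + 10) = ew 0 1 (?w i)" by simp
    have r: "\<phi> x + \<phi> y = \<phi> z" if "chain_rel i x y z" for x y z
    proof (rule \<phi>)
      have "i < e" using Suc.prems by simp
      then show "rel e x y z" using that unfolding rel_def by blast
    qed
    have "\<phi> (12 * i + 10) + \<phi> 6 = \<phi> (12 * i + 14)" "\<phi> 6 + \<phi> (12 * i + 10) = \<phi> (12 * i + 16)"
      "\<phi> (12 * i + 12) + \<phi> (12 * i + 16) = \<phi> (12 * i + 14)"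
      by (rule r; simp add: chain_rel_def)+
    then have "commutator (\<phi> (12 * i + 10)) (\<phi> 6) = \<phi> (12 * i + 12)"
      by (simp add: commutator_eq_iff)
    then have 1: "\<phi> (12 * i + 12) = ew 0 2 (?w i @ [Cc 0])"
      using IH codes ew_snoc[of "?w i" 0 2 1 "Cc 0"] by simp
    have "\<phi> (12 * i + 12) + \<phi> 8 = \<phi> (12 * i + 18)" "\<phi> 8 + \<phi> (12 * i + 12) = \<phi> (12 * i + 20)"
      "\<phi> (12 * i + 22) + \<phi> (12 * i + 20) = \<phi> (12 * i + 18)"
      by (rule r; simp add: chain_rel_def)+
    then have "commutator (\<phi> (12 * i + 12)) (\<phi> 8) = \<phi> (12 * i + 22)"
      by (simp add: commutator_eq_iff)
    then have "\<phi> (12 * i + 22) = ew 0 1 ((?w i @ [Cc 0]) @ [Cc 1])"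
      using 1 codes ew_snoc[of "?w i @ [Cc 0]" 0 1 2 "Cc 1"] by simp
    moreover have "?w (Suc i) = (?w i @ [Cc 0]) @ [Cc 1]"
    proof -
      have "replicate (Suc i) [Cc 0, Cc 1] = replicate i [Cc 0, Cc 1] @ [[Cc 0, Cc 1]]"
        by (metis replicate_append_same replicate_Suc)
      then show ?thesis by simp
    qed
    moreover have "12 * Suc i + 10 = 12 * i + 22" by simp
    ultimately show ?case by (simp only:)
  qed
  have r: "\<phi> x + \<phi> y = \<phi> z" if "final_rel e x y z" for x y z
    by (rule \<phi>) (use that in \<open>auto simp: rel_def\<close>)
  have "\<phi> (12 * e + 10) + \<phi> 4 = \<phi> (12 * e + 14)" "\<phi> 4 + \<phi> (12 * e + 10) = \<phi> (12 * e + 16)"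
    "\<phi> 2 + \<phi> (12 * e + 16) = \<phi> (12 * e + 14)"
    by (rule r; simp add: final_rel_def)+
  then have "commutator (\<phi> (12 * e + 10)) (\<phi> 4) = \<phi> 2"
    by (simp add: commutator_eq_iff)
  then have "\<phi> 2 = ew 0 2 (?w e @ [Qq cs])"
    using chain[of e] codes ew_snoc[of "?w e" 0 2 1 "Qq cs"] by simp
  then show ?thesis using zero by (simp add: input_word_def)
qed

theorem presentation_model:
  assumes st: "steps T (cs, \<lambda>j. if j < 2 then e else 0) ([], r)" "r 2 = 0" "regs cs \<subseteq> {..<k}" "2 < k"
    and e: "e = presentation k cs"
  obtains \<phi> :: "nat \<Rightarrow> (nat \<times> cell) set bijection" and \<Omega> where
    "finite \<Omega>" "\<Omega> \<noteq> {}" "\<And>s b. b \<in> \<Omega> \<Longrightarrow> \<phi> s + b \<in> \<Omega>"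
    "\<And>x y z. rel e x y z \<Longrightarrow> \<phi> x + \<phi> y = \<phi> z" "\<phi> 2 + \<phi> 2 = 0" "\<phi> 2 \<noteq> 0"
proof -
  let ?\<Sigma> = "alphabet k (conts cs [])"
  obtain Y and f :: "letter \<Rightarrow> cell \<Rightarrow> cell option" where
    Y: "finite Y" "\<And>x v w. f x v = Some w \<Longrightarrow> v \<in> Y \<and> w \<in> Y"
    and T: "\<And>x y z. trip k (conts cs []) x y z \<Longrightarrow> andthen (f x) (f y) = f z"
    and Oo: "\<And>v. f Oo v = None"
    and w: "\<exists>v. word_map f (input_word k cs e) v \<noteq> None"
    by (rule input_word_model[OF st]) (rule that; assumption)
  define U where "U = {..<5::nat} \<times> Y"
  define supp where "supp f \<longleftrightarrow> (\<forall>v w. f v = Some w \<longrightarrow> v \<in> Y \<and> w \<in> Y)" for f :: "cell \<Rightarrow> cell option"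
  interpret transvections U supp
    by unfold_locales (auto simp: supp_def U_def)
  have supp: "supp (f x)" for x using Y(2) by (auto simp: supp_def)
  have supp_at: "supp (andthen a b)" if "supp a" "supp b" for a b
    using that by (auto simp: supp_def andthen_def Option.bind_eq_Some_conv)
  define G where "G i j a = (if i \<noteq> j \<and> i < 5 then gtransv U i j a else 0)" for i j a
  have G_pinned: "supp a \<Longrightarrow> G i j a \<in> pinned U" for i j a
    using gtransv_pinned by (auto simp: G_def pinned_0)
  have G_comm: "G i j a + G j h b = G i h (andthen a b) + (G j h b + G i j a)"
    if "distinct [i, j, h]" "supp a" "supp b" "i < 5" "j < 5" for i j h a b
    using gtransv_commutator[OF that(1-3) supp_at[OF that(2,3)] that(4,5)] that by (simp add: G_def)
  define val where "val = rec_sym (\<lambda>i j x. G i j (f x)) (\<lambda>i j x y. G i j (andthen (f x) (f y))) 0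
     (\<lambda>_ _ _ a b v. a + b) (\<lambda>_ _ _ a b v. b + a)"
  have val: "val (Elem i j x) = G i j (f x)" "val (Elem2 i j x y) = G i j (andthen (f x) (f y))" "val Unit = 0"
    "val (Pr s t u) = val s + val t" "val (Ro s t u) = val t + val s" for i j x y s t u
    by (simp_all add: val_def)
  have val_pinned: "val s \<in> pinned U" for s
    by (induction s) (auto simp: val supp supp_at G_pinned pinned_0 intro: pinned_plus)
  have val_comm: "val x + val y = val v + (val y + val x)" if "comm_rel k cs x y v" for x y v
    using that
  proof cases
    case (comm i j h l x y)
    then show ?thesis using gtransv_commute[of i j h l "f x" "f y"] supp by (simp add: val G_def)
  next
    case (prod i j h x y)
    then show ?thesis using G_comm[of i j h "f x" "f y"] supp by (simp add: val)
  next
    case (trip i j h x y z)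
    then show ?thesis using G_comm[of i j h "f x" "f y"] supp T[OF trip(8)] by (simp add: val)
  next
    case (zero i j)
    then show ?thesis using gtransv_0[of i j "f Oo"] Oo supp by (simp add: val G_def)
  qed (simp add: val)
  have val_trip: "val x + val y = val z" if "(x, y, z) \<in> sym_triples k cs" for x y z
    using that val_comm unfolding sym_triples_def by (auto simp: val)
  define W where "W w = word_map f w" for w
  have W_snoc: "W (u @ [x]) = andthen (W u) (f x)" for u x
    by (rule ext) (auto simp: W_def word_map_append andthen_def split: bind_splits)
  have W_single: "W [x] = f x" for x
  proof
    fix v show "W [x] v = f x v" by (cases "f x v") (simp_all add: W_def)
  qed
  have suppW: "supp (W (x # u))" for x u
  proof (induction u rule: rev_induct)
    case (snoc y u)
    have "supp (W ((x # u) @ [y]))" unfolding W_snoc by (rule supp_at[OF snoc supp])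
    then show ?case by simp
  qed (simp add: W_single supp)
  let ?w = "\<lambda>i. Bb k # concat (replicate i [Cc 0, Cc 1])"
  define R where "R i = G 0 1 (W (?w i))" for i
  define R' where "R' i = G 0 2 (W (?w i @ [Cc 0]))" for i
  define S where "S = G 0 2 (W (input_word k cs e))"
  \<comment> \<open>The letter appended after \<open>i\<close> rounds: \<open>Cc 0\<close> within
    the chain and the state letter \<open>Qq cs\<close> at its end \<open>i = e\<close>. One table
    \<open>ch\<close> then serves both \<open>chain_rel\<close> and
    \<open>final_rel\<close>.\<close>
  define X where "X i = (if i < e then val (Elem 1 2 (Cc 0)) else val (Elem 1 2 (Qq cs)))" for i
  define C where "C = val (Elem 2 1 (Cc 1))"
  have w_Suc: "?w (Suc i) = (?w i @ [Cc 0]) @ [Cc 1]" for i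
  proof -
    have "replicate (Suc i) [Cc 0, Cc 1] = replicate i [Cc 0, Cc 1] @ [[Cc 0, Cc 1]]"
      by (metis replicate_append_same replicate_Suc)
    then show ?thesis by simp
  qed
  have RX: "R i + X i = R' i + (X i + R i)" if "i < e" for i
    unfolding R_def R'_def X_def W_snoc using G_comm[of 0 1 2 "W (?w i)" "f (Cc 0)"] suppW supp that by (simp add: val)
  have R'C: "R' i + C = R (Suc i) + (C + R' i)" for i
    unfolding R_def R'_def C_def w_Suc W_snoc[of "?w i @ [Cc 0]"]
    using G_comm[of 0 2 1 "W (?w i @ [Cc 0])" "f (Cc 1)"] suppW supp by (simp add: val)
  have RS: "R e + X e = S + (X e + R e)"
    unfolding R_def S_def X_def input_word_def
    using G_comm[of 0 1 2 "W (?w e)" "f (Qq cs)"] suppW supp W_snoc[of "?w e"] by (simp add: val)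
  \<comment> \<open>The number 10 is at once the code of \<open>Elem 0 1 (Bb k)\<close> and the
    start of the chain; both readings must give the same element.\<close>
  have R_0: "R 0 = val (Elem 0 1 (Bb k))" by (simp add: R_def val W_single)
  define ch where "ch i t = (if t = 0 then R i else if t = 2 then R' i else if t = 4 then R i + X i
    else if t = 6 then X i + R i else if t = 8 then R' i + C else C + R' i)" for i t :: nat
  define \<phi> where "\<phi> s = (if s = 2 then S else if s = 4 then val (Elem 1 2 (Qq cs)) else if s = 6 then val (Elem 1 2 (Cc 0))
     else if s = 8 then C else if s < 10 then 0 else if even s then ch ((s - 10) div 12) ((s - 10) mod 12)
     else if s \<in> range (sym_code k cs) then val (inv (sym_code k cs) s) else 0)" for s
  have \<phi>_val: "\<phi> (sym_code k cs s) = val s" for s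
  proof -
    have inv: "inv (sym_code k cs) (sym_code k cs s) = s" by (rule inv_f_f[OF inj_sym_code])
    have "2 * to_nat s + 11 \<noteq> c" if "even c" for c using that by auto
    then show ?thesis using inv
      by (auto simp: sym_code_def \<phi>_def ch_def R_0 C_def split: if_splits)
  qed
  have \<phi>_ch: "\<phi> (12 * i + t + 10) = ch i t" if "even t" "t < 12" for i t
    using that by (simp add: \<phi>_def)
  have \<phi>_chain: "\<phi> (12 * i + 10) = R i" "\<phi> (12 * i + 12) = R' i" "\<phi> (12 * i + 14) = R i + X i"
    "\<phi> (12 * i + 16) = X i + R i" "\<phi> (12 * i + 18) = R' i + C" "\<phi> (12 * i + 20) = C + R' i"
    "\<phi> (12 * i + 22) = R (Suc i)" for i
    using \<phi>_ch[of 0 i] \<phi>_ch[of 2 i] \<phi>_ch[of 4 i] \<phi>_ch[of 6 i] \<phi>_ch[of 8 i] \<phi>_ch[of 10 i] \<phi>_ch[of 0 "Suc i"]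
    by (simp_all add: ch_def algebra_simps)
  have \<phi>_const: "\<phi> 2 = S" "\<phi> 4 = val (Elem 1 2 (Qq cs))" "\<phi> 6 = val (Elem 1 2 (Cc 0))" "\<phi> 8 = C"
    by (simp_all add: \<phi>_def)
  \<comment> \<open>Here characteristic two pays off: the element of the input word is an
    involution, as the sign function constructed later requires.\<close>
  have S_inv: "S + S = 0" unfolding S_def G_def input_word_def using gtransv_involution[of 0 2] suppW by simp
  obtain v u where vu: "W (input_word k cs e) v = Some u" using w unfolding W_def by blast
  have S_neq: "S \<noteq> 0"
  proof -
    have "(2, u) \<in> U" using vu suppW[of "Bb k"] by (auto simp: U_def supp_def input_word_def)
    moreover have "supp (W (input_word k cs e))" using suppW by (simp add: input_word_def)
    ultimately show ?thesis
      unfolding S_def G_def using gtransv_neq_0[of 0 2 _ v u] vu by simp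
  qed
  have pin: "\<phi> s \<in> pinned U" for s
    using suppW supp by (auto simp: \<phi>_def ch_def R_def R'_def S_def X_def C_def val_pinned pinned_0 input_word_def
        intro!: pinned_plus G_pinned)
  show thesis
  proof
    show "finite (pinned U)" using Y(1) by (intro finite_pinned) (simp add: U_def)
    show "pinned U \<noteq> {}" using pinned_0 by auto
    show "\<phi> s + b \<in> pinned U" if "b \<in> pinned U" for s b by (rule pinned_plus[OF pin that])
    show "\<phi> 2 + \<phi> 2 = 0" "\<phi> 2 \<noteq> 0" using S_inv S_neq by (simp_all add: \<phi>_const)
    show "\<phi> x + \<phi> y = \<phi> z" if "rel e x y z" for x y z
      using that unfolding rel_def
    proof (elim disjE exE conjE)
      assume "triple_code x y z \<in> set_decode e"
      then obtain a b c where "(a, b, c) \<in> sym_triples k cs" "x = sym_code k cs a" "y = sym_code k cs b" "z = sym_code k cs c"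
        unfolding e presentation_iff by auto
      then show ?thesis using val_trip by (simp add: \<phi>_val)
    next
      fix i assume "i < e" "chain_rel i x y z"
      then show ?thesis unfolding chain_rel_def
        using RX[of i] R'C[of i] by (elim disjE) (auto simp: \<phi>_chain \<phi>_const X_def)
    next
      assume "final_rel e x y z"
      then show ?thesis unfolding final_rel_def
        using RS by (elim disjE) (auto simp: \<phi>_chain \<phi>_const X_def)
    qed
  qed
qed

section \<open>The matroid of a presentation\<close>

locale partial_linear_space =
  fixes lines :: "'p set set"
  assumes lines_meet: "\<lbrakk>L \<in> lines; L' \<in> lines; p \<in> L; q \<in> L; p \<in> L'; q \<in> L'; p \<noteq> q\<rbrakk> \<Longrightarrow> L = L'"
begin

definition coll :: "'p \<Rightarrow> 'p \<Rightarrow> 'p \<Rightarrow> bool" where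
  "coll p q r \<longleftrightarrow> p = q \<or> q = r \<or> p = r \<or> (\<exists>L\<in>lines. p \<in> L \<and> q \<in> L \<and> r \<in> L)"

text \<open>Rank at most 3 as a sum of three existential statements. With bounded quantifiers in
  their place the rank becomes computable.\<close>

definition rk :: "'p set \<Rightarrow> nat" where
  "rk S = of_bool (S \<noteq> {}) + of_bool (\<exists>p\<in>S. \<exists>q\<in>S. p \<noteq> q) + of_bool (\<exists>p\<in>S. \<exists>q\<in>S. \<exists>r\<in>S. \<not> coll p q r)"

lemma coll_trans:
  assumes "coll p q r" "coll p q s" "coll p q t" "p \<noteq> q"
  shows "coll r s t"
proof (cases "\<exists>L\<in>lines. p \<in> L \<and> q \<in> L")
  case True
  then obtain L where L: "L \<in> lines" "p \<in> L" "q \<in> L" by blast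
  have "x \<in> L" if "coll p q x" for x
    using that assms(4) L lines_meet[OF _ L(1), of _ p q] unfolding coll_def by blast
  then have "r \<in> L" "s \<in> L" "t \<in> L" using assms by auto
  then show ?thesis using L(1) unfolding coll_def by blast
next
  case False
  then have "x = p \<or> x = q" if "coll p q x" for x
    using that assms(4) unfolding coll_def by blast
  then have "r \<in> {p, q}" "s \<in> {p, q}" "t \<in> {p, q}" using assms(1-3) by auto
  then show ?thesis unfolding coll_def by auto
qed

lemma rk_mono: "S \<subseteq> T \<Longrightarrow> rk S \<le> rk T"
  unfolding rk_def by (intro add_mono) (auto simp: of_bool_def)

lemma rk_le_card:
  assumes "finite S"
  shows "rk S \<le> card S"
proof -
  have c: "rk S \<le> card T" if "T \<subseteq> S" "finite T" "rk S \<le> card T" for T using that by simp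
  show ?thesis
  proof (cases "\<exists>p\<in>S. \<exists>q\<in>S. \<exists>r\<in>S. \<not> coll p q r")
    case True
    then obtain p q r where pqr: "p \<in> S" "q \<in> S" "r \<in> S" "\<not> coll p q r" by auto
    then have "p \<noteq> q" "q \<noteq> r" "p \<noteq> r" by (auto simp: coll_def)
    then have "card {p, q, r} = 3" by simp
    moreover have "card {p, q, r} \<le> card S" by (rule card_mono) (use pqr assms in auto)
    moreover have "rk S \<le> 3" by (simp add: rk_def of_bool_def)
    ultimately show ?thesis by simp
  next
    case no3: False
    show ?thesis
    proof (cases "\<exists>p\<in>S. \<exists>q\<in>S. p \<noteq> q")
      case True
      then obtain p q where "p \<in> S" "q \<in> S" "p \<noteq> q" by auto
      then have "card {p, q} \<le> card S" "card {p, q} = 2" using card_mono[OF assms, of "{p, q}"] by auto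
      moreover have "rk S \<le> 2" using no3 by (simp add: rk_def of_bool_def)
      ultimately show ?thesis by simp
    next
      case False
      then have "rk S = of_bool (S \<noteq> {})" using no3 by (simp add: rk_def of_bool_def)
      then show ?thesis using assms by (cases "S = {}") (auto simp: Suc_le_eq card_gt_0_iff)
    qed
  qed
qed

lemma rk_le_3: "rk S \<le> 3"
  by (simp add: rk_def of_bool_def)

lemma rk_le_2I: "(\<And>p q r. p \<in> S \<Longrightarrow> q \<in> S \<Longrightarrow> r \<in> S \<Longrightarrow> coll p q r) \<Longrightarrow> rk S \<le> 2"
  by (auto simp: rk_def of_bool_def)

lemma rk_eq_3: "p \<in> S \<Longrightarrow> q \<in> S \<Longrightarrow> r \<in> S \<Longrightarrow> \<not> coll p q r \<Longrightarrow> rk S = 3"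
proof -
  assume *: "p \<in> S" "q \<in> S" "r \<in> S" "\<not> coll p q r"
  then have "p \<noteq> q" by (auto simp: coll_def)
  then have "S \<noteq> {}" "\<exists>p\<in>S. \<exists>q\<in>S. p \<noteq> q" "\<exists>p\<in>S. \<exists>q\<in>S. \<exists>r\<in>S. \<not> coll p q r" using * by blast+
  then show ?thesis unfolding rk_def by (simp only: of_bool_eq) simp
qed

lemma rk_eq_2:
  assumes "p \<in> S" "q \<in> S" "p \<noteq> q" "\<And>p q r. p \<in> S \<Longrightarrow> q \<in> S \<Longrightarrow> r \<in> S \<Longrightarrow> coll p q r"
  shows "rk S = 2"
proof -
  have "S \<noteq> {}" "\<exists>p\<in>S. \<exists>q\<in>S. p \<noteq> q" "\<not> (\<exists>p\<in>S. \<exists>q\<in>S. \<exists>r\<in>S. \<not> coll p q r)" using assms by blast+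
  then show ?thesis unfolding rk_def by (simp only: of_bool_eq) simp
qed

lemma rk_empty: "rk {} = 0"
  by (simp add: rk_def)

lemma rk_singleton: "rk {p} = 1"
  by (simp add: rk_def coll_def)

lemma rk_le_2D: "rk S \<le> 2 \<Longrightarrow> p \<in> S \<Longrightarrow> q \<in> S \<Longrightarrow> r \<in> S \<Longrightarrow> coll p q r"
  using rk_eq_3[of p S q r] by (cases "coll p q r") auto

lemma rk_ge_2: "p \<in> S \<Longrightarrow> q \<in> S \<Longrightarrow> p \<noteq> q \<Longrightarrow> 2 \<le> rk S"
proof (cases "rk S \<le> 2")
  case True
  then have "\<And>p q r. p \<in> S \<Longrightarrow> q \<in> S \<Longrightarrow> r \<in> S \<Longrightarrow> coll p q r" using rk_le_2D by metis
  then show "p \<in> S \<Longrightarrow> q \<in> S \<Longrightarrow> p \<noteq> q \<Longrightarrow> 2 \<le> rk S" using rk_eq_2[of p S q] by simp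
qed simp

lemma rk_le_1D: "rk S \<le> 1 \<Longrightarrow> p \<in> S \<Longrightarrow> q \<in> S \<Longrightarrow> p = q"
  using rk_ge_2[of p S q] by (cases "p = q") auto

text \<open>The case that uses the geometry is that of two sets of rank 2 with two common points:
  both lie on the line of these points, and so does the union. Elsewhere bounds on the ranks
  suffice.\<close>

lemma rk_submodular: "rk (S \<union> T) + rk (S \<inter> T) \<le> rk S + rk T"
proof -
  have i: "rk (S \<inter> T) \<le> rk S" "rk (S \<inter> T) \<le> rk T" by (rule rk_mono; blast)+
  consider "S \<subseteq> T" | "T \<subseteq> S" | "rk S = 3 \<or> rk T = 3" | "\<not> S \<subseteq> T" "\<not> T \<subseteq> S" "rk S \<le> 2" "rk T \<le> 2"
    using rk_le_3[of S] rk_le_3[of T] by force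
  then show ?thesis
  proof cases
    case 3
    then show ?thesis using i rk_le_3[of "S \<union> T"] by linarith
  next
    case 4
    have ge1: "rk X \<ge> 1" if "x \<in> X" for x X using that by (auto simp: rk_def)
    have ne: "rk S \<ge> 1" "rk T \<ge> 1" using 4 ge1 by blast+
    show ?thesis
    proof (cases "rk S = 1 \<or> rk T = 1")
      case True
      have "S \<inter> T = {}"
      proof (rule ccontr)
        assume "S \<inter> T \<noteq> {}"
        then obtain x where x: "x \<in> S" "x \<in> T" by auto
        from True show False
        proof
          assume "rk S = 1"
          then have "y = x" if "y \<in> S" for y using rk_le_1D[of S y x] x that by simp
          then have "S \<subseteq> {x}" by blast
          then show False using 4 x by auto
        next
          assume "rk T = 1"
          then have "y = x" if "y \<in> T" for y using rk_le_1D[of T y x] x that by simp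
          then have "T \<subseteq> {x}" by blast
          then show False using 4 x by auto
        qed
      qed
      then have z: "rk (S \<inter> T) = 0" by (simp add: rk_def)
      show ?thesis
      proof (cases "rk S = 1 \<and> rk T = 1")
        case True
        obtain x y where xy: "x \<in> S" "y \<in> T" using 4 by blast
        have "u = x" if "u \<in> S" for u using True rk_le_1D[of S u x] that xy by simp
        moreover have "u = y" if "u \<in> T" for u using True rk_le_1D[of T u y] that xy by simp
        ultimately have xy: "u = x \<or> u = y" if "u \<in> S \<union> T" for u using that by blast
        have "rk (S \<union> T) \<le> 2"
        proof (rule rk_le_2I)
          fix p q r assume "p \<in> S \<union> T" "q \<in> S \<union> T" "r \<in> S \<union> T"
          from this[THEN xy] show "coll p q r" by (elim disjE) (simp_all add: coll_def)
        qed
        then show ?thesis using z True by simp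
      next
        case False
        then have "rk S + rk T \<ge> 3" using ne by linarith
        then show ?thesis using z rk_le_3[of "S \<union> T"] by simp
      qed
    next
      case False
      then have 2: "rk S = 2" "rk T = 2" using 4 ne by linarith+
      show ?thesis
      proof (cases "rk (S \<inter> T) \<le> 1")
        case True
        then show ?thesis using 2 rk_le_3[of "S \<union> T"] by linarith
      next
        case False
        have "\<exists>p\<in>S \<inter> T. \<exists>q\<in>S \<inter> T. p \<noteq> q"
        proof (rule ccontr)
          assume *: "\<not> (\<exists>p\<in>S \<inter> T. \<exists>q\<in>S \<inter> T. p \<noteq> q)"
          then have "S \<inter> T = {} \<or> (\<exists>x. S \<inter> T = {x})" by blast
          then show False using False by (auto simp: rk_empty rk_singleton)
        qed
        then obtain p q where pq: "p \<in> S" "p \<in> T" "q \<in> S" "q \<in> T" "p \<noteq> q" by auto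
        have c: "coll p q r" if "r \<in> S \<union> T" for r
          using that pq rk_le_2D[of S p q r] rk_le_2D[of T p q r] 4 by auto
        have "rk (S \<union> T) \<le> 2"
          by (rule rk_le_2I, rule coll_trans[OF c c c pq(5)])
        then show ?thesis using i 2 False by linarith
      qed
    qed
  qed (use i in \<open>auto simp: Un_absorb1 Un_absorb2 Int_absorb1 Int_absorb2\<close>)
qed

lemma matroid_rk:
  fixes E :: "'b set"
  assumes "finite E" "inj_on code P"
  shows "matroid E (\<lambda>A. rk {p \<in> P. code p \<in> A})"
  unfolding matroid_def
proof (intro conjI allI impI)
  show "finite E" by fact
next
  fix A assume A: "A \<subseteq> E"
  have fin: "finite A" by (rule finite_subset[OF A assms(1)])
  have inj: "inj_on code {p \<in> P. code p \<in> A}" by (rule inj_on_subset[OF assms(2)]) auto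
  have im: "code ` {p \<in> P. code p \<in> A} \<subseteq> A" by auto
  have "finite {p \<in> P. code p \<in> A}" by (rule inj_on_finite[OF inj im fin])
  then have "rk {p \<in> P. code p \<in> A} \<le> card {p \<in> P. code p \<in> A}" by (rule rk_le_card)
  also have "\<dots> \<le> card A" by (rule card_inj_on_le[OF inj im fin])
  finally show "rk {p \<in> P. code p \<in> A} \<le> card A" .
next
  fix A B :: "'b set" assume "A \<subseteq> B"
  then show "rk {p \<in> P. code p \<in> A} \<le> rk {p \<in> P. code p \<in> B}"
    by (intro rk_mono) auto
next
  fix A B :: "'b set"
  have "{p \<in> P. code p \<in> A \<union> B} = {p \<in> P. code p \<in> A} \<union> {p \<in> P. code p \<in> B}"
    "{p \<in> P. code p \<in> A \<inter> B} = {p \<in> P. code p \<in> A} \<inter> {p \<in> P. code p \<in> B}" by auto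
  then show "rk {p \<in> P. code p \<in> A \<union> B} + rk {p \<in> P. code p \<in> A \<inter> B} \<le> rk {p \<in> P. code p \<in> A} + rk {p \<in> P. code p \<in> B}"
    using rk_submodular by (simp only:)
qed

end


section \<open>The incidence geometry of a relation \<open>R\<close> on symbols\<close>

text \<open>The points of a Dowling-like geometry over the frame \<open>JJ 0\<close>, \<open>JJ 1\<close>, \<open>JJ 2\<close>. The points
  \<open>PA u\<close>, \<open>PB u\<close>, \<open>PC u s\<close> lie on the three lines of the frame; an even index \<open>u = 2 s\<close> belongs to
  the symbol \<open>s\<close> (with \<open>0\<close> for the identity), and an odd one to one of the two scalars attached to
  a relation. The point \<open>PD l\<close> is a multiple of the second factor of the relation \<open>l\<close>, and \<open>PX\<close>,
  \<open>PY\<close> are the two products of the symbols \<open>1\<close> and \<open>2\<close>.\<close>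

datatype pt = JJ nat | PA nat | PB nat | PD nat | PC nat nat | PX | PY

locale gadget =
  fixes R :: "nat \<Rightarrow> nat \<Rightarrow> nat \<Rightarrow> bool" and n :: nat
  assumes R: "R x y z \<Longrightarrow> 2 \<le> x \<and> 2 \<le> y \<and> 2 \<le> z \<and> z \<noteq> x \<and> z \<noteq> y"
    and R_less: "R x y z \<Longrightarrow> x < n \<and> y < n \<and> z < n"
    and n_gt: "2 < n"
begin

text \<open>For the relation with code \<open>l\<close>, the number \<open>4 * l + 1\<close> stands
  for the factor \<open>\<kappa>\<close> of its second argument and \<open>4 * l + 3\<close> for the
  factor \<open>\<sigma>\<close> of its product. Being odd, they avoid the even indices of
  symbols.\<close>

definition scalar :: "nat \<Rightarrow> bool" where
  "scalar u \<longleftrightarrow> u = 0 \<or> (\<exists>x y z. R x y z \<and> (u = 4 * triple_code x y z + 1 \<or> u = 4 * triple_code x y z + 3))"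

definition index :: "nat \<Rightarrow> bool" where
  "index u \<longleftrightarrow> scalar u \<or> (\<exists>s<n. u = 2 * s)"

definition points :: "pt set" where
  "points = {JJ 0, JJ 1, JJ 2, PX, PY} \<union> PA ` {u. index u} \<union> PB ` {u. index u}
     \<union> {PD (triple_code x y z) |x y z. R x y z} \<union> {PC u s |u s. scalar u \<and> s < n}"

definition line12 :: "pt set" where "line12 = {JJ 0, JJ 1} \<union> range PA"
definition line23 :: "pt set" where "line23 = {JJ 1, JJ 2} \<union> range PB \<union> range PD"
definition line13 :: "pt set" where "line13 = {JJ 0, JJ 2, PX, PY} \<union> range (\<lambda>(u, s). PC u s)"

text \<open>\<open>abc a b c\<close> stands for \<open>a b = c\<close>. \<open>PC u s\<close> lies
  on lines for scalar times symbol (\<open>ab1\<close>) and symbol times scalar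
  (\<open>ab2\<close>), so scalars are central; for \<open>u = 0\<close> these lines identify the
  copies of a symbol on the three frame lines. \<open>d1\<close> makes \<open>PD\<close> the element
  \<open>\<kappa> y\<close>, and \<open>d2\<close> says
  \<open>x (\<kappa> y) = \<sigma> z\<close>.\<close>

inductive abc :: "pt \<Rightarrow> pt \<Rightarrow> pt \<Rightarrow> bool" where
  ab1: "scalar u \<Longrightarrow> s < n \<Longrightarrow> abc (PA u) (PB (2 * s)) (PC u s)"
| ab2: "scalar u \<Longrightarrow> s < n \<Longrightarrow> abc (PA (2 * s)) (PB u) (PC u s)"
| d1: "R x y z \<Longrightarrow> abc (PA 0) (PD (triple_code x y z)) (PC (4 * triple_code x y z + 1) y)"
| d2: "R x y z \<Longrightarrow> abc (PA (2 * x)) (PD (triple_code x y z)) (PC (4 * triple_code x y z + 3) z)"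
| px: "abc (PA 2) (PB 4) PX"
| py: "abc (PA 4) (PB 2) PY"

lemma scalar_cases: "scalar u \<Longrightarrow> u = 0 \<or> odd u"
  by (auto simp: scalar_def)

lemma abc_sides: "abc a b c \<Longrightarrow> a \<in> range PA \<and> b \<in> range PB \<union> range PD \<and> c \<in> range (\<lambda>(u, s). PC u s) \<union> {PX, PY}"
  by (auto elim!: abc.cases)

lemma scalarI: "scalar 0" "R x y z \<Longrightarrow> scalar (4 * triple_code x y z + 1)" "R x y z \<Longrightarrow> scalar (4 * triple_code x y z + 3)"
  unfolding scalar_def by blast+

lemma indexI: "scalar u \<Longrightarrow> index u" "s < n \<Longrightarrow> index (2 * s)"
  unfolding index_def by blast+

lemma pointsI:
  "JJ 0 \<in> points" "JJ 1 \<in> points" "JJ 2 \<in> points" "PX \<in> points" "PY \<in> points"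
  "index u \<Longrightarrow> PA u \<in> points" "index u \<Longrightarrow> PB u \<in> points" "R x y z \<Longrightarrow> PD (triple_code x y z) \<in> points"
  "scalar u \<Longrightarrow> s < n \<Longrightarrow> PC u s \<in> points"
  unfolding points_def by blast+

lemma abc_points: "abc a b c \<Longrightarrow> a \<in> points \<and> b \<in> points \<and> c \<in> points"
proof (induction rule: abc.induct)
  case (d1 x y z)
  then show ?case using R_less[OF d1] by (intro conjI pointsI indexI scalarI) auto
next
  case (d2 x y z)
  then show ?case using R_less[OF d2] by (intro conjI pointsI indexI scalarI) auto
next
  case px
  then show ?case using indexI(2)[of 1] indexI(2)[of 2] n_gt by (simp add: pointsI)
next
  case py
  then show ?case using indexI(2)[of 1] indexI(2)[of 2] n_gt by (simp add: pointsI)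
qed (auto intro: pointsI indexI)

text \<open>Most clashes are excluded by parity or because symbols of relations are at least 2. In
  the second part \<open>z \<noteq> x\<close> is what separates \<open>d2\<close> from
  \<open>ab2\<close>, which could otherwise share both \<open>PA (2 * x)\<close> and
  \<open>PC (4 * l + 3) z\<close>.\<close>

lemma abc_unique:
  "abc a b c \<Longrightarrow> abc a b c' \<Longrightarrow> c = c'"
  "abc a b c \<Longrightarrow> abc a b' c \<Longrightarrow> b = b'"
  "abc a b c \<Longrightarrow> abc a' b c \<Longrightarrow> a = a'"
  subgoal by (elim abc.cases, simp_all) (auto dest!: scalar_cases R, (presburger+)?)
  subgoal by (elim abc.cases, simp_all) (auto dest!: scalar_cases R, (presburger+)?)
  subgoal by (elim abc.cases, simp_all)
  done

definition lines :: "pt set set" where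
  "lines = {line12, line23, line13} \<union> {{a, b, c} |a b c. abc a b c}"

sublocale partial_linear_space lines
proof
  fix L L' p q
  assume L: "L \<in> lines" "L' \<in> lines" and pq: "p \<in> L" "q \<in> L" "p \<in> L'" "q \<in> L'" "p \<noteq> q"
  have long: "L = L'" if "L \<in> {line12, line23, line13}" "L' \<in> {line12, line23, line13}"
    using that pq by (auto simp: line12_def line23_def line13_def)
  have short: "\<not> (p \<in> L \<and> q \<in> L)" if "L \<in> {line12, line23, line13}" "abc a b c" "p \<in> {a, b, c}" "q \<in> {a, b, c}" for L a b c
    using that abc_sides[OF that(2)] \<open>p \<noteq> q\<close> by (auto simp: line12_def line23_def line13_def)
  have both: "{a, b, c} = {a', b', c'}" if "abc a b c" "abc a' b' c'" "p \<in> {a, b, c}" "q \<in> {a, b, c}"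
    "p \<in> {a', b', c'}" "q \<in> {a', b', c'}" for a b c a' b' c'
  proof -
    note pq' = that(3-6)
    have s: "a \<noteq> b'" "a \<noteq> c'" "b \<noteq> a'" "b \<noteq> c'" "c \<noteq> a'" "c \<noteq> b'"
      using abc_sides[OF that(1)] abc_sides[OF that(2)] by auto
    consider "a = a'" "b = b'" | "a = a'" "c = c'" | "b = b'" "c = c'"
      using pq' s \<open>p \<noteq> q\<close> by blast
    then show ?thesis using abc_unique that(1,2) by cases metis+
  qed
  have cases: "L \<in> {line12, line23, line13} \<or> (\<exists>a b c. L = {a, b, c} \<and> abc a b c)" if "L \<in> lines" for L
    using that unfolding lines_def by blast
  from cases[OF L(1)] show "L = L'"
  proof (elim disjE exE conjE)
    assume 1: "L \<in> {line12, line23, line13}"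
    from cases[OF L(2)] show ?thesis
    proof (elim disjE exE conjE)
      fix a b c assume "L' = {a, b, c}" "abc a b c"
      then show ?thesis using short[OF 1, of a b c] pq by simp
    qed (rule long[OF 1])
  next
    fix a b c assume 1: "L = {a, b, c}" "abc a b c"
    from cases[OF L(2)] show ?thesis
    proof (elim disjE exE conjE)
      assume "L' \<in> {line12, line23, line13}"
      then show ?thesis using short[OF _ 1(2), of L'] pq 1 by simp
    next
      fix a' b' c' assume 2: "L' = {a', b', c'}" "abc a' b' c'"
      show ?thesis unfolding 1(1) 2(1) by (rule both[OF 1(2) 2(2)]) (use pq 1 2 in simp_all)
    qed
  qed
qed

fun code :: "pt \<Rightarrow> nat" where
  "code (JJ i) = prod_encode (0, i)"
| "code (PA u) = prod_encode (1, u)"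
| "code (PB u) = prod_encode (2, u)"
| "code (PD l) = prod_encode (3, l)"
| "code (PC u s) = prod_encode (4, prod_encode (u, s))"
| "code PX = prod_encode (5, 0)"
| "code PY = prod_encode (5, 1)"

lemma inj_code: "inj code"
proof (rule injI)
  fix p q assume "code p = code q" then show "p = q" by (cases p; cases q) auto
qed

definition point_rank :: "nat set \<Rightarrow> nat" where
  "point_rank A = rk {p \<in> points. code p \<in> A}"

lemma matroid_point_rank: "finite E \<Longrightarrow> matroid E point_rank"
  unfolding point_rank_def by (rule matroid_rk) (auto intro: inj_on_subset[OF inj_code])

definition bound :: nat where
  "bound = Suc (prod_encode (5, prod_encode (4 * triple_code n n n + 2 * n + 4, n)))"

lemma prod_encode_mono: "a \<le> a' \<Longrightarrow> b \<le> b' \<Longrightarrow> prod_encode (a, b) \<le> prod_encode (a', b')"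
proof -
  assume *: "a \<le> a'" "b \<le> b'"
  have "m \<le> m' \<Longrightarrow> triangle m \<le> triangle m'" for m m'
    by (rule lift_Suc_mono_le[of triangle]) auto
  from this[of "a + b" "a' + b'"] * show ?thesis by (simp add: prod_encode_def)
qed

lemma code_less_bound: "p \<in> points \<Longrightarrow> code p < bound"
proof -
  let ?l = "triple_code n n n" and ?U = "4 * triple_code n n n + 2 * n + 4"
  assume p: "p \<in> points"
  have l: "triple_code x y z \<le> ?l" if "R x y z" for x y z
    using R_less[OF that] unfolding triple_code_def by (intro prod_encode_mono) auto
  have scalar: "u \<le> ?U" if "scalar u" for u
    using that l by (fastforce simp: scalar_def)
  have idx: "u \<le> ?U" if "index u" for u
    using that scalar by (auto simp: index_def)
  have U: "?U \<le> prod_encode (?U, n)" by (rule le_prod_encode_1)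
  have "\<exists>t a. code p = prod_encode (t, a) \<and> t \<le> 5 \<and> a \<le> prod_encode (?U, n)"
  proof (cases p)
    case (JJ i)
    then show ?thesis using p U by (intro exI[of _ 0] exI[of _ i]) (auto simp: points_def)
  next
    case (PA u)
    then show ?thesis using p U idx by (intro exI[of _ 1] exI[of _ u]) (fastforce simp: points_def)
  next
    case (PB u)
    then show ?thesis using p U idx by (intro exI[of _ 2] exI[of _ u]) (fastforce simp: points_def)
  next
    case (PD m)
    then have "m \<le> ?l" using p l by (auto simp: points_def)
    then show ?thesis using U PD by (intro exI[of _ 3] exI[of _ m]) auto
  next
    case (PC u s)
    then have "scalar u" "s < n" using p by (auto simp: points_def)
    then show ?thesis using PC scalar
      by (intro exI[of _ 4] exI[of _ "prod_encode (u, s)"]) (auto intro: prod_encode_mono)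
  next
    case PX
    then show ?thesis by (intro exI[of _ 5] exI[of _ 0]) auto
  next
    case PY
    then show ?thesis using U by (intro exI[of _ 5] exI[of _ 1]) auto
  qed
  then obtain t a where "code p = prod_encode (t, a)" "t \<le> 5" "a \<le> prod_encode (?U, n)" by blast
  then show ?thesis using prod_encode_mono[of t 5 a "prod_encode (?U, n)"] by (simp add: bound_def)
qed

lemma finite_points: "finite points"
  by (rule inj_on_finite[of code _ "{..<bound}"]) (auto intro: inj_on_subset[OF inj_code] code_less_bound)

end

section \<open>From entropic representations to groups\<close>

definition conj_set :: "'g::group_add \<Rightarrow> 'g set \<Rightarrow> 'g set" where
  "conj_set g X = {g} + X + {- g}"

lemma sing_plus: "{a} + {b} = {a + b :: 'g::group_add}"
  by (auto simp: set_plus_def)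

lemma sing_zero: "{0} + X = X" "X + {0} = (X :: 'g::group_add set)"
  by (auto simp: set_plus_def)

lemma sing_cancel: "{g} + ({- g} + X) = X" "{- g} + ({g} + X) = (X :: 'g::group_add set)"
  "X + {g} + {- g} = X" "X + {- g} + {g} = X"
proof -
  show "{g} + ({- g} + X) = X" "{- g} + ({g} + X) = X"
    unfolding add.assoc[symmetric] sing_plus by (simp_all add: sing_zero)
  show "X + {g} + {- g} = X" "X + {- g} + {g} = X"
    unfolding add.assoc sing_plus by (simp_all add: sing_zero)
qed

lemma conj_set_plus: "conj_set (a + b) X = conj_set a (conj_set b X)"
  unfolding conj_set_def minus_add sing_plus[symmetric] by (simp only: add.assoc)

lemma conj_set_minus: "conj_set (- g) (conj_set g X) = X" "conj_set g (conj_set (- g) X) = X"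
  by (simp_all flip: conj_set_plus) (simp_all add: conj_set_def sing_zero)

lemma conj_set_sum: "conj_set g (X + Y) = conj_set g X + conj_set g Y"
proof -
  have "conj_set g X + conj_set g Y = {g} + X + ({- g} + ({g} + (Y + {- g})))"
    by (simp add: conj_set_def add.assoc)
  then show ?thesis by (simp add: sing_cancel conj_set_def add.assoc)
qed

lemma conj_set_eq: "conj_set g X = X \<longleftrightarrow> {g} + X = X + {g}"
  unfolding conj_set_def by (metis sing_cancel(3,4))

text \<open>The relations hold up to the central elements \<open>Z u\<close>. Conjugation on the sets that commute with
  all \<open>Z u\<close> forgets these, which turns \<open>G\<close> into a model of the exact relations.\<close>

lemma central_quotient:
  fixes K :: "'g::group_add set" and G Z :: "nat \<Rightarrow> 'g set"
  assumes K: "K + K = K" "0 \<in> K" "\<And>k. k \<in> K \<Longrightarrow> - k \<in> K"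
    and g: "\<And>s. s < n \<Longrightarrow> G s = {g s} + K \<and> G s = K + {g s}"
    and c: "\<And>u. scalar u \<Longrightarrow> Z u = {c u} + K \<and> Z u = K + {c u}"
    and GZ: "\<And>u s. scalar u \<Longrightarrow> s < n \<Longrightarrow> Z u + G s = G s + Z u"
    and rel: "\<And>x y z. R x y z \<Longrightarrow> x < n \<and> y < n \<and> z < n \<and> (\<exists>u v. scalar u \<and> scalar v \<and> G x + (Z u + G y) = Z v + G z)"
    and n: "2 < n" and neq: "G 1 + G 2 \<noteq> G 2 + G 1"
  shows "\<exists>\<phi> :: nat \<Rightarrow> 'g set bijection. (\<forall>x y z. R x y z \<longrightarrow> \<phi> x + \<phi> y = \<phi> z) \<and> \<phi> 2 \<noteq> 0"
proof -
  have g1: "G s = {g s} + K" and g2: "G s = K + {g s}" if "s < n" for s using g[OF that] by blast+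
  have c1: "Z u = {c u} + K" and c2: "Z u = K + {c u}" if "scalar u" for u using c[OF that] by blast+
  have kK: "{k} + K = K" "K + {k} = K" if "k \<in> K" for k
  proof -
    have le: "{a} + K \<subseteq> K" "K + {a} \<subseteq> K" if "a \<in> K" for a
      using set_plus_mono2[of "{a}" K K K] set_plus_mono2[of K K "{a}" K] K(1) that by simp_all
    have "K = {k} + ({- k} + K)" "K = K + {- k} + {k}" by (simp_all only: sing_cancel)
    then have "K \<subseteq> {k} + K" "K \<subseteq> K + {k}"
      using set_plus_mono2[OF subset_refl[of "{k}"] le(1)[OF K(3)[OF that]]]
        set_plus_mono2[OF le(2)[OF K(3)[OF that]] subset_refl[of "{k}"]] by simp_all
    then show "{k} + K = K" "K + {k} = K" using le[OF that] by auto
  qed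
  define D where "D = {X. K + X = X \<and> X + K = X \<and> (\<forall>u. scalar u \<longrightarrow> Z u + X = X + Z u)}"
  have gK: "conj_set (g s) K = K" if "s < n" for s
    unfolding conj_set_eq using g1[OF that] g2[OF that] by (simp only:)
  have Zg: "conj_set (g s) (Z u) = Z u" if "s < n" "scalar u" for s u
  proof -
    have ZK: "Z u + K = Z u" "K + Z u = Z u" using c1[OF that(2)] c2[OF that(2)] K(1) by (metis add.assoc)+
    have "Z u + {g s} = Z u + (K + {g s})" by (simp only: ZK flip: add.assoc)
    also have "\<dots> = Z u + G s" by (simp only: g2[OF that(1)])
    also have "\<dots> = G s + Z u" by (rule GZ[OF that(2,1)])
    also have "\<dots> = {g s} + (K + Z u)" by (simp only: g1[OF that(1)] add.assoc)
    also have "\<dots> = {g s} + Z u" by (simp only: ZK)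
    finally show ?thesis by (simp only: conj_set_eq)
  qed
  have inv: "conj_set (- a) X = X" if "conj_set a X = X" for a and X :: "'g set"
    using conj_set_minus(1)[of a X] that by simp
  have closed: "conj_set a X \<in> D" if "X \<in> D" "conj_set a K = K" "\<And>u. scalar u \<Longrightarrow> conj_set a (Z u) = Z u" for a X
    using that conj_set_sum[of a] unfolding D_def mem_Collect_eq by metis
  have gD: "conj_set (g s) X \<in> D" "conj_set (- g s) X \<in> D" if "X \<in> D" "s < n" for X s
    using closed that gK Zg inv by metis+
  have cX: "conj_set x X = X" if xZ: "x \<in> Z u" and uS: "scalar u" and "X \<in> D" for x u X
  proof -
    obtain k where k: "k \<in> K" "x = c u + k" using xZ c1[OF uS] by (auto simp: set_plus_def)
    have X: "K + X = X" "X + K = X" "Z u + X = X + Z u" using that by (auto simp: D_def)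
    have kX: "{k} + X = X" "X + {k} = X" using kK[OF k(1)] X by (metis add.assoc)+
    have "{c u} + X = Z u + X" by (simp only: c1[OF that(2)] add.assoc X(1))
    also have "\<dots> = X + Z u" by (rule X(3))
    also have "\<dots> = X + K + {c u}" by (simp only: c2[OF that(2)] add.assoc)
    finally have cu: "{c u} + X = X + {c u}" by (simp only: X(2))
    have "{x} + X = {c u} + ({k} + X)" by (simp only: k(2) add.assoc flip: sing_plus)
    moreover have "X + {x} = X + {c u} + {k}" by (simp only: k(2) add.assoc flip: sing_plus)
    moreover have "X + {c u} + {k} = {c u} + (X + {k})" by (simp only: cu[symmetric] add.assoc)
    ultimately show ?thesis by (simp only: conj_set_eq kX)
  qed
  have kX: "conj_set k X = X" if "k \<in> K" "X \<in> D" for k X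
  proof -
    have X: "K + X = X" "X + K = X" using that by (auto simp: D_def)
    then have "{k} + X = X" "X + {k} = X" using kK[OF that(1)] by (metis add.assoc)+
    then show ?thesis by (simp add: conj_set_eq)
  qed
  have gX: "conj_set a X = conj_set (g s) X" if aG: "a \<in> G s" and sn: "s < n" and "X \<in> D" for a s X
  proof -
    obtain k where k: "k \<in> K" "a = g s + k" using aG g1[OF sn] by (auto simp: set_plus_def)
    then show ?thesis using kX that(3) by (simp add: conj_set_plus)
  qed
  have G_mem: "g s \<in> G s" if "s < n" for s using g1[OF that] K(2) by (force simp: set_plus_def)
  have Z_mem: "c u \<in> Z u" if "scalar u" for u using c1[OF that] K(2) by (force simp: set_plus_def)
  have relX: "conj_set (g x) (conj_set (g y) X) = conj_set (g z) X" if R: "R x y z" and X: "X \<in> D" for x y z X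
  proof -
    obtain u v where uv: "scalar u" "scalar v" "G x + (Z u + G y) = Z v + G z" and xyz: "x < n" "y < n" "z < n"
      using rel[OF R] by blast
    have "g x + (c u + g y) \<in> Z v + G z"
      unfolding uv(3)[symmetric] by (intro set_plus_intro G_mem Z_mem uv xyz)
    then obtain a b where ab: "a \<in> Z v" "b \<in> G z" "g x + (c u + g y) = a + b" by (auto simp: set_plus_def)
    have "conj_set (g x) (conj_set (c u) (conj_set (g y) X)) = conj_set a (conj_set b X)"
      using ab(3) by (simp flip: conj_set_plus)
    moreover have "conj_set (c u) (conj_set (g y) X) = conj_set (g y) X"
      by (rule cX[OF Z_mem[OF uv(1)] uv(1) gD(1)[OF X xyz(2)]])
    moreover have "conj_set a (conj_set b X) = conj_set (g z) X"
      using gX[OF ab(2) xyz(3) X] cX[OF ab(1) uv(2) gD(1)[OF X xyz(3)]] by simp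
    ultimately show ?thesis by simp
  qed
  \<comment> \<open>The conjugation is extended by the identity, outside \<open>D\<close> and for
    indices from \<open>n\<close> on, to a permutation of all sets.\<close>
  define act where "act s X = (if X \<in> D \<and> s < n then conj_set (g s) X else X)" for s X
  have bij: "bij (act s)" for s
  proof (rule o_bij)
    let ?inv = "\<lambda>X. if X \<in> D \<and> s < n then conj_set (- g s) X else X"
    show "?inv \<circ> act s = id" "act s \<circ> ?inv = id"
      using gD by (auto simp: act_def fun_eq_iff conj_set_minus)
  qed
  define \<phi> where "\<phi> s = Bij (act s)" for s
  have \<phi>: "bij_fun (\<phi> s) = act s" for s unfolding \<phi>_def using bij by (simp add: Bij_inverse)
  have "\<phi> x + \<phi> y = \<phi> z" if R: "R x y z" for x y z
    using rel[OF R] relX[OF R] gD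
    by (intro bijection_eqI) (auto simp: bij_fun_plus \<phi> act_def)
  moreover have "\<phi> 2 \<noteq> 0"
  proof
    assume "\<phi> 2 = 0"
    then have a2: "act 2 X = X" for X using \<phi>[of 2] bij_fun_zero by metis
    have 1: "1 < n" using n by simp
    \<comment> \<open>\<open>G 1\<close> is itself one of the sets acted upon, and a trivial action
      of the symbol 2 on it would make \<open>G 1\<close> and \<open>G 2\<close> commute.\<close>
    have G1: "G 1 \<in> D"
    proof -
      have "K + G 1 = G 1" by (subst (1 2) g2[OF 1]) (simp only: K(1) flip: add.assoc)
      moreover have "G 1 + K = G 1" by (subst (1 2) g1[OF 1]) (simp only: K(1) add.assoc)
      ultimately show ?thesis unfolding D_def using GZ[OF _ 1] by blast
    qed
    then have KG1: "K + G 1 = G 1" "G 1 + K = G 1" by (simp_all add: D_def)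
    have "conj_set (g 2) (G 1) = G 1" using a2[of "G 1"] n G1 unfolding act_def by simp
    then have eq: "{g 2} + G 1 = G 1 + {g 2}" by (simp add: conj_set_eq)
    have "G 2 + G 1 = {g 2} + G 1" by (simp only: g1[OF n] KG1(1) add.assoc)
    also have "\<dots> = G 1 + K + {g 2}" by (simp only: eq KG1(2))
    also have "\<dots> = G 1 + G 2" by (simp only: g2[OF n] add.assoc)
    finally show False using neq by simp
  qed
  ultimately show ?thesis by blast
qed

section \<open>Permutations from three independent coordinates\<close>

locale latin_frame =
  fixes Om :: "'z set" and Q :: "nat set" and X1 X2 X3 :: "'z \<Rightarrow> nat"
  assumes coords: "X1 ` Om = Q" "X2 ` Om = Q" "X3 ` Om = Q"
    and joint: "\<lbrakk>z1 \<in> Om; z2 \<in> Om; z3 \<in> Om\<rbrakk> \<Longrightarrow> \<exists>z\<in>Om. X1 z = X1 z1 \<and> X2 z = X2 z2 \<and> X3 z = X3 z3"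
    and nonempty: "Om \<noteq> {}"
begin

definition det :: "('z \<Rightarrow> 'a) \<Rightarrow> ('z \<Rightarrow> 'b) \<Rightarrow> ('z \<Rightarrow> 'c) \<Rightarrow> bool" where
  "det u v w \<longleftrightarrow> (\<forall>z\<in>Om. \<forall>z'\<in>Om. u z = u z' \<longrightarrow> v z = v z' \<longrightarrow> w z = w z')"

definition indep :: "('z \<Rightarrow> 'a) \<Rightarrow> ('z \<Rightarrow> 'b) \<Rightarrow> bool" where
  "indep u v \<longleftrightarrow> (\<forall>z1\<in>Om. \<forall>z2\<in>Om. \<exists>z\<in>Om. u z = u z1 \<and> v z = v z2)"

text \<open>\<open>w\<close> labels a Latin square with rows \<open>U\<close> and columns
  \<open>V\<close>: for each value of \<open>w\<close> the pairs of row and column form the graph of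
  a permutation of \<open>Q\<close>.\<close>

definition latin :: "('z \<Rightarrow> nat) \<Rightarrow> ('z \<Rightarrow> nat) \<Rightarrow> ('z \<Rightarrow> nat) \<Rightarrow> bool" where
  "latin U V w \<longleftrightarrow> U ` Om = Q \<and> V ` Om = Q \<and> det U w V \<and> det V w U \<and> det U V w \<and> indep U w \<and> indep V w \<and> indep U V"

definition pm :: "('z \<Rightarrow> nat) \<Rightarrow> ('z \<Rightarrow> nat) \<Rightarrow> ('z \<Rightarrow> nat) \<Rightarrow> nat \<Rightarrow> nat bijection" where
  "pm U V w \<alpha> = Bij (\<lambda>y. if y \<in> Q then V (SOME z. z \<in> Om \<and> U z = y \<and> w z = \<alpha>) else y)"

lemma pm_raw:
  assumes "latin U V w" "z \<in> Om" "w z = \<alpha>"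
  shows "V (SOME z'. z' \<in> Om \<and> U z' = U z \<and> w z' = \<alpha>) = V z"
proof -
  let ?P = "\<lambda>z'. z' \<in> Om \<and> U z' = U z \<and> w z' = \<alpha>"
  have "?P (SOME z'. ?P z')" by (rule someI[of ?P z]) (use assms in auto)
  then show ?thesis using assms unfolding latin_def det_def by blast
qed

lemma latin_sym: "latin U V w \<Longrightarrow> latin V U w"
  unfolding latin_def det_def indep_def by (elim conjE, intro conjI) (assumption | blast)+

lemma latin_ex: "latin U V w \<Longrightarrow> y \<in> Q \<Longrightarrow> \<alpha> \<in> w ` Om \<Longrightarrow> \<exists>z\<in>Om. U z = y \<and> w z = \<alpha>"
  unfolding latin_def indep_def by blast

lemma bij_fun_pm:
  assumes "latin U V w" "\<alpha> \<in> w ` Om"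
  shows "bij_fun (pm U V w \<alpha>) = (\<lambda>y. if y \<in> Q then V (SOME z. z \<in> Om \<and> U z = y \<and> w z = \<alpha>) else y)"
proof -
  let ?f = "\<lambda>U V y. if y \<in> Q then V (SOME z. z \<in> Om \<and> U z = y \<and> w z = \<alpha>) else y"
  have inv: "?f V U (?f U V y) = y" if lat: "latin U V w" for U V y
  proof (cases "y \<in> Q")
    case True
    then obtain z where z: "z \<in> Om" "U z = y" "w z = \<alpha>" using latin_ex[OF lat True assms(2)] by blast
    have "?f U V y = V z" using pm_raw[OF that z(1,3)] z True by simp
    moreover have "V z \<in> Q" using that z by (auto simp: latin_def)
    moreover have "?f V U (V z) = U z" using pm_raw[OF latin_sym[OF that] z(1,3)] \<open>V z \<in> Q\<close> by simp
    ultimately show ?thesis using z by simp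
  qed simp
  have "bij (?f U V)"
    by (rule o_bij[of "?f V U"]) (use inv[OF assms(1)] inv[OF latin_sym[OF assms(1)]] in \<open>auto simp: fun_eq_iff\<close>)
  then show ?thesis unfolding pm_def by (simp add: Bij_inverse)
qed

lemma pm_apply: "latin U V w \<Longrightarrow> z \<in> Om \<Longrightarrow> bij_fun (pm U V w (w z)) (U z) = V z"
  using pm_raw[of U V w z "w z"] bij_fun_pm[of U V w "w z"] by (auto simp: latin_def)

lemma pm_outside: "latin U V w \<Longrightarrow> \<alpha> \<in> w ` Om \<Longrightarrow> y \<notin> Q \<Longrightarrow> bij_fun (pm U V w \<alpha>) y = y"
  by (simp add: bij_fun_pm)

text \<open>Sharply transitive sets of permutations of \<open>Q\<close>, extended by the identity.
  An inclusion between two such sets is an equality, which replaces comparison of cardinalities when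
  \<open>Q\<close> is infinite.\<close>

definition sharp :: "nat bijection set \<Rightarrow> bool" where
  "sharp S \<longleftrightarrow> (\<forall>g\<in>S. \<forall>y. y \<notin> Q \<longrightarrow> bij_fun g y = y) \<and> (\<forall>g\<in>S. \<forall>y\<in>Q. bij_fun g y \<in> Q)
     \<and> (\<forall>y\<in>Q. \<forall>y'\<in>Q. \<exists>g\<in>S. bij_fun g y = y')
     \<and> (\<forall>g\<in>S. \<forall>h\<in>S. \<forall>y\<in>Q. bij_fun g y = bij_fun h y \<longrightarrow> g = h)"

definition fam :: "('z \<Rightarrow> nat) \<Rightarrow> ('z \<Rightarrow> nat) \<Rightarrow> ('z \<Rightarrow> nat) \<Rightarrow> nat bijection set" where
  "fam U V w = pm U V w ` w ` Om"

lemma sharp_fam: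
  assumes l: "latin U V w"
  shows "sharp (fam U V w)"
  unfolding sharp_def
proof (intro conjI ballI allI impI)
  fix g y assume g: "g \<in> fam U V w"
  then obtain \<alpha> where \<alpha>: "\<alpha> \<in> w ` Om" "g = pm U V w \<alpha>" unfolding fam_def by blast
  show "bij_fun g y = y" if "y \<notin> Q" using pm_outside[OF l \<alpha>(1) that] \<alpha>(2) by simp
  show "bij_fun g y \<in> Q" if y: "y \<in> Q"
  proof -
    obtain z where "z \<in> Om" "U z = y" "w z = \<alpha>" using latin_ex[OF l y \<alpha>(1)] by blast
    then show ?thesis using pm_apply[OF l, of z] l \<alpha>(2) by (auto simp: latin_def)
  qed
next
  fix y y' assume "y \<in> Q" "y' \<in> Q"
  then have "y \<in> U ` Om" "y' \<in> V ` Om" using l by (simp_all add: latin_def)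
  then obtain z1 z2 where "z1 \<in> Om" "U z1 = y" "z2 \<in> Om" "V z2 = y'" by blast
  then obtain z where "z \<in> Om" "U z = y" "V z = y'" using l unfolding latin_def indep_def by metis
  then show "\<exists>g\<in>fam U V w. bij_fun g y = y'"
    using pm_apply[OF l, of z] unfolding fam_def by blast
next
  fix g h y assume g: "g \<in> fam U V w" "h \<in> fam U V w" and y: "y \<in> Q" and eq: "bij_fun g y = bij_fun h y"
  obtain \<alpha> where \<alpha>: "\<alpha> \<in> w ` Om" "g = pm U V w \<alpha>" using g unfolding fam_def by blast
  obtain \<beta> where \<beta>: "\<beta> \<in> w ` Om" "h = pm U V w \<beta>" using g unfolding fam_def by blast
  obtain z where z: "z \<in> Om" "U z = y" "w z = \<alpha>" using latin_ex[OF l y \<alpha>(1)] by blast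
  obtain z' where z': "z' \<in> Om" "U z' = y" "w z' = \<beta>" using latin_ex[OF l y \<beta>(1)] by blast
  have "V z = V z'" using pm_apply[OF l z(1)] pm_apply[OF l z'(1)] z z' eq \<alpha> \<beta> by simp
  then have "w z = w z'" using l z z' unfolding latin_def det_def by metis
  then show "g = h" using z z' \<alpha> \<beta> by simp
qed

lemma Q_nonempty: "Q \<noteq> {}"
  using coords(1) nonempty by auto

lemma sharp_subset: "sharp S \<Longrightarrow> sharp T \<Longrightarrow> S \<subseteq> T \<Longrightarrow> S = T"
proof
  assume *: "sharp S" "sharp T" "S \<subseteq> T"
  show "T \<subseteq> S"
  proof
    fix t assume t: "t \<in> T"
    obtain y where y: "y \<in> Q" using Q_nonempty by blast
    have "bij_fun t y \<in> Q" using *(2) t y unfolding sharp_def by blast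
    then obtain s where s: "s \<in> S" "bij_fun s y = bij_fun t y" using *(1) y unfolding sharp_def by metis
    then have "s = t" using *(2,3) t y unfolding sharp_def by blast
    then show "t \<in> S" using s by simp
  qed
qed

text \<open>By independence of the frame there is an outcome through any values of
  \<open>X3\<close>, \<open>X2\<close> and \<open>X1\<close>. Along two composable permutations it
  has the prescribed values of \<open>wa\<close> and \<open>wb\<close>, and these determine
  \<open>wc\<close>.\<close>

lemma fam_plus:
  assumes a: "latin X2 X1 wa" and b: "latin X3 X2 wb" and c: "latin X3 X1 wc"
    and det: "det wa wb wc"
  shows "fam X2 X1 wa + fam X3 X2 wb = fam X3 X1 wc"
proof -
  have *: "pm X2 X1 wa (wa z) + pm X3 X2 wb (wb z) = pm X3 X1 wc (wc z)" if z: "z \<in> Om" for z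
  proof (rule bijection_eqI)
    fix y
    show "bij_fun (pm X2 X1 wa (wa z) + pm X3 X2 wb (wb z)) y = bij_fun (pm X3 X1 wc (wc z)) y"
    proof (cases "y \<in> Q")
      case True
      obtain z1 where z1: "z1 \<in> Om" "X3 z1 = y" "wb z1 = wb z" using latin_ex[OF b True, of "wb z"] z by blast
      have "X2 z1 \<in> Q" using coords z1 by blast
      then obtain z2 where z2: "z2 \<in> Om" "X2 z2 = X2 z1" "wa z2 = wa z" using latin_ex[OF a _, of "X2 z1" "wa z"] z by blast
      obtain z3 where z3: "z3 \<in> Om" "X1 z3 = X1 z2" "X2 z3 = X2 z1" "X3 z3 = X3 z1"
        using joint[OF z2(1) z1(1) z1(1)] by blast
      have wb: "wb z3 = wb z" using b z1 z3 unfolding latin_def det_def by metis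
      have wa: "wa z3 = wa z" using a z2 z3 unfolding latin_def det_def by metis
      have wc: "wc z3 = wc z" using det z3(1) z wa wb unfolding det_def by blast
      have "bij_fun (pm X3 X2 wb (wb z)) y = X2 z3" using pm_apply[OF b z3(1)] wb z3 z1 by simp
      moreover have "bij_fun (pm X2 X1 wa (wa z)) (X2 z3) = X1 z3" using pm_apply[OF a z3(1)] wa by simp
      moreover have "bij_fun (pm X3 X1 wc (wc z)) y = X1 z3" using pm_apply[OF c z3(1)] wc z3 z1 by simp
      ultimately show ?thesis by (simp add: bij_fun_plus)
    next
      case False
      then show ?thesis using pm_outside[OF a _ False] pm_outside[OF b _ False] pm_outside[OF c _ False] z
        by (simp add: bij_fun_plus)
    qed
  qed
  show ?thesis
  proof
    show "fam X2 X1 wa + fam X3 X2 wb \<subseteq> fam X3 X1 wc"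
    proof
      fix g assume "g \<in> fam X2 X1 wa + fam X3 X2 wb"
      then obtain za zb where g: "za \<in> Om" "zb \<in> Om" "g = pm X2 X1 wa (wa za) + pm X3 X2 wb (wb zb)"
        unfolding set_plus_def fam_def by blast
      obtain z1 where z1: "z1 \<in> Om" "X2 z1 = X2 za" "wb z1 = wb zb"
        using b g unfolding latin_def indep_def by metis
      obtain z where z: "z \<in> Om" "X1 z = X1 za" "X2 z = X2 za" "X3 z = X3 z1"
        using joint[OF g(1) g(1) z1(1)] by blast
      have "wa z = wa za" using a g z unfolding latin_def det_def by metis
      moreover have "wb z = wb zb" using b z1 z unfolding latin_def det_def by metis
      ultimately have "g = pm X3 X1 wc (wc z)" using *[OF z(1)] g(3) by simp
      then show "g \<in> fam X3 X1 wc" unfolding fam_def using z by blast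
    qed
    show "fam X3 X1 wc \<subseteq> fam X2 X1 wa + fam X3 X2 wb"
    proof
      fix g assume "g \<in> fam X3 X1 wc"
      then obtain z where z: "z \<in> Om" "g = pm X3 X1 wc (wc z)" unfolding fam_def by blast
      show "g \<in> fam X2 X1 wa + fam X3 X2 wb"
        unfolding z(2) *[OF z(1), symmetric] by (rule set_plus_intro) (use z in \<open>auto simp: fam_def\<close>)
    qed
  qed
qed

text \<open>The element that takes \<open>k y\<close> back to \<open>y\<close>, composed with
  \<open>k\<close>, fixes \<open>y\<close>; by sharpness it then agrees with the identity.\<close>

lemma sharp_group:
  assumes "sharp K" "0 \<in> K" "K + K = K" "k \<in> K"
  shows "- k \<in> K"
proof -
  obtain y where y: "y \<in> Q" using Q_nonempty by blast
  have "bij_fun k y \<in> Q" using assms y unfolding sharp_def by blast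
  then obtain h where h: "h \<in> K" "bij_fun h (bij_fun k y) = y" using assms(1) y unfolding sharp_def by blast
  have "h + k \<in> K" using set_plus_intro[OF h(1) assms(4)] assms(3) by simp
  moreover have "bij_fun (h + k) y = bij_fun 0 y" using h by (simp add: bij_fun_plus bij_fun_zero)
  ultimately have "h + k = 0" using assms(1,2) y unfolding sharp_def by blast
  then have "h = - k" by (rule eq_neg_iff_add_eq_0[THEN iffD2])
  then show ?thesis using h by simp
qed

lemma sharp_coset:
  assumes K: "sharp K" and S: "sharp S" and g: "g \<in> S"
  shows "K + S = S \<Longrightarrow> S = K + {g}" "S + K = S \<Longrightarrow> S = {g} + K"
proof -
  have gQ: "bij_fun g y \<in> Q" if "y \<in> Q" for y using S g that unfolding sharp_def by blast
  obtain y where y: "y \<in> Q" using Q_nonempty by blast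
  show "S = K + {g}" if KS: "K + S = S"
  proof
    show "K + {g} \<subseteq> S" using set_plus_mono2[of K K "{g}" S] g KS by simp
    show "S \<subseteq> K + {g}"
    proof
      fix s assume s: "s \<in> S"
      then have "bij_fun s y \<in> Q" using S y unfolding sharp_def by blast
      then obtain k where k: "k \<in> K" "bij_fun k (bij_fun g y) = bij_fun s y"
        using K gQ[OF y] unfolding sharp_def by metis
      have "k + g \<in> S" using set_plus_intro[OF k(1) g] KS by simp
      then have "k + g = s" using S s y k(2) unfolding sharp_def by (metis bij_fun_plus)
      then show "s \<in> K + {g}" using k by (auto simp: set_plus_def)
    qed
  qed
  show "S = {g} + K" if SK: "S + K = S"
  proof
    show "{g} + K \<subseteq> S" using set_plus_mono2[of "{g}" S K K] g SK by simp
    show "S \<subseteq> {g} + K"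
    proof
      fix s assume s: "s \<in> S"
      then have sy: "bij_fun s y \<in> Q" using S y unfolding sharp_def by blast
      have "bij_fun (- g) (bij_fun s y) \<in> Q"
      proof (rule ccontr)
        assume n: "bij_fun (- g) (bij_fun s y) \<notin> Q"
        then have "bij_fun g (bij_fun (- g) (bij_fun s y)) = bij_fun (- g) (bij_fun s y)"
          using S g unfolding sharp_def by blast
        then show False using n sy by (simp add: bij_fun_uminus)
      qed
      then obtain k where k: "k \<in> K" "bij_fun k y = bij_fun (- g) (bij_fun s y)"
        using K y unfolding sharp_def by metis
      have "g + k \<in> S" using set_plus_intro[OF g k(1)] SK by simp
      moreover have "bij_fun (g + k) y = bij_fun s y" by (simp add: bij_fun_plus k(2) bij_fun_uminus)
      ultimately have "g + k = s" using S s y unfolding sharp_def by blast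
      then show "s \<in> {g} + K" using k by (auto simp: set_plus_def)
    qed
  qed
qed

end

lemma ennreal_scale_cancel:
  fixes a b :: ennreal
  assumes "0 < c" "ennreal c * a = ennreal c * b"
  shows "a = b"
  using assms by (simp add: ennreal_mult_cancel_left)

lemma ennreal_scale_finite:
  fixes a :: ennreal
  assumes "0 < c" "ennreal c * a = of_nat k"
  shows "a \<noteq> \<infinity>"
proof
  assume "a = \<infinity>"
  then have "ennreal c * a = \<infinity>" using assms(1) by (simp add: ennreal_mult_top)
  then show False using assms(2) by simp
qed

section \<open>Group relations on the support of an entropic representation\<close>

context gadget
begin

lemma frame_points: "JJ 0 \<in> points" "JJ 1 \<in> points" "JJ 2 \<in> points"
  by (rule pointsI)+

lemma not_coll_frame: "\<not> coll (JJ 0) (JJ 1) (JJ 2)"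
  unfolding coll_def unfolding lines_def line12_def line23_def line13_def by (auto dest!: abc_sides)

lemma coll_abc: "abc a b c \<Longrightarrow> coll a b c"
  unfolding coll_def unfolding lines_def by blast

lemma coll_perm: "coll p q r \<Longrightarrow> coll q p r" "coll p q r \<Longrightarrow> coll p r q" "coll p q r \<Longrightarrow> coll r q p"
  "coll p q r \<Longrightarrow> coll q r p" "coll p q r \<Longrightarrow> coll r p q"
  unfolding coll_def by blast+

lemma coll_lines:
  "coll (JJ 0) (JJ 1) (PA u)" "coll (JJ 1) (JJ 2) (PB u)" "coll (JJ 1) (JJ 2) (PD l)"
  "coll (JJ 0) (JJ 2) (PC u s)" "coll (JJ 0) (JJ 2) PX" "coll (JJ 0) (JJ 2) PY"
  unfolding coll_def unfolding lines_def line12_def line23_def line13_def by auto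

theorem entropic_imp_group:
  fixes M :: "'w measure" and X :: "nat \<Rightarrow> 'w \<Rightarrow> nat"
  assumes rep: "entropic_representation M X c E point_rank" and E: "finite E" "code ` points \<subseteq> E"
  shows "\<exists>\<phi> :: nat \<Rightarrow> nat bijection set bijection. (\<forall>x y z. R x y z \<longrightarrow> \<phi> x + \<phi> y = \<phi> z) \<and> \<phi> 2 \<noteq> 0"
proof -
  note [simp del] = One_nat_def
  have c: "0 < c" using rep by (simp add: entropic_representation_def)
  obtain \<pi> :: "(nat \<Rightarrow> nat) pmf" where \<pi>: "\<And>A. A \<subseteq> E \<Longrightarrow> of_nat (point_rank A) = ennreal c * pent \<pi> (\<lambda>z. restrict z A)"
    using entropic_pmf[OF rep E(1)] by blast
  define Om where "Om = set_pmf \<pi>"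
  define v where "v p z = z (code p)" for p and z :: "nat \<Rightarrow> nat"
  have pr: "point_rank (code ` S) = rk S" if "S \<subseteq> points" for S
  proof -
    have "{p \<in> points. code p \<in> code ` S} = S" using that inj_code by (auto dest: injD)
    then show ?thesis by (simp add: point_rank_def)
  qed
  have restr: "restrict z A = restrict z' A \<longleftrightarrow> (\<forall>a\<in>A. z a = z' a)" for z z' :: "nat \<Rightarrow> nat" and A
    by (auto simp: restrict_def fun_eq_iff)
  have H: "of_nat (rk S) = ennreal c * pent \<pi> g"
    if "S \<subseteq> points" "\<And>z z'. g z = g z' \<longleftrightarrow> (\<forall>p\<in>S. v p z = v p z')" for S and g :: "(nat \<Rightarrow> nat) \<Rightarrow> 'b"
  proof -
    have "pent \<pi> (\<lambda>z. restrict z (code ` S)) = pent \<pi> g"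
      by (rule pent_inj_image) (simp add: restr that(2) v_def)
    then show ?thesis using \<pi>[of "code ` S"] pr[OF that(1)] that(1) E(2) by auto
  qed
  have h1: "ennreal c * pent \<pi> (v p) = 1" if "p \<in> points" for p
    using H[of "{p}" "v p"] that by (simp add: rk_singleton)
  have h2: "ennreal c * pent \<pi> (\<lambda>z. (v p z, v q z)) = 2" if "p \<in> points" "q \<in> points" "p \<noteq> q" for p q
  proof -
    have "rk {p, q} = 2" by (rule rk_eq_2[of p _ q]) (use that in \<open>auto simp: coll_def\<close>)
    then show ?thesis using H[of "{p, q}" "\<lambda>z. (v p z, v q z)"] that by simp
  qed
  have h3: "ennreal c * pent \<pi> (\<lambda>z. ((v p z, v q z), v r z)) = of_nat (rk {p, q, r})"
    if "p \<in> points" "q \<in> points" "r \<in> points" for p q r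
    using H[of "{p, q, r}" "\<lambda>z. ((v p z, v q z), v r z)"] that by simp
  have det: "v r z = v r z'"
    if "p \<in> points" "q \<in> points" "r \<in> points" "p \<noteq> q" "coll p q r" "z \<in> Om" "z' \<in> Om" "v p z = v p z'" "v q z = v q z'" for p q r z z'
  proof -
    have "coll a b d" if "a \<in> {p, q, r}" "b \<in> {p, q, r}" "d \<in> {p, q, r}" for a b d
    proof (rule coll_trans[of p q])
      have "coll p q x" if "x \<in> {p, q, r}" for x using that \<open>coll p q r\<close> by (auto simp: coll_def)
      then show "coll p q a" "coll p q b" "coll p q d" using that by blast+
    qed fact
    then have "rk {p, q, r} = 2" by (intro rk_eq_2[of p _ q]) (use that in auto)
    then have e: "ennreal c * pent \<pi> (\<lambda>z. ((v p z, v q z), v r z)) = 2" using h3[of p q r] that by simp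
    show ?thesis
    proof (rule pent_determined_support[of \<pi> "\<lambda>z. (v p z, v q z)" "v r"])
      show "pent \<pi> (\<lambda>z. ((v p z, v q z), v r z)) = pent \<pi> (\<lambda>z. (v p z, v q z))"
        by (rule ennreal_scale_cancel[OF c]) (simp add: e h2 that)
      show "pent \<pi> (\<lambda>z. (v p z, v q z)) \<noteq> \<infinity>"
        by (rule ennreal_scale_finite[OF c, of _ 2]) (simp add: h2 that)
    qed (use that in \<open>auto simp: Om_def\<close>)
  qed
  have indep: "\<exists>z\<in>Om. v p z = v p z1 \<and> v q z = v q z2"
    if "p \<in> points" "q \<in> points" "p \<noteq> q" "z1 \<in> Om" "z2 \<in> Om" for p q z1 z2
  proof -
    have "pent \<pi> (\<lambda>z. (v p z, v q z)) = pent \<pi> (v p) + pent \<pi> (v q)"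
      by (rule ennreal_scale_cancel[OF c]) (simp add: h1 h2 that distrib_left)
    moreover have "pent \<pi> (\<lambda>z. (v p z, v q z)) \<noteq> \<infinity>"
      by (rule ennreal_scale_finite[OF c, of _ 2]) (simp add: h2 that)
    ultimately show ?thesis using pent_independent_support[of \<pi> "v p" "v q" z1 z2] that(4,5) by (simp add: Om_def)
  qed
  have indep3: "\<exists>z\<in>Om. v (JJ 0) z = v (JJ 0) z1 \<and> v (JJ 1) z = v (JJ 1) z2 \<and> v (JJ 2) z = v (JJ 2) z3"
    if zs: "z1 \<in> Om" "z2 \<in> Om" "z3 \<in> Om" for z1 z2 z3
  proof -
    have "rk {JJ 0, JJ 1, JJ 2} = 3" by (rule rk_eq_3[OF _ _ _ not_coll_frame]) auto
    then have e: "ennreal c * pent \<pi> (\<lambda>z. ((v (JJ 0) z, v (JJ 1) z), v (JJ 2) z)) = 3"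
      using h3[OF frame_points] by simp
    obtain z12 where z12: "z12 \<in> Om" "v (JJ 0) z12 = v (JJ 0) z1" "v (JJ 1) z12 = v (JJ 1) z2"
      using indep[of "JJ 0" "JJ 1" z1 z2] frame_points zs by auto
    have "pent \<pi> (\<lambda>z. ((v (JJ 0) z, v (JJ 1) z), v (JJ 2) z)) = pent \<pi> (\<lambda>z. (v (JJ 0) z, v (JJ 1) z)) + pent \<pi> (v (JJ 2))"
      by (rule ennreal_scale_cancel[OF c]) (simp add: h1 h2 e frame_points distrib_left)
    moreover have "pent \<pi> (\<lambda>z. ((v (JJ 0) z, v (JJ 1) z), v (JJ 2) z)) \<noteq> \<infinity>"
      by (rule ennreal_scale_finite[OF c, of _ 3]) (simp add: e)
    ultimately show ?thesis
      using pent_independent_support[of \<pi> "\<lambda>z. (v (JJ 0) z, v (JJ 1) z)" "v (JJ 2)" z12 z3] zs z12 by (auto simp: Om_def)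
  qed
  have idx0: "index 0" "scalar 0" using scalarI(1) indexI(1) by auto
  have AB0: "PA 0 \<in> points" "PB 0 \<in> points" using pointsI(6,7) idx0 by auto
  obtain z0 where z0: "z0 \<in> Om" using set_pmf_not_empty[of \<pi>] unfolding Om_def by blast
  define Q where "Q = v (JJ 1) ` Om"
  \<comment> \<open>The values of \<open>JJ 0\<close> and \<open>JJ 2\<close> are relabelled by
    values of \<open>JJ 1\<close> through the points \<open>PA 0\<close> and \<open>PB 0\<close>,
    held at their values in a reference outcome \<open>z0\<close>. In these coordinates the families
    of \<open>PA 0\<close> and \<open>PB 0\<close> contain the identity.\<close>
  define n1 where "n1 z = (SOME z'. z' \<in> Om \<and> v (JJ 0) z' = v (JJ 0) z \<and> v (PA 0) z' = v (PA 0) z0)" for z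
  define n3 where "n3 z = (SOME z'. z' \<in> Om \<and> v (JJ 2) z' = v (JJ 2) z \<and> v (PB 0) z' = v (PB 0) z0)" for z
  define X1 where "X1 z = v (JJ 1) (n1 z)" for z
  define X3 where "X3 z = v (JJ 1) (n3 z)" for z
  have n1: "n1 z \<in> Om \<and> v (JJ 0) (n1 z) = v (JJ 0) z \<and> v (PA 0) (n1 z) = v (PA 0) z0" if "z \<in> Om" for z
    unfolding n1_def by (rule someI_ex[of "\<lambda>z'. z' \<in> Om \<and> v (JJ 0) z' = v (JJ 0) z \<and> v (PA 0) z' = v (PA 0) z0"]) (use indep[of "JJ 0" "PA 0" z z0] frame_points AB0 that z0 in auto)
  have n3: "n3 z \<in> Om \<and> v (JJ 2) (n3 z) = v (JJ 2) z \<and> v (PB 0) (n3 z) = v (PB 0) z0" if "z \<in> Om" for z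
    unfolding n3_def by (rule someI_ex[of "\<lambda>z'. z' \<in> Om \<and> v (JJ 2) z' = v (JJ 2) z \<and> v (PB 0) z' = v (PB 0) z0"]) (use indep[of "JJ 2" "PB 0" z z0] frame_points AB0 that z0 in auto)
  note dA = det[of "JJ 0" "PA 0" "JJ 1"] det[of "JJ 1" "PA 0" "JJ 0"]
  note dB = det[of "JJ 2" "PB 0" "JJ 1"] det[of "JJ 1" "PB 0" "JJ 2"]
  note cl = coll_lines coll_lines[THEN coll_perm(1)] coll_lines[THEN coll_perm(2)] coll_lines[THEN coll_perm(3)]
     coll_lines[THEN coll_perm(4)] coll_lines[THEN coll_perm(5)]
  have X1_unit: "X1 z = v (JJ 1) z" if "z \<in> Om" "v (PA 0) z = v (PA 0) z0" for z
    unfolding X1_def by (rule dA(1)) (use n1[OF that(1)] that frame_points AB0 cl in auto)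
  have X3_unit: "X3 z = v (JJ 1) z" if "z \<in> Om" "v (PB 0) z = v (PB 0) z0" for z
    unfolding X3_def by (rule dB(1)) (use n3[OF that(1)] that frame_points AB0 cl in auto)
  have X1_iff: "X1 z = X1 z' \<longleftrightarrow> v (JJ 0) z = v (JJ 0) z'" if "z \<in> Om" "z' \<in> Om" for z z'
  proof
    assume "v (JJ 0) z = v (JJ 0) z'"
    then show "X1 z = X1 z'" by (simp add: X1_def n1_def)
  next
    assume "X1 z = X1 z'"
    then have "v (JJ 0) (n1 z) = v (JJ 0) (n1 z')"
      unfolding X1_def by (intro dA(2)) (use n1 that frame_points AB0 cl in auto)
    then show "v (JJ 0) z = v (JJ 0) z'" using n1 that by metis
  qed
  have X3_iff: "X3 z = X3 z' \<longleftrightarrow> v (JJ 2) z = v (JJ 2) z'" if "z \<in> Om" "z' \<in> Om" for z z'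
  proof
    assume "v (JJ 2) z = v (JJ 2) z'"
    then show "X3 z = X3 z'" by (simp add: X3_def n3_def)
  next
    assume "X3 z = X3 z'"
    then have "v (JJ 2) (n3 z) = v (JJ 2) (n3 z')"
      unfolding X3_def by (intro dB(2)) (use n3 that frame_points AB0 cl in auto)
    then show "v (JJ 2) z = v (JJ 2) z'" using n3 that by metis
  qed
  have X1_Q: "X1 ` Om = Q"
  proof
    show "X1 ` Om \<subseteq> Q" using n1 by (auto simp: X1_def Q_def)
    show "Q \<subseteq> X1 ` Om"
    proof
      fix y assume "y \<in> Q"
      then obtain z where z: "z \<in> Om" "y = v (JJ 1) z" by (auto simp: Q_def)
      obtain z' where "z' \<in> Om" "v (JJ 1) z' = v (JJ 1) z" "v (PA 0) z' = v (PA 0) z0"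
        using indep[of "JJ 1" "PA 0" z z0] frame_points AB0 z z0 by auto
      then show "y \<in> X1 ` Om" using X1_unit z by (metis imageI)
    qed
  qed
  have X3_Q: "X3 ` Om = Q"
  proof
    show "X3 ` Om \<subseteq> Q" using n3 by (auto simp: X3_def Q_def)
    show "Q \<subseteq> X3 ` Om"
    proof
      fix y assume "y \<in> Q"
      then obtain z where z: "z \<in> Om" "y = v (JJ 1) z" by (auto simp: Q_def)
      obtain z' where "z' \<in> Om" "v (JJ 1) z' = v (JJ 1) z" "v (PB 0) z' = v (PB 0) z0"
        using indep[of "JJ 1" "PB 0" z z0] frame_points AB0 z z0 by auto
      then show "y \<in> X3 ` Om" using X3_unit z by (metis imageI)
    qed
  qed
  define X2 where "X2 = v (JJ 1)"
  interpret F: latin_frame Om Q X1 X2 X3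
  proof
    show "X1 ` Om = Q" "X3 ` Om = Q" by fact+
    show "X2 ` Om = Q" by (simp add: Q_def X2_def)
    show "Om \<noteq> {}" using z0 by auto
    fix z1 z2 z3 assume "z1 \<in> Om" "z2 \<in> Om" "z3 \<in> Om"
    then show "\<exists>z\<in>Om. X1 z = X1 z1 \<and> X2 z = X2 z2 \<and> X3 z = X3 z3"
      using indep3[of z1 z2 z3] X1_iff X3_iff unfolding X2_def by metis
  qed
  have latin: "F.latin U V (v p)"
    if UV: "U ` Om = Q" "V ` Om = Q" and pts: "P1 \<in> points" "P2 \<in> points" "p \<in> points"
      and ne: "P1 \<noteq> P2" "p \<noteq> P1" "p \<noteq> P2" and cll: "coll P1 P2 p"
      and U: "\<And>z z'. z \<in> Om \<Longrightarrow> z' \<in> Om \<Longrightarrow> U z = U z' \<longleftrightarrow> v P1 z = v P1 z'"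
      and V: "\<And>z z'. z \<in> Om \<Longrightarrow> z' \<in> Om \<Longrightarrow> V z = V z' \<longleftrightarrow> v P2 z = v P2 z'"
    for U V P1 P2 p
    unfolding F.latin_def
  proof (intro conjI UV)
    note perms = cll coll_perm(1)[OF cll] coll_perm(2)[OF cll] coll_perm(3)[OF cll] coll_perm(4)[OF cll] coll_perm(5)[OF cll]
    show "F.det U (v p) V" unfolding F.det_def
      using det[of P1 p P2] pts ne perms U V by metis
    show "F.det V (v p) U" unfolding F.det_def
      using det[of P2 p P1] pts ne perms U V by metis
    show "F.det U V (v p)" unfolding F.det_def
      using det[of P1 P2 p] pts ne perms U V by metis
    show "F.indep U (v p)" unfolding F.indep_def
      using indep[of P1 p] pts ne U by metis
    show "F.indep V (v p)" unfolding F.indep_def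
      using indep[of P2 p] pts ne V by metis
    show "F.indep U V" unfolding F.indep_def
      using indep[of P1 P2] pts ne U V by metis
  qed
  have LA: "F.latin X2 X1 (v (PA u))" if "PA u \<in> points" for u
    by (rule latin[of _ _ "JJ 1" "JJ 0"]) (use X1_iff X1_Q cl frame_points that in \<open>auto simp: X2_def Q_def\<close>)
  have LB: "F.latin X3 X2 (v (PB u))" if "PB u \<in> points" for u
    by (rule latin[of _ _ "JJ 2" "JJ 1"]) (use X3_iff X3_Q cl frame_points that in \<open>auto simp: X2_def Q_def\<close>)
  have LD: "F.latin X3 X2 (v (PD u))" if "PD u \<in> points" for u
    by (rule latin[of _ _ "JJ 2" "JJ 1"]) (use X3_iff X3_Q cl frame_points that in \<open>auto simp: X2_def Q_def\<close>)
  have LC: "F.latin X3 X1 (v p)" if "p \<in> points" "p \<in> {PX, PY} \<union> range (\<lambda>(u, s). PC u s)" for p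
    by (rule latin[of _ _ "JJ 2" "JJ 0"]) (use X1_iff X3_iff X1_Q X3_Q cl frame_points that in \<open>auto simp: Q_def\<close>)
  define fA where "fA p = F.fam X2 X1 (v p)" for p
  define fB where "fB p = F.fam X3 X2 (v p)" for p
  define fC where "fC p = F.fam X3 X1 (v p)" for p
  have plus: "fA a + fB b = fC cc" if "abc a b cc" for a b cc
  proof -
    have pts: "a \<in> points" "b \<in> points" "cc \<in> points" using abc_points[OF that] by auto
    have s: "a \<in> range PA" "b \<in> range PB \<union> range PD" "cc \<in> range (\<lambda>(u, s). PC u s) \<union> {PX, PY}"
      using abc_sides[OF that] by auto
    have "a \<noteq> b" using s by auto
    then have "F.det (v a) (v b) (v cc)"
      unfolding F.det_def using det[of a b cc] pts coll_abc[OF that] by blast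
    then show ?thesis
      unfolding fA_def fB_def fC_def
      by (intro F.fam_plus) (use pts s LA LB LD LC in auto)
  qed
  have shA: "F.sharp (fA (PA u))" if "index u" for u unfolding fA_def by (rule F.sharp_fam[OF LA]) (rule pointsI(6)[OF that])
  have shB: "F.sharp (fB (PB u))" if "index u" for u unfolding fB_def by (rule F.sharp_fam[OF LB]) (rule pointsI(7)[OF that])
  have shD: "F.sharp (fB (PD (triple_code x y z)))" if "R x y z" for x y z
    unfolding fB_def by (rule F.sharp_fam[OF LD]) (rule pointsI(8)[OF that])
  have shC: "F.sharp (fC (PC u s))" if "scalar u" "s < n" for u s
    unfolding fC_def by (rule F.sharp_fam[OF LC]) (use pointsI(9)[OF that] in auto)
  define K where "K = fA (PA 0)"
  have unitA: "0 \<in> K"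
  proof -
    have "F.pm X2 X1 (v (PA 0)) (v (PA 0) z0) = 0"
    proof (rule bijection_eqI)
      fix y show "bij_fun (F.pm X2 X1 (v (PA 0)) (v (PA 0) z0)) y = bij_fun 0 y"
      proof (cases "y \<in> Q")
        case True
        then obtain z where z: "z \<in> Om" "X2 z = y" "v (PA 0) z = v (PA 0) z0"
          using F.latin_ex[OF LA[OF AB0(1)] True, of "v (PA 0) z0"] z0 by blast
        then show ?thesis using F.pm_apply[OF LA[OF AB0(1)] z(1)] X1_unit[OF z(1,3)] by (simp add: bij_fun_zero X2_def)
      qed (use F.pm_outside[OF LA[OF AB0(1)]] z0 in \<open>simp add: bij_fun_zero\<close>)
    qed
    then show ?thesis unfolding K_def fA_def F.fam_def using z0 by (metis imageI)
  qed
  have unitB: "0 \<in> fB (PB 0)"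
  proof -
    have "F.pm X3 X2 (v (PB 0)) (v (PB 0) z0) = 0"
    proof (rule bijection_eqI)
      fix y show "bij_fun (F.pm X3 X2 (v (PB 0)) (v (PB 0) z0)) y = bij_fun 0 y"
      proof (cases "y \<in> Q")
        case True
        then obtain z where z: "z \<in> Om" "X3 z = y" "v (PB 0) z = v (PB 0) z0"
          using F.latin_ex[OF LB[OF AB0(2)] True, of "v (PB 0) z0"] z0 by blast
        then show ?thesis using F.pm_apply[OF LB[OF AB0(2)] z(1)] X3_unit[OF z(1,3)] by (simp add: bij_fun_zero X2_def)
      qed (use F.pm_outside[OF LB[OF AB0(2)]] z0 in \<open>simp add: bij_fun_zero\<close>)
    qed
    then show ?thesis unfolding fB_def F.fam_def using z0 by (metis imageI)
  qed
  have left: "S \<subseteq> T" if "0 \<in> L" "L + S = T" for L S T :: "nat bijection set"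
    using that by (force simp: set_plus_def)
  have right: "S \<subseteq> T" if "0 \<in> L" "S + L = T" for L S T :: "nat bijection set"
    using that by (force simp: set_plus_def)
  have n0: "0 < n" using n_gt by simp
  have p00: "K + fB (PB 0) = fC (PC 0 0)" using plus[OF ab1[OF idx0(2) n0]] by (simp add: K_def)
  have shK: "F.sharp K" unfolding K_def by (rule shA[OF idx0(1)])
  \<comment> \<open>The identity in one factor gives an inclusion, and sharpness turns it into an
    equality. So the three frame lines carry the same family at index 0, closed under composition;
    the same trick below identifies the copies of every symbol and scalar.\<close>
  have K_C: "K = fC (PC 0 0)" by (rule F.sharp_subset[OF shK shC[OF idx0(2) n0] right[OF unitB p00]])
  have B_C: "fB (PB 0) = fC (PC 0 0)" by (rule F.sharp_subset[OF shB[OF idx0(1)] shC[OF idx0(2) n0] left[OF unitA p00]])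
  have KB: "fB (PB 0) = K" using K_C B_C by simp
  have KK: "K + K = K" using p00 K_C B_C by simp
  define G where "G s = fA (PA (2 * s))" for s
  have AC: "fA (PA (2 * s)) = fC (PC 0 s) \<and> fB (PB (2 * s)) = fC (PC 0 s) \<and> K + G s = G s \<and> G s + K = G s" if s: "s < n" for s
  proof -
    have 1: "K + fB (PB (2 * s)) = fC (PC 0 s)" using plus[OF ab1[OF idx0(2) s]] by (simp add: K_def)
    have 2: "G s + K = fC (PC 0 s)" using plus[OF ab2[OF idx0(2) s]] KB by (simp add: G_def)
    have B: "fB (PB (2 * s)) = fC (PC 0 s)"
      by (rule F.sharp_subset[OF shB[OF indexI(2)[OF s]] shC[OF idx0(2) s] left[OF unitA 1]])
    have A: "G s = fC (PC 0 s)"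
      unfolding G_def by (rule F.sharp_subset[OF shA[OF indexI(2)[OF s]] shC[OF idx0(2) s] right[OF unitA 2[unfolded G_def]]])
    show ?thesis using 1 2 A B by (simp add: G_def)
  qed
  have ZC: "fA (PA u) = fC (PC u 0) \<and> fB (PB u) = fC (PC u 0) \<and> K + fA (PA u) = fA (PA u) \<and> fA (PA u) + K = fA (PA u)"
    if u: "scalar u" for u
  proof -
    have 1: "K + fB (PB u) = fC (PC u 0)" using plus[OF ab2[OF u n0]] by (simp add: K_def)
    have 2: "fA (PA u) + K = fC (PC u 0)" using plus[OF ab1[OF u n0]] KB by simp
    have B: "fB (PB u) = fC (PC u 0)"
      by (rule F.sharp_subset[OF shB[OF indexI(1)[OF u]] shC[OF u n0] left[OF unitA 1]])
    have A: "fA (PA u) = fC (PC u 0)"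
      by (rule F.sharp_subset[OF shA[OF indexI(1)[OF u]] shC[OF u n0] right[OF unitA 2]])
    show ?thesis using 1 2 A B by simp
  qed
  have ex: "\<exists>g. S = {g} + K \<and> S = K + {g}" if Ssh: "F.sharp S" "K + S = S" "S + K = S" for S
  proof -
    obtain y where "y \<in> Q" using F.Q_nonempty by blast
    then obtain g where "g \<in> S" using Ssh(1) unfolding F.sharp_def by blast
    then show ?thesis using F.sharp_coset[OF shK Ssh(1)] Ssh(2,3) by blast
  qed
  obtain g where g: "\<And>s. s < n \<Longrightarrow> G s = {g s} + K \<and> G s = K + {g s}"
  proof -
    have "\<forall>s. \<exists>g. s < n \<longrightarrow> G s = {g} + K \<and> G s = K + {g}"
      using ex[OF shA[OF indexI(2)]] AC unfolding G_def by blast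
    then show thesis using that by metis
  qed
  obtain d where d: "\<And>u. scalar u \<Longrightarrow> fA (PA u) = {d u} + K \<and> fA (PA u) = K + {d u}"
  proof -
    have "\<forall>u. \<exists>d. scalar u \<longrightarrow> fA (PA u) = {d} + K \<and> fA (PA u) = K + {d}"
      using ex[OF shA[OF indexI(1)]] ZC by blast
    then show thesis using that by metis
  qed
  \<comment> \<open>Both products are the family of the single point \<open>PC u s\<close>; this is
    how the geometry expresses that scalars are central.\<close>
  have comm: "fA (PA u) + G s = fC (PC u s) \<and> G s + fA (PA u) = fC (PC u s)" if u: "scalar u" and s: "s < n" for u s
    using plus[OF ab1[OF u s]] plus[OF ab2[OF u s]] AC[OF s] ZC[OF u] by (simp add: G_def)
  \<comment> \<open>With equal families, a permutation belonging to a value of \<open>PX\<close>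
    also belongs to a value of \<open>PY\<close>, so the former value determines the latter. As
    \<open>PX\<close> and \<open>PY\<close> are independent, \<open>PY\<close> would be constant,
    against its rank 1.\<close>
  have X_neq_Y: "fC PX \<noteq> fC PY"
  proof
    assume eq: "fC PX = fC PY"
    have P: "PX \<in> points" "PY \<in> points" using pointsI(4,5) by auto
    have LX: "F.latin X3 X1 (v PX)" "F.latin X3 X1 (v PY)" using LC P by auto
    have "F.pm X3 X1 (v PX) (v PX z0) \<in> fC PX" unfolding fC_def F.fam_def using z0 by auto
    then have "F.pm X3 X1 (v PX) (v PX z0) \<in> fC PY" by (simp only: eq)
    then obtain z1 where z1: "z1 \<in> Om" "F.pm X3 X1 (v PX) (v PX z0) = F.pm X3 X1 (v PY) (v PY z1)"
      unfolding fC_def F.fam_def by auto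
    have same: "v PY z = v PY z1" if z: "z \<in> Om" "v PX z = v PX z0" for z
    proof -
      have zQ: "X3 z \<in> Q" using X3_Q z(1) by blast
      obtain z' where z': "z' \<in> Om" "X3 z' = X3 z" "v PY z' = v PY z1"
        using F.latin_ex[OF LX(2) zQ, of "v PY z1"] z1(1) by blast
      have "X1 z' = X1 z" using F.pm_apply[OF LX(1) z(1)] F.pm_apply[OF LX(2) z'(1)] z z' z1 by simp
      then have "v PY z = v PY z'" using LX(2) z z' unfolding F.latin_def F.det_def by metis
      then show ?thesis using z' by simp
    qed
    have const: "v PY z = v PY z1" if "z \<in> Om" for z
      using indep[OF P _ z0 that] same by auto
    have "v PY z \<in> {v PY z1}" if "z \<in> set_pmf \<pi>" for z using const that by (simp add: Om_def)
    then have "map_pmf (v PY) \<pi> = return_pmf (v PY z1)"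
      by (metis (no_types, lifting) map_pmf_const map_pmf_cong singletonD)
    then have "pent \<pi> (v PY) = (\<integral>\<^sup>+z. ennreal (- ln (indicator {v PY z} (v PY z1))) \<partial>measure_pmf \<pi>)"
      by (simp add: pent_def)
    also have "\<dots> = (\<integral>\<^sup>+z. 0 \<partial>measure_pmf \<pi>)"
      by (rule nn_integral_cong_AE) (use const in \<open>simp add: AE_measure_pmf_iff Om_def\<close>)
    finally show False using h1[OF P(2)] by simp
  qed
  show ?thesis
  proof (rule central_quotient[where K = K and G = G and Z = "\<lambda>u. fA (PA u)" and g = g and c = d and scalar = scalar and n = n])
    show "K + K = K" "0 \<in> K" by fact+
    show "- k \<in> K" if "k \<in> K" for k by (rule F.sharp_group[OF shK unitA KK that])
    show "G s = {g s} + K \<and> G s = K + {g s}" if "s < n" for s by (rule g[OF that])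
    show "fA (PA u) = {d u} + K \<and> fA (PA u) = K + {d u}" if "scalar u" for u by (rule d[OF that])
    show "fA (PA u) + G s = G s + fA (PA u)" if "scalar u" "s < n" for u s using comm[OF that] by simp
    show "2 < n" by (rule n_gt)
    have n1: "1 < n" using n_gt by simp
    have "G 1 + G 2 = fC PX" using plus[OF px] AC[OF n_gt] by (simp add: G_def)
    moreover have "G 2 + G 1 = fC PY" using plus[OF py] AC[OF n1] by (simp add: G_def)
    ultimately show "G 1 + G 2 \<noteq> G 2 + G 1" using X_neq_Y by simp
    fix x y z assume R: "R x y z"
    let ?\<kappa> = "4 * triple_code x y z + 1" and ?\<sigma> = "4 * triple_code x y z + 3"
    have xyz: "x < n" "y < n" "z < n" using R_less[OF R] by auto
    have s: "scalar ?\<kappa>" "scalar ?\<sigma>" using scalarI(2,3)[OF R] by auto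
    let ?D = "fB (PD (triple_code x y z))"
    have 1: "K + ?D = fC (PC ?\<kappa> y)" using plus[OF d1[OF R]] by (simp add: K_def)
    have "?D = fC (PC ?\<kappa> y)" by (rule F.sharp_subset[OF shD[OF R] shC[OF s(1) xyz(2)] left[OF unitA 1]])
    then have "?D = fA (PA ?\<kappa>) + G y" using comm[OF s(1) xyz(2)] by simp
    moreover have "G x + ?D = fA (PA ?\<sigma>) + G z" using plus[OF d2[OF R]] comm[OF s(2) xyz(3)] by (simp add: G_def)
    ultimately have "G x + (fA (PA ?\<kappa>) + G y) = fA (PA ?\<sigma>) + G z" by simp
    then show "x < n \<and> y < n \<and> z < n \<and> (\<exists>u v. scalar u \<and> scalar v \<and> G x + (fA (PA u) + G y) = fA (PA v) + G z)"
      using xyz s by blast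
  qed
qed

end

section \<open>From groups to entropic representations\<close>

text \<open>The lowest digit is divisible by 16 and smaller than 16 in absolute value. The digits to
  come are combinations of up to three entries bounded by 3.\<close>

lemma base_expansion_zero:
  fixes v :: "nat \<Rightarrow> int"
  assumes "\<And>j. \<bar>v j\<bar> \<le> 15" "(\<Sum>j<m. v j * 16 ^ j) = 0" "j < m"
  shows "v j = 0"
  using assms
proof (induction m arbitrary: v j)
  case (Suc m)
  have "(\<Sum>j<Suc m. v j * 16 ^ j) = v 0 + 16 * (\<Sum>j<m. v (Suc j) * 16 ^ j)"
    by (subst sum.lessThan_Suc_shift) (simp add: sum_distrib_left mult_ac)
  then have eq: "v 0 + 16 * (\<Sum>j<m. v (Suc j) * 16 ^ j) = 0" using Suc.prems(2) by simp
  then have "v 0 = 0" using Suc.prems(1)[of 0] by presburger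
  moreover from this eq have "(\<Sum>j<m. v (Suc j) * 16 ^ j) = 0" by simp
  then have "v (Suc i) = 0" if "i < m" for i using Suc.IH[of "\<lambda>j. v (Suc j)" i] Suc.prems(1) that by blast
  ultimately show ?case using Suc.prems(3) by (cases j) simp_all
qed simp

lemma funpow_return:
  assumes "finite A" "bij_betw \<rho> A A" "c \<in> A"
  shows "\<exists>k. 0 < k \<and> k \<le> card A \<and> (\<rho> ^^ k) c = c"
proof -
  have mem: "(\<rho> ^^ i) c \<in> A" for i
    by (induction i) (use assms in \<open>auto simp: bij_betw_def\<close>)
  have "\<not> inj_on (\<lambda>i. (\<rho> ^^ i) c) {..card A}"
  proof
    assume "inj_on (\<lambda>i. (\<rho> ^^ i) c) {..card A}"
    then have "card {..card A} \<le> card A" using mem by (intro card_inj_on_le assms) auto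
    then show False by simp
  qed
  then obtain i j where ij: "i < j" "j \<le> card A" "(\<rho> ^^ i) c = (\<rho> ^^ j) c"
    unfolding inj_on_def by (metis atMost_iff linorder_neqE_nat)
  have inj: "x = y" if "(\<rho> ^^ i) x = (\<rho> ^^ i) y" "x \<in> A" "y \<in> A" for x y
    using that
  proof (induction i)
    case (Suc i)
    have "(\<rho> ^^ i) x \<in> A" if "x \<in> A" for x
      by (induction i) (use assms(2) that in \<open>auto simp: bij_betw_def\<close>)
    then show ?case using Suc assms(2) by (auto simp: bij_betw_def dest: inj_onD)
  qed simp
  have "(\<rho> ^^ i) c = (\<rho> ^^ i) ((\<rho> ^^ (j - i)) c)"
    using ij by (metis add_diff_inverse_nat comp_apply funpow_add not_less_iff_gr_or_eq)
  then have "(\<rho> ^^ (j - i)) c = c" using inj[of c "(\<rho> ^^ (j - i)) c"] mem assms(3) by simp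
  then show ?thesis using ij by (intro exI[of _ "j - i"]) auto
qed

text \<open>Squaring removes the signs. Along the permutation \<open>\<rho>\<close>, which carries
  \<open>\<tau> b\<close> to \<open>\<tau>' b\<close>, the squares then change by a fixed power of
  2, so on a cycle of length \<open>k\<close> a factor \<open>2 ^ (2 * d * k)\<close> must act as 1
  on \<open>f c ^ 2\<close>. The bound on \<open>p\<close>, with 2 from squaring, \<open>D\<close>
  for the weights and \<open>card \<Omega>\<close> for the cycle, keeps this factor different from 1
  modulo \<open>p\<close>.\<close>

lemma weighted_fixed_zero:
  fixes p :: int and f :: "'b \<Rightarrow> int"
  assumes p: "prime p" "2 ^ (2 * D * card \<Omega>) < p" "p \<noteq> 2" and \<Omega>: "finite \<Omega>"
    and \<tau>: "bij_betw \<tau> \<Omega> \<Omega>" "bij_betw \<tau>' \<Omega> \<Omega>"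
    and sg: "\<And>b. b \<in> \<Omega> \<Longrightarrow> sg b ^ 2 = 1" "\<And>b. b \<in> \<Omega> \<Longrightarrow> sg' b ^ 2 = 1"
    and w: "w < w'" "w' \<le> D"
    and eq: "\<And>b. b \<in> \<Omega> \<Longrightarrow> [2 ^ w * sg b * f (\<tau> b) = 2 ^ w' * sg' b * f (\<tau>' b)] (mod p)"
    and c: "c \<in> \<Omega>"
  shows "[f c = 0] (mod p)"
proof -
  define \<rho> where "\<rho> c = \<tau>' (inv_into \<Omega> \<tau> c)" for c
  have inv: "bij_betw (inv_into \<Omega> \<tau>) \<Omega> \<Omega>" using \<tau>(1) by (rule bij_betw_inv_into)
  have "bij_betw (\<tau>' \<circ> inv_into \<Omega> \<tau>) \<Omega> \<Omega>" by (rule bij_betw_trans[OF inv \<tau>(2)])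
  then have \<rho>: "bij_betw \<rho> \<Omega> \<Omega>" unfolding \<rho>_def comp_def .
  define d where "d = w' - w"
  have "odd p" using p(1,3) prime_ge_2_int[OF p(1)] by (intro prime_odd_int) auto
  then have cop: "coprime (2 ^ i :: int) p" for i by simp
  have step: "[f c ^ 2 = 2 ^ (2 * d) * f (\<rho> c) ^ 2] (mod p)" if "c \<in> \<Omega>" for c
  proof -
    define b where "b = inv_into \<Omega> \<tau> c"
    have b: "b \<in> \<Omega>" "\<tau> b = c" "\<rho> c = \<tau>' b"
      using inv that \<tau>(1) by (auto simp: b_def \<rho>_def bij_betw_def f_inv_into_f)
    have *: "[(2 ^ w * sg b * f (\<tau> b)) ^ 2 = (2 ^ w' * sg' b * f (\<tau>' b)) ^ 2] (mod p)"
      by (rule cong_pow[OF eq[OF b(1)]])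
    have "[2 ^ (2 * w) * f c ^ 2 = 2 ^ (2 * w) * (2 ^ (2 * d) * f (\<rho> c) ^ 2)] (mod p)"
    proof -
      have w': "2 * w' = 2 * w + 2 * d" using w(1) by (simp add: d_def)
      have "(2 ^ w * sg b * f (\<tau> b)) ^ 2 = 2 ^ (2 * w) * f c ^ 2"
        using sg(1)[OF b(1)] b(2) by (simp only: power_mult_distrib power_mult[symmetric] mult.commute[of w] mult_1_right)
      moreover have "(2 ^ w' * sg' b * f (\<tau>' b)) ^ 2 = 2 ^ (2 * w) * (2 ^ (2 * d) * f (\<rho> c) ^ 2)"
        using sg(2)[OF b(1)] b(3) w' by (simp only: power_mult_distrib power_mult[symmetric] mult.commute[of w'] mult_1_right power_add mult.assoc)
      ultimately show ?thesis using *  by simp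
    qed
    then show ?thesis using cop[of "2 * w"] by (simp add: cong_mult_lcancel)
  qed
  have iter: "[f c ^ 2 = 2 ^ (2 * d * k) * f ((\<rho> ^^ k) c) ^ 2] (mod p)" for k
  proof (induction k)
    case (Suc k)
    have "(\<rho> ^^ k) c \<in> \<Omega>" by (induction k) (use \<rho> c in \<open>auto simp: bij_betw_def\<close>)
    from cong_mult[OF cong_refl[of "2 ^ (2 * d * k)"] step[OF this]]
    have "[2 ^ (2 * d * k) * f ((\<rho> ^^ k) c) ^ 2 = 2 ^ (2 * d * Suc k) * f ((\<rho> ^^ Suc k) c) ^ 2] (mod p)"
      by (simp add: power_add mult_ac)
    then show ?case using Suc cong_trans by blast
  qed simp
  obtain k where k: "0 < k" "k \<le> card \<Omega>" "(\<rho> ^^ k) c = c" using funpow_return[OF \<Omega> \<rho> c] by blast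
  have "p dvd (2 ^ (2 * d * k) - 1) * f c ^ 2"
    using iter[of k] k(3) by (simp add: cong_iff_dvd_diff algebra_simps dvd_diff_commute)
  moreover have "\<not> p dvd 2 ^ (2 * d * k) - 1"
  proof
    assume "p dvd 2 ^ (2 * d * k) - 1"
    moreover have "(0 :: int) < 2 ^ (2 * d * k) - 1"
      using k(1) w(1) by (simp add: d_def)
    ultimately have "p \<le> 2 ^ (2 * d * k) - 1" by (rule zdvd_imp_le)
    moreover have "2 * d * k \<le> 2 * D * card \<Omega>" using k(2) w(2) by (auto simp: d_def intro!: mult_le_mono)
    then have "(2 :: int) ^ (2 * d * k) \<le> 2 ^ (2 * D * card \<Omega>)" by (rule power_increasing) simp
    ultimately show False using p(2) by linarith
  qed
  ultimately have "p dvd f c ^ 2" using p(1) by (simp add: prime_dvd_mult_iff)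
  then have "p dvd f c" using p(1) prime_dvd_power by blast
  then show ?thesis by (simp add: cong_0_iff)
qed

section \<open>Generic exponents for the scalars\<close>

context gadget
begin

definition rx :: "nat \<Rightarrow> nat" where "rx l = fst (prod_decode l)"
definition ry :: "nat \<Rightarrow> nat" where "ry l = fst (prod_decode (snd (prod_decode l)))"
definition rz :: "nat \<Rightarrow> nat" where "rz l = snd (prod_decode (snd (prod_decode l)))"

lemma triple_decode [simp]: "rx (triple_code x y z) = x" "ry (triple_code x y z) = y" "rz (triple_code x y z) = z"
  by (simp_all add: rx_def ry_def rz_def triple_code_def)

text \<open>The exponents of the scalars of a point, as a vector with a coordinate for every symbol and
  every relation; \<open>kpart\<close> is the relation occurring in it, and \<open>epart\<close> the symbol coordinates.\<close>

definition ikpart :: "nat \<Rightarrow> nat option" where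
  "ikpart u = (if even u then None else Some (u div 4))"

text \<open>\<open>\<kappa>\<close> has a coordinate of its own and no symbol part. The exponent of
  \<open>\<sigma>\<close> is then forced by \<open>d2\<close>: that of \<open>\<kappa>\<close> plus
  those of \<open>x\<close> and \<open>y\<close> minus that of \<open>z\<close>.\<close>

definition iepart :: "nat \<Rightarrow> nat \<Rightarrow> int" where
  "iepart u t = (if even u then of_bool (u div 2 = t) else if u mod 4 = 1 then 0
     else of_bool (rx (u div 4) = t) + of_bool (ry (u div 4) = t) - of_bool (rz (u div 4) = t))"

fun kpart :: "pt \<Rightarrow> nat option" where
  "kpart (PA u) = ikpart u"
| "kpart (PB u) = ikpart u"
| "kpart (PD l) = Some l"
| "kpart (PC u s) = ikpart u"
| "kpart _ = None"

fun epart :: "pt \<Rightarrow> nat \<Rightarrow> int" where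
  "epart (PA u) t = iepart u t"
| "epart (PB u) t = iepart u t"
| "epart (PD l) t = of_bool (ry l = t)"
| "epart (PC u s) t = iepart u t + of_bool (s = t)"
| "epart PX t = of_bool (t = 1) + of_bool (t = 2)"
| "epart PY t = of_bool (t = 1) + of_bool (t = 2)"
| "epart _ t = 0"

definition wvec :: "pt \<Rightarrow> nat \<Rightarrow> int" where
  "wvec p j = (if j = 0 then 0 else if even j then epart p (j div 2) else of_bool (kpart p = Some (j div 2)))"

lemma wvec_bound: "\<bar>wvec p j\<bar> \<le> 3"
proof -
  have "\<bar>iepart u t\<bar> \<le> 2" for u t unfolding iepart_def by (simp add: of_bool_def)
  note ie = this[THEN order_trans, of 3, simplified] this
  have "\<bar>epart p t\<bar> \<le> 3" for t
  proof (cases p)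
    case (PC u s)
    have "\<bar>of_bool (s = t) :: int\<bar> \<le> 1" by simp
    then show ?thesis using PC ie(2)[of u t] by (simp only: epart.simps)
  qed (use ie in \<open>simp_all add: of_bool_def\<close>)
  then show ?thesis by (simp add: wvec_def)
qed

lemma wvec_even: "1 \<le> t \<Longrightarrow> wvec p (2 * t) = epart p t"
  by (simp add: wvec_def)

lemma wvec_odd: "wvec p (2 * l + 1) = of_bool (kpart p = Some l)"
  by (simp add: wvec_def)

lemma scalar_kappa: "ikpart (4 * l + 1) = Some l" "ikpart (4 * l + 3) = Some l"
  "iepart (4 * l + 1) t = 0" "iepart (4 * l + 3) t = of_bool (rx l = t) + of_bool (ry l = t) - of_bool (rz l = t)"
  "ikpart (2 * s) = None" "iepart (2 * s) t = of_bool (s = t)" "ikpart 0 = None" "iepart 0 t = of_bool (0 = t)"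
  "ikpart (Suc (4 * l)) = Some l" "iepart (Suc (4 * l)) t = 0"
proof -
  have "(4 * l + 1) div 4 = l" "(4 * l + 3) div 4 = l" "(4 * l + 1) mod 4 = 1" "(4 * l + 3) mod 4 = 3" "odd (4 * l + 3)"
    by presburger+
  then show "ikpart (4 * l + 1) = Some l" "ikpart (4 * l + 3) = Some l"
  "iepart (4 * l + 1) t = 0" "iepart (4 * l + 3) t = of_bool (rx l = t) + of_bool (ry l = t) - of_bool (rz l = t)"
  "ikpart (Suc (4 * l)) = Some l" "iepart (Suc (4 * l)) t = 0"
    by (simp_all add: ikpart_def iepart_def)
qed (simp_all add: ikpart_def iepart_def)

lemma index_cases:
  assumes "index u"
  obtains s where "s < n" "u = 2 * s"
  | x y z where "R x y z" "u = 4 * triple_code x y z + 1"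
  | x y z where "R x y z" "u = 4 * triple_code x y z + 3"
  using assms n_gt unfolding index_def scalar_def by (metis mult_0_right neq0_conv not_less_zero)

lemma scalar_cases':
  assumes "scalar u"
  obtains "u = 0"
  | x y z where "R x y z" "u = 4 * triple_code x y z + 1"
  | x y z where "R x y z" "u = 4 * triple_code x y z + 3"
  using assms unfolding scalar_def by blast

text \<open>The delicate pair is \<open>\<kappa>\<close> and \<open>\<sigma>\<close> of one
  relation. Their difference \<open>x + y - z\<close> has coefficient -1 at \<open>z\<close>,
  because \<open>z\<close> differs from \<open>x\<close> and \<open>y\<close>.\<close>

lemma iweight_inj:
  assumes "index u" "index u'" "ikpart u = ikpart u'" "\<And>t. 1 \<le> t \<Longrightarrow> iepart u t = iepart u' t"
  shows "u = u'"
proof -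
  have two: False if "R x y z" "\<And>t. 1 \<le> t \<Longrightarrow> (of_bool (x = t) + of_bool (y = t) - of_bool (z = t) :: int) = 0" for x y z
    using that(2)[of z] R[OF that(1)] by auto
  show ?thesis
    using assms(1)
  proof (cases rule: index_cases)
    case (1 s)
    from assms(2) show ?thesis
    proof (cases rule: index_cases)
      fix s' assume "u' = 2 * s'"
      then have "s = s'" using assms(4)[of s] assms(4)[of s'] 1 by (cases "s = 0"; cases "s' = 0") (auto simp: scalar_kappa)
      then show ?thesis using 1 \<open>u' = 2 * s'\<close> by simp
    qed (use 1 assms(3) in \<open>simp_all add: scalar_kappa\<close>)
  next
    case (2 x y z)
    from assms(2) show ?thesis
    proof (cases rule: index_cases)
      fix x' y' z' assume "R x' y' z'" "u' = 4 * triple_code x' y' z' + 3"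
      then show ?thesis using two[of x' y' z'] assms(4) 2 by (simp add: scalar_kappa)
    qed (use 2 assms(3) in \<open>simp_all add: scalar_kappa\<close>)
  next
    case (3 x y z)
    from assms(2) show ?thesis
    proof (cases rule: index_cases)
      fix x' y' z' assume "R x' y' z'" "u' = 4 * triple_code x' y' z' + 1"
      then show ?thesis using two[of x y z] assms(4) 3 by (simp add: scalar_kappa)
    qed (use 3 assms(3) in \<open>simp_all add: scalar_kappa\<close>)
  qed
qed

definition sideA :: "pt set" where "sideA = {PA u |u. index u}"
definition sideB :: "pt set" where "sideB = {PB u |u. index u} \<union> {PD (triple_code x y z) |x y z. R x y z}"
definition sideC :: "pt set" where "sideC = {PC u s |u s. scalar u \<and> s < n} \<union> {PX, PY}"

lemma points_sides: "points = {JJ 0, JJ 1, JJ 2} \<union> sideA \<union> sideB \<union> sideC"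
  unfolding points_def sideA_def sideB_def sideC_def by blast

lemma wvec_eqD:
  assumes "wvec p = wvec q"
  shows "kpart p = kpart q" "1 \<le> t \<Longrightarrow> epart p t = epart q t"
proof -
  have "kpart p = Some l \<longleftrightarrow> kpart q = Some l" for l
    using wvec_odd[of p l] wvec_odd[of q l] assms by (auto split: if_splits)
  then show "kpart p = kpart q" by (metis not_Some_eq)
  show "1 \<le> t \<Longrightarrow> epart p t = epart q t" using wvec_even[of t p] wvec_even[of t q] assms by simp
qed

lemma wvec_sideA: "p \<in> sideA \<Longrightarrow> q \<in> sideA \<Longrightarrow> wvec p = wvec q \<Longrightarrow> p = q"
  using wvec_eqD[of p q] by (auto simp: sideA_def intro!: iweight_inj)

lemma wvec_sideB:
  assumes "p \<in> sideB" "q \<in> sideB" "wvec p = wvec q"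
  shows "p = q"
proof -
  have mixed: False if "index u" "R x y z" "wvec (PB u) = wvec (PD (triple_code x y z))" for u x y z
    using that(1)
  proof (cases rule: index_cases)
    case (1 s)
    then show ?thesis using wvec_eqD(1)[OF that(3)] by (simp add: scalar_kappa)
  next
    case (2 x' y' z')
    then show ?thesis using wvec_eqD(2)[OF that(3), of y] R[OF that(2)] by (simp add: scalar_kappa)
  next
    case (3 x' y' z')
    then have "triple_code x' y' z' = triple_code x y z" using wvec_eqD(1)[OF that(3)] by (simp add: scalar_kappa)
    then have "x' = x" "y' = y" "z' = z" by simp_all
    then show ?thesis using wvec_eqD(2)[OF that(3), of z] R[OF that(2)] 3 by (auto simp: scalar_kappa split: if_splits)
  qed
  have PB: "u = v" if "index u" "index v" "wvec (PB u) = wvec (PB v)" for u v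
    using iweight_inj[OF that(1,2)] wvec_eqD[OF that(3)] by simp
  show ?thesis
    using assms mixed mixed[OF _ _ HOL.sym] PB wvec_eqD(1)[of p q] by (auto simp: sideB_def)
qed

text \<open>\<open>PX\<close> and \<open>PY\<close> are products of the same two symbols, so
  exponents cannot distinguish them; their separation is left to signs.\<close>

lemma wvec_sideC:
  assumes "p \<in> sideC" "q \<in> sideC" "wvec p = wvec q" "{p, q} \<noteq> {PX, PY}"
  shows "p = q"
proof -
  have CX: False if "scalar u" "r = PX \<or> r = PY" "wvec (PC u s) = wvec r" for u s r
    using that(1)
  proof (cases rule: scalar_cases')
    case 1
    then show ?thesis using wvec_eqD(2)[OF that(3), of 1] wvec_eqD(2)[OF that(3), of 2] that(2)
      by (auto simp: scalar_kappa split: if_splits)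
  qed (use wvec_eqD(1)[OF that(3)] that(2) in \<open>auto simp: scalar_kappa\<close>)
  have CC: "PC u s = PC u' s'" if u: "scalar u" "scalar u'" and eq: "wvec (PC u s) = wvec (PC u' s')" for u s u' s'
  proof -
    have no: False if "R x y z" "\<And>t. 1 \<le> t \<Longrightarrow> (of_bool (s = t) :: int) = of_bool (x = t) + of_bool (y = t) - of_bool (z = t) + of_bool (s' = t)"
      for x y z s s'
      using that(2)[of x] that(2)[of y] that(2)[of z] R[OF that(1)] by (auto simp: of_bool_def split: if_splits)
    have e: "iepart u t + of_bool (s = t) = iepart u' t + of_bool (s' = t)" if "1 \<le> t" for t
      using wvec_eqD(2)[OF eq that] by simp
    have k: "ikpart u = ikpart u'" using wvec_eqD(1)[OF eq] by simp
    have "u = u'"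
      using u(1)
    proof (cases rule: scalar_cases')
      case 1
      from u(2) show ?thesis by (cases rule: scalar_cases') (use 1 k in \<open>auto simp: scalar_kappa\<close>)
    next
      case (2 x y z)
      from u(2) show ?thesis
      proof (cases rule: scalar_cases')
        fix x' y' z' assume 3: "R x' y' z'" "u' = 4 * triple_code x' y' z' + 3"
        have "(of_bool (s = t) :: int) = of_bool (x' = t) + of_bool (y' = t) - of_bool (z' = t) + of_bool (s' = t)" if "1 \<le> t" for t
          using e[OF that] 2 3 by (simp add: scalar_kappa)
        then show ?thesis using no[OF 3(1)] by blast
      qed (use 2 k in \<open>auto simp: scalar_kappa\<close>)
    next
      case (3 x y z)
      from u(2) show ?thesis
      proof (cases rule: scalar_cases')
        fix x' y' z' assume 2: "R x' y' z'" "u' = 4 * triple_code x' y' z' + 1"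
        have "(of_bool (s' = t) :: int) = of_bool (x = t) + of_bool (y = t) - of_bool (z = t) + of_bool (s = t)" if "1 \<le> t" for t
          using e[OF that] 2 3 by (simp add: scalar_kappa)
        then show ?thesis using no[OF 3(1)] by blast
      qed (use 3 k in \<open>auto simp: scalar_kappa\<close>)
    qed
    moreover have "s = s'"
      using e[of s] e[of s'] \<open>u = u'\<close> by (cases "s = 0"; cases "s' = 0") (auto split: if_splits)
    ultimately show ?thesis by simp
  qed
  show ?thesis
    using assms CX CX[OF _ _ HOL.sym] CC unfolding sideC_def by (auto; metis)
qed

lemma wvec_abc:
  assumes "abc a b c"
  shows "wvec a j + wvec b j = wvec c j"
  using assms
proof cases
  case (ab1 u s)
  then show ?thesis by (auto simp: wvec_def scalar_kappa)
next
  case (ab2 u s)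
  then show ?thesis by (auto simp: wvec_def scalar_kappa)
next
  case (d1 x y z)
  then show ?thesis using R[OF d1(4)] by (auto simp: wvec_def scalar_kappa simp del: One_nat_def)
next
  case (d2 x y z)
  then show ?thesis by (auto simp: wvec_def scalar_kappa)
next
  case px
  have "2 = 2 * (1::nat)" "4 = 2 * (2::nat)" by simp_all
  then have "iepart 2 t = of_bool (1 = t)" "iepart 4 t = of_bool (2 = t)" "ikpart 2 = None" "ikpart 4 = None" for t
    by (metis scalar_kappa(6), metis scalar_kappa(6), simp_all add: ikpart_def)
  then show ?thesis using px by (auto simp: wvec_def)
next
  case py
  have "2 = 2 * (1::nat)" "4 = 2 * (2::nat)" by simp_all
  then have "iepart 2 t = of_bool (1 = t)" "iepart 4 t = of_bool (2 = t)" "ikpart 2 = None" "ikpart 4 = None" for t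
    by (metis scalar_kappa(6), metis scalar_kappa(6), simp_all add: ikpart_def)
  then show ?thesis using py by (auto simp: wvec_def)
qed

lemma delta_sum1:
  assumes "\<And>t. 1 \<le> t \<Longrightarrow> of_bool (a = t) + of_bool (b = t) = (of_bool (c = t) :: int)"
  shows "(a = 0 \<and> b = c) \<or> (b = 0 \<and> a = (c :: nat))"
  using assms[of a] assms[of b] assms[of c]
  by (cases "a = 0"; cases "b = 0"; cases "c = 0") (auto simp: of_bool_def split: if_splits)

lemma delta_sum2:
  assumes "\<And>t. 1 \<le> t \<Longrightarrow> of_bool (a = t) + of_bool (b = t) = (of_bool (c = t) + of_bool (d = t) :: int)"
    and "1 \<le> c" "1 \<le> d" "c \<noteq> (d :: nat)"
  shows "(a = c \<and> b = d) \<or> (a = d \<and> b = c)"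
  using assms(2-) assms(1)[of c] assms(1)[of d]
  by (auto simp: of_bool_def split: if_splits)

lemma sideC_kpart_None: "c \<in> sideC \<Longrightarrow> kpart c = None \<Longrightarrow> (\<exists>s<n. c = PC 0 s) \<or> c = PX \<or> c = PY"
  by (auto simp: sideC_def scalar_def scalar_kappa)

lemma sideC_kpart_Some: "c \<in> sideC \<Longrightarrow> kpart c = Some l \<Longrightarrow> \<exists>s<n. c = PC (4 * l + 1) s \<or> c = PC (4 * l + 3) s"
  by (auto simp: sideC_def scalar_def scalar_kappa)

text \<open>The converse of \<open>wvec_abc\<close>. In \<open>c\<close> at most one relation
  coordinate occurs, with coefficient 1, so at most one of \<open>a\<close> and \<open>b\<close>
  carries one; the symbol coordinates then decide. The two exceptions are the products of the
  symbols 1 and 2 with the result interchanged, since exponents commute.\<close>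

lemma wvec_sum_eqD:
  assumes abc: "a \<in> sideA" "b \<in> sideB" "c \<in> sideC" and eq: "\<And>j. wvec a j + wvec b j = wvec c j"
  shows "abc a b c \<or> (a = PA 2 \<and> b = PB 4 \<and> c = PY) \<or> (a = PA 4 \<and> b = PB 2 \<and> c = PX)"
proof -
  note [simp del] = One_nat_def
  have k: "of_bool (kpart a = Some l) + of_bool (kpart b = Some l) = (of_bool (kpart c = Some l) :: int)" for l
    using eq[of "2 * l + 1"] by (simp add: wvec_odd)
  have e: "epart a t + epart b t = epart c t" if "1 \<le> t" for t
    using eq[of "2 * t"] that by (simp add: wvec_even)
  have no: False if "R x y z"
    "\<And>t. 1 \<le> t \<Longrightarrow> (of_bool (s = t) :: int) = of_bool (x = t) + of_bool (y = t) - of_bool (z = t) + of_bool (s' = t)" for x y z s s'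
    using that(2)[of x] that(2)[of y] that(2)[of z] R[OF that(1)] by (auto simp: of_bool_def split: if_splits)
  have kNone: "kpart c = None" if "kpart a = None" "kpart b = None"
    using k[of "the (kpart c)"] that by (cases "kpart c") (auto simp: of_bool_def split: if_splits)
  have kSome: "kpart c = Some l" if "kpart a = Some l \<or> kpart b = Some l" for l
    using k[of l] that by (auto simp: of_bool_def split: if_splits)
  have both: False if "kpart a = Some l" "kpart b = Some l'" for l l'
    using k[of l] k[of l'] that by (auto simp: of_bool_def split: if_splits)
  obtain u where u: "a = PA u" "index u" using abc(1) by (auto simp: sideA_def)
  from u(2) show ?thesis
  proof (cases rule: index_cases)
    case s1: (1 s1)
    have ka: "kpart a = None" and ea: "epart a t = of_bool (s1 = t)" for t using s1 u by (simp_all add: scalar_kappa)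
    from abc(2) consider (index) v where "b = PB v" "index v" | (D) x y z where "b = PD (triple_code x y z)" "R x y z"
      by (auto simp: sideB_def)
    then show ?thesis
    proof cases
      case index
      from index(2) show ?thesis
      proof (cases rule: index_cases)
        case s2: (1 s2)
        have kb: "kpart b = None" and eb: "epart b t = of_bool (s2 = t)" for t using s2 index by (simp_all add: scalar_kappa)
        from sideC_kpart_None[OF abc(3) kNone[OF ka kb]] consider s where "s < n" "c = PC 0 s" | "c = PX \<or> c = PY" by blast
        then show ?thesis
        proof cases
          case 1
          have "of_bool (s1 = t) + of_bool (s2 = t) = (of_bool (s = t) :: int)" if "1 \<le> t" for t
            using e[OF that] 1 that by (simp add: ea eb scalar_kappa)
          from delta_sum1[OF this] show ?thesis
            using abc.ab1[of 0 s] abc.ab2[of 0 s] 1 s1 s2 u index scalarI(1) by auto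
        next
          case 2
          have "of_bool (s1 = t) + of_bool (s2 = t) = (of_bool (1 = t) + of_bool (2 = t) :: int)" if "1 \<le> t" for t
            using e[OF that] 2 that by (auto simp: ea eb)
          from delta_sum2[OF this] have "(s1 = 1 \<and> s2 = 2) \<or> (s1 = 2 \<and> s2 = 1)" by simp
          then show ?thesis using 2 s1 s2 u index abc.px abc.py by auto
        qed
      next
        case (2 x y z)
        have kb: "kpart b = Some (triple_code x y z)" and eb: "epart b t = 0" for t using 2 index by (simp_all add: scalar_kappa)
        obtain s where s: "s < n" "c = PC (4 * triple_code x y z + 1) s \<or> c = PC (4 * triple_code x y z + 3) s"
          using sideC_kpart_Some[OF abc(3)] kSome kb by blast
        show ?thesis
        proof (cases "c = PC (4 * triple_code x y z + 1) s")
          case True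
          have "of_bool (s1 = t) = (of_bool (s = t) :: int)" if "1 \<le> t" for t
            using e[OF that] True that by (simp add: ea eb scalar_kappa)
          from this[of s1] this[of s] have "s1 = s" by (cases "s = 0"; cases "s1 = 0") (auto split: if_splits)
          then show ?thesis using abc.ab2[OF scalarI(2)[OF 2(1)] s(1)] True u s1 index 2 by simp
        next
          case False
          then have "of_bool (s1 = t) = (of_bool (x = t) + of_bool (y = t) - of_bool (z = t) + of_bool (s = t) :: int)" if "1 \<le> t" for t
            using e[OF that] s that by (simp add: ea eb scalar_kappa)
          then show ?thesis using no[OF 2(1)] by blast
        qed
      next
        case (3 x y z)
        have kb: "kpart b = Some (triple_code x y z)" 
          and eb: "epart b t = of_bool (x = t) + of_bool (y = t) - of_bool (z = t)" for t using 3 index by (simp_all add: scalar_kappa)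
        obtain s where s: "s < n" "c = PC (4 * triple_code x y z + 1) s \<or> c = PC (4 * triple_code x y z + 3) s"
          using sideC_kpart_Some[OF abc(3)] kSome kb by blast
        show ?thesis
        proof (cases "c = PC (4 * triple_code x y z + 3) s")
          case True
          have "of_bool (s1 = t) = (of_bool (s = t) :: int)" if "1 \<le> t" for t
            using e[OF that] True that by (simp add: ea eb scalar_kappa)
          from this[of s1] this[of s] have "s1 = s" by (cases "s = 0"; cases "s1 = 0") (auto split: if_splits)
          then show ?thesis using abc.ab2[OF scalarI(3)[OF 3(1)] s(1)] True u s1 index 3 by simp
        next
          case False
          then have "of_bool (s = t) = (of_bool (x = t) + of_bool (y = t) - of_bool (z = t) + of_bool (s1 = t) :: int)" if "1 \<le> t" for t
            using e[OF that] s that by (simp add: ea eb scalar_kappa)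
          then show ?thesis using no[OF 3(1)] by blast
        qed
      qed
    next
      case (D x y z)
      have kb: "kpart b = Some (triple_code x y z)" and eb: "epart b t = of_bool (y = t)" for t using D by simp_all
      obtain s where s: "s < n" "c = PC (4 * triple_code x y z + 1) s \<or> c = PC (4 * triple_code x y z + 3) s"
        using sideC_kpart_Some[OF abc(3)] kSome kb by blast
      show ?thesis
      proof (cases "c = PC (4 * triple_code x y z + 1) s")
        case True
        have "of_bool (s1 = t) + of_bool (y = t) = (of_bool (s = t) :: int)" if "1 \<le> t" for t
          using e[OF that] True that by (simp add: ea eb scalar_kappa)
        from delta_sum1[OF this] have "s1 = 0 \<and> y = s" using R[OF D(2)] by simp
        then show ?thesis using abc.d1[OF D(2)] True u s1 D by simp
      next
        case False
        then have "of_bool (s1 = t) + of_bool (z = t) = (of_bool (x = t) + of_bool (s = t) :: int)" if "1 \<le> t" for t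
          using e[OF that] s that by (simp add: ea eb scalar_kappa)
        from this[of x] this[of z] have "s1 = x \<and> s = z" using R[OF D(2)] by (auto simp: of_bool_def split: if_splits)
        then show ?thesis using abc.d2[OF D(2)] False s(2) u s1 D by simp
      qed
    qed
  next
    case (2 x y z)
    have ka: "kpart a = Some (triple_code x y z)" and ea: "epart a t = 0" for t using 2 u by (simp_all add: scalar_kappa)
    obtain s2 where s2: "s2 < n" "b = PB (2 * s2)"
      using abc(2) both[OF ka] by (auto simp: sideB_def scalar_kappa elim!: index_cases)
    have eb: "epart b t = of_bool (s2 = t)" for t using s2 by (simp add: scalar_kappa)
    obtain s where s: "s < n" "c = PC (4 * triple_code x y z + 1) s \<or> c = PC (4 * triple_code x y z + 3) s"
      using sideC_kpart_Some[OF abc(3)] kSome ka by blast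
    show ?thesis
    proof (cases "c = PC (4 * triple_code x y z + 1) s")
      case True
      have "of_bool (s2 = t) = (of_bool (s = t) :: int)" if "1 \<le> t" for t
        using e[OF that] True that by (simp add: ea eb scalar_kappa)
      from this[of s2] this[of s] have "s2 = s" by (cases "s = 0"; cases "s2 = 0") (auto split: if_splits)
      then show ?thesis using abc.ab1[OF scalarI(2)[OF 2(1)] s(1)] True u s2 2 by simp
    next
      case False
      then have "of_bool (s2 = t) = (of_bool (x = t) + of_bool (y = t) - of_bool (z = t) + of_bool (s = t) :: int)" if "1 \<le> t" for t
        using e[OF that] s that by (simp add: ea eb scalar_kappa)
      then show ?thesis using no[OF 2(1)] by blast
    qed
  next
    case (3 x y z)
    have ka: "kpart a = Some (triple_code x y z)"
      and ea: "epart a t = of_bool (x = t) + of_bool (y = t) - of_bool (z = t)" for t using 3 u by (simp_all add: scalar_kappa)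
    obtain s2 where s2: "s2 < n" "b = PB (2 * s2)"
      using abc(2) both[OF ka] by (auto simp: sideB_def scalar_kappa elim!: index_cases)
    have eb: "epart b t = of_bool (s2 = t)" for t using s2 by (simp add: scalar_kappa)
    obtain s where s: "s < n" "c = PC (4 * triple_code x y z + 1) s \<or> c = PC (4 * triple_code x y z + 3) s"
      using sideC_kpart_Some[OF abc(3)] kSome ka by blast
    show ?thesis
    proof (cases "c = PC (4 * triple_code x y z + 3) s")
      case True
      have "of_bool (s2 = t) = (of_bool (s = t) :: int)" if "1 \<le> t" for t
        using e[OF that] True that by (simp add: ea eb scalar_kappa)
      from this[of s2] this[of s] have "s2 = s" by (cases "s = 0"; cases "s2 = 0") (auto split: if_splits)
      then show ?thesis using abc.ab1[OF scalarI(3)[OF 3(1)] s(1)] True u s2 3 by simp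
    next
      case False
      then have "of_bool (s = t) = (of_bool (x = t) + of_bool (y = t) - of_bool (z = t) + of_bool (s2 = t) :: int)" if "1 \<le> t" for t
        using e[OF that] s that by (simp add: ea eb scalar_kappa)
      then show ?thesis using no[OF 3(1)] by blast
    qed
  qed
qed

lemma sides_points: "sideA \<union> sideB \<union> sideC \<subseteq> points"
  using points_sides by blast

lemma abc_in_sides: "abc a b c \<Longrightarrow> a \<in> sideA \<and> b \<in> sideB \<and> c \<in> sideC"
proof -
  assume *: "abc a b c"
  then have "a \<in> points \<and> b \<in> points \<and> c \<in> points" by (rule abc_points)
  then show ?thesis using abc_sides[OF *] unfolding points_sides by (auto simp: sideA_def sideB_def sideC_def)
qed

text \<open>Finitely many combinations of exponent vectors matter, so finitely many base-16 digits
  determine them. Shifting by \<open>B\<close> on the first two sides and by \<open>2 * B\<close> on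
  the third makes the numbers nonnegative and preserves the equations \<open>a + b = c\<close>; sums
  are then at most \<open>4 * B\<close>.\<close>

lemma weights_exist:
  obtains wt :: "pt \<Rightarrow> nat" and D where
    "\<And>a b c. a \<in> sideA \<Longrightarrow> b \<in> sideB \<Longrightarrow> c \<in> sideC \<Longrightarrow> wt a + wt b \<le> D \<and> wt c \<le> D"
    "\<And>p q S. S \<in> {sideA, sideB, sideC} \<Longrightarrow> p \<in> S \<Longrightarrow> q \<in> S \<Longrightarrow> p \<noteq> q \<Longrightarrow> {p, q} \<noteq> {PX, PY} \<Longrightarrow> wt p \<noteq> wt q"
    "\<And>a b c. a \<in> sideA \<Longrightarrow> b \<in> sideB \<Longrightarrow> c \<in> sideC \<Longrightarrow> wt a + wt b = wt c \<Longrightarrow>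
       abc a b c \<or> (a = PA 2 \<and> b = PB 4 \<and> c = PY) \<or> (a = PA 4 \<and> b = PB 2 \<and> c = PX)"
    "\<And>a b c. abc a b c \<Longrightarrow> wt a + wt b = wt c" "wt PX = wt PY"
proof -
  define F where "F = (\<lambda>(p, q). \<lambda>j. wvec p j - wvec q j) ` (points \<times> points)
    \<union> (\<lambda>(a, b, c). \<lambda>j. wvec a j + wvec b j - wvec c j) ` (points \<times> points \<times> points)"
  have "finite F" using finite_points by (simp add: F_def)
  define J where "J f = (LEAST j. f j \<noteq> 0)" for f :: "nat \<Rightarrow> int"
  define m where "m = Suc (Max (insert 0 (J ` F)))"
  have J: "f = (\<lambda>_. 0)" if "f \<in> F" "\<And>j. j < m \<Longrightarrow> f j = 0" for f
  proof (rule ccontr)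
    assume "f \<noteq> (\<lambda>_. 0)"
    then have "f (J f) \<noteq> 0" unfolding J_def by (metis (mono_tags) LeastI ext)
    moreover have "J f < m" using that(1) \<open>finite F\<close> by (auto simp: m_def less_Suc_eq_le intro!: Max_ge)
    ultimately show False using that(2) by blast
  qed
  define W where "W p = (\<Sum>j<m. wvec p j * 16 ^ j)" for p
  have W1: "wvec p = wvec q" if "p \<in> points" "q \<in> points" "W p = W q" for p q
  proof -
    have "(\<Sum>j<m. (wvec p j - wvec q j) * 16 ^ j) = 0"
      using that(3) by (simp add: W_def left_diff_distrib sum_subtractf)
    moreover have "\<bar>wvec p j - wvec q j\<bar> \<le> 15" for j using wvec_bound[of p j] wvec_bound[of q j] by linarith
    ultimately have "wvec p j - wvec q j = 0" if "j < m" for j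
      using base_expansion_zero[of "\<lambda>j. wvec p j - wvec q j"] that by blast
    moreover have "(\<lambda>j. wvec p j - wvec q j) \<in> F" unfolding F_def using that by (intro UnI1 image_eqI[of _ _ "(p, q)"]) auto
    ultimately have "(\<lambda>j. wvec p j - wvec q j) = (\<lambda>_. 0)" by (intro J) auto
    then show ?thesis by (simp add: fun_eq_iff)
  qed
  have W2: "wvec a j + wvec b j = wvec c j" if "a \<in> points" "b \<in> points" "c \<in> points" "W a + W b = W c" for a b c j
  proof -
    have "(\<Sum>j<m. (wvec a j + wvec b j - wvec c j) * 16 ^ j) = 0"
      using that(4) by (simp add: W_def left_diff_distrib distrib_right sum_subtractf sum.distrib)
    moreover have "\<bar>wvec a j + wvec b j - wvec c j\<bar> \<le> 15" for j
      using wvec_bound[of a j] wvec_bound[of b j] wvec_bound[of c j] by linarith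
    ultimately have "wvec a j + wvec b j - wvec c j = 0" if "j < m" for j
      using base_expansion_zero[of "\<lambda>j. wvec a j + wvec b j - wvec c j"] that by blast
    moreover have "(\<lambda>j. wvec a j + wvec b j - wvec c j) \<in> F"
      unfolding F_def using that by (intro UnI2 image_eqI[of _ _ "(a, b, c)"]) auto
    ultimately have "(\<lambda>j. wvec a j + wvec b j - wvec c j) = (\<lambda>_. 0)" by (intro J) auto
    then show ?thesis by (simp add: fun_eq_iff)
  qed
  have W3: "W a + W b = W c" if "abc a b c" for a b c
    using wvec_abc[OF that] by (simp add: W_def sum.distrib[symmetric] distrib_right[symmetric])
  define B where "B = (\<Sum>p\<in>points. \<bar>W p\<bar>)"
  have B: "\<bar>W p\<bar> \<le> B" if "p \<in> points" for p
    unfolding B_def using member_le_sum[of p points "\<lambda>p. \<bar>W p\<bar>"] that finite_points by simp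
  define wt where "wt p = nat (W p + (if p \<in> sideC then 2 * B else B))" for p
  have disj: "sideA \<inter> sideC = {}" "sideB \<inter> sideC = {}" by (auto simp: sideA_def sideB_def sideC_def)
  have AB: "int (wt p) = W p + B" if "p \<in> sideA \<union> sideB" for p
    using that disj B[of p] sides_points by (auto simp: wt_def)
  have C: "int (wt p) = W p + 2 * B" if "p \<in> sideC" for p
    using that B[of p] sides_points by (auto simp: wt_def)
  show ?thesis
  proof (rule that[of wt "nat (4 * B)"])
    fix a b c assume *: "a \<in> sideA" "b \<in> sideB" "c \<in> sideC"
    then have "a \<in> points" "b \<in> points" "c \<in> points" using sides_points by auto
    note B[OF this(1)] B[OF this(2)] B[OF this(3)]
    then show "wt a + wt b \<le> nat (4 * B) \<and> wt c \<le> nat (4 * B)"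
      using AB[of a] AB[of b] C[of c] * by auto
  next
    fix p q S assume S: "S \<in> {sideA, sideB, sideC}" "p \<in> S" "q \<in> S" "p \<noteq> q" "{p, q} \<noteq> {PX, PY}"
    show "wt p \<noteq> wt q"
    proof
      assume eq: "wt p = wt q"
      from S have pq: "p \<in> points" "q \<in> points" using sides_points by auto
      have "W p = W q" using S(1-3) AB[of p] AB[of q] C[of p] C[of q] eq by auto
      then have "wvec p = wvec q" by (rule W1[OF pq])
      then show False using S wvec_sideA[of p q] wvec_sideB[of p q] wvec_sideC[of p q] by auto
    qed
  next
    fix a b c assume *: "a \<in> sideA" "b \<in> sideB" "c \<in> sideC" "wt a + wt b = wt c"
    then have "W a + W b = W c" using AB[of a] AB[of b] C[of c] by auto
    then show "abc a b c \<or> (a = PA 2 \<and> b = PB 4 \<and> c = PY) \<or> (a = PA 4 \<and> b = PB 2 \<and> c = PX)"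
      using * sides_points by (intro wvec_sum_eqD[OF *(1-3)] W2) auto
  next
    fix a b c assume "abc a b c"
    then show "wt a + wt b = wt c" using W3[of a b c] abc_in_sides[of a b c] AB[of a] AB[of b] C[of c] by auto
  next
    have "wvec PX = wvec PY" by (auto simp: wvec_def fun_eq_iff)
    then show "wt PX = wt PY" by (simp add: wt_def W_def sideC_def)
  qed
qed

end

lemma shannon_entropy_uniform:
  fixes S :: "'w set" and Y :: "'w \<Rightarrow> 'v"
  assumes S: "finite S" "S \<noteq> {}" and F: "\<And>x. x \<in> S \<Longrightarrow> card {x' \<in> S. Y x' = Y x} = F" and N: "card S = N * F"
  shows "shannon_entropy (uniform_count_measure S) Y = ennreal (ln N)"
proof -
  let ?T = "Y ` S"
  have T: "finite ?T" using S(1) by simp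
  have "card S > 0" using S by (simp add: card_gt_0_iff)
  then have pos: "N > 0" "F > 0" using N by (cases N; cases F; simp)+
  have "(\<Sum>y\<in>?T. \<Sum>x' \<in> {x' \<in> S. Y x' = y}. 1 :: nat) = (\<Sum>x\<in>S. 1)"
    using S(1) T by (intro sum.group) auto
  then have "card S = (\<Sum>y\<in>?T. card {x' \<in> S. Y x' = y})" by simp
  also have "\<dots> = (\<Sum>y\<in>?T. F)" using F by (intro sum.cong) auto
  finally have cT: "card ?T = N" using N pos by simp
  have m: "measure (uniform_count_measure S) {w \<in> space (uniform_count_measure S). Y w = y} = (if y \<in> ?T then 1 / N else 0)" for y
  proof -
    have "measure (uniform_count_measure S) {w \<in> S. Y w = y} = card {w \<in> S. Y w = y} / card S"
      using S by (intro measure_uniform_count_measure) auto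
    also have "\<dots> = (if y \<in> ?T then 1 / N else 0)"
    proof (cases "y \<in> ?T")
      case True
      then have "card {w \<in> S. Y w = y} = F" using F by auto
      then show ?thesis using True N pos by simp
    next
      case False
      then have "{w \<in> S. Y w = y} = {}" by auto
      then show ?thesis using False by (simp only: card.empty) simp
    qed
    finally show ?thesis by (simp add: space_uniform_count_measure)
  qed
  have "shannon_entropy (uniform_count_measure S) Y
      = (\<Sum>\<^sub>\<infinity>y\<in>?T. ennreal (- ((1 / N) * ln (1 / N))))"
    unfolding shannon_entropy_def m by (rule infsum_cong_neutral) auto
  also have "\<dots> = (\<Sum>y\<in>?T. ennreal (ln N / N))"
    using T pos by (simp add: ln_div)
  also have "\<dots> = ennreal (N * (ln N / N))"
    using cT pos by (simp add: ennreal_of_nat_eq_real_of_nat ennreal_mult'[symmetric])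
  also have "\<dots> = ennreal (ln N)" using pos by simp
  finally show ?thesis .
qed

section \<open>Translations and signs over a finite model\<close>

locale gadget_model = gadget R n for R n +
  fixes \<phi> :: "nat \<Rightarrow> 'g :: group_add" and \<Omega> :: "'g set"
  assumes Om: "finite \<Omega>" "\<Omega> \<noteq> {}" "\<And>s b. b \<in> \<Omega> \<Longrightarrow> \<phi> s + b \<in> \<Omega>"
    and rels: "\<And>x y z. R x y z \<Longrightarrow> \<phi> x + \<phi> y = \<phi> z"
    and invol: "\<phi> 2 + \<phi> 2 = 0" "\<phi> 2 \<noteq> 0"
begin

text \<open>A choice of sign on every orbit \<open>{b, \<phi> 2 + b}\<close>. The predicate under
  \<open>SOME\<close> is symmetric in the two elements, so both refer to the same representative and
  get opposite signs.\<close>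

definition chi :: "'g \<Rightarrow> int" where
  "chi b = (if b = (SOME c. c = b \<or> c = \<phi> 2 + b) then 1 else - 1)"

lemma chi_shift: "chi (\<phi> 2 + b) = - chi b"
proof -
  have 2: "\<phi> 2 + (\<phi> 2 + b) = b" using invol(1) by (simp add: add.assoc[symmetric])
  have ne: "\<phi> 2 + b \<noteq> b" using invol(2) add_right_cancel[of "\<phi> 2" b 0] by simp
  define v where "v = (SOME c. c = b \<or> c = \<phi> 2 + b)"
  have "v = b \<or> v = \<phi> 2 + b" unfolding v_def by (rule someI_ex) blast
  moreover have "(SOME c. c = \<phi> 2 + b \<or> c = \<phi> 2 + (\<phi> 2 + b)) = v" unfolding v_def 2 by (rule arg_cong[of _ _ Eps]) auto
  ultimately show ?thesis using ne unfolding chi_def v_def[symmetric] by auto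
qed

lemma chi_sq: "chi b ^ 2 = 1" by (simp add: chi_def)

definition lab :: "nat \<Rightarrow> nat" where "lab u = (if even u then u div 2 else 0)"

fun lbl :: "pt \<Rightarrow> nat" where
  "lbl (PA u) = lab u" | "lbl (PB u) = lab u" | "lbl (PD l) = ry l" | "lbl (PC u s) = s" | "lbl _ = 2"

text \<open>Scalars and the symbols 0 and 1 do not move the model; a symbol from 2 on acts by left
  translation. The symbol 1 acts by the sign \<open>chi\<close> alone, which is possible because
  relations only involve symbols from 2 on.\<close>

definition tau :: "pt \<Rightarrow> 'g \<Rightarrow> 'g" where
  "tau p b = (if lbl p \<le> 1 then b else \<phi> (lbl p) + b)"

text \<open>\<open>PX\<close> and \<open>PY\<close> share their translation but have opposite signs,
  because \<open>chi\<close> changes sign under the translation by \<open>\<phi> 2\<close>.\<close>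

definition sg :: "pt \<Rightarrow> 'g \<Rightarrow> int" where
  "sg p b = (if p = PX then - chi b else if p = PY then chi b else if lbl p = 1 then chi b else 1)"

lemma sg_sq: "sg p b ^ 2 = 1" by (auto simp: sg_def chi_sq)

lemma tau_in: "b \<in> \<Omega> \<Longrightarrow> tau p b \<in> \<Omega>" using Om(3) by (simp add: tau_def)

lemma tau_bij: "bij_betw (tau p) \<Omega> \<Omega>"
proof -
  have "inj_on (tau p) \<Omega>" by (auto simp: tau_def inj_on_def)
  moreover have "tau p ` \<Omega> \<subseteq> \<Omega>" using tau_in by blast
  ultimately show ?thesis using Om(1) by (simp add: bij_betw_def endo_inj_surj)
qed

lemma lab_simps: "lab 0 = 0" "lab (2 * s) = s" "lab (Suc (4 * l)) = 0" "lab (4 * l + 3) = 0" "odd u \<Longrightarrow> lab u = 0"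
  "scalar u \<Longrightarrow> lab u = 0"
  by (auto simp: lab_def dest: scalar_cases)

lemma tau_sg_abc:
  assumes "abc a b c"
  shows "tau a (tau b x) = tau c x" "sg b x * sg a (tau b x) = sg c x"
proof -
  have "tau a (tau b x) = tau c x \<and> sg b x * sg a (tau b x) = sg c x"
    using assms
  proof cases
    case (d2 y z w)
    have "\<phi> y + (\<phi> z + x) = \<phi> w + x" using rels[OF d2(4)] by (simp add: add.assoc[symmetric])
    then show ?thesis using d2 R[OF d2(4)] by (auto simp: tau_def sg_def lab_simps)
  next
    case px
    have "lab 2 = 1" "lab 4 = 2" by (simp_all add: lab_def)
    then show ?thesis using px chi_shift by (auto simp: tau_def sg_def)
  next
    case py
    have "lab 2 = 1" "lab 4 = 2" by (simp_all add: lab_def)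
    then show ?thesis using py chi_shift by (auto simp: tau_def sg_def)
  qed (use R in \<open>auto simp: tau_def sg_def lab_simps\<close>)
  then show "tau a (tau b x) = tau c x" "sg b x * sg a (tau b x) = sg c x" by auto
qed

lemma tau_swap:
  "tau (PA 2) (tau (PB 4) x) = tau PX x" "tau (PA 4) (tau (PB 2) x) = tau PY x" "tau PX x = tau PY x"
  using tau_sg_abc(1)[OF abc.px] tau_sg_abc(1)[OF abc.py] by (simp_all add: tau_def)

end

section \<open>Linear forms modulo a large prime\<close>

locale weighted_model = gadget_model R n \<phi> \<Omega> for R n and \<phi> :: "nat \<Rightarrow> 'g :: group_add" and \<Omega> +
  fixes wt :: "pt \<Rightarrow> nat" and D :: nat and P :: int
  assumes wt_le: "\<And>a b c. a \<in> sideA \<Longrightarrow> b \<in> sideB \<Longrightarrow> c \<in> sideC \<Longrightarrow> wt a + wt b \<le> D \<and> wt c \<le> D"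
    and wt_neq: "\<And>p q S. S \<in> {sideA, sideB, sideC} \<Longrightarrow> p \<in> S \<Longrightarrow> q \<in> S \<Longrightarrow> p \<noteq> q \<Longrightarrow> {p, q} \<noteq> {PX, PY} \<Longrightarrow> wt p \<noteq> wt q"
    and wt_sum: "\<And>a b c. a \<in> sideA \<Longrightarrow> b \<in> sideB \<Longrightarrow> c \<in> sideC \<Longrightarrow> wt a + wt b = wt c \<Longrightarrow>
       abc a b c \<or> (a = PA 2 \<and> b = PB 4 \<and> c = PY) \<or> (a = PA 4 \<and> b = PB 2 \<and> c = PX)"
    and wt_abc: "\<And>a b c. abc a b c \<Longrightarrow> wt a + wt b = wt c" and wt_XY: "wt PX = wt PY"
    and P: "prime P" "2 ^ (2 * D * card \<Omega>) < P" "P \<noteq> 2"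
begin

text \<open>The weighted translation attached to a point, acting on functions by substitution. This
  reverses the order of composition: the product of \<open>a\<close> and \<open>b\<close> is applied
  as \<open>M b (M a f)\<close>.\<close>

definition M :: "pt \<Rightarrow> ('g \<Rightarrow> int) \<Rightarrow> 'g \<Rightarrow> int" where
  "M p f b = 2 ^ wt p * sg p b * f (tau p b)"

definition nul :: "('g \<Rightarrow> int) \<Rightarrow> bool" where "nul f \<longleftrightarrow> (\<forall>b\<in>\<Omega>. P dvd f b)"

lemma P_odd: "odd P" using P(1,3) prime_ge_2_int[OF P(1)] by (intro prime_odd_int) auto

lemma unit_dvd: "P dvd 2 ^ k * x \<longleftrightarrow> P dvd x"
proof -
  have "coprime P (2 ^ k)" using P_odd by (simp add: coprime_commute)
  then show ?thesis by (simp add: coprime_dvd_mult_right_iff)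
qed

lemma sign_dvd: "P dvd sg p b * x \<longleftrightarrow> P dvd x" "P dvd chi b * x \<longleftrightarrow> P dvd x"
  by (auto simp: sg_def chi_def)

lemma nul_M: "nul (M p f) \<longleftrightarrow> nul f"
proof -
  have "nul (M p f) \<longleftrightarrow> (\<forall>b\<in>\<Omega>. P dvd f (tau p b))"
    unfolding nul_def M_def by (simp add: unit_dvd sign_dvd mult.assoc)
  also have "\<dots> \<longleftrightarrow> (\<forall>c\<in>tau p ` \<Omega>. P dvd f c)" by blast
  also have "tau p ` \<Omega> = \<Omega>" using tau_bij by (simp add: bij_betw_def)
  finally show ?thesis by (simp add: nul_def)
qed

lemma nul_diff: "nul f \<Longrightarrow> nul g \<Longrightarrow> nul (\<lambda>b. f b - g b)" by (simp add: nul_def)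

lemma nul_diffD: "nul (\<lambda>b. f b - g b) \<Longrightarrow> nul f \<longleftrightarrow> nul g"
  using dvd_add_right_iff[of P "f b - g b" "g b" for b] by (simp add: nul_def)

lemma nul_cong: "nul (\<lambda>b. f b - g b) \<Longrightarrow> nul (\<lambda>b. g b - f b)"
  by (auto simp: nul_def dvd_diff_commute)

lemma nul_trans: "nul (\<lambda>b. f b - g b) \<Longrightarrow> nul (\<lambda>b. g b - h b) \<Longrightarrow> nul (\<lambda>b. f b - h b)"
  using dvd_add[of P "f b - g b" "g b - h b" for b] by (simp add: nul_def)

lemma M_diff: "M p (\<lambda>b. f b - g b) = (\<lambda>b. M p f b - M p g b)"
  by (auto simp: M_def algebra_simps)

lemma M_abc: "abc a b c \<Longrightarrow> M b (M a f) = M c f"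
proof
  fix x assume abc: "abc a b c"
  have "M b (M a f) x = 2 ^ (wt a + wt b) * (sg b x * sg a (tau b x)) * f (tau a (tau b x))"
    by (simp add: M_def power_add mult_ac)
  then show "M b (M a f) x = M c f x" by (simp only: tau_sg_abc[OF abc] wt_abc[OF abc] M_def)
qed

lemma weights_separate:
  assumes "w \<noteq> w'" "w \<le> D" "w' \<le> D" "bij_betw t \<Omega> \<Omega>" "bij_betw t' \<Omega> \<Omega>"
    "\<And>b. b \<in> \<Omega> \<Longrightarrow> s b ^ 2 = 1" "\<And>b. b \<in> \<Omega> \<Longrightarrow> s' b ^ 2 = (1 :: int)"
    and eq: "nul (\<lambda>b. 2 ^ w * s b * f (t b) - 2 ^ w' * s' b * f (t' b))"
  shows "nul f"
proof -
  have e: "[2 ^ w * s b * f (t b) = 2 ^ w' * s' b * f (t' b)] (mod P)" if "b \<in> \<Omega>" for b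
    using eq that by (simp add: nul_def cong_iff_dvd_diff)
  have "[f c = 0] (mod P)" if "c \<in> \<Omega>" for c
  proof (cases "w < w'")
    case True
    show ?thesis
      by (rule weighted_fixed_zero[OF P Om(1) assms(4,5,6,7) True assms(3) e that])
  next
    case False
    then have less: "w' < w" using assms(1) by simp
    show ?thesis
      by (rule weighted_fixed_zero[OF P Om(1) assms(5,4,7,6) less assms(2) cong_sym[OF e] that])
  qed
  then show ?thesis by (simp add: nul_def cong_0_iff)
qed

text \<open>The two operators differ by a sign, so their difference is twice one of them, whence the
  exponent \<open>wt PX + 1\<close>; and 2 is invertible modulo the odd prime.\<close>

lemma PX_PY_separate:
  assumes "nul (\<lambda>b. M PX f b - M PY f b)"
  shows "nul f"
proof -
  have "M PX f b - M PY f b = 2 ^ (wt PX + 1) * (- (chi b * f (tau PX b)))" for b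
    using wt_XY tau_swap(3) by (simp add: M_def sg_def)
  then have "nul (\<lambda>b. 2 ^ (wt PX + 1) * (- (chi b * f (tau PX b))))" using assms by simp
  then have "\<forall>b\<in>\<Omega>. P dvd f (tau PX b)" unfolding nul_def unit_dvd dvd_minus_iff sign_dvd .
  then have "nul (M PX f)" unfolding nul_def M_def by simp
  then show ?thesis by (simp add: nul_M)
qed

lemma sideA0: "PA 0 \<in> sideA" and sideB0: "PB 0 \<in> sideB" and sideC0: "PX \<in> sideC"
  using indexI(1)[OF scalarI(1)] by (auto simp: sideA_def sideB_def sideC_def)

lemma side_separate:
  assumes S: "S \<in> {sideA, sideB, sideC}" "p \<in> S" "q \<in> S" "p \<noteq> q" and eq: "nul (\<lambda>b. M p f b - M q f b)"
  shows "nul f"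
proof (cases "{p, q} = {PX, PY}")
  case True
  then have "(p = PX \<and> q = PY) \<or> (p = PY \<and> q = PX)" by (simp add: doubleton_eq_iff)
  then show ?thesis
  proof (elim disjE conjE)
    assume "p = PX" "q = PY"
    then show ?thesis using eq by (simp add: PX_PY_separate[of f])
  next
    assume "p = PY" "q = PX"
    then show ?thesis using nul_cong[OF eq] by (simp add: PX_PY_separate[of f])
  qed
next
  case False
  have D: "wt p \<le> D" "wt q \<le> D"
    using S wt_le[OF _ sideB0 sideC0, of p] wt_le[OF sideA0 _ sideC0, of p] wt_le[OF sideA0 sideB0, of p]
       wt_le[OF _ sideB0 sideC0, of q] wt_le[OF sideA0 _ sideC0, of q] wt_le[OF sideA0 sideB0, of q]
    by auto
  show ?thesis
    by (rule weights_separate[OF wt_neq[OF S False] D tau_bij[of p] tau_bij[of q] sg_sq[of p] sg_sq[of q] eq[unfolded M_def]])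
qed

text \<open>If the weights balance without incidence, \<open>c\<close> is the wrong one of
  \<open>PX\<close> and \<open>PY\<close>, and signs decide. Otherwise two operators with different
  powers of 2 agree on \<open>f\<close>, so \<open>f\<close> vanishes by
  \<open>weights_separate\<close>.\<close>

lemma triple_separate:
  assumes abc: "a \<in> sideA" "b \<in> sideB" "c \<in> sideC" "\<not> abc a b c" and eq: "nul (\<lambda>x. M b (M a f) x - M c f x)"
  shows "nul f"
proof (cases "wt a + wt b = wt c")
  case True
  then consider "a = PA 2" "b = PB 4" "c = PY" | "a = PA 4" "b = PB 2" "c = PX"
    using wt_sum[OF abc(1-3)] abc(4) by blast
  then show ?thesis
  proof cases
    case 1
    then show ?thesis using eq PX_PY_separate[of f] M_abc[OF abc.px, of f] by simp
  next
    case 2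
    then show ?thesis using eq nul_cong PX_PY_separate[of f] M_abc[OF abc.py, of f] by simp
  qed
next
  case False
  have MM: "M b (M a f) x = 2 ^ (wt a + wt b) * (sg b x * sg a (tau b x)) * f ((tau a \<circ> tau b) x)" for x
    by (simp add: M_def power_add mult_ac)
  have "bij_betw (tau a \<circ> tau b) \<Omega> \<Omega>" by (rule bij_betw_trans[OF tau_bij tau_bij])
  moreover have "(sg b x * sg a (tau b x)) ^ 2 = 1" for x by (simp add: power_mult_distrib sg_sq)
  ultimately show ?thesis
    using eq wt_le[OF abc(1-3)] False
    by (intro weights_separate[of "wt a + wt b" "wt c" "tau a \<circ> tau b" "tau c" "\<lambda>x. sg b x * sg a (tau b x)" "sg c" f])
       (auto simp: MM tau_bij sg_sq M_def[of c])
qed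

definition src :: "pt \<Rightarrow> nat" where
  "src p = (if p \<in> sideB then 1 else 0)"

definition dst :: "pt \<Rightarrow> nat" where
  "dst p = (if p \<in> sideA then 1 else 2)"

text \<open>On a line \<open>abc a b c\<close> the form of \<open>c\<close> is the form of
  \<open>b\<close> plus the image under \<open>M b\<close> of the form of \<open>a\<close>; this is
  the linear dependence behind collinearity.\<close>

definition form :: "pt \<Rightarrow> (nat \<Rightarrow> 'g \<Rightarrow> int) \<Rightarrow> 'g \<Rightarrow> int" where
  "form p x = (case p of JJ i \<Rightarrow> x i | _ \<Rightarrow> \<lambda>b. x (dst p) b - M p (x (src p)) b)"

text \<open>The frame line containing a point is recorded by the index of the frame point off it.\<close>

definition offs :: "pt \<Rightarrow> nat set" where
  "offs p = (case p of JJ i \<Rightarrow> {0, 1, 2} - {i} | _ \<Rightarrow> {3 - src p - dst p})"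

lemma sides_disjoint: "sideA \<inter> sideB = {}" "sideA \<inter> sideC = {}" "sideB \<inter> sideC = {}" "JJ i \<notin> sideA" "JJ i \<notin> sideB" "JJ i \<notin> sideC"
  by (auto simp: sideA_def sideB_def sideC_def)

lemma form_sides:
  "form (JJ i) x = x i"
  "a \<in> sideA \<Longrightarrow> form a x = (\<lambda>b. x 1 b - M a (x 0) b)"
  "b \<in> sideB \<Longrightarrow> form b x = (\<lambda>t. x 2 t - M b (x 1) t)"
  "c \<in> sideC \<Longrightarrow> form c x = (\<lambda>b. x 2 b - M c (x 0) b)"
proof -
  show "form (JJ i) x = x i" by (simp add: form_def)
  have J: "form p x = (\<lambda>b. x (dst p) b - M p (x (src p)) b)" if "p \<in> sideA \<union> sideB \<union> sideC" for p
    using that sides_disjoint(4-6) by (cases p) (simp_all add: form_def)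
  show "form a x = (\<lambda>b. x 1 b - M a (x 0) b)" if "a \<in> sideA"
    using that sides_disjoint J[of a] by (auto simp: src_def dst_def)
  show "form b x = (\<lambda>t. x 2 t - M b (x 1) t)" if "b \<in> sideB"
    using that sides_disjoint J[of b] by (auto simp: src_def dst_def)
  show "form c x = (\<lambda>b. x 2 b - M c (x 0) b)" if "c \<in> sideC"
    using that sides_disjoint J[of c] by (auto simp: src_def dst_def)
qed

lemma offs_sides: "offs (JJ i) = {0, 1, 2} - {i}" "a \<in> sideA \<Longrightarrow> offs a = {2}" "b \<in> sideB \<Longrightarrow> offs b = {0}" "c \<in> sideC \<Longrightarrow> offs c = {1}"
proof -
  show "offs (JJ i) = {0, 1, 2} - {i}" by (simp add: offs_def)
  have J: "offs p = {3 - src p - dst p}" if "p \<in> sideA \<union> sideB \<union> sideC" for p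
    using that sides_disjoint(4-6) by (cases p) (simp_all add: offs_def)
  show "offs a = {2}" if "a \<in> sideA" using that sides_disjoint J[of a] by (auto simp: src_def dst_def)
  show "offs b = {0}" if "b \<in> sideB" using that sides_disjoint J[of b] by (auto simp: src_def dst_def)
  show "offs c = {1}" if "c \<in> sideC" using that sides_disjoint J[of c] by (auto simp: src_def dst_def)
qed

lemma point_cases:
  assumes "p \<in> points"
  obtains i where "i < 3" "p = JJ i" | "p \<in> sideA" | "p \<in> sideB" | "p \<in> sideC"
  using assms unfolding points_sides by auto

lemma side_lines: "sideA \<subseteq> line12" "sideB \<subseteq> line23" "sideC \<subseteq> line13"
  by (auto simp: sideA_def sideB_def sideC_def line12_def line23_def line13_def)

lemma offs_line:
  assumes "p \<in> points" "k \<in> offs p"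
  shows "(k = 2 \<and> p \<in> line12) \<or> (k = 0 \<and> p \<in> line23) \<or> (k = 1 \<and> p \<in> line13)"
  using assms(1)
proof (cases rule: point_cases)
  case (1 i)
  then have "i = 0 \<or> i = 1 \<or> i = 2" by auto
  then show ?thesis using 1 assms(2) by (auto simp: offs_sides line12_def line23_def line13_def)
qed (use assms(2) side_lines in \<open>auto simp: offs_sides\<close>)

lemma line_offs:
  assumes "p \<in> points"
  shows "p \<in> line12 \<Longrightarrow> 2 \<in> offs p" "p \<in> line23 \<Longrightarrow> 0 \<in> offs p" "p \<in> line13 \<Longrightarrow> 1 \<in> offs p"
  using assms
  by (cases rule: point_cases; auto simp: offs_sides line12_def line23_def line13_def sideA_def sideB_def sideC_def)+

lemma offs_coll:
  assumes "p \<in> points" "q \<in> points" "r \<in> points" "k \<in> offs p" "k \<in> offs q" "k \<in> offs r"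
  shows "coll p q r"
proof -
  have "(\<exists>L\<in>{line12, line23, line13}. p \<in> L \<and> q \<in> L \<and> r \<in> L)"
    using offs_line[OF assms(1,4)] offs_line[OF assms(2,5)] offs_line[OF assms(3,6)] by auto
  then show ?thesis unfolding coll_def unfolding lines_def by blast
qed

lemma nul_M0: "nul f \<Longrightarrow> nul (M p f)" by (simp add: nul_M)

lemma line_solve:
  assumes S: "S \<in> {sideA, sideB, sideC}" "p \<in> S" "q \<in> S" "p \<noteq> q"
    and eq: "nul (\<lambda>b. y b - M p x b)" "nul (\<lambda>b. y b - M q x b)"
  shows "nul x" "nul y"
proof -
  show x: "nul x" by (rule side_separate[OF S nul_trans[OF nul_cong[OF eq(1)] eq(2)]])
  show "nul y" using nul_diffD[OF eq(1)] nul_M0[OF x] by simp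
qed

text \<open>The points of a frame line involve only the two coordinates different from
  \<open>k\<close>. Two side points force both to vanish by \<open>side_separate\<close>; a frame
  point makes one vanish, and a side point transports this to the other.\<close>

lemma frame_solve:
  assumes pts: "p \<in> points" "q \<in> points" and "p \<noteq> q" and k: "k \<in> offs p" "k \<in> offs q"
    and nul: "nul (form p x)" "nul (form q x)" and i: "i < 3" "i \<noteq> k"
  shows "nul (x i)"
proof -
  have two: "nul (x s) \<and> nul (x t)"
    if T: "S \<in> {sideA, sideB, sideC}" "\<And>r. r \<in> S \<Longrightarrow> form r x = (\<lambda>b. x t b - M r (x s) b)"
      and p: "p = JJ s \<or> p = JJ t \<or> p \<in> S" and q: "q = JJ s \<or> q = JJ t \<or> q \<in> S" for S s t
  proof -
    have one: "nul (x s) \<longleftrightarrow> nul (x t)" if "r \<in> S" "nul (form r x)" for r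
      using nul_diffD[of "x t" "M r (x s)"] T(2)[OF that(1)] that(2) by (simp add: nul_M)
    show ?thesis
    proof (cases "p \<in> S \<and> q \<in> S")
      case True
      then show ?thesis using line_solve[OF T(1), of p q "x t" "x s"] T(2) nul \<open>p \<noteq> q\<close> by simp
    next
      case False
      then show ?thesis using p q \<open>p \<noteq> q\<close> nul one by (auto simp: form_sides(1))
    qed
  qed
  have k012: "k = 0 \<or> k = 1 \<or> k = 2" using offs_line[OF pts(1) k(1)] by blast
  have i012: "i = 0 \<or> i = 1 \<or> i = 2" using i by auto
  have on: "(k = 2 \<and> (p = JJ 0 \<or> p = JJ 1 \<or> p \<in> sideA)) \<or> (k = 0 \<and> (p = JJ 1 \<or> p = JJ 2 \<or> p \<in> sideB))
      \<or> (k = 1 \<and> (p = JJ 0 \<or> p = JJ 2 \<or> p \<in> sideC))" if "p \<in> points" "k \<in> offs p" for p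
    using that(1)
  proof (cases rule: point_cases)
    case (1 i)
    then have "i = 0 \<or> i = 1 \<or> i = 2" by auto
    then show ?thesis using 1 that(2) by (auto simp: offs_sides)
  qed (use that(2) in \<open>auto simp: offs_sides\<close>)
  note on = on[OF pts(1) k(1)] on[OF pts(2) k(2)]
  from k012 show ?thesis
  proof (elim disjE)
    assume "k = 0"
    then have "nul (x 1) \<and> nul (x 2)" using on by (intro two[of sideB] form_sides) auto
    then show ?thesis using i012 i(2) \<open>k = 0\<close> by auto
  next
    assume "k = 1"
    then have "nul (x 0) \<and> nul (x 2)" using on by (intro two[of sideC] form_sides) auto
    then show ?thesis using i012 i(2) \<open>k = 1\<close> by auto
  next
    assume "k = 2"
    then have "nul (x 0) \<and> nul (x 1)" using on by (intro two[of sideA] form_sides) auto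
    then show ?thesis using i012 i(2) \<open>k = 2\<close> by auto
  qed
qed

lemma off_solve:
  assumes r: "r \<in> points" "k \<notin> offs r" "k < 3" "nul (form r x)" and others: "\<And>i. i < 3 \<Longrightarrow> i \<noteq> k \<Longrightarrow> nul (x i)"
  shows "nul (x k)"
proof -
  have i: "nul (x s) \<longleftrightarrow> nul (x t)" if "form r x = (\<lambda>b. x t b - M r (x s) b)" for s t
    using nul_diffD[of "x t" "M r (x s)"] that r(4) by (simp add: nul_M)
  have k: "k = 0 \<or> k = 1 \<or> k = 2" using r(3) by auto
  from r(1) show ?thesis
  proof (cases rule: point_cases)
    case (1 i)
    then have "k = i" using r(2) k by (auto simp: offs_sides)
    then show ?thesis using 1 r(4) by (simp add: form_sides)
  next
    case 2
    then show ?thesis using i[of 1 0, OF form_sides(2)] others[of 0] others[of 1] k r(2) by (auto simp: offs_sides)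
  next
    case 3
    then show ?thesis using i[of 2 1, OF form_sides(3)] others[of 1] others[of 2] k r(2) by (auto simp: offs_sides)
  next
    case 4
    then show ?thesis using i[of 2 0, OF form_sides(4)] others[of 0] others[of 2] k r(2) by (auto simp: offs_sides)
  qed
qed

lemma frame_solve3:
  assumes "p \<in> points" "q \<in> points" "r \<in> points" "\<not> coll p q r" "k \<in> offs p" "k \<in> offs q"
    "nul (form p x)" "nul (form q x)" "nul (form r x)" "i < 3"
  shows "nul (x i)"
proof -
  have "p \<noteq> q" using assms(4) by (auto simp: coll_def)
  then have o: "nul (x i)" if "i < 3" "i \<noteq> k" for i
    using frame_solve[OF assms(1,2) _ assms(5,6,7,8) that] by blast
  have "k \<notin> offs r" using offs_coll[OF assms(1-3) assms(5,6)] assms(4) by blast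
  moreover have "k < 3" using offs_line[OF assms(1,5)] by auto
  ultimately have "nul (x k)" using off_solve[OF assms(3) _ _ assms(9)] o by blast
  then show ?thesis using o assms(10) by (cases "i = k") auto
qed

text \<open>If two of the points share a frame line, they annihilate its two coordinates and the
  third point the remaining one. Otherwise there is one point on each side, and eliminating
  coordinates leads to \<open>triple_separate\<close>.\<close>

lemma noncoll_solve:
  assumes pts: "p \<in> points" "q \<in> points" "r \<in> points" and nc: "\<not> coll p q r"
    and nul: "nul (form p x)" "nul (form q x)" "nul (form r x)" and i: "i < 3"
  shows "nul (x i)"
proof (cases "offs p \<inter> offs q = {} \<and> offs p \<inter> offs r = {} \<and> offs q \<inter> offs r = {}")
  case False
  then consider k where "k \<in> offs p" "k \<in> offs q" | k where "k \<in> offs p" "k \<in> offs r" | k where "k \<in> offs q" "k \<in> offs r" by blast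
  then show ?thesis
  proof cases
    case 1
    then show ?thesis using frame_solve3[OF pts nc _ _ nul i] by blast
  next
    case 2
    have "\<not> coll p r q" using nc coll_perm(2) by blast
    then show ?thesis using frame_solve3[OF pts(1,3,2) _ _ _ nul(1,3,2) i] 2 by blast
  next
    case 3
    have "\<not> coll q r p" using nc coll_perm by blast
    then show ?thesis using frame_solve3[OF pts(2,3,1) _ _ _ nul(2,3,1) i] 3 by blast
  qed
next
  case disj: True
  have abc: "nul (x i)" if "a \<in> sideA" "b \<in> sideB" "c \<in> sideC" "\<not> coll a b c"
     "nul (form a x)" "nul (form b x)" "nul (form c x)" for a b c
  proof -
    have f: "nul (\<lambda>t. x 1 t - M a (x 0) t)" "nul (\<lambda>t. x 2 t - M b (x 1) t)" "nul (\<lambda>t. x 2 t - M c (x 0) t)"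
      using that form_sides by simp_all
    have "nul (\<lambda>t. M b (x 1) t - M b (M a (x 0)) t)" using nul_M0[OF f(1), of b] by (simp only: M_diff)
    then have "nul (\<lambda>t. M b (M a (x 0)) t - M c (x 0) t)"
      by (rule nul_trans[OF nul_cong nul_trans[OF nul_cong[OF f(2)] f(3)]])
    moreover have "\<not> abc a b c" using that(4) coll_abc by blast
    ultimately have x0: "nul (x 0)" using triple_separate[OF that(1-3)] by blast
    then have x1: "nul (x 1)" using nul_diffD[OF f(1)] by (simp add: nul_M)
    then have "nul (x 2)" using nul_diffD[OF f(2)] by (simp add: nul_M)
    moreover have "i = 0 \<or> i = 1 \<or> i = 2" using i by auto
    ultimately show ?thesis using x0 x1 by auto
  qed
  \<comment> \<open>A frame point lies on two of the three frame lines, so two points avoiding both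
    of these would share the third.\<close>
  have J: "\<not> (i < 3 \<and> p = JJ i)" if "p \<in> points" "q \<in> points" "r \<in> points"
    "offs p \<inter> offs q = {}" "offs p \<inter> offs r = {}" "offs q \<inter> offs r = {}" for p q r i
  proof
    assume i: "i < 3 \<and> p = JJ i"
    then have op: "offs p = {0, 1, 2} - {i}" by (simp add: offs_sides)
    have "offs s \<noteq> {} \<and> offs s \<subseteq> {0, 1, 2}" if "s \<in> points" for s
      using that
    proof (cases rule: point_cases)
      case (1 i)
      then have "i = 0 \<or> i = 1 \<or> i = 2" by auto
      then show ?thesis using 1 by (auto simp: offs_sides)
    qed (auto simp: offs_sides)
    note sub = this[OF that(2)] this[OF that(3)]
    have "offs s = {i}" if "offs s \<noteq> {}" "offs s \<subseteq> {0, 1, 2}" "offs p \<inter> offs s = {}" for s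
    proof -
      have "offs s \<subseteq> {i}" using that(2,3) unfolding op by blast
      then show ?thesis using that(1) by (simp add: subset_singleton_iff)
    qed
    then have "offs q = {i}" "offs r = {i}" using sub that(4,5) by simp_all
    then show False using that(6) by simp
  qed
  have nJ: "s \<in> sideA \<or> s \<in> sideB \<or> s \<in> sideC" if "s \<in> points" "\<And>i. \<not> (i < 3 \<and> s = JJ i)" for s
    using that by (cases rule: point_cases) blast+
  have sides: "p \<in> sideA \<or> p \<in> sideB \<or> p \<in> sideC" "q \<in> sideA \<or> q \<in> sideB \<or> q \<in> sideC" "r \<in> sideA \<or> r \<in> sideB \<or> r \<in> sideC"
    using nJ[OF pts(1) J[of p q r]] nJ[OF pts(2) J[of q p r]] nJ[OF pts(3) J[of r p q]] pts disj by (simp_all add: Int_commute)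
  have same: "\<not> (s \<in> S \<and> t \<in> S)" if "offs s \<inter> offs t = {}" "S \<in> {sideA, sideB, sideC}" for s t S
    using that by (auto simp: offs_sides)
  have "\<not> (p \<in> S \<and> q \<in> S) \<and> \<not> (p \<in> S \<and> r \<in> S) \<and> \<not> (q \<in> S \<and> r \<in> S)" if "S \<in> {sideA, sideB, sideC}" for S
    using same[OF _ that] disj by blast
  then have
    "\<not> (p \<in> sideA \<and> q \<in> sideA) \<and> \<not> (p \<in> sideA \<and> r \<in> sideA) \<and> \<not> (q \<in> sideA \<and> r \<in> sideA)"
    "\<not> (p \<in> sideB \<and> q \<in> sideB) \<and> \<not> (p \<in> sideB \<and> r \<in> sideB) \<and> \<not> (q \<in> sideB \<and> r \<in> sideB)"
    "\<not> (p \<in> sideC \<and> q \<in> sideC) \<and> \<not> (p \<in> sideC \<and> r \<in> sideC) \<and> \<not> (q \<in> sideC \<and> r \<in> sideC)"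
    by simp_all
  with sides have "(p \<in> sideA \<and> q \<in> sideB \<and> r \<in> sideC) \<or> (p \<in> sideA \<and> r \<in> sideB \<and> q \<in> sideC)
    \<or> (q \<in> sideA \<and> p \<in> sideB \<and> r \<in> sideC) \<or> (q \<in> sideA \<and> r \<in> sideB \<and> p \<in> sideC)
    \<or> (r \<in> sideA \<and> p \<in> sideB \<and> q \<in> sideC) \<or> (r \<in> sideA \<and> q \<in> sideB \<and> p \<in> sideC)" by argo
  then consider
      "p \<in> sideA" "q \<in> sideB" "r \<in> sideC" | "p \<in> sideA" "r \<in> sideB" "q \<in> sideC"
    | "q \<in> sideA" "p \<in> sideB" "r \<in> sideC" | "q \<in> sideA" "r \<in> sideB" "p \<in> sideC"
    | "r \<in> sideA" "p \<in> sideB" "q \<in> sideC" | "r \<in> sideA" "q \<in> sideB" "p \<in> sideC" by blast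
  then show ?thesis
  proof cases
    case 1
    then show ?thesis by (rule abc[OF _ _ _ nc nul])
  next
    case 2
    have "\<not> coll p r q" using nc coll_perm(2) by blast
    then show ?thesis by (rule abc[OF 2(1,2,3) _ nul(1,3,2)])
  next
    case 3
    have "\<not> coll q p r" using nc coll_perm(1) by blast
    then show ?thesis by (rule abc[OF 3(1,2,3) _ nul(2,1,3)])
  next
    case 4
    have "\<not> coll q r p" using nc coll_perm by blast
    then show ?thesis by (rule abc[OF 4(1,2,3) _ nul(2,3,1)])
  next
    case 5
    have "\<not> coll r p q" using nc coll_perm by blast
    then show ?thesis by (rule abc[OF 5(1,2,3) _ nul(3,1,2)])
  next
    case 6
    have "\<not> coll r q p" using nc coll_perm(3) by blast
    then show ?thesis by (rule abc[OF 6(1,2,3) _ nul(3,2,1)])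
  qed
qed

lemma coll_solve:
  assumes pts: "p \<in> points" "q \<in> points" "r \<in> points" and c: "coll p q r" "p \<noteq> q"
    and nul: "nul (form p x)" "nul (form q x)"
  shows "nul (form r x)"
proof -
  have third: "nul (form s x)" if "k \<in> offs p" "k \<in> offs q" "k \<in> offs s" "s \<in> points" for k s
  proof -
    have o: "nul (x i)" if "i < 3" "i \<noteq> k" for i
      using frame_solve[OF pts(1,2) c(2) \<open>k \<in> offs p\<close> \<open>k \<in> offs q\<close> nul that] .
    have lin: "nul (form s x)" if "form s x = (\<lambda>b. x t b - M s (x u) b)" "nul (x t)" "nul (x u)" for t u
      unfolding that(1) by (rule nul_diff[OF that(2) nul_M0[OF that(3)]])
    from that(4) show ?thesis
    proof (cases rule: point_cases)
      case (1 i)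
      then show ?thesis using that(3) o by (auto simp: offs_sides form_sides)
    next
      case 2
      then show ?thesis using lin[OF form_sides(2)] o[of 0] o[of 1] that(3) by (auto simp: offs_sides)
    next
      case 3
      then show ?thesis using lin[OF form_sides(3)] o[of 1] o[of 2] that(3) by (auto simp: offs_sides)
    next
      case 4
      then show ?thesis using lin[OF form_sides(4)] o[of 0] o[of 2] that(3) by (auto simp: offs_sides)
    qed
  qed
  consider "r = p \<or> r = q" | L where "L \<in> {line12, line23, line13}" "p \<in> L" "q \<in> L" "r \<in> L"
    | a b c where "abc a b c" "p \<in> {a, b, c}" "q \<in> {a, b, c}" "r \<in> {a, b, c}"
    using c unfolding coll_def unfolding lines_def by blast
  then show ?thesis
  proof cases
    case 1
    then show ?thesis using nul by auto
  next
    case 2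
    then obtain k where "k \<in> offs p" "k \<in> offs q" "k \<in> offs r"
      using line_offs[OF pts(1)] line_offs[OF pts(2)] line_offs[OF pts(3)] by auto
    then show ?thesis using third pts(3) by blast
  next
    case (3 a b c)
    have s: "a \<in> sideA" "b \<in> sideB" "c \<in> sideC" using abc_in_sides[OF 3(1)] by auto
    let ?A = "nul (\<lambda>t. x 1 t - M a (x 0) t)" and ?B = "nul (\<lambda>t. x 2 t - M b (x 1) t)" and ?C = "nul (\<lambda>t. x 2 t - M c (x 0) t)"
    have f: "nul (form a x) \<longleftrightarrow> ?A" "nul (form b x) \<longleftrightarrow> ?B" "nul (form c x) \<longleftrightarrow> ?C" using s form_sides by simp_all
    have A: "?A \<longleftrightarrow> nul (\<lambda>t. M b (x 1) t - M c (x 0) t)"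
      using nul_M[of b "\<lambda>t. x 1 t - M a (x 0) t"] by (simp only: M_diff M_abc[OF 3(1)])
    have AB: "?A \<Longrightarrow> ?B \<Longrightarrow> ?C" unfolding A by (rule nul_trans)
    have AC: "?A \<Longrightarrow> ?C \<Longrightarrow> ?B" unfolding A by (rule nul_trans[OF _ nul_cong])
    have BC: "?B \<Longrightarrow> ?C \<Longrightarrow> ?A" unfolding A by (rule nul_trans[OF nul_cong])
    show ?thesis using 3(2-4) nul c(2) AB AC BC unfolding f[symmetric] by auto
  qed
qed

lemma form_diff: "form p (\<lambda>i b. x i b - x' i b) = (\<lambda>b. form p x b - form p x' b)"
  by (cases p) (simp_all add: form_def M_diff fun_eq_iff)

lemma form_nul:
  assumes "p \<in> points" "\<And>i. i < 3 \<Longrightarrow> nul (x i)"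
  shows "nul (form p x)"
  using assms(1)
proof (cases rule: point_cases)
  case 2
  then show ?thesis using assms(2)[of 0] assms(2)[of 1] by (simp add: form_sides nul_diff nul_M0)
next
  case 3
  then show ?thesis using assms(2)[of 1] assms(2)[of 2] by (simp add: form_sides nul_diff nul_M0)
next
  case 4
  then show ?thesis using assms(2)[of 0] assms(2)[of 2] by (simp add: form_sides nul_diff nul_M0)
qed (simp add: form_sides assms(2))

section \<open>The uniform distribution on triples of functions modulo the prime\<close>

definition K :: "('g \<Rightarrow> int) set" where
  "K = {f. \<forall>b. (b \<in> \<Omega> \<longrightarrow> f b \<in> {0..<P}) \<and> (b \<notin> \<Omega> \<longrightarrow> f b = 0)}"

definition val :: "pt \<Rightarrow> (nat \<Rightarrow> 'g \<Rightarrow> int) \<Rightarrow> 'g \<Rightarrow> int" where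
  "val p x b = (if b \<in> \<Omega> then form p x b mod P else 0)"

definition smp :: "(nat \<Rightarrow> 'g \<Rightarrow> int) set" where
  "smp = ({..<3} \<rightarrow>\<^sub>E K)"

lemma P_gt: "2 \<le> P" using P(1) by (rule prime_ge_2_int)

lemma finite_K: "finite K" unfolding K_def using Om(1) by (rule finite_set_of_finite_funs) simp

lemma card_K: "2 \<le> card K"
proof -
  have "(\<lambda>_. 0) \<in> K" "(\<lambda>b. if b \<in> \<Omega> then 1 else 0) \<in> K" using P_gt by (auto simp: K_def)
  moreover have "(\<lambda>_. 0) \<noteq> (\<lambda>b. if b \<in> \<Omega> then 1 else 0 :: int)" using Om(2) by (auto simp: fun_eq_iff)
  ultimately have "{(\<lambda>_. 0), (\<lambda>b. if b \<in> \<Omega> then 1 else 0 :: int)} \<subseteq> K" "card {(\<lambda>_. 0), (\<lambda>b. if b \<in> \<Omega> then 1 else 0 :: int)} = 2"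
    by (blast, simp only: card_2_iff, blast)
  then show ?thesis using card_mono[OF finite_K] by metis
qed

lemma val_K: "val p x \<in> K" using P_gt by (simp add: K_def val_def)

lemma val_eq_iff: "val p x = val p x' \<longleftrightarrow> nul (form p (\<lambda>i b. x i b - x' i b))"
  unfolding form_diff nul_def by (auto simp: val_def fun_eq_iff mod_eq_dvd_iff)

lemma smp_eqI:
  assumes x: "x \<in> smp" "x' \<in> smp" and nul: "\<And>i. i < 3 \<Longrightarrow> nul (\<lambda>b. x i b - x' i b)"
  shows "x = x'"
proof (rule PiE_ext)
  show "x \<in> {..<3} \<rightarrow>\<^sub>E K" "x' \<in> {..<3} \<rightarrow>\<^sub>E K" using x by (simp_all add: smp_def)
  fix i :: nat assume i: "i \<in> {..<3}"
  then have K: "x i \<in> K" "x' i \<in> K" using x by (auto simp: smp_def)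
  show "x i = x' i"
  proof
    fix b show "x i b = x' i b"
    proof (cases "b \<in> \<Omega>")
      case True
      then have "x i b mod P = x' i b mod P" using nul[of i] i by (simp add: nul_def mod_eq_dvd_iff)
      then show ?thesis using K True by (simp add: K_def)
    qed (use K in \<open>simp add: K_def\<close>)
  qed
qed

text \<open>The three forms of a noncollinear triple map the finite set \<open>smp\<close>
  injectively into itself, hence bijectively. Prescribing \<open>d\<close> of the three values
  leaves the other \<open>3 - d\<close> free.\<close>

lemma card_fiber:
  assumes B: "B 0 \<in> points" "B 1 \<in> points" "B 2 \<in> points" "\<not> coll (B 0) (B 1) (B 2)"
    and d: "d \<le> 3" and x: "x \<in> smp"
  shows "card {x' \<in> smp. \<forall>i<d. val (B i) x' = val (B i) x} = card K ^ (3 - d)"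
proof -
  define \<Phi> where "\<Phi> x = (\<lambda>i\<in>{..<3}. val (B i) x)" for x
  have \<Phi>: "\<Phi> x i = val (B i) x" if "i < 3" for x i using that by (simp add: \<Phi>_def)
  have fin: "finite smp" unfolding smp_def by (rule finite_PiE) (simp_all add: finite_K)
  have "\<Phi> x \<in> smp" for x unfolding \<Phi>_def smp_def by (simp add: restrict_PiE_iff val_K)
  then have into: "\<Phi> ` smp \<subseteq> smp" by blast
  have inj: "inj_on \<Phi> smp"
  proof (rule inj_onI)
    fix y y' assume y: "y \<in> smp" "y' \<in> smp" "\<Phi> y = \<Phi> y'"
    have "val (B i) y = val (B i) y'" if "i < 3" for i
      using fun_cong[OF y(3), of i] by (simp only: \<Phi>[OF that])
    then have "nul (form (B i) (\<lambda>i b. y i b - y' i b))" if "i < 3" for i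
      using that unfolding val_eq_iff by blast
    from noncoll_solve[OF B this[of 0] this[of 1] this[of 2]] show "y = y'"
      by (intro smp_eqI y) simp_all
  qed
  have surj: "\<Phi> ` smp = smp" by (rule endo_inj_surj[OF fin into inj])
  let ?C = "{x' \<in> smp. \<forall>i<d. val (B i) x' = val (B i) x}" and ?D = "PiE {..<3} (\<lambda>i. if i < d then {\<Phi> x i} else K)"
  have "\<Phi> ` ?C = ?D"
  proof
    show "\<Phi> ` ?C \<subseteq> ?D"
    proof (rule image_subsetI)
      fix y assume "y \<in> ?C"
      then show "\<Phi> y \<in> ?D" using d by (simp add: \<Phi>_def restrict_PiE_iff val_K)
    qed
    show "?D \<subseteq> \<Phi> ` ?C"
    proof
      fix u assume u: "u \<in> ?D"
      have "\<Phi> x i \<in> K" if "i < 3" for i using that by (simp add: \<Phi> val_K)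
      then have "u i \<in> K" if "i < 3" for i using PiE_mem[OF u, of i] that by (cases "i < d") auto
      then have "u \<in> smp" using u by (simp add: smp_def PiE_iff)
      then obtain x' where x': "x' \<in> smp" "u = \<Phi> x'" using surj by blast
      have "val (B i) x' = val (B i) x" if "i < d" for i
        using PiE_mem[OF u, of i] that d x'(2) by (simp add: \<Phi>)
      then show "u \<in> \<Phi> ` ?C" using x' by blast
    qed
  qed
  moreover have "inj_on \<Phi> ?C" by (rule inj_on_subset[OF inj]) auto
  ultimately have "card ?C = card ?D" by (metis (no_types, lifting) card_image)
  also have "\<dots> = (\<Prod>i<3. if i < d then 1 else card K)"
    by (subst card_PiE) (auto intro!: prod.cong)
  also have "\<dots> = card K ^ (3 - d)"
  proof -
    have "{..<3 :: nat} = {0, 1, 2}" by auto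
    then have "(\<Prod>i<3. if i < d then 1 else card K)
        = (if 0 < d then 1 else card K) * ((if 1 < d then 1 else card K) * (if 2 < d then 1 else card K))" by simp
    moreover have "d = 0 \<or> d = 1 \<or> d = 2 \<or> d = 3" using d by auto
    ultimately show ?thesis by (elim disjE) (simp_all add: power3_eq_cube power2_eq_square)
  qed
  finally show ?thesis .
qed

lemma extend_pair:
  assumes "p \<noteq> q"
  obtains r where "r \<in> points" "\<not> coll p q r"
  using coll_trans[OF _ _ _ assms, of "JJ 0" "JJ 1" "JJ 2"] not_coll_frame frame_points by blast

text \<open>A common shape for the ranks 0 to 3: a noncollinear triple whose first
  \<open>rk T\<close> members carry the same information as \<open>T\<close>, completed by points
  outside its span.\<close>

lemma rank_basis:
  assumes T: "T \<subseteq> points"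
  obtains B where "B 0 \<in> points" "B 1 \<in> points" "B 2 \<in> points" "\<not> coll (B 0) (B 1) (B (2 :: nat))"
    "\<And>x x'. (\<forall>p\<in>T. val p x = val p x') \<longleftrightarrow> (\<forall>i<rk T. val (B i) x = val (B i) x')"
proof -
  define B where "B p q r = (\<lambda>i. if i = 0 then p else if i = (1 :: nat) then q else r)" for p q r :: pt
  have B: "B p q r 0 = p" "B p q r 1 = q" "B p q r 2 = r" for p q r by (simp_all add: B_def)
  have lt: "(\<forall>i<3. Q i) \<longleftrightarrow> Q 0 \<and> Q 1 \<and> Q 2" "(\<forall>i<2. Q i) \<longleftrightarrow> Q 0 \<and> Q 1" for Q :: "nat \<Rightarrow> bool"
    by (auto simp: numeral_3_eq_3 numeral_2_eq_2 less_Suc_eq)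
  note [simp del] = One_nat_def
  consider (3) p q r where "p \<in> T" "q \<in> T" "r \<in> T" "\<not> coll p q r"
    | (2) p q where "p \<in> T" "q \<in> T" "p \<noteq> q" "\<And>p q r. p \<in> T \<Longrightarrow> q \<in> T \<Longrightarrow> r \<in> T \<Longrightarrow> coll p q r"
    | (1) p where "T = {p}" | (0) "T = {}" by blast
  then show ?thesis
  proof cases
    case 3
    then have pts: "p \<in> points" "q \<in> points" "r \<in> points" using T by auto
    show ?thesis
    proof (rule that[of "B p q r"])
      fix x x'
      have "val s x = val s x'" if "s \<in> T" "val p x = val p x'" "val q x = val q x'" "val r x = val r x'" for s
        using noncoll_solve[OF pts 3(4) that(2-4)[unfolded val_eq_iff]] T that(1)
        unfolding val_eq_iff by (intro form_nul) auto
      then show "(\<forall>p\<in>T. val p x = val p x') \<longleftrightarrow> (\<forall>i<rk T. val (B p q r i) x = val (B p q r i) x')"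
        unfolding rk_eq_3[OF 3] lt B using 3(1-3) by metis
    qed (use pts 3 in \<open>simp_all add: B\<close>)
  next
    case 2
    then have pts: "p \<in> points" "q \<in> points" using T by auto
    have r2: "rk T = 2" by (rule rk_eq_2[OF 2(1-3)]) (rule 2(4))
    obtain r where r: "r \<in> points" "\<not> coll p q r" by (rule extend_pair[OF 2(3)])
    show ?thesis
    proof (rule that[of "B p q r"])
      fix x x'
      have "val s x = val s x'" if s: "s \<in> T" and eq: "val p x = val p x'" "val q x = val q x'" for s
        unfolding val_eq_iff
        by (rule coll_solve[OF pts subsetD[OF T s] 2(4)[OF 2(1,2) s] 2(3) eq[unfolded val_eq_iff]])
      then show "(\<forall>p\<in>T. val p x = val p x') \<longleftrightarrow> (\<forall>i<rk T. val (B p q r i) x = val (B p q r i) x')"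
        unfolding r2 lt B using 2(1,2) by metis
    qed (use pts r in \<open>simp_all add: B\<close>)
  next
    case 1
    obtain q where q: "q \<in> points" "p \<noteq> q" using frame_points by (cases "p = JJ 0") auto
    obtain r where r: "r \<in> points" "\<not> coll p q r" by (rule extend_pair[OF q(2)])
    show ?thesis
      by (rule that[of "B p q r"]) (use 1 T q r in \<open>simp_all add: B rk_singleton\<close>)
  next
    case 0
    show ?thesis
      by (rule that[of "B (JJ 0) (JJ 1) (JJ 2)"]) (use 0 not_coll_frame frame_points in \<open>simp_all add: B rk_empty\<close>)
  qed
qed

lemma weighted_entropic:
  assumes "finite E"
  shows "entropic E point_rank"
proof -
  define X where "X e = (if e \<in> code ` points then val (inv_into points code e) else (\<lambda>_ _. 0))" for e
  let ?M = "uniform_count_measure smp"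
  have fin: "finite smp" unfolding smp_def by (rule finite_PiE) (simp_all add: finite_K)
  have card: "card smp = card K ^ 3" unfolding smp_def by (subst card_PiE) simp_all
  then have ne: "smp \<noteq> {}" using card_K by (metis card.empty not_numeral_le_zero power_not_zero zero_neq_numeral)
  have lnK: "ln (card K) > 0" using card_K by simp
  \<comment> \<open>Each point is uniform on \<open>K\<close>, so dividing by
    \<open>ln (card K)\<close> gives it entropy 1.\<close>
  have "entropic_representation ?M X (1 / ln (card K)) E point_rank"
    unfolding entropic_representation_def
  proof (intro conjI ballI allI impI)
    show "prob_space ?M" using fin ne by (rule prob_space_uniform_count_measure)
    show "discrete_rv ?M (X e)" for e
      using fin by (simp add: discrete_rv_def measurable_def space_uniform_count_measure sets_uniform_count_measure countable_finite)
    show "0 < 1 / ln (card K)" using lnK by simp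
    fix A assume "A \<subseteq> E"
    define T where "T = {p \<in> points. code p \<in> A}"
    have r: "point_rank A = rk T" by (simp add: point_rank_def T_def)
    have Xcode: "X (code p) = val p" if "p \<in> points" for p
      using that inj_on_subset[OF inj_code] by (simp add: X_def inv_into_f_f)
    have J: "joint_rv X A x = joint_rv X A x' \<longleftrightarrow> (\<forall>p\<in>T. val p x = val p x')" for x x'
    proof
      assume eq: "joint_rv X A x = joint_rv X A x'"
      show "\<forall>p\<in>T. val p x = val p x'"
      proof
        fix p assume "p \<in> T"
        then show "val p x = val p x'" using fun_cong[OF eq, of "code p"] by (simp add: T_def joint_rv_def Xcode)
      qed
    next
      assume T: "\<forall>p\<in>T. val p x = val p x'"
      have "X e x = X e x'" if "e \<in> A" for e
      proof (cases "e \<in> code ` points")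
        case True
        then obtain p where "p \<in> points" "e = code p" by blast
        then show ?thesis using T that by (simp add: T_def Xcode)
      qed (simp add: X_def)
      then show "joint_rv X A x = joint_rv X A x'" by (simp add: joint_rv_def fun_eq_iff restrict_def)
    qed
    have "T \<subseteq> points" by (auto simp: T_def)
    then obtain B where B: "B 0 \<in> points" "B 1 \<in> points" "B 2 \<in> points" "\<not> coll (B 0) (B 1) (B (2 :: nat))"
      "\<And>x x'. (\<forall>p\<in>T. val p x = val p x') \<longleftrightarrow> (\<forall>i<rk T. val (B i) x = val (B i) x')"
      using rank_basis by blast
    have "shannon_entropy ?M (joint_rv X A) = ennreal (ln (card K ^ rk T))"
    proof (rule shannon_entropy_uniform[OF fin ne])
      show "card {x' \<in> smp. joint_rv X A x' = joint_rv X A x} = card K ^ (3 - rk T)" if "x \<in> smp" for x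
        unfolding J B(5) by (rule card_fiber[of B, OF B(1-4) rk_le_3 that])
      show "card smp = card K ^ rk T * card K ^ (3 - rk T)"
        using rk_le_3[of T] by (simp add: card power_add[symmetric])
    qed
    also have "\<dots> = ennreal (rk T * ln (card K))" using card_K by (simp add: ln_realpow)
    finally show "of_nat (point_rank A) = ennreal (1 / ln (card K)) * shannon_entropy ?M (joint_rv X A)"
      using lnK by (simp add: r ennreal_mult'[symmetric] ennreal_of_nat_eq_real_of_nat)
  qed
  then show ?thesis by (rule entropicI[OF assms])
qed

end

lemma (in gadget_model) entropic_point_rank:
  assumes "finite E"
  shows "entropic E point_rank"
proof (rule weights_exist)
  fix wt :: "pt \<Rightarrow> nat" and D :: nat
  assume wt:
    "\<And>a b c. a \<in> sideA \<Longrightarrow> b \<in> sideB \<Longrightarrow> c \<in> sideC \<Longrightarrow> wt a + wt b \<le> D \<and> wt c \<le> D"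
    "\<And>p q S. S \<in> {sideA, sideB, sideC} \<Longrightarrow> p \<in> S \<Longrightarrow> q \<in> S \<Longrightarrow> p \<noteq> q \<Longrightarrow> {p, q} \<noteq> {PX, PY} \<Longrightarrow> wt p \<noteq> wt q"
    "\<And>a b c. a \<in> sideA \<Longrightarrow> b \<in> sideB \<Longrightarrow> c \<in> sideC \<Longrightarrow> wt a + wt b = wt c \<Longrightarrow>
       abc a b c \<or> (a = PA 2 \<and> b = PB 4 \<and> c = PY) \<or> (a = PA 4 \<and> b = PB 2 \<and> c = PX)"
    "\<And>a b c. abc a b c \<Longrightarrow> wt a + wt b = wt c" "wt PX = wt PY"
  \<comment> \<open>The summand 2 excludes the prime 2 even when the power of 2 is 1.\<close>
  obtain p :: nat where p: "prime p" "2 + 2 ^ (2 * D * card \<Omega>) < p" using bigger_prime by blast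
  have "2 ^ (2 * D * card \<Omega>) < p" "p \<noteq> 2" using p(2) by linarith+
  then have "int (2 ^ (2 * D * card \<Omega>)) < int p" by (simp only: of_nat_less_iff)
  then have P: "2 ^ (2 * D * card \<Omega>) < int p" "int p \<noteq> 2" using \<open>p \<noteq> 2\<close> by (simp_all only: of_nat_power of_nat_numeral of_nat_eq_iff)
  have "prime (int p)" using p(1) by simp
  then interpret weighted_model R n \<phi> \<Omega> wt D "int p"
    using wt P by (intro weighted_model.intro weighted_model_axioms.intro gadget_model_axioms)
  show ?thesis by (rule weighted_entropic[OF assms])
qed

section \<open>Computing the matroid\<close>

lemma rf_triple_code: "rf n X \<Longrightarrow> rf n Y \<Longrightarrow> rf n Z \<Longrightarrow> rf n (\<lambda>xs. triple_code (X xs) (Y xs) (Z xs))"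
  unfolding triple_code_def by (intro rf_prod_encode)

lemma rp_rel:
  assumes "rf n E" "rf n X" "rf n Y" "rf n Z"
  shows "rp n (\<lambda>xs. rel (E xs) (X xs) (Y xs) (Z xs))"
  unfolding rel_def chain_rel_def final_rel_def
  by (intro rp_disj rp_conj rp_bex rp_eq rp_set_decode rf_triple_code rf_add rf_mult rf_const assms rf_tl[OF assms(2)]
      rf_tl[OF assms(3)] rf_tl[OF assms(4)] rf_var(1)) simp_all

text \<open>The incidence structure of \<open>gadget (rel e) (12 * e + 23)\<close> on the codes of its points, written
  with bounded quantifiers only. It is defined for every \<open>e\<close>, whether or not \<open>rel e\<close> is valid.\<close>

definition cscalar :: "nat \<Rightarrow> nat \<Rightarrow> bool" where
  "cscalar e u \<longleftrightarrow> u = 0 \<or> (\<exists>x<12 * e + 23. \<exists>y<12 * e + 23. \<exists>z<12 * e + 23. rel e x y z \<and>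
     (u = 4 * triple_code x y z + 1 \<or> u = 4 * triple_code x y z + 3))"

definition cindex :: "nat \<Rightarrow> nat \<Rightarrow> bool" where
  "cindex e u \<longleftrightarrow> cscalar e u \<or> (\<exists>s<12 * e + 23. u = 2 * s)"

definition cpoint :: "nat \<Rightarrow> nat \<Rightarrow> bool" where
  "cpoint e a \<longleftrightarrow> a = prod_encode (0, 0) \<or> a = prod_encode (0, 1) \<or> a = prod_encode (0, 2)
     \<or> a = prod_encode (5, 0) \<or> a = prod_encode (5, 1)
     \<or> (\<exists>u<Suc a. cindex e u \<and> (a = prod_encode (1, u) \<or> a = prod_encode (2, u)))
     \<or> (\<exists>x<12 * e + 23. \<exists>y<12 * e + 23. \<exists>z<12 * e + 23. rel e x y z \<and> a = prod_encode (3, triple_code x y z))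
     \<or> (\<exists>u<Suc a. \<exists>s<12 * e + 23. cscalar e u \<and> a = prod_encode (4, prod_encode (u, s)))"

definition cline12 :: "nat \<Rightarrow> bool" where
  "cline12 a \<longleftrightarrow> a = prod_encode (0, 0) \<or> a = prod_encode (0, 1) \<or> (\<exists>u<Suc a. a = prod_encode (1, u))"

definition cline23 :: "nat \<Rightarrow> bool" where
  "cline23 a \<longleftrightarrow> a = prod_encode (0, 1) \<or> a = prod_encode (0, 2)
     \<or> (\<exists>u<Suc a. a = prod_encode (2, u) \<or> a = prod_encode (3, u))"

definition cline13 :: "nat \<Rightarrow> bool" where
  "cline13 a \<longleftrightarrow> a = prod_encode (0, 0) \<or> a = prod_encode (0, 2) \<or> a = prod_encode (5, 0) \<or> a = prod_encode (5, 1)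
     \<or> (\<exists>u<Suc a. a = prod_encode (4, u))"

definition cabc :: "nat \<Rightarrow> nat \<Rightarrow> nat \<Rightarrow> nat \<Rightarrow> bool" where
  "cabc e a b c \<longleftrightarrow>
     (\<exists>u<Suc a. \<exists>s<12 * e + 23. cscalar e u \<and>
        a = prod_encode (1, u) \<and> b = prod_encode (2, 2 * s) \<and> c = prod_encode (4, prod_encode (u, s)))
   \<or> (\<exists>u<Suc b. \<exists>s<12 * e + 23. cscalar e u \<and>
        a = prod_encode (1, 2 * s) \<and> b = prod_encode (2, u) \<and> c = prod_encode (4, prod_encode (u, s)))
   \<or> (\<exists>x<12 * e + 23. \<exists>y<12 * e + 23. \<exists>z<12 * e + 23. rel e x y z \<and> b = prod_encode (3, triple_code x y z) \<and>
        (a = prod_encode (1, 0) \<and> c = prod_encode (4, prod_encode (4 * triple_code x y z + 1, y))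
       \<or> a = prod_encode (1, 2 * x) \<and> c = prod_encode (4, prod_encode (4 * triple_code x y z + 3, z))))
   \<or> a = prod_encode (1, 2) \<and> b = prod_encode (2, 4) \<and> c = prod_encode (5, 0)
   \<or> a = prod_encode (1, 4) \<and> b = prod_encode (2, 2) \<and> c = prod_encode (5, 1)"

definition ccoll :: "nat \<Rightarrow> nat \<Rightarrow> nat \<Rightarrow> nat \<Rightarrow> bool" where
  "ccoll e a b c \<longleftrightarrow> a = b \<or> b = c \<or> a = c \<or> (cline12 a \<and> cline12 b \<and> cline12 c)
     \<or> (cline23 a \<and> cline23 b \<and> cline23 c) \<or> (cline13 a \<and> cline13 b \<and> cline13 c)
     \<or> cabc e a b c \<or> cabc e a c b \<or> cabc e b a c \<or> cabc e b c a \<or> cabc e c a b \<or> cabc e c b a"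

definition cbound :: "nat \<Rightarrow> nat" where
  "cbound e = Suc (prod_encode (5, prod_encode (4 * triple_code (12 * e + 23) (12 * e + 23) (12 * e + 23) + 2 * (12 * e + 23) + 4, 12 * e + 23)))"

definition crank :: "nat \<Rightarrow> nat \<Rightarrow> nat" where
  "crank e k = of_bool (\<exists>a<cbound e. cpoint e a \<and> a \<in> set_decode k)
     + of_bool (\<exists>a<cbound e. \<exists>b<cbound e. cpoint e a \<and> cpoint e b \<and> a \<in> set_decode k \<and> b \<in> set_decode k \<and> a \<noteq> b)
     + of_bool (\<exists>a<cbound e. \<exists>b<cbound e. \<exists>c<cbound e. cpoint e a \<and> cpoint e b \<and> cpoint e c
         \<and> a \<in> set_decode k \<and> b \<in> set_decode k \<and> c \<in> set_decode k \<and> \<not> ccoll e a b c)"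

text \<open>The ground set is an initial segment containing the codes of all points; its other
  elements become loops. The codes of its subsets are exactly the numbers below
  \<open>2 ^ cbound e\<close>, so the rank table is a map over that range.\<close>

definition gadget_code :: "nat \<Rightarrow> nat" where
  "gadget_code e = prod_encode (2 ^ cbound e - 1, list_encode (map (\<lambda>k. crank e k) [0..<2 ^ cbound e]))"

lemma rp_cscalar:
  assumes "rf n E" "rf n U"
  shows "rp n (\<lambda>xs. cscalar (E xs) (U xs))"
  unfolding cscalar_def
  by (intro rp_disj rp_conj rp_bex rp_eq rp_rel rf_triple_code rf_add rf_mult rf_const
      rf_tl[OF rf_tl[OF rf_tl[OF assms(1)]]] rf_tl[OF rf_tl[OF rf_tl[OF assms(2)]]] rf_tl[OF rf_tl[OF assms(1)]] rf_tl[OF assms(1)]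
      assms rf_var(1-3)) simp_all

lemma rp_cindex:
  assumes "rf n E" "rf n U"
  shows "rp n (\<lambda>xs. cindex (E xs) (U xs))"
  unfolding cindex_def
  by (intro rp_disj rp_bex rp_eq rp_cscalar rf_add rf_mult rf_const rf_tl[OF assms(2)] assms rf_var(1)) simp_all

lemma rp_cpoint:
  assumes "rf n E" "rf n U"
  shows "rp n (\<lambda>xs. cpoint (E xs) (U xs))"
  unfolding cpoint_def
  by (intro rp_disj rp_conj rp_bex rp_eq rp_rel rp_cindex rp_cscalar rf_Suc rf_prod_encode rf_triple_code rf_add rf_mult rf_const
      rf_tl[OF rf_tl[OF rf_tl[OF assms(1)]]] rf_tl[OF rf_tl[OF rf_tl[OF assms(2)]]] rf_tl[OF rf_tl[OF assms(1)]] rf_tl[OF assms(1)]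
      rf_tl[OF rf_tl[OF assms(2)]] rf_tl[OF assms(2)]
      assms rf_var(1-3)) simp_all

lemma rp_cline:
  assumes "rf n U"
  shows "rp n (\<lambda>xs. cline12 (U xs))" "rp n (\<lambda>xs. cline23 (U xs))" "rp n (\<lambda>xs. cline13 (U xs))"
  unfolding cline12_def cline23_def cline13_def
  by (intro rp_disj rp_bex rp_eq rf_Suc rf_prod_encode rf_const rf_tl[OF assms] assms rf_var(1); simp)+

lemma rp_cabc:
  assumes "rf n E" "rf n A" "rf n B" "rf n C"
  shows "rp n (\<lambda>xs. cabc (E xs) (A xs) (B xs) (C xs))"
  unfolding cabc_def
  by (intro rp_disj rp_conj rp_bex rp_eq rp_rel rp_cscalar rf_Suc rf_prod_encode rf_triple_code rf_add rf_mult rf_const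
      assms assms[THEN rf_tl] assms[THEN rf_tl, THEN rf_tl] assms[THEN rf_tl, THEN rf_tl, THEN rf_tl] rf_var(1-3)) simp_all

lemma rp_ccoll:
  assumes "rf n E" "rf n A" "rf n B" "rf n C"
  shows "rp n (\<lambda>xs. ccoll (E xs) (A xs) (B xs) (C xs))"
  unfolding ccoll_def by (intro rp_disj rp_conj rp_eq rp_cline rp_cabc assms)

lemma rf_cbound: "rf n E \<Longrightarrow> rf n (\<lambda>xs. cbound (E xs))"
  unfolding cbound_def by (intro rf_Suc rf_prod_encode rf_triple_code rf_add rf_mult rf_const)

lemma rf_crank:
  assumes "rf n E" "rf n K"
  shows "rf n (\<lambda>xs. crank (E xs) (K xs))"
  unfolding crank_def
  by (intro rf_add rp_conj rp_bex rp_not rp_eq rp_set_decode rp_cpoint rp_ccoll rf_cbound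
      assms assms[THEN rf_tl] assms[THEN rf_tl, THEN rf_tl] assms[THEN rf_tl, THEN rf_tl, THEN rf_tl] rf_var(1-3)) simp_all

lemma rf_gadget_code: "rf 1 (\<lambda>xs. gadget_code (hd xs))"
  unfolding gadget_code_def
  by (intro rf_prod_encode rf_diff rf_pow2 rf_list_encode_map rf_crank rf_cbound rf_const rf_var) simp_all

lemma gadget_rel: "e = presentation k cs \<Longrightarrow> gadget (rel e) (12 * e + 23)"
  by unfold_locales (use rel_valid rel_bounded in auto)

section \<open>Agreement of the coded incidence structure with the geometry\<close>

locale coded_gadget = gadget "rel e" "12 * e + 23" for e
begin

lemma code_eq_iff:
  "code p = prod_encode (0, i) \<longleftrightarrow> p = JJ i" "code p = prod_encode (Suc 0, u) \<longleftrightarrow> p = PA u"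
  "code p = prod_encode (2, u) \<longleftrightarrow> p = PB u" "code p = prod_encode (3, u) \<longleftrightarrow> p = PD u"
  "code p = prod_encode (4, prod_encode (u, s)) \<longleftrightarrow> p = PC u s"
  "code p = prod_encode (5, 0) \<longleftrightarrow> p = PX" "code p = prod_encode (5, Suc 0) \<longleftrightarrow> p = PY"
  by ((cases p; simp), (cases p; simp), (cases p; simp), (cases p; simp), (cases p; simp), (cases p; simp), (cases p; simp))

lemma cscalar_iff: "cscalar e u \<longleftrightarrow> scalar u"
  unfolding cscalar_def scalar_def using R_less by blast

lemma cindex_iff: "cindex e u \<longleftrightarrow> index u"
  unfolding cindex_def index_def cscalar_iff ..

lemma cpoint_iff: "cpoint e a \<longleftrightarrow> a \<in> code ` points"
proof
  assume "cpoint e a"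
  then show "a \<in> code ` points"
    unfolding cpoint_def cscalar_iff cindex_iff
  proof (elim disjE exE conjE)
    assume "a = prod_encode (0, 0)" then show ?thesis by (intro image_eqI[of _ _ "JJ 0"]) (simp_all add: pointsI)
  next
    assume "a = prod_encode (0, 1)" then show ?thesis by (intro image_eqI[of _ _ "JJ 1"]) (simp_all add: pointsI del: One_nat_def)
  next
    assume "a = prod_encode (0, 2)" then show ?thesis by (intro image_eqI[of _ _ "JJ 2"]) (simp_all add: pointsI)
  next
    assume "a = prod_encode (5, 0)" then show ?thesis by (intro image_eqI[of _ _ PX]) (simp_all add: pointsI)
  next
    assume "a = prod_encode (5, 1)" then show ?thesis by (intro image_eqI[of _ _ PY]) (simp_all add: pointsI)
  next
    fix u assume "index u" "a = prod_encode (1, u)" then show ?thesis by (intro image_eqI[of _ _ "PA u"]) (simp_all add: pointsI)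
  next
    fix u assume "index u" "a = prod_encode (2, u)" then show ?thesis by (intro image_eqI[of _ _ "PB u"]) (simp_all add: pointsI)
  next
    fix x y z assume "rel e x y z" "a = prod_encode (3, triple_code x y z)"
    then show ?thesis by (intro image_eqI[of _ _ "PD (triple_code x y z)"]) (simp_all add: pointsI)
  next
    fix u s assume "scalar u" "s < 12 * e + 23" "a = prod_encode (4, prod_encode (u, s))"
    then show ?thesis by (intro image_eqI[of _ _ "PC u s"]) (simp_all add: pointsI)
  qed
next
  have le: "u < Suc (prod_encode (i, u))" "u < Suc (prod_encode (i, prod_encode (u, s)))" for u i s
    using le_prod_encode_2[of u i] le_prod_encode_2[of "prod_encode (u, s)" i] le_prod_encode_1[of u s] by auto
  assume "a \<in> code ` points"
  then obtain p where p: "p \<in> points" "a = code p" by blast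
  show "cpoint e a"
  proof (cases p)
    case (JJ i)
    then have "i = 0 \<or> i = 1 \<or> i = 2" using p(1) by (auto simp: points_def)
    then show ?thesis using p JJ by (auto simp: cpoint_def)
  next
    case (PA u)
    then have "index u" using p(1) by (auto simp: points_def)
    then have "\<exists>v<Suc a. cindex e v \<and> (a = prod_encode (1, v) \<or> a = prod_encode (2, v))"
      using p PA le(1)[of u 1] by (intro exI[of _ u]) (simp add: cindex_iff)
    then show ?thesis unfolding cpoint_def by blast
  next
    case (PB u)
    then have "index u" using p(1) by (auto simp: points_def)
    then have "\<exists>v<Suc a. cindex e v \<and> (a = prod_encode (1, v) \<or> a = prod_encode (2, v))"
      using p PB le(1)[of u 2] by (intro exI[of _ u]) (simp add: cindex_iff)
    then show ?thesis unfolding cpoint_def by blast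
  next
    case (PD l)
    then obtain x y z where "rel e x y z" "l = triple_code x y z" using p(1) by (auto simp: points_def)
    moreover from this(1) have "x < 12 * e + 23" "y < 12 * e + 23" "z < 12 * e + 23" using R_less by auto
    moreover have "a = prod_encode (3, l)" using p(2) PD by simp
    ultimately show ?thesis unfolding cpoint_def by blast
  next
    case (PC u s)
    then have "scalar u" "s < 12 * e + 23" using p(1) by (auto simp: points_def)
    then have "\<exists>u<Suc a. \<exists>s<12 * e + 23. cscalar e u \<and> a = prod_encode (4, prod_encode (u, s))"
      using p PC le(2)[of u 4 s] by (intro exI[of _ u] conjI exI[of _ s]) (simp_all add: cscalar_iff)
    then show ?thesis unfolding cpoint_def by blast
  qed (use p in \<open>simp_all add: cpoint_def\<close>)
qed

lemma cline_iff: "cline12 (code p) \<longleftrightarrow> p \<in> line12" "cline23 (code p) \<longleftrightarrow> p \<in> line23" "cline13 (code p) \<longleftrightarrow> p \<in> line13"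
  using le_prod_encode_2
  by (cases p; auto simp: cline12_def cline23_def cline13_def line12_def line23_def line13_def less_Suc_eq_le)+

lemma cabc_iff: "cabc e (code p) (code q) (code r) \<longleftrightarrow> abc p q r"
proof
  assume "cabc e (code p) (code q) (code r)"
  then show "abc p q r"
    unfolding cabc_def cscalar_iff One_nat_def code_eq_iff
  proof (elim disjE exE conjE)
    fix u s assume "scalar u" "s < 12 * e + 23" "p = PA u" "q = PB (2 * s)" "r = PC u s"
    then show ?thesis using abc.ab1 by simp
  next
    fix u s assume "scalar u" "s < 12 * e + 23" "p = PA (2 * s)" "q = PB u" "r = PC u s"
    then show ?thesis using abc.ab2 by simp
  next
    fix x y z assume "rel e x y z" "q = PD (triple_code x y z)" "p = PA 0" "r = PC (4 * triple_code x y z + Suc 0) y"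
    then show ?thesis using abc.d1[of x y z] by simp
  next
    fix x y z assume "rel e x y z" "q = PD (triple_code x y z)" "p = PA (2 * x)" "r = PC (4 * triple_code x y z + 3) z"
    then show ?thesis using abc.d2[of x y z] by simp
  qed (use abc.px abc.py in simp_all)
next
  have le: "u < Suc (prod_encode (i, u))" for u i using le_prod_encode_2[of u i] by simp
  assume "abc p q r"
  then show "cabc e (code p) (code q) (code r)"
  proof cases
    case (ab1 u s)
    then have "\<exists>u<Suc (code p). \<exists>s<12 * e + 23. cscalar e u \<and>
        code p = prod_encode (1, u) \<and> code q = prod_encode (2, 2 * s) \<and> code r = prod_encode (4, prod_encode (u, s))"
      using le[of u 1] by (intro exI[of _ u] conjI exI[of _ s]) (simp_all add: cscalar_iff)
    then show ?thesis unfolding cabc_def by blast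
  next
    case (ab2 u s)
    then have "\<exists>u<Suc (code q). \<exists>s<12 * e + 23. cscalar e u \<and>
        code p = prod_encode (1, 2 * s) \<and> code q = prod_encode (2, u) \<and> code r = prod_encode (4, prod_encode (u, s))"
      using le[of u 2] by (intro exI[of _ u] conjI exI[of _ s]) (simp_all add: cscalar_iff)
    then show ?thesis unfolding cabc_def by blast
  next
    case (d1 x y z)
    have "code p = prod_encode (1, 0)" "code q = prod_encode (3, triple_code x y z)"
      "code r = prod_encode (4, prod_encode (4 * triple_code x y z + 1, y))" using d1 by simp_all
    then show ?thesis unfolding cabc_def using d1(4) R_less[OF d1(4)] by blast
  next
    case (d2 x y z)
    have "code p = prod_encode (1, 2 * x)" "code q = prod_encode (3, triple_code x y z)"
      "code r = prod_encode (4, prod_encode (4 * triple_code x y z + 3, z))" using d2 by simp_all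
    then show ?thesis unfolding cabc_def using d2(4) R_less[OF d2(4)] by blast
  qed (simp_all add: cabc_def)
qed

lemma ccoll_iff: "ccoll e (code p) (code q) (code r) \<longleftrightarrow> coll p q r"
proof -
  have "(\<exists>L\<in>{{a, b, c} |a b c. abc a b c}. p \<in> L \<and> q \<in> L \<and> r \<in> L) \<longleftrightarrow>
      abc p q r \<or> abc p r q \<or> abc q p r \<or> abc q r p \<or> abc r p q \<or> abc r q p" if "p \<noteq> q" "q \<noteq> r" "p \<noteq> r"
  proof
    assume "\<exists>L\<in>{{a, b, c} |a b c. abc a b c}. p \<in> L \<and> q \<in> L \<and> r \<in> L"
    then obtain a b c where *: "abc a b c" "p \<in> {a, b, c}" "q \<in> {a, b, c}" "r \<in> {a, b, c}" by blast
    then show "abc p q r \<or> abc p r q \<or> abc q p r \<or> abc q r p \<or> abc r p q \<or> abc r q p"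
      using that by auto
  next
    have L: "\<exists>L\<in>{{a, b, c} |a b c. abc a b c}. p \<in> L \<and> q \<in> L \<and> r \<in> L" if "abc a b c" "p \<in> {a, b, c}" "q \<in> {a, b, c}" "r \<in> {a, b, c}" for a b c
      using that by blast
    assume "abc p q r \<or> abc p r q \<or> abc q p r \<or> abc q r p \<or> abc r p q \<or> abc r q p"
    then show "\<exists>L\<in>{{a, b, c} |a b c. abc a b c}. p \<in> L \<and> q \<in> L \<and> r \<in> L"
      by (elim disjE) (rule L, assumption, simp, simp, simp)+
  qed
  moreover have "code p = code q \<longleftrightarrow> p = q" for p q using inj_code by (simp add: inj_eq)
  ultimately show ?thesis
    unfolding ccoll_def cline_iff cabc_iff coll_def unfolding lines_def bex_Un by auto
qed

lemma cbound_eq: "cbound e = bound"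
  by (simp add: cbound_def bound_def)

lemma crank_eq: "crank e k = point_rank (set_decode k)"
proof -
  have ex: "(\<exists>a<cbound e. cpoint e a \<and> Q a) \<longleftrightarrow> (\<exists>p\<in>points. Q (code p))" for Q
    unfolding cpoint_iff cbound_eq using code_less_bound by blast
  have "(\<exists>a<cbound e. cpoint e a \<and> a \<in> set_decode k) \<longleftrightarrow> {p \<in> points. code p \<in> set_decode k} \<noteq> {}"
    unfolding ex by blast
  moreover have "(\<exists>a<cbound e. \<exists>b<cbound e. cpoint e a \<and> cpoint e b \<and> a \<in> set_decode k \<and> b \<in> set_decode k \<and> a \<noteq> b) \<longleftrightarrow>
      (\<exists>a<cbound e. cpoint e a \<and> (\<exists>b<cbound e. cpoint e b \<and> (a \<in> set_decode k \<and> b \<in> set_decode k \<and> a \<noteq> b)))" by blast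
  moreover have "\<dots> \<longleftrightarrow> (\<exists>p\<in>{p \<in> points. code p \<in> set_decode k}. \<exists>q\<in>{p \<in> points. code p \<in> set_decode k}. p \<noteq> q)"
    unfolding ex using inj_code by (auto simp: inj_eq)
  moreover have "(\<exists>a<cbound e. \<exists>b<cbound e. \<exists>c<cbound e. cpoint e a \<and> cpoint e b \<and> cpoint e c
         \<and> a \<in> set_decode k \<and> b \<in> set_decode k \<and> c \<in> set_decode k \<and> \<not> ccoll e a b c) \<longleftrightarrow>
      (\<exists>a<cbound e. cpoint e a \<and> (\<exists>b<cbound e. cpoint e b \<and> (\<exists>c<cbound e. cpoint e c
         \<and> (a \<in> set_decode k \<and> b \<in> set_decode k \<and> c \<in> set_decode k \<and> \<not> ccoll e a b c))))" by blast
  moreover have "\<dots> \<longleftrightarrow> (\<exists>p\<in>{p \<in> points. code p \<in> set_decode k}. \<exists>q\<in>{p \<in> points. code p \<in> set_decode k}.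
      \<exists>r\<in>{p \<in> points. code p \<in> set_decode k}. \<not> coll p q r)"
    unfolding ex ccoll_iff by blast
  ultimately show ?thesis unfolding crank_def point_rank_def rk_def by simp
qed

lemma gadget_code_eq: "gadget_code e = matroid_code {..<bound} point_rank"
proof -
  have enc: "set_encode {..<N} = 2 ^ N - 1" for N
    by (induction N) (simp_all add: lessThan_Suc set_encode_insert)
  have "set_decode k \<subseteq> {..<N}" if "k < 2 ^ N" for k N
  proof
    fix i assume "i \<in> set_decode k"
    then have "odd (k div 2 ^ i)" by (simp add: set_decode_def)
    then have "2 ^ i \<le> k" by (metis div_less even_zero not_less)
    from this that have "(2 :: nat) ^ i < 2 ^ N" by (rule le_less_trans)
    then show "i \<in> {..<N}" by simp
  qed
  then have "subset_codes {..<N} = [0..<2 ^ N]" for N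
    unfolding subset_codes_def enc by (simp del: upt_Suc)
  then show ?thesis by (simp add: gadget_code_def matroid_code_def enc cbound_eq crank_eq)
qed

end

section \<open>The diagonal argument\<close>

theorem theorem1p2:
  shows "\<not> (\<exists>p. \<forall>(E :: nat set) r. matroid E r \<longrightarrow>
           computes p [matroid_code E r] (if entropic E r then 1 else 0))"
proof
  assume "\<exists>p. \<forall>(E :: nat set) r. matroid E r \<longrightarrow>
           computes p [matroid_code E r] (if entropic E r then 1 else 0)"
  then obtain p where p: "\<And>(E :: nat set) r. matroid E r \<Longrightarrow>
           computes p [matroid_code E r] (if entropic E r then 1 else 0)" by blast
  obtain f where "\<forall>xs. length xs = 1 \<longrightarrow> computes f xs (gadget_code (hd xs))"
    using rf_gadget_code unfolding rf_def by blast
  then have f: "computes f [e] (gadget_code e)" for e by (metis One_nat_def length_Cons list.sel(1) list.size(3))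
  define cs where "cs = compile (Comp p [f]) [0] 2 3"
  obtain k where k: "regs cs \<subseteq> {..<k}" "2 < k"
  proof -
    obtain m where "regs cs \<subseteq> {..<m}" using finite_nat_iff_bounded finite_regs by blast
    then show ?thesis by (intro that[of "m + 3"]) auto
  qed
  \<comment> \<open>There is no circularity: \<open>cs\<close> and \<open>k\<close> are fixed first,
    \<open>e\<close> is computed from them, and \<open>cs\<close> is then run on the input
    \<open>e\<close>.\<close>
  define e where "e = presentation k cs"
  \<comment> \<open>As \<open>e\<close> is the number of a presentation, its relations are valid and
    \<open>gadget_code e\<close> is the code of a matroid, so the decider has to answer on
    it.\<close>
  interpret coded_gadget e by (rule coded_gadget.intro, rule gadget_rel, rule e_def)
  have "computes p [gadget_code e] (if entropic {..<bound} point_rank then 1 else 0)"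
    unfolding gadget_code_eq by (rule p, rule matroid_point_rank) simp
  then have "computes (Comp p [f]) [e] (if entropic {..<bound} point_rank then 1 else 0)"
    using f by (intro computes.Comp[where ys = "[gadget_code e]"]) simp_all
  from compile_steps[OF this] obtain T r where
    st: "steps T (cs, \<lambda>j. if j < 2 then e else 0) ([], r)" "r 2 = (if entropic {..<bound} point_rank then 1 else 0)"
    unfolding cs_def by blast
  show False
  proof (cases "entropic {..<bound} point_rank")
    case True
    then obtain M and X :: "nat \<Rightarrow> nat \<Rightarrow> nat" and c where "entropic_representation M X c {..<bound} point_rank"
      unfolding entropic_def by blast
    then obtain \<phi> :: "nat \<Rightarrow> nat bijection set bijection" where \<phi>: "\<And>x y z. rel e x y z \<Longrightarrow> \<phi> x + \<phi> y = \<phi> z" "\<phi> 2 \<noteq> 0"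
      using entropic_imp_group[of M X c "{..<bound}"] code_less_bound by (auto simp: image_subset_iff)
    have "r 2 \<noteq> 0" using st(2) True by simp
    then have "\<phi> 2 = 0" by (rule presentation_trivial[OF st(1) _ k e_def \<phi>(1)])
    then show False using \<phi>(2) by contradiction
  next
    case False
    then have "r 2 = 0" using st(2) by simp
    then obtain \<phi> :: "nat \<Rightarrow> (nat \<times> cell) set bijection" and \<Omega> where
      "finite \<Omega>" "\<Omega> \<noteq> {}" "\<And>s b. b \<in> \<Omega> \<Longrightarrow> \<phi> s + b \<in> \<Omega>"
      "\<And>x y z. rel e x y z \<Longrightarrow> \<phi> x + \<phi> y = \<phi> z" "\<phi> 2 + \<phi> 2 = 0" "\<phi> 2 \<noteq> 0"
      by (rule presentation_model[OF st(1) _ k e_def]) (rule that; assumption)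
    then interpret gadget_model "rel e" "12 * e + 23" \<phi> \<Omega>
      by unfold_locales auto
    show False using entropic_point_rank[of "{..<bound}"] False by simp
  qed
qed

end
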